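(* The following are equivalent for $K\in\mathrm{Alg}\,\mathcal{A}$: (i) $V\otimes C^{bar}K$ is weakly contractible for every $V\in\mathcal{A}$; (ii) $K$ is $C$-excisive; (iii) $K$ is $C^{bar}$-excisive; (iv) $K$ is $\Omega$-excisive; (v) $K$ is $\mathbb{B}\Omega$-excisive.
   Context: **Base category.** $\mathcal{A}$ is an additive category closed under finite limits and finite colimits, with a fixed class $\mathcal{J}$ of objects called basic. A map $i:A'\to A$ is a cofibration if $\hom(i,J)$ is surjective for every $J\in\mathcal{J}$; an object $F$ is relatively injective if $\hom(-,F)$ sends cofibrations to surjections. $\otimes:\mathcal{A}\times\mathcal{A}\to\mathcal{A}$ is a tensor product: $(\mathcal{A},\otimes)$ is symmetric strict monoidal with unit $k$, and for each $V\in\mathcal{A}$ the functors $V\otimes-$ and $-\otimes V$ are additive, preserve cofibrations and pushouts along cofibrations, and preserve all cokernels. $\mathrm{Alg}\,\mathcal{A}$ is the category of (not necessarily unital) associative algebras $A\otimes A\to A$; $\tilde A=A\oplus k$ is the unitalization. A two-sided ideal $K$ of $A$ is a cof-ideal if $K\to A$ is a cofibration. **Weak equivalences.** $\mathrm{Ch}\,\mathcal{A}$ is the category of chain complexes; $\mathrm{HOM}(A,B)$ is the chain complex of homogeneous maps with boundary $f\mapsto\partial f-(-1)^{|f|}f\partial$. A chain map $f$ is a weak equivalence if $\mathrm{HOM}(f,J)$ is a quasi-isomorphism for every relatively injective $J\in\mathcal{A}$ (in degree 0); $Q$ is weakly contractible if $0\to Q$ is a weak equivalence. A map of mixed complexes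 $(M,b,B)$ is a weak equivalence if it is one for the underlying complexes $(M,b)$. An $S$-complex is a bounded below chain complex $P$ with a chain map $S:P_*\to P_{*-2}$; a map of $S$-complexes is a weak equivalence if it is one of underlying chain complexes. For a (bounded below) mixed complex $M$, $\mathbb{B}M$ is the $S$-complex $\mathbb{B}M_n=\bigoplus_{p\ge0}M_{n-2p}$ with boundary $b+B$ (where $B$ maps the summand of index $p$ to that of index $p-1$, zero for $p=0$), and $S$ the canonical projection killing the summand $p=0$. **Complexes of an algebra.** $\Omega A$ is the mixed complex with $\Omega^0A=A$, $\Omega^nA=\tilde A\otimes A^{\otimes n}=A^{\otimes n+1}\oplus A^{\otimes n}$ ($n\ge1$), with (in element notation, to be read in terms of arrows) $b(a_0\otimes\cdots\otimes a_n)=\sum_{i=0}^{n-1}(-1)^i a_0\otimes\cdots\otimes a_ia_{i+1}\otimes\cdots\otimes a_n+(-1)^n a_na_0\otimes a_1\otimes\cdots\otimes a_{n-1}$, and $B:\Omega^nA\to\Omega^{n+1}A$ zero on $k\otimes A^{\otimes n}$ ($n\ge1$) and $B(a_0\otimes\cdots\otimes a_n)=\sum_{i=0}^n(-1)^{ni}\,1\otimes t^i(a_0\otimes\cdots\otimes a_n)$ on $A^{\otimes n+1}$, $t$ moving the last factor to the front. $C(A)\subset\Omega A$ is the $b$-subcomplex $C_nA=A^{\otimes n+1}$. $C^{bar}A$ is defined by $C^{bar}A[-1]=\Omega A/C(A)$ (where $Q[-1]_n=Q_{n-1}$); thus $C^{bar}_nA=A^{\otimes n+1}$, $n\ge0$,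 with boundary (up to sign) $b'=\sum_{i=0}^{n-1}(-1)^i a_0\otimes\cdots\otimes a_ia_{i+1}\otimes\cdots\otimes a_n$. **Relative complexes.** For a cof-ideal $K\to A$, let $[n]=\{0,\dots,n\}$, order the set of maps $[n]\to\{0,1\}$ pointwise, and let $\mathcal{C}_n(f)=Y_{f(0)}\otimes\cdots\otimes Y_{f(n)}$ with $Y_0=K$, $Y_1=A$, a functor via $K\to A$. $C_n(K:A)$ is the colimit of $\mathcal{C}_n$ over all $f$ except the constant map $1$ (so $C_0(K:A)=K$). $\Omega^0(K:A)=K$, $\Omega^n(K:A)=C_n(K:A)\oplus C_{n-1}(K:A)$ ($n\ge1$), a mixed complex with $b,B$ induced by those of $\Omega A$; $C(K:A)\subset\Omega(K:A)$ is a $b$-subcomplex and $C^{bar}(K:A)[-1]=\Omega(K:A)/C(K:A)$. $\mathbb{B}\Omega(K:A)=\mathbb{B}(\Omega(K:A))$. **Excisive.** For $D\in\{C,C^{bar},\Omega,\mathbb{B}\Omega\}$, $K$ is $D$-excisive if for every algebra map $K\to A$ which is a cofibration making $K$ a cof-ideal of $A$, the natural map $D(K)\to D(K:A)$ is a weak equivalence. *)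

theory Defs
  imports "HOL-Algebra.Coset" "HOL-Algebra.FiniteProduct"
begin

section \<open>Categories with addition, tensor product and basic objects\<close>

text \<open>The objects are all elements of \<^typ>\<open>'o\<close> and the arrows all elements of \<^typ>\<open>'m\<close>.
  \<open>g \<cdot> f\<close> is composition (first \<open>f\<close>), \<open>\<boxplus>\<close> the addition of parallel arrows, \<open>\<odot>\<close> the tensor
  product of objects and \<open>\<boxtimes>\<close> that of arrows.\<close>

record ('o, 'm) tensor_cat =
  Dom   :: "'m \<Rightarrow> 'o"
  Cod   :: "'m \<Rightarrow> 'o"
  Comp  :: "'m \<Rightarrow> 'm \<Rightarrow> 'm" (infixr "\<cdot>\<index>" 75)
  Idn   :: "'o \<Rightarrow> 'm"
  Plus  :: "'m \<Rightarrow> 'm \<Rightarrow> 'm" (infixl "\<boxplus>\<index>" 65)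
  Zero  :: "'o \<Rightarrow> 'o \<Rightarrow> 'm"
  TensO :: "'o \<Rightarrow> 'o \<Rightarrow> 'o" (infixr "\<odot>\<index>" 80)
  TensM :: "'m \<Rightarrow> 'm \<Rightarrow> 'm" (infixr "\<boxtimes>\<index>" 80)
  Unit  :: "'o"
  Symm  :: "'o \<Rightarrow> 'o \<Rightarrow> 'm"
  Basic :: "'o set"

record ('o, 'm) alg =
  Und :: "'o"
  Mul :: "'m"

record ('o, 'm) chain =
  Ob :: "int \<Rightarrow> 'o"
  Bd :: "int \<Rightarrow> 'm"

record ('o, 'm) mixed = "('o, 'm) chain" +
  Bop :: "int \<Rightarrow> 'm"

record ('o, 'm) schain = "('o, 'm) chain" +
  Sop :: "int \<Rightarrow> 'm"

text \<open>The operators on the objects \<open>CX n\<close> (\<open>C\<^sub>n A\<close> or \<open>C\<^sub>n (K:A)\<close>) from which all complexes are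
  built: the Hochschild boundary \<open>Cb n : CX n \<rightarrow> CX (n-1)\<close>, the bar boundary \<open>Cb' n\<close> of the same
  type, and the (unsigned) rotation \<open>Ct n : CX n \<rightarrow> CX n\<close>.  \<open>Cb 0\<close> and \<open>Cb' 0\<close> are not used.\<close>

record ('o, 'm) cyc =
  CX  :: "nat \<Rightarrow> 'o"
  Cb  :: "nat \<Rightarrow> 'm"
  Cb' :: "nat \<Rightarrow> 'm"
  Ct  :: "nat \<Rightarrow> 'm"


section \<open>Homology of complexes of abelian groups\<close>

text \<open>Abelian groups are written as (multiplicative) \<^typ>\<open>'g monoid\<close> records.\<close>

definition grp_boundaries :: "(int \<Rightarrow> 'g monoid) \<Rightarrow> (int \<Rightarrow> 'g \<Rightarrow> 'g) \<Rightarrow> int \<Rightarrow> 'g set" where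
  "grp_boundaries G d n = d (n + 1) ` carrier (G (n + 1))"

definition grp_homology :: "(int \<Rightarrow> 'g monoid) \<Rightarrow> (int \<Rightarrow> 'g \<Rightarrow> 'g) \<Rightarrow> int \<Rightarrow> 'g set monoid" where
  "grp_homology G d n =
     (G n)\<lparr>carrier := kernel (G n) (G (n - 1)) (d n)\<rparr> Mod grp_boundaries G d n"

definition quasi_iso ::
  "(int \<Rightarrow> 'g monoid) \<Rightarrow> (int \<Rightarrow> 'g \<Rightarrow> 'g) \<Rightarrow> (int \<Rightarrow> 'h monoid) \<Rightarrow> (int \<Rightarrow> 'h \<Rightarrow> 'h) \<Rightarrow>
   (int \<Rightarrow> 'g \<Rightarrow> 'h) \<Rightarrow> bool" where
  "quasi_iso G d G' d' F \<longleftrightarrow>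
     (\<forall>n. (\<lambda>c. \<Union>x\<in>c. grp_boundaries G' d' n #>\<^bsub>G' n\<^esub> F n x)
            \<in> iso (grp_homology G d n) (grp_homology G' d' n))"


context
  fixes C :: "('o, 'm) tensor_cat" (structure)
begin

section \<open>The base category\<close>

definition Hom :: "'o \<Rightarrow> 'o \<Rightarrow> 'm set" where
  "Hom a b = {f. Dom C f = a \<and> Cod C f = b}"

definition hom_group :: "'o \<Rightarrow> 'o \<Rightarrow> 'm monoid" where
  "hom_group a b = \<lparr>carrier = Hom a b, monoid.mult = (\<lambda>f g. f \<boxplus> g), one = Zero C a b\<rparr>"

definition arr_sum :: "'o \<Rightarrow> 'o \<Rightarrow> ('i \<Rightarrow> 'm) \<Rightarrow> 'i set \<Rightarrow> 'm" where
  "arr_sum a b f I = finprod (hom_group a b) f I"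

definition scale :: "int \<Rightarrow> 'm \<Rightarrow> 'm" where
  "scale z f = f [^]\<^bsub>hom_group (Dom C f) (Cod C f)\<^esub> z"

definition category :: bool where
  "category \<longleftrightarrow>
     (\<forall>a. Idn C a \<in> Hom a a) \<and>
     (\<forall>f g. Cod C f = Dom C g \<longrightarrow> g \<cdot> f \<in> Hom (Dom C f) (Cod C g)) \<and>
     (\<forall>f. f \<cdot> Idn C (Dom C f) = f \<and> Idn C (Cod C f) \<cdot> f = f) \<and>
     (\<forall>f g h. Cod C f = Dom C g \<and> Cod C g = Dom C h \<longrightarrow> (h \<cdot> g) \<cdot> f = h \<cdot> (g \<cdot> f))"

definition preadditive :: bool where
  "preadditive \<longleftrightarrow>
     (\<forall>a b. comm_group (hom_group a b)) \<and>
     (\<forall>a b c. \<forall>f\<in>Hom a b. \<forall>g\<in>Hom a b. \<forall>h\<in>Hom b c. h \<cdot> (f \<boxplus> g) = (h \<cdot> f) \<boxplus> (h \<cdot> g)) \<and>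
     (\<forall>a b c. \<forall>f\<in>Hom a b. \<forall>g\<in>Hom b c. \<forall>h\<in>Hom b c. (g \<boxplus> h) \<cdot> f = (g \<cdot> f) \<boxplus> (h \<cdot> f))"

definition is_zero_ob :: "'o \<Rightarrow> bool" where
  "is_zero_ob z \<longleftrightarrow> (\<forall>a. (\<exists>!f. f \<in> Hom a z) \<and> (\<exists>!f. f \<in> Hom z a))"

definition zero_ob :: "'o" where
  "zero_ob = (SOME z. is_zero_ob z)"

definition is_dsum ::
  "nat set \<Rightarrow> (nat \<Rightarrow> 'o) \<Rightarrow> 'o \<Rightarrow> (nat \<Rightarrow> 'm) \<Rightarrow> (nat \<Rightarrow> 'm) \<Rightarrow> bool" where
  "is_dsum I X P inc prj \<longleftrightarrow>
     (\<forall>i\<in>I. inc i \<in> Hom (X i) P \<and> prj i \<in> Hom P (X i)) \<and>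
     (\<forall>i\<in>I. \<forall>j\<in>I. prj j \<cdot> inc i = (if i = j then Idn C (X i) else Zero C (X i) (X j))) \<and>
     arr_sum P P (\<lambda>i. inc i \<cdot> prj i) I = Idn C P"

definition additive_category :: bool where
  "additive_category \<longleftrightarrow> category \<and> preadditive \<and> (\<exists>z. is_zero_ob z) \<and>
     (\<forall>I X. finite I \<longrightarrow> (\<exists>P inc prj. is_dsum I X P inc prj))"

text \<open>Diagrams are indexed by quivers with vertex set \<open>I\<close>; an edge \<open>(i, u, j)\<close> carries the arrow
  \<open>u : X i \<rightarrow> X j\<close>.\<close>

definition diagram :: "'i set \<Rightarrow> ('i \<Rightarrow> 'o) \<Rightarrow> ('i \<times> 'm \<times> 'i) set \<Rightarrow> bool" where
  "diagram I X E \<longleftrightarrow> (\<forall>(i, u, j)\<in>E. i \<in> I \<and> j \<in> I \<and> u \<in> Hom (X i) (X j))"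

definition cone :: "'i set \<Rightarrow> ('i \<Rightarrow> 'o) \<Rightarrow> ('i \<times> 'm \<times> 'i) set \<Rightarrow> 'o \<Rightarrow> ('i \<Rightarrow> 'm) \<Rightarrow> bool" where
  "cone I X E P c \<longleftrightarrow> (\<forall>i\<in>I. c i \<in> Hom P (X i)) \<and> (\<forall>(i, u, j)\<in>E. u \<cdot> c i = c j)"

definition cocone :: "'i set \<Rightarrow> ('i \<Rightarrow> 'o) \<Rightarrow> ('i \<times> 'm \<times> 'i) set \<Rightarrow> 'o \<Rightarrow> ('i \<Rightarrow> 'm) \<Rightarrow> bool" where
  "cocone I X E P c \<longleftrightarrow> (\<forall>i\<in>I. c i \<in> Hom (X i) P) \<and> (\<forall>(i, u, j)\<in>E. c j \<cdot> u = c i)"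

definition is_limit :: "'i set \<Rightarrow> ('i \<Rightarrow> 'o) \<Rightarrow> ('i \<times> 'm \<times> 'i) set \<Rightarrow> 'o \<Rightarrow> ('i \<Rightarrow> 'm) \<Rightarrow> bool" where
  "is_limit I X E P c \<longleftrightarrow> cone I X E P c \<and>
     (\<forall>Q d. cone I X E Q d \<longrightarrow> (\<exists>!h. h \<in> Hom Q P \<and> (\<forall>i\<in>I. c i \<cdot> h = d i)))"

definition is_colimit :: "'i set \<Rightarrow> ('i \<Rightarrow> 'o) \<Rightarrow> ('i \<times> 'm \<times> 'i) set \<Rightarrow> 'o \<Rightarrow> ('i \<Rightarrow> 'm) \<Rightarrow> bool" where
  "is_colimit I X E P c \<longleftrightarrow> cocone I X E P c \<and>
     (\<forall>Q d. cocone I X E Q d \<longrightarrow> (\<exists>!h. h \<in> Hom P Q \<and> (\<forall>i\<in>I. h \<cdot> c i = d i)))"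

definition has_finite_limits :: bool where
  "has_finite_limits \<longleftrightarrow>
     (\<forall>(I :: nat set) X E. finite I \<and> finite E \<and> diagram I X E \<longrightarrow> (\<exists>P c. is_limit I X E P c))"

definition has_finite_colimits :: bool where
  "has_finite_colimits \<longleftrightarrow>
     (\<forall>(I :: nat set) X E. finite I \<and> finite E \<and> diagram I X E \<longrightarrow> (\<exists>P c. is_colimit I X E P c))"

definition is_cokernel :: "'m \<Rightarrow> 'm \<Rightarrow> bool" where
  "is_cokernel f q \<longleftrightarrow> Dom C q = Cod C f \<and> q \<cdot> f = Zero C (Dom C f) (Cod C q) \<and>
     (\<forall>g. Dom C g = Cod C f \<and> g \<cdot> f = Zero C (Dom C f) (Cod C g) \<longrightarrow>
        (\<exists>!h. h \<in> Hom (Cod C q) (Cod C g) \<and> h \<cdot> q = g))"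

text \<open>\<open>is_pushout i f f' i'\<close>: the square \<open>f' \<cdot> i = i' \<cdot> f\<close> is a pushout of \<open>i\<close> and \<open>f\<close>.\<close>

definition is_pushout :: "'m \<Rightarrow> 'm \<Rightarrow> 'm \<Rightarrow> 'm \<Rightarrow> bool" where
  "is_pushout i f f' i' \<longleftrightarrow>
     Dom C i = Dom C f \<and> Dom C f' = Cod C i \<and> Dom C i' = Cod C f \<and> Cod C f' = Cod C i' \<and>
     f' \<cdot> i = i' \<cdot> f \<and>
     (\<forall>u v. Dom C u = Cod C i \<and> Dom C v = Cod C f \<and> Cod C u = Cod C v \<and> u \<cdot> i = v \<cdot> f \<longrightarrow>
        (\<exists>!h. h \<in> Hom (Cod C f') (Cod C u) \<and> h \<cdot> f' = u \<and> h \<cdot> i' = v))"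

definition monic :: "'m \<Rightarrow> bool" where
  "monic f \<longleftrightarrow>
     (\<forall>g h. Cod C g = Dom C f \<and> Cod C h = Dom C f \<and> Dom C g = Dom C h \<and> f \<cdot> g = f \<cdot> h \<longrightarrow> g = h)"

definition hom_surj :: "'m \<Rightarrow> 'o \<Rightarrow> bool" where
  "hom_surj i J \<longleftrightarrow> (\<lambda>g. g \<cdot> i) ` Hom (Cod C i) J = Hom (Dom C i) J"

definition cofibration :: "'m \<Rightarrow> bool" where
  "cofibration i \<longleftrightarrow> (\<forall>J\<in>Basic C. hom_surj i J)"

definition rel_injective :: "'o \<Rightarrow> bool" where
  "rel_injective F \<longleftrightarrow> (\<forall>i. cofibration i \<longrightarrow> hom_surj i F)"

definition symmetric_strict_monoidal :: bool where
  "symmetric_strict_monoidal \<longleftrightarrow>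
     (\<forall>f g. f \<boxtimes> g \<in> Hom (Dom C f \<odot> Dom C g) (Cod C f \<odot> Cod C g)) \<and>
     (\<forall>a b. Idn C a \<boxtimes> Idn C b = Idn C (a \<odot> b)) \<and>
     (\<forall>f f' g g'. Cod C f = Dom C f' \<and> Cod C g = Dom C g' \<longrightarrow>
        (f' \<cdot> f) \<boxtimes> (g' \<cdot> g) = (f' \<boxtimes> g') \<cdot> (f \<boxtimes> g)) \<and>
     (\<forall>a b c. (a \<odot> b) \<odot> c = a \<odot> (b \<odot> c)) \<and>
     (\<forall>f g h. (f \<boxtimes> g) \<boxtimes> h = f \<boxtimes> (g \<boxtimes> h)) \<and>
     (\<forall>a. Unit C \<odot> a = a \<and> a \<odot> Unit C = a) \<and>
     (\<forall>f. Idn C (Unit C) \<boxtimes> f = f \<and> f \<boxtimes> Idn C (Unit C) = f) \<and>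
     (\<forall>a b. Symm C a b \<in> Hom (a \<odot> b) (b \<odot> a)) \<and>
     (\<forall>f g. Symm C (Cod C f) (Cod C g) \<cdot> (f \<boxtimes> g) = (g \<boxtimes> f) \<cdot> Symm C (Dom C f) (Dom C g)) \<and>
     (\<forall>a b. Symm C b a \<cdot> Symm C a b = Idn C (a \<odot> b)) \<and>
     (\<forall>a b c. Symm C a (b \<odot> c) = (Idn C b \<boxtimes> Symm C a c) \<cdot> (Symm C a b \<boxtimes> Idn C c))"

definition tensor_compatible :: bool where
  "tensor_compatible \<longleftrightarrow> (\<forall>V. \<forall>T \<in> {\<lambda>f. Idn C V \<boxtimes> f, \<lambda>f. f \<boxtimes> Idn C V}.
     (\<forall>a b. \<forall>f\<in>Hom a b. \<forall>g\<in>Hom a b. T (f \<boxplus> g) = T f \<boxplus> T g) \<and>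
     (\<forall>i. cofibration i \<longrightarrow> cofibration (T i)) \<and>
     (\<forall>i f f' i'. cofibration i \<and> is_pushout i f f' i' \<longrightarrow> is_pushout (T i) (T f) (T f') (T i')) \<and>
     (\<forall>f q. is_cokernel f q \<longrightarrow> is_cokernel (T f) (T q)))"

definition base_category :: bool where
  "base_category \<longleftrightarrow> additive_category \<and> has_finite_limits \<and> has_finite_colimits \<and>
     symmetric_strict_monoidal \<and> tensor_compatible"


section \<open>Direct sums and matrices of arrows\<close>

definition dsum :: "nat set \<Rightarrow> (nat \<Rightarrow> 'o) \<Rightarrow> 'o \<times> (nat \<Rightarrow> 'm) \<times> (nat \<Rightarrow> 'm)" where
  "dsum I X = (SOME (P, inc, prj). is_dsum I X P inc prj)"

definition dsum_ob :: "nat set \<Rightarrow> (nat \<Rightarrow> 'o) \<Rightarrow> 'o" where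
  "dsum_ob I X = fst (dsum I X)"

definition dsum_inj :: "nat set \<Rightarrow> (nat \<Rightarrow> 'o) \<Rightarrow> nat \<Rightarrow> 'm" where
  "dsum_inj I X = fst (snd (dsum I X))"

definition dsum_prj :: "nat set \<Rightarrow> (nat \<Rightarrow> 'o) \<Rightarrow> nat \<Rightarrow> 'm" where
  "dsum_prj I X = snd (snd (dsum I X))"

text \<open>The arrow between direct sums whose component from summand \<open>i\<close> to summand \<open>j\<close> is \<open>\<phi> i j\<close> if
  \<open>R i j\<close> holds, and zero otherwise.\<close>

definition mat_arr ::
  "nat set \<Rightarrow> (nat \<Rightarrow> 'o) \<Rightarrow> nat set \<Rightarrow> (nat \<Rightarrow> 'o) \<Rightarrow> (nat \<Rightarrow> nat \<Rightarrow> bool) \<Rightarrow>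
   (nat \<Rightarrow> nat \<Rightarrow> 'm) \<Rightarrow> 'm" where
  "mat_arr I X J Y R \<phi> =
     arr_sum (dsum_ob I X) (dsum_ob J Y)
       (\<lambda>(i, j). dsum_inj J Y j \<cdot> \<phi> i j \<cdot> dsum_prj I X i)
       {(i, j). i \<in> I \<and> j \<in> J \<and> R i j}"


section \<open>Chain complexes and weak equivalences\<close>

definition chain_complex :: "('o, 'm, 'z) chain_scheme \<Rightarrow> bool" where
  "chain_complex X \<longleftrightarrow>
     (\<forall>n. Bd X n \<in> Hom (Ob X n) (Ob X (n - 1)) \<and>
          Bd X (n - 1) \<cdot> Bd X n = Zero C (Ob X n) (Ob X (n - 2)))"

definition chain_map ::
  "('o, 'm, 'y) chain_scheme \<Rightarrow> ('o, 'm, 'z) chain_scheme \<Rightarrow> (int \<Rightarrow> 'm) \<Rightarrow> bool" where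
  "chain_map X Y f \<longleftrightarrow> chain_complex X \<and> chain_complex Y \<and>
     (\<forall>n. f n \<in> Hom (Ob X n) (Ob Y n) \<and> Bd Y n \<cdot> f n = f (n - 1) \<cdot> Bd X n)"

definition HOM_group ::
  "('o, 'm, 'y) chain_scheme \<Rightarrow> ('o, 'm, 'z) chain_scheme \<Rightarrow> int \<Rightarrow> (int \<Rightarrow> 'm) monoid" where
  "HOM_group X Y n =
     \<lparr>carrier = {\<phi>. \<forall>i. \<phi> i \<in> Hom (Ob X i) (Ob Y (i + n))},
      monoid.mult = (\<lambda>\<phi> \<psi> i. \<phi> i \<boxplus> \<psi> i),
      one = (\<lambda>i. Zero C (Ob X i) (Ob Y (i + n)))\<rparr>"

definition HOM_bd ::
  "('o, 'm, 'y) chain_scheme \<Rightarrow> ('o, 'm, 'z) chain_scheme \<Rightarrow> int \<Rightarrow> (int \<Rightarrow> 'm) \<Rightarrow> int \<Rightarrow> 'm" where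
  "HOM_bd X Y n \<phi> =
     (\<lambda>i. Bd Y (i + n) \<cdot> \<phi> i \<boxplus> scale (- (if even n then 1 else - 1)) (\<phi> (i - 1) \<cdot> Bd X i))"

definition in_degree_0 :: "'o \<Rightarrow> ('o, 'm) chain" where
  "in_degree_0 J =
     (let X = (\<lambda>n :: int. if n = 0 then J else zero_ob)
      in \<lparr>Ob = X, Bd = (\<lambda>n. Zero C (X n) (X (n - 1)))\<rparr>)"

definition weak_equiv ::
  "('o, 'm, 'y) chain_scheme \<Rightarrow> ('o, 'm, 'z) chain_scheme \<Rightarrow> (int \<Rightarrow> 'm) \<Rightarrow> bool" where
  "weak_equiv X Y f \<longleftrightarrow> chain_map X Y f \<and>
     (\<forall>J. rel_injective J \<longrightarrow>
        quasi_iso (HOM_group Y (in_degree_0 J)) (HOM_bd Y (in_degree_0 J))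
                  (HOM_group X (in_degree_0 J)) (HOM_bd X (in_degree_0 J))
                  (\<lambda>n \<phi> i. \<phi> i \<cdot> f i))"

definition weakly_contractible :: "('o, 'm, 'z) chain_scheme \<Rightarrow> bool" where
  "weakly_contractible Q \<longleftrightarrow> weak_equiv (in_degree_0 zero_ob) Q (\<lambda>n. Zero C zero_ob (Ob Q n))"

definition tensor_chain :: "'o \<Rightarrow> ('o, 'm, 'z) chain_scheme \<Rightarrow> ('o, 'm) chain" where
  "tensor_chain V X = \<lparr>Ob = (\<lambda>n. V \<odot> Ob X n), Bd = (\<lambda>n. Idn C V \<boxtimes> Bd X n)\<rparr>"

definition mixed_complex :: "('o, 'm, 'z) mixed_scheme \<Rightarrow> bool" where
  "mixed_complex M \<longleftrightarrow> chain_complex M \<and>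
     (\<forall>n. Bop M n \<in> Hom (Ob M n) (Ob M (n + 1)) \<and>
          Bop M (n + 1) \<cdot> Bop M n = Zero C (Ob M n) (Ob M (n + 2)) \<and>
          Bd M (n + 1) \<cdot> Bop M n \<boxplus> Bop M (n - 1) \<cdot> Bd M n = Zero C (Ob M n) (Ob M n))"

definition mixed_weak_equiv ::
  "('o, 'm, 'y) mixed_scheme \<Rightarrow> ('o, 'm, 'z) mixed_scheme \<Rightarrow> (int \<Rightarrow> 'm) \<Rightarrow> bool" where
  "mixed_weak_equiv M N f \<longleftrightarrow> mixed_complex M \<and> mixed_complex N \<and>
     (\<forall>n. Bop N n \<cdot> f n = f (n + 1) \<cdot> Bop M n) \<and> weak_equiv M N f"

definition S_complex :: "('o, 'm, 'z) schain_scheme \<Rightarrow> bool" where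
  "S_complex P \<longleftrightarrow> chain_complex P \<and> (\<exists>m. \<forall>n<m. is_zero_ob (Ob P n)) \<and>
     (\<forall>n. Sop P n \<in> Hom (Ob P n) (Ob P (n - 2)) \<and>
          Bd P (n - 2) \<cdot> Sop P n = Sop P (n - 1) \<cdot> Bd P n)"

definition S_weak_equiv ::
  "('o, 'm, 'y) schain_scheme \<Rightarrow> ('o, 'm, 'z) schain_scheme \<Rightarrow> (int \<Rightarrow> 'm) \<Rightarrow> bool" where
  "S_weak_equiv P Q f \<longleftrightarrow> S_complex P \<and> S_complex Q \<and>
     (\<forall>n. Sop Q n \<cdot> f n = f (n - 2) \<cdot> Sop P n) \<and> weak_equiv P Q f"


section \<open>The S-complex of a mixed complex\<close>

text \<open>For a mixed complex concentrated in degrees \<open>\<ge> 0\<close>, so that the summands with \<open>n - 2p < 0\<close> can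
  be left out and the direct sum is finite.\<close>

definition BB_idx :: "int \<Rightarrow> nat set" where
  "BB_idx n = {p. 2 * int p \<le> n}"

definition BB_smd :: "('o, 'm, 'z) mixed_scheme \<Rightarrow> int \<Rightarrow> nat \<Rightarrow> 'o" where
  "BB_smd M n p = Ob M (n - 2 * int p)"

definition BB :: "('o, 'm, 'z) mixed_scheme \<Rightarrow> ('o, 'm) schain" where
  "BB M =
     \<lparr>Ob = (\<lambda>n. dsum_ob (BB_idx n) (BB_smd M n)),
      Bd = (\<lambda>n. mat_arr (BB_idx n) (BB_smd M n) (BB_idx (n - 1)) (BB_smd M (n - 1))
              (\<lambda>p q. p = q \<or> p = Suc q)
              (\<lambda>p q. if p = q then Bd M (n - 2 * int p) else Bop M (n - 2 * int p))),
      Sop = (\<lambda>n. mat_arr (BB_idx n) (BB_smd M n) (BB_idx (n - 2)) (BB_smd M (n - 2))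
              (\<lambda>p q. p = Suc q)
              (\<lambda>p q. Idn C (Ob M (n - 2 * int p))))\<rparr>"

definition BB_map ::
  "('o, 'm, 'y) mixed_scheme \<Rightarrow> ('o, 'm, 'z) mixed_scheme \<Rightarrow> (int \<Rightarrow> 'm) \<Rightarrow> int \<Rightarrow> 'm" where
  "BB_map M N f n =
     mat_arr (BB_idx n) (BB_smd M n) (BB_idx n) (BB_smd N n) (=) (\<lambda>p q. f (n - 2 * int p))"


section \<open>The complexes built from the cyclic operators\<close>

definition nonneg_chain :: "(nat \<Rightarrow> 'o) \<Rightarrow> (nat \<Rightarrow> 'm) \<Rightarrow> ('o, 'm) chain" where
  "nonneg_chain X d =
     (let Y = (\<lambda>n :: int. if n < 0 then zero_ob else X (nat n))
      in \<lparr>Ob = Y, Bd = (\<lambda>n. if n \<le> 0 then Zero C (Y n) (Y (n - 1)) else d (nat n))\<rparr>)"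

definition nonneg_map :: "(nat \<Rightarrow> 'm) \<Rightarrow> int \<Rightarrow> 'm" where
  "nonneg_map f n = (if n < 0 then Zero C zero_ob zero_ob else f (nat n))"

text \<open>The bar complex carries the boundary \<open>b'\<close>: the boundary \<open>-b'\<close> of \<open>\<Omega>A/C(A)\<close> is that of the
  shift of \<open>(C, b')\<close>, with the usual sign of a shift.\<close>

definition Hoch :: "('o, 'm) cyc \<Rightarrow> ('o, 'm) chain" where
  "Hoch D = nonneg_chain (CX D) (Cb D)"

definition Bar :: "('o, 'm) cyc \<Rightarrow> ('o, 'm) chain" where
  "Bar D = nonneg_chain (CX D) (Cb' D)"

text \<open>The norm operator \<open>\<Sum>\<^sub>i (-1)\<^bsup>n i\<^esup> t\<^sup>i\<close>, \<open>0 \<le> i \<le> n\<close>.\<close>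

definition cyc_norm :: "('o, 'm) cyc \<Rightarrow> nat \<Rightarrow> 'm" where
  "cyc_norm D n =
     arr_sum (CX D n) (CX D n)
       (\<lambda>i. scale ((- 1) ^ (n * i)) (((\<lambda>g. Ct D n \<cdot> g) ^^ i) (Idn C (CX D n)))) {..n}"

text \<open>\<open>\<Omega>\<^sup>n\<close> is the direct sum of \<open>C\<^sub>n\<close> (summand 0) and, for \<open>n \<ge> 1\<close>, of \<open>C\<^bsub>n-1\<^esub>\<close> (summand 1, the
  part \<open>1 \<otimes> A\<^bsup>\<otimes>n\<^esup>\<close> of the tensor product of the unitalization with \<open>A\<^bsup>\<otimes>n\<^esup>\<close>); in negative degrees
  the direct sum is empty.  Evaluating the formula for \<open>b\<close> on \<open>1 \<otimes> a\<^sub>1 \<otimes> \<dots> \<otimes> a\<^sub>n\<close>, the terms \<open>i = 0\<close>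
  and \<open>i = n\<close> are \<open>a\<^sub>1 \<otimes> \<dots> \<otimes> a\<^sub>n\<close> and \<open>(-1)\<^sup>n a\<^sub>n \<otimes> a\<^sub>1 \<otimes> \<dots> \<otimes> a\<^bsub>n-1\<^esub>\<close> in \<open>C\<^bsub>n-1\<^esub>\<close>, and the remaining
  ones add up to \<open>- 1 \<otimes> b'(a\<^sub>1 \<otimes> \<dots> \<otimes> a\<^sub>n)\<close>.\<close>

definition Om_idx :: "int \<Rightarrow> nat set" where
  "Om_idx n = {s. s \<le> 1 \<and> int s \<le> n}"

definition Om_smd :: "('o, 'm) cyc \<Rightarrow> int \<Rightarrow> nat \<Rightarrow> 'o" where
  "Om_smd D n s = CX D (nat (n - int s))"

definition Om :: "('o, 'm) cyc \<Rightarrow> ('o, 'm) mixed" where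
  "Om D =
     \<lparr>Ob = (\<lambda>n. dsum_ob (Om_idx n) (Om_smd D n)),
      Bd = (\<lambda>n. mat_arr (Om_idx n) (Om_smd D n) (Om_idx (n - 1)) (Om_smd D (n - 1))
              (\<lambda>s s'. s' \<le> s)
              (\<lambda>s s'. if s = 0 then Cb D (nat n)
                      else if s' = 0
                      then Idn C (CX D (nat (n - 1))) \<boxplus> scale ((- 1) ^ nat n) (Ct D (nat (n - 1)))
                      else scale (- 1) (Cb' D (nat (n - 1))))),
      Bop = (\<lambda>n. mat_arr (Om_idx n) (Om_smd D n) (Om_idx (n + 1)) (Om_smd D (n + 1))
              (\<lambda>s s'. s = 0 \<and> s' = 1)
              (\<lambda>s s'. cyc_norm D (nat n)))\<rparr>"

definition Om_map :: "('o, 'm) cyc \<Rightarrow> ('o, 'm) cyc \<Rightarrow> (nat \<Rightarrow> 'm) \<Rightarrow> int \<Rightarrow> 'm" where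
  "Om_map D D' f n =
     mat_arr (Om_idx n) (Om_smd D n) (Om_idx n) (Om_smd D' n) (=) (\<lambda>s s'. f (nat (n - int s)))"


section \<open>Algebras and ideals\<close>

definition algebra :: "('o, 'm) alg \<Rightarrow> bool" where
  "algebra A \<longleftrightarrow> Mul A \<in> Hom (Und A \<odot> Und A) (Und A) \<and>
     Mul A \<cdot> (Mul A \<boxtimes> Idn C (Und A)) = Mul A \<cdot> (Idn C (Und A) \<boxtimes> Mul A)"

definition algebra_map :: "('o, 'm) alg \<Rightarrow> ('o, 'm) alg \<Rightarrow> 'm \<Rightarrow> bool" where
  "algebra_map A A' f \<longleftrightarrow> algebra A \<and> algebra A' \<and> f \<in> Hom (Und A) (Und A') \<and>
     f \<cdot> Mul A = Mul A' \<cdot> (f \<boxtimes> f)"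

text \<open>An ideal is a subobject \<open>i : K \<rightarrow> A\<close> that absorbs multiplication by \<open>A\<close>; \<open>l\<close> and \<open>r\<close> (unique, as
  \<open>i\<close> is monic) are the multiplications \<open>A \<otimes> K \<rightarrow> K\<close> and \<open>K \<otimes> A \<rightarrow> K\<close>.\<close>

definition is_left_mult :: "('o, 'm) alg \<Rightarrow> ('o, 'm) alg \<Rightarrow> 'm \<Rightarrow> 'm \<Rightarrow> bool" where
  "is_left_mult K A i l \<longleftrightarrow> l \<in> Hom (Und A \<odot> Und K) (Und K) \<and>
     i \<cdot> l = Mul A \<cdot> (Idn C (Und A) \<boxtimes> i)"

definition is_right_mult :: "('o, 'm) alg \<Rightarrow> ('o, 'm) alg \<Rightarrow> 'm \<Rightarrow> 'm \<Rightarrow> bool" where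
  "is_right_mult K A i r \<longleftrightarrow> r \<in> Hom (Und K \<odot> Und A) (Und K) \<and>
     i \<cdot> r = Mul A \<cdot> (i \<boxtimes> Idn C (Und A))"

definition two_sided_ideal :: "('o, 'm) alg \<Rightarrow> ('o, 'm) alg \<Rightarrow> 'm \<Rightarrow> bool" where
  "two_sided_ideal K A i \<longleftrightarrow> algebra_map K A i \<and> monic i \<and>
     (\<exists>l. is_left_mult K A i l) \<and> (\<exists>r. is_right_mult K A i r)"

definition cof_ideal :: "('o, 'm) alg \<Rightarrow> ('o, 'm) alg \<Rightarrow> 'm \<Rightarrow> bool" where
  "cof_ideal K A i \<longleftrightarrow> two_sided_ideal K A i \<and> cofibration i"


section \<open>The operators of an algebra\<close>

fun tens_obs :: "'o list \<Rightarrow> 'o" where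
  "tens_obs [] = Unit C"
| "tens_obs (x # xs) = x \<odot> tens_obs xs"

fun tens_arrs :: "'m list \<Rightarrow> 'm" where
  "tens_arrs [] = Idn C (Unit C)"
| "tens_arrs (f # fs) = f \<boxtimes> tens_arrs fs"

text \<open>For objects \<open>x\<^sub>0, \<dots>, x\<^sub>n\<close> and \<open>m : x\<^sub>i \<otimes> x\<^bsub>i+1\<^esub> \<rightarrow> y\<close>, the arrow that applies \<open>m\<close> to the factors
  \<open>i\<close> and \<open>i + 1\<close>; and the arrow that moves the last factor to the front.\<close>

definition face_arr :: "'o list \<Rightarrow> nat \<Rightarrow> 'm \<Rightarrow> 'm" where
  "face_arr xs i m =
     Idn C (tens_obs (take i xs)) \<boxtimes> m \<boxtimes> Idn C (tens_obs (drop (i + 2) xs))"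

definition rot_arr :: "'o list \<Rightarrow> 'm" where
  "rot_arr xs = Symm C (tens_obs (butlast xs)) (last xs)"

definition alg_ob :: "('o, 'm) alg \<Rightarrow> nat \<Rightarrow> 'o" where
  "alg_ob A n = tens_obs (replicate (n + 1) (Und A))"

definition alg_face :: "('o, 'm) alg \<Rightarrow> nat \<Rightarrow> nat \<Rightarrow> 'm" where
  "alg_face A n i = face_arr (replicate (n + 1) (Und A)) i (Mul A)"

definition alg_rot :: "('o, 'm) alg \<Rightarrow> nat \<Rightarrow> 'm" where
  "alg_rot A n = rot_arr (replicate (n + 1) (Und A))"

definition alg_b' :: "('o, 'm) alg \<Rightarrow> nat \<Rightarrow> 'm" where
  "alg_b' A n =
     arr_sum (alg_ob A n) (alg_ob A (n - 1)) (\<lambda>i. scale ((- 1) ^ i) (alg_face A n i)) {..<n}"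

definition alg_b :: "('o, 'm) alg \<Rightarrow> nat \<Rightarrow> 'm" where
  "alg_b A n = alg_b' A n \<boxplus> scale ((- 1) ^ n) (alg_face A n 0 \<cdot> alg_rot A n)"

definition cyc_of :: "('o, 'm) alg \<Rightarrow> ('o, 'm) cyc" where
  "cyc_of A = \<lparr>CX = alg_ob A, Cb = alg_b A, Cb' = alg_b' A, Ct = alg_rot A\<rparr>"


section \<open>The operators of a cof-ideal\<close>

text \<open>A map \<open>f : {0, \<dots>, n} \<rightarrow> {0, 1}\<close> is encoded as the list \<open>[f 0, \<dots>, f n]\<close> of Booleans, with
  \<^term>\<open>False\<close> for 0 (factor \<open>K\<close>) and \<^term>\<open>True\<close> for 1 (factor \<open>A\<close>).  Multiplying neighbouring
  factors of types \<open>u\<close> and \<open>v\<close> gives a factor of type \<open>u \<and> v\<close>.\<close>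

definition pair_ob :: "('o, 'm) alg \<Rightarrow> ('o, 'm) alg \<Rightarrow> bool \<Rightarrow> 'o" where
  "pair_ob K A u = (if u then Und A else Und K)"

definition pair_mul :: "('o, 'm) alg \<Rightarrow> ('o, 'm) alg \<Rightarrow> 'm \<Rightarrow> bool \<Rightarrow> bool \<Rightarrow> 'm" where
  "pair_mul K A i u v =
     (if u then (if v then Mul A else (THE l. is_left_mult K A i l))
           else (if v then (THE r. is_right_mult K A i r) else Mul K))"

definition word_obs :: "('o, 'm) alg \<Rightarrow> ('o, 'm) alg \<Rightarrow> bool list \<Rightarrow> 'o list" where
  "word_obs K A w = map (pair_ob K A) w"

definition word_ob :: "('o, 'm) alg \<Rightarrow> ('o, 'm) alg \<Rightarrow> bool list \<Rightarrow> 'o" where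
  "word_ob K A w = tens_obs (word_obs K A w)"

definition word_incl :: "('o, 'm) alg \<Rightarrow> ('o, 'm) alg \<Rightarrow> 'm \<Rightarrow> bool list \<Rightarrow> bool list \<Rightarrow> 'm" where
  "word_incl K A i w w' =
     tens_arrs (map2 (\<lambda>u v. if u = v then Idn C (pair_ob K A u) else i) w w')"

definition merge :: "nat \<Rightarrow> bool list \<Rightarrow> bool list" where
  "merge j w = take j w @ [w ! j \<and> w ! (j + 1)] @ drop (j + 2) w"

definition rot :: "bool list \<Rightarrow> bool list" where
  "rot w = last w # butlast w"

definition word_face :: "('o, 'm) alg \<Rightarrow> ('o, 'm) alg \<Rightarrow> 'm \<Rightarrow> bool list \<Rightarrow> nat \<Rightarrow> 'm" where
  "word_face K A i w j = face_arr (word_obs K A w) j (pair_mul K A i (w ! j) (w ! (j + 1)))"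

definition word_rot :: "('o, 'm) alg \<Rightarrow> ('o, 'm) alg \<Rightarrow> bool list \<Rightarrow> 'm" where
  "word_rot K A w = rot_arr (word_obs K A w)"

definition words :: "nat \<Rightarrow> bool list set" where
  "words n = {w. length w = n + 1 \<and> w \<noteq> replicate (n + 1) True}"

definition word_edges ::
  "('o, 'm) alg \<Rightarrow> ('o, 'm) alg \<Rightarrow> 'm \<Rightarrow> nat \<Rightarrow> (bool list \<times> 'm \<times> bool list) set" where
  "word_edges K A i n =
     {(w, word_incl K A i w w', w') | w w'. w \<in> words n \<and> w' \<in> words n \<and> list_all2 (\<le>) w w'}"

definition rel_colim ::
  "('o, 'm) alg \<Rightarrow> ('o, 'm) alg \<Rightarrow> 'm \<Rightarrow> nat \<Rightarrow> 'o \<times> (bool list \<Rightarrow> 'm)" where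
  "rel_colim K A i n =
     (SOME (P, c). is_colimit (words n) (word_ob K A) (word_edges K A i n) P c)"

definition rel_ob :: "('o, 'm) alg \<Rightarrow> ('o, 'm) alg \<Rightarrow> 'm \<Rightarrow> nat \<Rightarrow> 'o" where
  "rel_ob K A i n = fst (rel_colim K A i n)"

definition rel_in :: "('o, 'm) alg \<Rightarrow> ('o, 'm) alg \<Rightarrow> 'm \<Rightarrow> nat \<Rightarrow> bool list \<Rightarrow> 'm" where
  "rel_in K A i n = snd (rel_colim K A i n)"

definition rel_induced ::
  "('o, 'm) alg \<Rightarrow> ('o, 'm) alg \<Rightarrow> 'm \<Rightarrow> nat \<Rightarrow> nat \<Rightarrow> (bool list \<Rightarrow> 'm) \<Rightarrow> 'm" where
  "rel_induced K A i n m u =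
     (THE h. h \<in> Hom (rel_ob K A i n) (rel_ob K A i m) \<and>
             (\<forall>w\<in>words n. h \<cdot> rel_in K A i n w = u w))"

definition rel_rot :: "('o, 'm) alg \<Rightarrow> ('o, 'm) alg \<Rightarrow> 'm \<Rightarrow> nat \<Rightarrow> 'm" where
  "rel_rot K A i n =
     rel_induced K A i n n (\<lambda>w. rel_in K A i n (rot w) \<cdot> word_rot K A w)"

definition word_b' :: "('o, 'm) alg \<Rightarrow> ('o, 'm) alg \<Rightarrow> 'm \<Rightarrow> nat \<Rightarrow> bool list \<Rightarrow> 'm" where
  "word_b' K A i n w =
     arr_sum (word_ob K A w) (rel_ob K A i (n - 1))
       (\<lambda>j. scale ((- 1) ^ j) (rel_in K A i (n - 1) (merge j w) \<cdot> word_face K A i w j)) {..<n}"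

definition word_b :: "('o, 'm) alg \<Rightarrow> ('o, 'm) alg \<Rightarrow> 'm \<Rightarrow> nat \<Rightarrow> bool list \<Rightarrow> 'm" where
  "word_b K A i n w =
     word_b' K A i n w \<boxplus>
     scale ((- 1) ^ n)
       (rel_in K A i (n - 1) (merge 0 (rot w)) \<cdot> word_face K A i (rot w) 0 \<cdot> word_rot K A w)"

definition cyc_rel :: "('o, 'm) alg \<Rightarrow> ('o, 'm) alg \<Rightarrow> 'm \<Rightarrow> ('o, 'm) cyc" where
  "cyc_rel K A i =
     \<lparr>CX = rel_ob K A i,
      Cb = (\<lambda>n. rel_induced K A i n (n - 1) (word_b K A i n)),
      Cb' = (\<lambda>n. rel_induced K A i n (n - 1) (word_b' K A i n)),
      Ct = rel_rot K A i\<rparr>"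

text \<open>The natural map \<open>C\<^sub>n K \<rightarrow> C\<^sub>n (K:A)\<close>.\<close>

definition rel_nat :: "('o, 'm) alg \<Rightarrow> ('o, 'm) alg \<Rightarrow> 'm \<Rightarrow> nat \<Rightarrow> 'm" where
  "rel_nat K A i n = rel_in K A i n (replicate (n + 1) False)"


section \<open>Excision\<close>

definition C_excisive :: "('o, 'm) alg \<Rightarrow> bool" where
  "C_excisive K \<longleftrightarrow> (\<forall>A i. cof_ideal K A i \<longrightarrow>
     weak_equiv (Hoch (cyc_of K)) (Hoch (cyc_rel K A i)) (nonneg_map (rel_nat K A i)))"

definition Cbar_excisive :: "('o, 'm) alg \<Rightarrow> bool" where
  "Cbar_excisive K \<longleftrightarrow> (\<forall>A i. cof_ideal K A i \<longrightarrow>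
     weak_equiv (Bar (cyc_of K)) (Bar (cyc_rel K A i)) (nonneg_map (rel_nat K A i)))"

definition Omega_excisive :: "('o, 'm) alg \<Rightarrow> bool" where
  "Omega_excisive K \<longleftrightarrow> (\<forall>A i. cof_ideal K A i \<longrightarrow>
     mixed_weak_equiv (Om (cyc_of K)) (Om (cyc_rel K A i))
       (Om_map (cyc_of K) (cyc_rel K A i) (rel_nat K A i)))"

definition BBOmega_excisive :: "('o, 'm) alg \<Rightarrow> bool" where
  "BBOmega_excisive K \<longleftrightarrow> (\<forall>A i. cof_ideal K A i \<longrightarrow>
     S_weak_equiv (BB (Om (cyc_of K))) (BB (Om (cyc_rel K A i)))
       (BB_map (Om (cyc_of K)) (Om (cyc_rel K A i))
         (Om_map (cyc_of K) (cyc_rel K A i) (rel_nat K A i))))"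

end

end

theory Submission
  imports Defs
begin

text \<open>Everything is tested on the cochains \<open>Hom(-, J)\<close> with \<open>J\<close> relatively injective; (i) says that
  \<open>Hom(V \<otimes> C\<^bsup>bar\<^esup> K, J)\<close> is acyclic for all \<open>V\<close>.

  Assume (i).  As \<open>K \<rightarrow> A\<close> is a cofibration, compatible families of arrows to \<open>J\<close> on a down-closed set of words in
  \<open>K\<close> and \<open>A\<close> extend to \<open>A\<^bsup>\<otimes>n+1\<^esup>\<close>, so the cochains of \<open>C(K:A)\<close> map onto those of \<open>C(K)\<close>.  The kernel is
  filtered by sets of words in such a way that, on each graded piece, both \<open>b\<close> and \<open>b'\<close> become the bar
  boundary of the middle factor of \<open>(A/K)\<^bsup>\<otimes>a\<^esup> \<otimes> C\<^bsup>bar\<^esup> K \<otimes> (A/K) \<otimes> A\<^bsup>\<otimes>c-1\<^esup>\<close> (without the factors on the right if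
  \<open>c = 0\<close>), and hence is acyclic.  The complexes \<open>\<Omega>\<close> and \<open>B\<Omega>\<close> are finite iterated extensions of \<open>C\<close> and \<open>C\<^bsup>bar\<^esup>\<close> in
  each degree.

  Conversely, let \<open>A = K \<oplus> V\<close> with \<open>V\<close> annihilated by all products.  The words with exactly one factor \<open>V\<close>, in
  the first place, retract \<open>V \<otimes> C\<^bsup>bar\<^esup> K\<close> (shifted) off the relative bar complex, compatibly with restriction
  to \<open>K\<close>.  Since \<open>N b = b' N\<close> for the norm \<open>N\<close>, composing with \<open>N\<close> does the same for \<open>C\<close>, \<open>\<Omega>\<close> and \<open>B\<Omega>\<close>.\<close>

text \<open>The base category offers no exact sequences: the tensor product is assumed to respect
  cofibrations and cokernels, not kernels. Two moves remain for arrows to \<open>J\<close>: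
  extension along a cofibration, and factorization through A/K of an arrow that kills K. Both are
  made one tensor factor at a time, and the factors already treated, among them copies of A/K, are
  absorbed into a coefficient object; this is why (i) has to speak of all V. The obstacle to
  treating \<open>b\<close> like \<open>b'\<close> is the last face, which multiplies the two ends
  of a word. As soon as A^a K^(m+1) A^c has a letter A at one end, that face lies in a lower step of
  the filtration. So modulo lower steps the two boundaries differ on the pure words of K alone,
  where the cochains in question vanish. The converse works with injectivity on cohomology. For the
  mixed complex and the S-complex, a Hochschild cochain extended by zero is a cocycle if it also
  kills 1 - t and the image of B. The first is achieved by the norm, the second holds because B
  lands in the part on which the extension is zero.\<close>

locale base_cat =
  fixes C :: "('o, 'm) tensor_cat" (structure)
  assumes base: "base_category C"
begin

lemma additive: "additive_category C"
  and monoidal: "symmetric_strict_monoidal C"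
  and compatible: "tensor_compatible C"
  using base by (simp_all add: base_category_def)

lemma cat: "category C" and preadd: "preadditive C"
  using additive by (simp_all add: additive_category_def)

lemma in_Hom [simp]: "f \<in> Hom C a b \<longleftrightarrow> Dom C f = a \<and> Cod C f = b"
  by (simp add: Hom_def)

lemma Dom_Idn [simp]: "Dom C (Idn C a) = a" and Cod_Idn [simp]: "Cod C (Idn C a) = a"
  using cat by (simp_all add: category_def)

lemma Dom_comp [simp]: "Cod C f = Dom C g \<Longrightarrow> Dom C (g \<cdot> f) = Dom C f"
  and Cod_comp [simp]: "Cod C f = Dom C g \<Longrightarrow> Cod C (g \<cdot> f) = Cod C g"
  using cat by (simp_all add: category_def)

lemma comp_Idn [simp]: "Dom C f = a \<Longrightarrow> f \<cdot> Idn C a = f"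
  and Idn_comp [simp]: "Cod C f = a \<Longrightarrow> Idn C a \<cdot> f = f"
  using cat by (auto simp: category_def)

lemma comp_assoc [simp]:
  "Cod C f = Dom C g \<Longrightarrow> Cod C g = Dom C h \<Longrightarrow> (h \<cdot> g) \<cdot> f = h \<cdot> (g \<cdot> f)"
  using cat by (simp add: category_def)

subsection \<open>The groups of arrows\<close>

lemma comm_group_hom: "comm_group (hom_group C a b)"
  using preadd by (simp add: preadditive_def)

sublocale HG: comm_group "hom_group C a b" for a b
  by (rule comm_group_hom)

lemma hom_group_simps [simp]:
  "carrier (hom_group C a b) = Hom C a b"
  "monoid.mult (hom_group C a b) f g = f \<boxplus> g"
  "one (hom_group C a b) = Zero C a b"
  by (simp_all add: hom_group_def)

lemma Dom_Zero [simp]: "Dom C (Zero C a b) = a" and Cod_Zero [simp]: "Cod C (Zero C a b) = b"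
  using HG.one_closed[of a b] by simp_all

lemma Plus_Hom:
  "Dom C f = Dom C g \<Longrightarrow> Cod C f = Cod C g \<Longrightarrow> f \<boxplus> g \<in> Hom C (Dom C f) (Cod C f)"
  using HG.m_closed[of f "Dom C f" "Cod C f" g] by (simp del: in_Hom) simp

lemma Dom_Plus [simp]: "Dom C f = Dom C g \<Longrightarrow> Cod C f = Cod C g \<Longrightarrow> Dom C (f \<boxplus> g) = Dom C f"
  and Cod_Plus [simp]: "Dom C f = Dom C g \<Longrightarrow> Cod C f = Cod C g \<Longrightarrow> Cod C (f \<boxplus> g) = Cod C f"
  using Plus_Hom by simp_all

lemma Plus_assoc:
  "\<lbrakk>Dom C f = Dom C g; Cod C f = Cod C g; Dom C h = Dom C g; Cod C h = Cod C g\<rbrakk> \<Longrightarrow>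
     (f \<boxplus> g) \<boxplus> h = f \<boxplus> (g \<boxplus> h)"
  using HG.m_assoc[of f "Dom C f" "Cod C f" g h] by simp

lemma Plus_commute: "Dom C f = Dom C g \<Longrightarrow> Cod C f = Cod C g \<Longrightarrow> f \<boxplus> g = g \<boxplus> f"
  using HG.m_comm[of f "Dom C f" "Cod C f" g] by simp

lemma Plus_left_commute:
  "\<lbrakk>Dom C f = Dom C g; Cod C f = Cod C g; Dom C h = Dom C g; Cod C h = Cod C g\<rbrakk> \<Longrightarrow>
     f \<boxplus> (g \<boxplus> h) = g \<boxplus> (f \<boxplus> h)"
  using HG.m_lcomm[of f "Dom C f" "Cod C f" g h] by simp

lemmas Plus_ac = Plus_assoc Plus_commute Plus_left_commute

lemma Plus_Zero [simp]: "Dom C f = a \<Longrightarrow> Cod C f = b \<Longrightarrow> f \<boxplus> Zero C a b = f"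
  and Zero_Plus [simp]: "Dom C f = a \<Longrightarrow> Cod C f = b \<Longrightarrow> Zero C a b \<boxplus> f = f"
  using HG.r_one[of f a b] HG.l_one[of f a b] by simp_all

lemma Plus_left_cancel:
  "\<lbrakk>Dom C f = Dom C g; Cod C f = Cod C g; Dom C h = Dom C g; Cod C h = Cod C g\<rbrakk> \<Longrightarrow>
     f \<boxplus> g = f \<boxplus> h \<longleftrightarrow> g = h"
  using HG.right_cancel[of f "Dom C f" "Cod C f" g h] by (simp add: Plus_commute[of f])

lemma comp_Plus [simp]:
  "\<lbrakk>Dom C f = Dom C g; Cod C f = Dom C h; Cod C g = Dom C h\<rbrakk> \<Longrightarrow> h \<cdot> (f \<boxplus> g) = (h \<cdot> f) \<boxplus> (h \<cdot> g)"
  using preadd unfolding preadditive_def by simp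

lemma Plus_comp [simp]:
  "\<lbrakk>Dom C g = Cod C f; Dom C h = Cod C f; Cod C g = Cod C h\<rbrakk> \<Longrightarrow> (g \<boxplus> h) \<cdot> f = (g \<cdot> f) \<boxplus> (h \<cdot> f)"
  using preadd unfolding preadditive_def by simp

lemma comp_Zero [simp]:
  assumes "b = Dom C g" shows "g \<cdot> Zero C a b = Zero C a (Cod C g)"
proof -
  let ?z = "g \<cdot> Zero C a b"
  have "?z \<boxplus> ?z = g \<cdot> (Zero C a b \<boxplus> Zero C a b)"
    using assms by (simp del: Plus_Zero Zero_Plus)
  then have "?z \<boxplus> ?z = ?z \<boxplus> Zero C a (Cod C g)"
    using assms by simp
  then show ?thesis
    using assms by (subst (asm) Plus_left_cancel) simp_all
qed

lemma Zero_comp [simp]: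
  assumes "b = Cod C f" shows "Zero C b c \<cdot> f = Zero C (Dom C f) c"
proof -
  let ?z = "Zero C b c \<cdot> f"
  have "?z \<boxplus> ?z = (Zero C b c \<boxplus> Zero C b c) \<cdot> f"
    using assms by (simp del: Plus_Zero Zero_Plus)
  then have "?z \<boxplus> ?z = ?z \<boxplus> Zero C (Dom C f) c"
    using assms by simp
  then show ?thesis
    using assms by (subst (asm) Plus_left_cancel) simp_all
qed

lemma scale_Hom: "scale C z f \<in> Hom C (Dom C f) (Cod C f)"
  using HG.int_pow_closed[of f "Dom C f" "Cod C f" z] by (simp add: scale_def del: in_Hom) simp

lemma Dom_scale [simp]: "Dom C (scale C z f) = Dom C f"
  and Cod_scale [simp]: "Cod C (scale C z f) = Cod C f"
  using scale_Hom by simp_all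

lemma scale_1 [simp]: "scale C 1 f = f"
  using HG.int_pow_1[of f "Dom C f" "Cod C f"] by (simp add: scale_def)

lemma scale_0 [simp]: "scale C 0 f = Zero C (Dom C f) (Cod C f)"
  by (simp add: scale_def)

lemma scale_add: "scale C (z + w) f = scale C z f \<boxplus> scale C w f"
  using HG.int_pow_mult[of f "Dom C f" "Cod C f" z w] by (simp add: scale_def)

lemma scale_scale [simp]: "scale C z (scale C w f) = scale C (z * w) f"
  using HG.int_pow_pow[of f "Dom C f" "Cod C f" w z]
  by (simp add: scale_def[of C z] mult.commute) (simp add: scale_def)

lemma scale_Plus [simp]:
  "Dom C f = Dom C g \<Longrightarrow> Cod C f = Cod C g \<Longrightarrow> scale C z (f \<boxplus> g) = scale C z f \<boxplus> scale C z g"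
  using HG.int_pow_distrib[of f "Dom C f" "Cod C f" g z] by (simp add: scale_def)

lemma scale_Zero [simp]: "scale C z (Zero C a b) = Zero C a b"
  using HG.int_pow_one[of a b z] by (simp add: scale_def)

lemma scale_minus_Plus [simp]: "f \<boxplus> scale C (- 1) f = Zero C (Dom C f) (Cod C f)"
  using scale_add[of 1 "-1" f] by simp

text \<open>One statement for every additive operation on arrows; it is instantiated with
  composition and with tensoring by an identity, on either side.\<close>

lemma hom_scale:
  assumes T: "\<And>f g. \<lbrakk>Dom C f = a; Cod C f = b; Dom C g = a; Cod C g = b\<rbrakk> \<Longrightarrow> T (f \<boxplus> g) = T f \<boxplus> T g"
    and Hom: "\<And>f. \<lbrakk>Dom C f = a; Cod C f = b\<rbrakk> \<Longrightarrow> Dom C (T f) = a' \<and> Cod C (T f) = b'"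
    and f: "Dom C f = a" "Cod C f = b"
  shows "T (scale C z f) = scale C z (T f)"
proof -
  have "T \<in> hom (hom_group C a b) (hom_group C a' b')"
    using T Hom by (auto simp: hom_def)
  then interpret group_hom "hom_group C a b" "hom_group C a' b'" T
    by (unfold_locales)
  show ?thesis
    using hom_int_pow[of f z] f Hom[OF f] by (simp add: scale_def int_pow_def)
qed

lemma comp_scale [simp]: "Cod C f = Dom C g \<Longrightarrow> g \<cdot> scale C z f = scale C z (g \<cdot> f)"
  by (rule hom_scale[where a = "Dom C f" and b = "Cod C f" and a' = "Dom C f" and b' = "Cod C g"]) simp_all

lemma scale_comp [simp]: "Cod C f = Dom C g \<Longrightarrow> scale C z g \<cdot> f = scale C z (g \<cdot> f)"
  by (rule hom_scale[where a = "Dom C g" and b = "Cod C g" and a' = "Dom C f" and b' = "Cod C g"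
        and T = "\<lambda>g. g \<cdot> f"]) simp_all

lemma scale_minus_one_eq_iff:
  assumes "Dom C f = Dom C g" "Cod C f = Cod C g" 
  shows "f \<boxplus> scale C (- 1) g = Zero C (Dom C g) (Cod C g) \<longleftrightarrow> f = g"
proof
  assume *: "f \<boxplus> scale C (- 1) g = Zero C (Dom C g) (Cod C g)"
  have "f = f \<boxplus> (scale C (- 1) g \<boxplus> g)"
    using assms by (simp add: Plus_commute)
  also have "\<dots> = (f \<boxplus> scale C (- 1) g) \<boxplus> g"
    using assms by (simp only: Plus_assoc Dom_scale Cod_scale)
  also have "\<dots> = g" using * assms by simp
  finally show "f = g" .
qed (use assms in simp)

lemma scale_sq [simp]: "scale C ((- 1) ^ n) (scale C ((- 1) ^ n) f) = f"
  by (simp flip: power_mult_distrib)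

lemma scale_eq_Zero_iff:
  assumes "Dom C f = a" "Cod C f = b"
  shows "scale C ((- 1) ^ n) f = Zero C a b \<longleftrightarrow> f = Zero C a b"
  by (metis scale_sq scale_Zero)

subsection \<open>Sums of arrows\<close>

lemma sum_Hom:
  assumes "\<And>i. i \<in> I \<Longrightarrow> Dom C (f i) = a \<and> Cod C (f i) = b"
  shows "arr_sum C a b f I \<in> Hom C a b"
  using HG.finprod_closed[of f I a b] assms by (auto simp: arr_sum_def Pi_def)

lemma Dom_sum [simp]:
  "(\<And>i. i \<in> I \<Longrightarrow> Dom C (f i) = a) \<Longrightarrow> (\<And>i. i \<in> I \<Longrightarrow> Cod C (f i) = b) \<Longrightarrow>
     Dom C (arr_sum C a b f I) = a"
  and Cod_sum [simp]:
  "(\<And>i. i \<in> I \<Longrightarrow> Dom C (f i) = a) \<Longrightarrow> (\<And>i. i \<in> I \<Longrightarrow> Cod C (f i) = b) \<Longrightarrow>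
     Cod C (arr_sum C a b f I) = b"
  using sum_Hom[of I f a b] by simp_all

lemma sum_empty [simp]: "arr_sum C a b f {} = Zero C a b"
  by (simp add: arr_sum_def)

lemma sum_insert [simp]:
  "\<lbrakk>finite I; i \<notin> I; Dom C (f i) = a; Cod C (f i) = b;
    \<And>j. j \<in> I \<Longrightarrow> Dom C (f j) = a; \<And>j. j \<in> I \<Longrightarrow> Cod C (f j) = b\<rbrakk>
    \<Longrightarrow> arr_sum C a b f (insert i I) = f i \<boxplus> arr_sum C a b f I"
  using HG.finprod_insert[of I i f a b] by (simp add: arr_sum_def Pi_def)

lemma sum_cong:
  "\<lbrakk>I = I'; \<And>i. i \<in> I' \<Longrightarrow> f i = g i; \<And>i. i \<in> I' \<Longrightarrow> Dom C (g i) = a; \<And>i. i \<in> I' \<Longrightarrow> Cod C (g i) = b\<rbrakk>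
    \<Longrightarrow> arr_sum C a b f I = arr_sum C a b g I'"
  using HG.finprod_cong'[of I I' g a b f] by (simp add: arr_sum_def Pi_def)

lemma sum_zero: "(\<And>i. i \<in> I \<Longrightarrow> f i = Zero C a b) \<Longrightarrow> arr_sum C a b f I = Zero C a b"
  using HG.finprod_one_eqI[of I f a b] by (simp add: arr_sum_def)

lemma sum_Un_disjoint:
  "\<lbrakk>finite I; finite I'; I \<inter> I' = {}; \<And>j. j \<in> I \<union> I' \<Longrightarrow> Dom C (f j) = a; \<And>j. j \<in> I \<union> I' \<Longrightarrow> Cod C (f j) = b\<rbrakk>
    \<Longrightarrow> arr_sum C a b f (I \<union> I') = arr_sum C a b f I \<boxplus> arr_sum C a b f I'"
  using HG.finprod_Un_disjoint[of I I' f a b] by (simp add: arr_sum_def Pi_def)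

lemma sum_Plus:
  "\<lbrakk>\<And>i. i \<in> I \<Longrightarrow> Dom C (f i) = a \<and> Cod C (f i) = b \<and> Dom C (g i) = a \<and> Cod C (g i) = b\<rbrakk>
    \<Longrightarrow> arr_sum C a b (\<lambda>i. f i \<boxplus> g i) I = arr_sum C a b f I \<boxplus> arr_sum C a b g I"
  using HG.finprod_multf[of f I a b g] by (simp add: arr_sum_def Pi_def)

lemma sum_reindex:
  "\<lbrakk>inj_on h I; \<And>i. i \<in> I \<Longrightarrow> Dom C (f (h i)) = a \<and> Cod C (f (h i)) = b\<rbrakk>
    \<Longrightarrow> arr_sum C a b f (h ` I) = arr_sum C a b (\<lambda>i. f (h i)) I"
  using HG.finprod_reindex[of f h I a b] by (auto simp: arr_sum_def Pi_def)

lemma sum_reindex_bij: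
  assumes "bij_betw h I I'" "\<And>i. i \<in> I \<Longrightarrow> f (h i) = g i"
    and "\<And>i. i \<in> I \<Longrightarrow> Dom C (g i) = a \<and> Cod C (g i) = b"
  shows "arr_sum C a b g I = arr_sum C a b f I'"
proof -
  have "arr_sum C a b f (h ` I) = arr_sum C a b (\<lambda>i. f (h i)) I"
    using assms by (intro sum_reindex) (auto simp: bij_betw_def)
  also have "\<dots> = arr_sum C a b g I"
    using assms by (intro sum_cong) auto
  finally show ?thesis
    using assms by (simp add: bij_betw_def)
qed

lemma sum_mono_neutral:
  "\<lbrakk>finite I; I' \<subseteq> I; \<And>i. i \<in> I - I' \<Longrightarrow> f i = Zero C a b;
    \<And>i. i \<in> I' \<Longrightarrow> Dom C (f i) = a \<and> Cod C (f i) = b\<rbrakk>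
    \<Longrightarrow> arr_sum C a b f I = arr_sum C a b f I'"
  unfolding arr_sum_def
  by (rule HG.finprod_mono_neutral_cong_right) (auto simp: Pi_def, (metis DiffI Dom_Zero Cod_Zero)+)

lemma sum_single:
  assumes "finite I" "i \<in> I" "\<And>j. j \<in> I \<Longrightarrow> j \<noteq> i \<Longrightarrow> f j = Zero C a b"
    and "Dom C (f i) = a" "Cod C (f i) = b"
  shows "arr_sum C a b f I = f i"
proof -
  have "arr_sum C a b f I = arr_sum C a b f {i}"
    using assms by (intro sum_mono_neutral) auto
  then show ?thesis
    using sum_insert[of "{}" i f a b] assms(4,5) by simp
qed

lemma hom_sum:
  assumes T: "\<And>f g. \<lbrakk>Dom C f = a; Cod C f = b; Dom C g = a; Cod C g = b\<rbrakk> \<Longrightarrow> T (f \<boxplus> g) = T f \<boxplus> T g"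
    and Hom: "\<And>f. \<lbrakk>Dom C f = a; Cod C f = b\<rbrakk> \<Longrightarrow> Dom C (T f) = a' \<and> Cod C (T f) = b'"
    and f: "\<And>i. i \<in> I \<Longrightarrow> Dom C (f i) = a \<and> Cod C (f i) = b"
  shows "T (arr_sum C a b f I) = arr_sum C a' b' (\<lambda>i. T (f i)) I"
proof -
  have "T \<in> hom (hom_group C a b) (hom_group C a' b')"
    using T Hom by (auto simp: hom_def)
  then interpret group_hom "hom_group C a b" "hom_group C a' b'" T
    by (unfold_locales)
  have T0: "T (Zero C a b) = Zero C a' b'"
    using hom_one by simp
  show ?thesis
    using f
  proof (induction I rule: infinite_finite_induct)
    \<comment> \<open>On an infinite index set \<open>finprod\<close> returns the unit, so the sum
      is the zero arrow, which the additive \<open>T\<close> preserves.\<close>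
    case (infinite I) then show ?case using T0 by (simp add: arr_sum_def)
  next
    case empty then show ?case using T0 by simp
  next
    case (insert i I) 
    then have "T (arr_sum C a b f (insert i I)) = T (f i) \<boxplus> T (arr_sum C a b f I)"
      by (simp add: T)
    then show ?case using insert Hom by simp
  qed
qed

lemma comp_sum:
  "\<lbrakk>Dom C g = b; Cod C g = c; \<And>i. i \<in> I \<Longrightarrow> Dom C (f i) = a \<and> Cod C (f i) = b\<rbrakk> \<Longrightarrow>
     g \<cdot> arr_sum C a b f I = arr_sum C a c (\<lambda>i. g \<cdot> f i) I"
  by (rule hom_sum) simp_all

lemma sum_comp:
  "\<lbrakk>Dom C g = c; Cod C g = a; \<And>i. i \<in> I \<Longrightarrow> Dom C (f i) = a \<and> Cod C (f i) = b\<rbrakk> \<Longrightarrow>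
     arr_sum C a b f I \<cdot> g = arr_sum C c b (\<lambda>i. f i \<cdot> g) I"
  by (rule hom_sum[where T = "\<lambda>f. f \<cdot> g"]) simp_all

lemma scale_sum:
  "\<lbrakk>\<And>i. i \<in> I \<Longrightarrow> Dom C (f i) = a \<and> Cod C (f i) = b\<rbrakk> \<Longrightarrow>
     scale C z (arr_sum C a b f I) = arr_sum C a b (\<lambda>i. scale C z (f i)) I"
  by (rule hom_sum) simp_all

lemma sum_Sigma:
  assumes "finite I" "finite J" "\<And>i j. i \<in> I \<Longrightarrow> j \<in> J \<Longrightarrow> Dom C (f i j) = a \<and> Cod C (f i j) = b"
  shows "arr_sum C a b (\<lambda>i. arr_sum C a b (f i) J) I = arr_sum C a b (\<lambda>(i, j). f i j) (I \<times> J)"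
  using assms(1,3)
proof (induction I rule: finite_induct)
  case empty then show ?case by simp
next
  case (insert i I)
  have "insert i I \<times> J = Pair i ` J \<union> I \<times> J" by auto
  then have "arr_sum C a b (\<lambda>(i, j). f i j) (insert i I \<times> J) =
      arr_sum C a b (\<lambda>(i, j). f i j) (Pair i ` J) \<boxplus> arr_sum C a b (\<lambda>(i, j). f i j) (I \<times> J)"
    using insert assms(2) by (simp only:) (rule sum_Un_disjoint, auto)
  also have "arr_sum C a b (\<lambda>(i, j). f i j) (Pair i ` J) = arr_sum C a b (f i) J"
    using insert.prems by (subst sum_reindex) (auto simp: inj_on_def)
  finally show ?case
    using insert by simp
qed

subsection \<open>The tensor product\<close>

lemma Dom_tensor [simp]: "Dom C (f \<boxtimes> g) = Dom C f \<odot> Dom C g"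
  and Cod_tensor [simp]: "Cod C (f \<boxtimes> g) = Cod C f \<odot> Cod C g"
  using monoidal by (simp_all add: symmetric_strict_monoidal_def)

lemma Idn_tensor: "Idn C a \<boxtimes> Idn C b = Idn C (a \<odot> b)"
  using monoidal by (simp add: symmetric_strict_monoidal_def)

lemma interchange:
  "Cod C f = Dom C f' \<Longrightarrow> Cod C g = Dom C g' \<Longrightarrow> (f' \<boxtimes> g') \<cdot> (f \<boxtimes> g) = (f' \<cdot> f) \<boxtimes> (g' \<cdot> g)"
  using monoidal unfolding symmetric_strict_monoidal_def by metis

lemma tensor_assoc [simp]: "(a \<odot> b) \<odot> c = a \<odot> b \<odot> c" "(f \<boxtimes> g) \<boxtimes> h = f \<boxtimes> g \<boxtimes> h"
  using monoidal unfolding symmetric_strict_monoidal_def by auto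

lemma tensor_Unit [simp]:
  "Unit C \<odot> a = a" "a \<odot> Unit C = a"
  "Idn C (Unit C) \<boxtimes> f = f" "f \<boxtimes> Idn C (Unit C) = f"
  using monoidal unfolding symmetric_strict_monoidal_def by auto

lemma Dom_Symm [simp]: "Dom C (Symm C a b) = a \<odot> b" and Cod_Symm [simp]: "Cod C (Symm C a b) = b \<odot> a"
  using monoidal by (simp_all add: symmetric_strict_monoidal_def)

lemma Symm_natural:
  "\<lbrakk>Dom C f = a; Cod C f = a'; Dom C g = b; Cod C g = b'\<rbrakk> \<Longrightarrow>
    Symm C a' b' \<cdot> (f \<boxtimes> g) = (g \<boxtimes> f) \<cdot> Symm C a b"
  using monoidal unfolding symmetric_strict_monoidal_def by metis

lemma Symm_Symm [simp]: "Symm C b a \<cdot> Symm C a b = Idn C (a \<odot> b)"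
  using monoidal by (simp add: symmetric_strict_monoidal_def)

lemma Symm_tensor: "Symm C a (b \<odot> c) = (Idn C b \<boxtimes> Symm C a c) \<cdot> (Symm C a b \<boxtimes> Idn C c)"
  using monoidal unfolding symmetric_strict_monoidal_def by metis

text \<open>With both other objects equal to the unit, the hexagon makes this arrow idempotent;
  being invertible, it is the identity.\<close>

lemma Symm_Unit [simp]: "Symm C a (Unit C) = Idn C a" "Symm C (Unit C) a = Idn C a"
proof -
  have *: "Symm C a (Unit C) \<cdot> Symm C a (Unit C) = Symm C a (Unit C)"
    using Symm_tensor[of a "Unit C" "Unit C"] by simp
  have "Symm C (Unit C) a \<cdot> (Symm C a (Unit C) \<cdot> Symm C a (Unit C)) = Symm C (Unit C) a \<cdot> Symm C a (Unit C)"
    using * by simp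
  then show 1: "Symm C a (Unit C) = Idn C a"
    by (simp flip: comp_assoc)
  show "Symm C (Unit C) a = Idn C a"
    using Symm_Symm[of "Unit C" a] 1 by simp
qed

lemma tensor_Plus:
  assumes "Dom C f = Dom C g" "Cod C f = Cod C g"
  shows "Idn C V \<boxtimes> (f \<boxplus> g) = Idn C V \<boxtimes> f \<boxplus> Idn C V \<boxtimes> g"
    and "(f \<boxplus> g) \<boxtimes> Idn C V = f \<boxtimes> Idn C V \<boxplus> g \<boxtimes> Idn C V"
  using compatible assms unfolding tensor_compatible_def by simp_all

lemma tensor_scale [simp]:
  "Idn C V \<boxtimes> scale C z f = scale C z (Idn C V \<boxtimes> f)"
  "scale C z f \<boxtimes> Idn C V = scale C z (f \<boxtimes> Idn C V)"
  by (rule hom_scale[where a = "Dom C f" and b = "Cod C f" and a' = "V \<odot> Dom C f" and b' = "V \<odot> Cod C f"],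
      simp_all add: tensor_Plus)
    (rule hom_scale[where a = "Dom C f" and b = "Cod C f" and a' = "Dom C f \<odot> V" and b' = "Cod C f \<odot> V"
       and T = "\<lambda>f. f \<boxtimes> Idn C V"], simp_all add: tensor_Plus)

lemma tensor_Zero [simp]:
  "Idn C V \<boxtimes> Zero C a b = Zero C (V \<odot> a) (V \<odot> b)"
  "Zero C a b \<boxtimes> Idn C V = Zero C (a \<odot> V) (b \<odot> V)"
  using tensor_scale(1)[of V 0 "Zero C a b"] tensor_scale(2)[of 0 "Zero C a b" V] by simp_all

text \<open>Additivity is assumed for tensoring with an identity; an arbitrary \<open>f\<close> is
  split off by the interchange law.\<close>

lemma tensor_Zero' [simp]:
  "f \<boxtimes> Zero C a b = Zero C (Dom C f \<odot> a) (Cod C f \<odot> b)"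
  "Zero C a b \<boxtimes> f = Zero C (a \<odot> Dom C f) (b \<odot> Cod C f)"
proof -
  have "f \<boxtimes> Zero C a b = (f \<boxtimes> Idn C b) \<cdot> (Idn C (Dom C f) \<boxtimes> Zero C a b)"
    by (subst interchange) simp_all
  then show "f \<boxtimes> Zero C a b = Zero C (Dom C f \<odot> a) (Cod C f \<odot> b)" by simp
  have "Zero C a b \<boxtimes> f = (Idn C b \<boxtimes> f) \<cdot> (Zero C a b \<boxtimes> Idn C (Dom C f))"
    by (subst interchange) simp_all
  then show "Zero C a b \<boxtimes> f = Zero C (a \<odot> Dom C f) (b \<odot> Cod C f)" by simp
qed

lemma tensor_sum:
  assumes "\<And>i. i \<in> I \<Longrightarrow> Dom C (f i) = a \<and> Cod C (f i) = b"
  shows "Idn C V \<boxtimes> arr_sum C a b f I = arr_sum C (V \<odot> a) (V \<odot> b) (\<lambda>i. Idn C V \<boxtimes> f i) I"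
    and "arr_sum C a b f I \<boxtimes> Idn C V = arr_sum C (a \<odot> V) (b \<odot> V) (\<lambda>i. f i \<boxtimes> Idn C V) I"
  using assms
  by (rule hom_sum[rotated 2], simp_all add: tensor_Plus)
    (rule hom_sum[where T = "\<lambda>f. f \<boxtimes> Idn C V", rotated 2], simp_all add: tensor_Plus assms)

lemma
  assumes "T \<in> {\<lambda>f. Idn C V \<boxtimes> f, \<lambda>f. f \<boxtimes> Idn C V}"
  shows cofibration_functor: "cofibration C i \<Longrightarrow> cofibration C (T i)"
    and cokernel_functor: "is_cokernel C f q \<Longrightarrow> is_cokernel C (T f) (T q)"
  using bspec[OF spec[OF compatible[unfolded tensor_compatible_def]] assms] by blast+

lemmas cofibration_tensor =
  cofibration_functor[OF insertI1] cofibration_functor[OF insertI2, OF insertI1]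

lemmas is_cokernel_tensor =
  cokernel_functor[OF insertI1] cokernel_functor[OF insertI2, OF insertI1]

lemma cofibration_extend:
  assumes "cofibration C i" "rel_injective C J" "Dom C f = Dom C i" "Cod C f = J"
  obtains g where "Dom C g = Cod C i" "Cod C g = J" "g \<cdot> i = f"
proof -
  have "f \<in> (\<lambda>g. g \<cdot> i) ` Hom C (Cod C i) J"
    using assms by (simp add: rel_injective_def hom_surj_def)
  then obtain g where "g \<in> Hom C (Cod C i) J" "f = g \<cdot> i"
    by blast
  then show ?thesis using that[of g] by simp
qed

lemma cokernel_factor:
  assumes "is_cokernel C s p" "Dom C f = Cod C s" "f \<cdot> s = Zero C (Dom C s) (Cod C f)"
  obtains g where "Dom C g = Cod C p" "Cod C g = Cod C f" "g \<cdot> p = f"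
proof -
  have "\<exists>g. g \<in> Hom C (Cod C p) (Cod C f) \<and> g \<cdot> p = f"
    using assms unfolding is_cokernel_def by blast
  then show ?thesis using that by (metis in_Hom)
qed

lemma is_cokernelD:
  assumes "is_cokernel C s p"
  shows "Dom C p = Cod C s" "p \<cdot> s = Zero C (Dom C s) (Cod C p)"
  using assms by (simp_all add: is_cokernel_def)

lemma cokernel_epi:
  assumes "is_cokernel C s p" "Dom C f = Cod C p" "Dom C g = Cod C p" "Cod C f = Cod C g" "f \<cdot> p = g \<cdot> p"
  shows "f = g"
proof -
  note p = is_cokernelD[OF assms(1)]
  have "Dom C (g \<cdot> p) = Cod C s \<and> (g \<cdot> p) \<cdot> s = Zero C (Dom C s) (Cod C (g \<cdot> p))"
    using assms(3) p by simp
  then have "\<exists>!h. h \<in> Hom C (Cod C p) (Cod C (g \<cdot> p)) \<and> h \<cdot> p = g \<cdot> p"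
    using assms(1) unfolding is_cokernel_def by blast
  moreover have "f \<in> Hom C (Cod C p) (Cod C (g \<cdot> p))" "g \<in> Hom C (Cod C p) (Cod C (g \<cdot> p))"
    using assms p by simp_all
  ultimately show ?thesis using assms(5) by blast
qed

subsection \<open>Zero objects\<close>

lemma is_zero_ob_zero_ob: "is_zero_ob C (zero_ob C)"
  using additive unfolding additive_category_def zero_ob_def by (metis someI_ex)

lemma zero_ob_arr_eq:
  assumes "is_zero_ob C z" "Dom C f = Dom C g" "Cod C f = Cod C g" "Dom C f = z \<or> Cod C f = z"
  shows "f = g"
  using assms unfolding is_zero_ob_def in_Hom by (metis)

lemma zero_ob_Zero:
  assumes "is_zero_ob C z" "Dom C f = a" "Cod C f = b" "a = z \<or> b = z"
  shows "f = Zero C a b"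
  by (rule zero_ob_arr_eq[OF assms(1)]) (use assms in auto)

lemma is_zero_obI:
  assumes "Idn C z = Zero C z z" shows "is_zero_ob C z"
proof -
  have "f = Zero C a z" if "f \<in> Hom C a z" for f a
    using that assms Idn_comp[of f z] by simp
  moreover have "f = Zero C z a" if "f \<in> Hom C z a" for f a
    using that assms comp_Idn[of f z] by simp
  moreover have "Zero C a z \<in> Hom C a z" "Zero C z a \<in> Hom C z a" for a by simp_all
  ultimately show ?thesis
    unfolding is_zero_ob_def by metis
qed

lemma is_zero_ob_tensor: "is_zero_ob C z \<Longrightarrow> is_zero_ob C (V \<odot> z)"
  using zero_ob_Zero[of z "Idn C z" z z] Idn_tensor[of V z]
  by (intro is_zero_obI) simp

subsection \<open>Finite colimits and cokernels\<close>

text \<open>The base category is assumed to have colimits of diagrams indexed by sets of natural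
  numbers. The diagram is transported along an enumeration of \<open>I\<close>; the colimits wanted
  later are indexed by words.\<close>

lemma finite_colimit:
  fixes I :: "'i set"
  assumes "finite I" "finite E" "diagram C I X E"
  shows "\<exists>P c. is_colimit C I X E P c"
proof -
  obtain h where h: "bij_betw h I {0..<card I}"
    using ex_bij_betw_finite_nat[OF assms(1)] by blast
  define k where "k = inv_into I h"
  have kh: "k (h i) = i" if "i \<in> I" for i
    using h that by (simp add: k_def bij_betw_inv_into_left)
  have E: "i \<in> I" "j \<in> I" "Dom C u = X i" "Cod C u = X j" if "(i, u, j) \<in> E" for i u j
    using assms(3) that by (auto simp: diagram_def)
  define E' where "E' = (\<lambda>(i, u, j). (h i, u, h j)) ` E"
  have "diagram C (h ` I) (X \<circ> k) E'"
    using E by (auto simp: diagram_def E'_def kh)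
  then obtain P c where c: "is_colimit C (h ` I) (X \<circ> k) E' P c"
    using base assms(1,2) unfolding base_category_def has_finite_colimits_def
    by (metis E'_def finite_imageI)
  have cc: "cocone C (h ` I) (X \<circ> k) E' Q d \<longleftrightarrow> cocone C I X E Q (d \<circ> h)" for Q d
    by (auto simp: cocone_def E'_def kh split_beta)
  have cone: "cocone C I X E Q d \<longleftrightarrow> cocone C I X E Q (d \<circ> k \<circ> h)" for Q d
    using E by (auto simp: cocone_def kh split_beta)
  have "is_colimit C I X E P (c \<circ> h)"
    unfolding is_colimit_def
  proof (intro conjI allI impI)
    show "cocone C I X E P (c \<circ> h)"
      using c cc by (simp add: is_colimit_def)
    fix Q d assume "cocone C I X E Q d"
    then have "cocone C (h ` I) (X \<circ> k) E' Q (d \<circ> k)"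
      using cc cone by blast
    then have "\<exists>!f. f \<in> Hom C P Q \<and> (\<forall>i\<in>h ` I. f \<cdot> c i = (d \<circ> k) i)"
      using c unfolding is_colimit_def by blast
    then show "\<exists>!f. f \<in> Hom C P Q \<and> (\<forall>i\<in>I. f \<cdot> (c \<circ> h) i = d i)"
      by (simp add: kh)
  qed
  then show ?thesis by blast
qed

text \<open>The cokernel is the colimit of the parallel pair consisting of \<open>f\<close> and
  zero, with the Booleans as vertices: \<open>False\<close> for the domain, \<open>True\<close> for
  the codomain.\<close>

lemma cokernel_exists: "\<exists>q. is_cokernel C f q"
proof -
  define a b where "a = Dom C f" and "b = Cod C f"
  define X where "X = (\<lambda>v. if v then b else a)"
  define E where "E = {(False, f, True), (False, Zero C a b, True)}"
  have "diagram C {False, True} X E"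
    by (auto simp: diagram_def E_def X_def a_def b_def)
  then obtain P c where c: "is_colimit C {False, True} X E P c"
    using finite_colimit[of "{False, True}" E X] by (auto simp: E_def)
  have cc: "cocone C {False, True} X E Q d \<longleftrightarrow> Dom C (d True) = b \<and> Cod C (d True) = Q \<and>
      d True \<cdot> f = Zero C a Q \<and> d False = Zero C a Q" for Q d
    by (auto simp: cocone_def E_def X_def b_def)
  have "is_cokernel C f (c True)"
    unfolding is_cokernel_def
  proof (intro conjI allI impI)
    have c': "cocone C {False, True} X E P c"
      using c by (simp add: is_colimit_def)
    then show "Dom C (c True) = Cod C f" "c True \<cdot> f = Zero C (Dom C f) (Cod C (c True))"
      by (auto simp: cc a_def b_def)
    fix g assume g: "Dom C g = Cod C f \<and> g \<cdot> f = Zero C (Dom C f) (Cod C g)"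
    have "cocone C {False, True} X E (Cod C g) (\<lambda>v. if v then g else Zero C a (Cod C g))"
      using g by (simp add: cc a_def b_def)
    then have "\<exists>!h. h \<in> Hom C P (Cod C g) \<and>
        (\<forall>i\<in>{False, True}. h \<cdot> c i = (if i then g else Zero C a (Cod C g)))"
      using c unfolding is_colimit_def by blast
    moreover have "h \<cdot> c False = Zero C a (Cod C g)" if "h \<in> Hom C P (Cod C g)" for h
      using that c' by (simp add: cc)
    ultimately have "\<exists>!h. h \<in> Hom C P (Cod C g) \<and> h \<cdot> c True = g"
      by (auto simp del: in_Hom)
    moreover have "Cod C (c True) = P" using c' by (simp add: cc)
    ultimately show "\<exists>!h. h \<in> Hom C (Cod C (c True)) (Cod C g) \<and> h \<cdot> c True = g" by simp
  qed
  then show ?thesis by blast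
qed

subsection \<open>Matrices\<close>

context
  fixes I :: "nat set" and X :: "nat \<Rightarrow> 'o"
  assumes fin: "finite I"
begin

lemma is_dsum_dsum: "is_dsum C I X (dsum_ob C I X) (dsum_inj C I X) (dsum_prj C I X)"
proof -
  have "\<exists>s. case s of (P, inc, prj) \<Rightarrow> is_dsum C I X P inc prj"
    using additive fin by (auto simp: additive_category_def)
  then have "case dsum C I X of (P, inc, prj) \<Rightarrow> is_dsum C I X P inc prj"
    unfolding dsum_def by (rule someI_ex)
  then show ?thesis
    by (simp add: dsum_ob_def dsum_inj_def dsum_prj_def split_beta)
qed

lemma Dom_Cod_dsum [simp]:
  assumes "i \<in> I"
  shows "Dom C (dsum_inj C I X i) = X i" "Cod C (dsum_inj C I X i) = dsum_ob C I X"
    "Dom C (dsum_prj C I X i) = dsum_ob C I X" "Cod C (dsum_prj C I X i) = X i"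
  using is_dsum_dsum assms by (simp_all add: is_dsum_def)

lemma prj_inj:
  assumes "i \<in> I" "j \<in> I"
  shows "dsum_prj C I X j \<cdot> dsum_inj C I X i = (if i = j then Idn C (X i) else Zero C (X i) (X j))"
  using is_dsum_dsum assms by (simp add: is_dsum_def)

text \<open>\<open>comp_assoc\<close> nests composites to the right, where \<open>prj_inj\<close>
  itself does not match.\<close>

lemma prj_inj_left:
  assumes "i \<in> I" "j \<in> I" "Cod C h = X i"
  shows "dsum_prj C I X j \<cdot> (dsum_inj C I X i \<cdot> h) = (if i = j then h else Zero C (Dom C h) (X j))"
  using assms by (simp add: prj_inj flip: comp_assoc)

lemma prj_inj_same [simp]: "i \<in> I \<Longrightarrow> dsum_prj C I X i \<cdot> dsum_inj C I X i = Idn C (X i)"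
  by (simp add: prj_inj)

lemma sum_inj_prj:
  "arr_sum C (dsum_ob C I X) (dsum_ob C I X) (\<lambda>i. dsum_inj C I X i \<cdot> dsum_prj C I X i) I =
     Idn C (dsum_ob C I X)"
  using is_dsum_dsum by (simp add: is_dsum_def)

lemma dsum_decompose:
  assumes "Dom C f = dsum_ob C I X" "Cod C g = dsum_ob C I X"
  shows "f \<cdot> g = arr_sum C (Dom C g) (Cod C f)
    (\<lambda>i. (f \<cdot> dsum_inj C I X i) \<cdot> (dsum_prj C I X i \<cdot> g)) I"
proof -
  have "f \<cdot> g = f \<cdot> (Idn C (dsum_ob C I X) \<cdot> g)"
    using assms by simp
  also have "\<dots> = f \<cdot> arr_sum C (Dom C g) (dsum_ob C I X) (\<lambda>i. dsum_inj C I X i \<cdot> dsum_prj C I X i \<cdot> g) I"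
    unfolding sum_inj_prj[symmetric] using assms
    by (subst sum_comp[where c = "Dom C g"]) (auto intro!: arg_cong[where f = "(\<cdot>) f"] sum_cong)
  also have "\<dots> = arr_sum C (Dom C g) (Cod C f) (\<lambda>i. (f \<cdot> dsum_inj C I X i) \<cdot> (dsum_prj C I X i \<cdot> g)) I"
    using assms by (subst comp_sum[where c = "Cod C f"]) (auto intro!: sum_cong)
  finally show ?thesis .
qed

lemma dsum_ext_inj:
  assumes "Dom C f = dsum_ob C I X" "Dom C g = dsum_ob C I X" "Cod C f = Cod C g"
    and "\<And>i. i \<in> I \<Longrightarrow> f \<cdot> dsum_inj C I X i = g \<cdot> dsum_inj C I X i"
  shows "f = g"
proof -
  have "f \<cdot> Idn C (dsum_ob C I X) = g \<cdot> Idn C (dsum_ob C I X)"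
    using assms by (subst (1 2) dsum_decompose) (auto intro!: sum_cong simp del: comp_assoc comp_Idn)
  then show ?thesis using assms by simp
qed

end

lemma dsum_empty_zero: "is_zero_ob C (dsum_ob C {} X)"
  using sum_inj_prj[of "{}" X] by (intro is_zero_obI) simp

context
  fixes I J :: "nat set" and X Y :: "nat \<Rightarrow> 'o" and R \<phi>
  assumes fin: "finite I" "finite J"
    and typed: "\<And>i j. i \<in> I \<Longrightarrow> j \<in> J \<Longrightarrow> R i j \<Longrightarrow> Dom C (\<phi> i j) = X i \<and> Cod C (\<phi> i j) = Y j"
begin

lemma mat_Hom [simp]:
  "Dom C (mat_arr C I X J Y R \<phi>) = dsum_ob C I X" "Cod C (mat_arr C I X J Y R \<phi>) = dsum_ob C J Y"
  unfolding mat_arr_def using fin typed by (auto intro!: Dom_sum Cod_sum)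

lemma mat_component:
  assumes "i \<in> I" "j \<in> J"
  shows "dsum_prj C J Y j \<cdot> (mat_arr C I X J Y R \<phi> \<cdot> dsum_inj C I X i) =
    (if R i j then \<phi> i j else Zero C (X i) (Y j))"
proof -
  let ?S = "{(i, j). i \<in> I \<and> j \<in> J \<and> R i j}"
  let ?g = "\<lambda>(i', j'). dsum_prj C J Y j \<cdot> ((dsum_inj C J Y j' \<cdot> \<phi> i' j' \<cdot> dsum_prj C I X i') \<cdot> dsum_inj C I X i)"
  have S: "finite ?S"
    by (rule finite_subset[of _ "I \<times> J"]) (use fin in auto)
  have "dsum_prj C J Y j \<cdot> (mat_arr C I X J Y R \<phi> \<cdot> dsum_inj C I X i) = arr_sum C (X i) (Y j) ?g ?S"
    unfolding mat_arr_def using fin typed assms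
    by (subst sum_comp[where c = "X i"], simp_all, force, subst comp_sum[where c = "Y j"])
      (auto intro!: sum_cong)
  also have "\<dots> = (if R i j then \<phi> i j else Zero C (X i) (Y j))"
  proof (cases "R i j")
    case True
    have "arr_sum C (X i) (Y j) ?g ?S = ?g (i, j)"
      using True assms S fin typed
      by (intro sum_single) (auto simp: prj_inj prj_inj_left split: if_splits)
    then show ?thesis
      using True assms fin typed by (simp add: prj_inj_left)
  next
    case False
    have "arr_sum C (X i) (Y j) ?g ?S = Zero C (X i) (Y j)"
      using False assms S fin typed
      by (intro sum_zero) (auto simp: prj_inj prj_inj_left split: if_splits)
    then show ?thesis using False by simp
  qed
  finally show ?thesis .
qed

lemma comp_mat_inj:
  assumes "i \<in> I" "Dom C f = dsum_ob C J Y"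
  shows "f \<cdot> (mat_arr C I X J Y R \<phi> \<cdot> dsum_inj C I X i) =
    arr_sum C (X i) (Cod C f) (\<lambda>j. (f \<cdot> dsum_inj C J Y j) \<cdot> \<phi> i j) {j \<in> J. R i j}"
proof -
  have "f \<cdot> (mat_arr C I X J Y R \<phi> \<cdot> dsum_inj C I X i) = arr_sum C (X i) (Cod C f)
     (\<lambda>j. (f \<cdot> dsum_inj C J Y j) \<cdot> (if R i j then \<phi> i j else Zero C (X i) (Y j))) J"
    using assms fin typed
    by (subst dsum_decompose[where I = J and X = Y])
      (auto intro!: sum_cong simp: mat_component simp del: comp_assoc)
  also have "\<dots> = arr_sum C (X i) (Cod C f)
     (\<lambda>j. (f \<cdot> dsum_inj C J Y j) \<cdot> (if R i j then \<phi> i j else Zero C (X i) (Y j))) {j \<in> J. R i j}"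
    using assms fin typed by (intro sum_mono_neutral) auto
  also have "\<dots> = arr_sum C (X i) (Cod C f) (\<lambda>j. (f \<cdot> dsum_inj C J Y j) \<cdot> \<phi> i j) {j \<in> J. R i j}"
    using assms fin typed by (intro sum_cong) auto
  finally show ?thesis .
qed

end

lemma mat_inj_diag:
  assumes "finite I" "i \<in> I" "\<And>j. j \<in> I \<Longrightarrow> Dom C (\<phi> j j) = X j \<and> Cod C (\<phi> j j) = Y j"
  shows "mat_arr C I X I Y (=) \<phi> \<cdot> dsum_inj C I X i = dsum_inj C I Y i \<cdot> \<phi> i i"
proof -
  have "{j \<in> I. i = j} = {i}" using assms by auto
  then have "Idn C (dsum_ob C I Y) \<cdot> (mat_arr C I X I Y (=) \<phi> \<cdot> dsum_inj C I X i) =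
      (Idn C (dsum_ob C I Y) \<cdot> dsum_inj C I Y i) \<cdot> \<phi> i i"
    using assms comp_mat_inj[of I I "(=)" \<phi> X Y i "Idn C (dsum_ob C I Y)"]
      sum_single[of "{i}" i "\<lambda>j. (Idn C (dsum_ob C I Y) \<cdot> dsum_inj C I Y j) \<cdot> \<phi> i j"]
    by simp
  then show ?thesis
    using assms by (simp add: mat_Hom)
qed

end

section \<open>Isomorphisms on homology in terms of representatives\<close>

text \<open>As \<open>F\<close> maps \<open>B\<close> into \<open>B'\<close>, the members of one
  coset have images in a single coset, and the union is that coset. Injectivity is then read off
  from the kernel and surjectivity on representatives.\<close>

lemma iso_Mod_iff:
  assumes "comm_group Z" "comm_group Z'" "subgroup B Z" "subgroup B' Z'" "F \<in> hom Z Z'" "F ` B \<subseteq> B'"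
  shows "(\<lambda>c. \<Union>x\<in>c. B' #>\<^bsub>Z'\<^esub> F x) \<in> iso (Z Mod B) (Z' Mod B') \<longleftrightarrow>
    (\<forall>x\<in>carrier Z. F x \<in> B' \<longrightarrow> x \<in> B) \<and> (\<forall>y\<in>carrier Z'. \<exists>x\<in>carrier Z. y \<in> B' #>\<^bsub>Z'\<^esub> F x)"
proof -
  interpret Z: comm_group Z by fact
  interpret Z': comm_group Z' by fact
  interpret F: group_hom Z Z' F using assms by unfold_locales
  interpret B: normal B Z using Z.subgroup_imp_normal assms by blast
  interpret B': normal B' Z' using Z'.subgroup_imp_normal assms by blast
  define h where "h = (\<lambda>c. \<Union>x\<in>c. B' #>\<^bsub>Z'\<^esub> F x)"
  have f: "h (B #>\<^bsub>Z\<^esub> x) = B' #>\<^bsub>Z'\<^esub> F x" if x: "x \<in> carrier Z" for x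
  proof -
    have "B' #>\<^bsub>Z'\<^esub> F u = B' #>\<^bsub>Z'\<^esub> F x" if u: "u \<in> B #>\<^bsub>Z\<^esub> x" for u
    proof -
      obtain b where b: "b \<in> B" "u = b \<otimes>\<^bsub>Z\<^esub> x" using u by (auto simp: r_coset_def)
      then have "F u = F b \<otimes>\<^bsub>Z'\<^esub> F x" "F b \<in> B'" using x assms(6) by auto
      then show ?thesis
        by (metis B'.rcos_const B'.subset F.hom_closed Z'.coset_mult_assoc Z'.group_axioms subsetD x)
    qed
    moreover have "x \<in> B #>\<^bsub>Z\<^esub> x" using x Z.rcos_self B.subgroup_axioms by blast
    ultimately show ?thesis unfolding h_def by blast
  qed
  have car: "c \<in> carrier (Z Mod B) \<longleftrightarrow> (\<exists>x\<in>carrier Z. c = B #>\<^bsub>Z\<^esub> x)" for c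
    by (auto simp: FactGroup_def RCOSETS_def)
  have car': "c \<in> carrier (Z' Mod B') \<longleftrightarrow> (\<exists>x\<in>carrier Z'. c = B' #>\<^bsub>Z'\<^esub> x)" for c
    by (auto simp: FactGroup_def RCOSETS_def)
  have hom: "h \<in> hom (Z Mod B) (Z' Mod B')"
  proof (rule homI)
    fix c assume "c \<in> carrier (Z Mod B)"
    then show "h c \<in> carrier (Z' Mod B')"
      using f F.hom_closed unfolding car car' by metis
  next
    fix c c' assume "c \<in> carrier (Z Mod B)" "c' \<in> carrier (Z Mod B)"
    then obtain x x' where x: "x \<in> carrier Z" "c = B #>\<^bsub>Z\<^esub> x" "x' \<in> carrier Z" "c' = B #>\<^bsub>Z\<^esub> x'"
      unfolding car by blast
    then have "c \<otimes>\<^bsub>Z Mod B\<^esub> c' = B #>\<^bsub>Z\<^esub> (x \<otimes>\<^bsub>Z\<^esub> x')"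
      by (simp add: FactGroup_def B.rcos_sum)
    then show "h (c \<otimes>\<^bsub>Z Mod B\<^esub> c') = h c \<otimes>\<^bsub>Z' Mod B'\<^esub> h c'"
      using x by (simp add: f FactGroup_def B'.rcos_sum)
  qed
  have eq: "B #>\<^bsub>Z\<^esub> x = B \<longleftrightarrow> x \<in> B" if "x \<in> carrier Z" for x
    using that by (metis B.rcos_const B.subgroup_axioms Z.rcos_self Z.group_axioms)
  have eq': "B' #>\<^bsub>Z'\<^esub> x = B' \<longleftrightarrow> x \<in> B'" if "x \<in> carrier Z'" for x
    using that by (metis B'.rcos_const B'.subgroup_axioms Z'.rcos_self Z'.group_axioms)
  interpret FG: group "Z Mod B" by (rule B.factorgroup_is_group)
  interpret FG': group "Z' Mod B'" by (rule B'.factorgroup_is_group)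
  interpret f: group_hom "Z Mod B" "Z' Mod B'" h
    using hom by unfold_locales
  have one: "\<one>\<^bsub>Z Mod B\<^esub> = B" "\<one>\<^bsub>Z' Mod B'\<^esub> = B'"
    by (simp_all add: FactGroup_def)
  have "inj_on h (carrier (Z Mod B)) \<longleftrightarrow> (\<forall>x\<in>carrier Z. F x \<in> B' \<longrightarrow> x \<in> B)"
  proof -
    have "inj_on h (carrier (Z Mod B)) \<longleftrightarrow> (\<forall>c\<in>carrier (Z Mod B). h c = B' \<longrightarrow> c = B)"
      unfolding f.inj_on_one_iff one Ball_def ..
    also have "\<dots> \<longleftrightarrow> (\<forall>x\<in>carrier Z. h (B #>\<^bsub>Z\<^esub> x) = B' \<longrightarrow> B #>\<^bsub>Z\<^esub> x = B)"
      unfolding Ball_def car by blast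
    also have "\<dots> \<longleftrightarrow> (\<forall>x\<in>carrier Z. F x \<in> B' \<longrightarrow> x \<in> B)"
      by (simp add: f eq eq')
    finally show ?thesis .
  qed
  moreover have "h ` carrier (Z Mod B) = carrier (Z' Mod B') \<longleftrightarrow>
      (\<forall>y\<in>carrier Z'. \<exists>x\<in>carrier Z. y \<in> B' #>\<^bsub>Z'\<^esub> F x)" (is "?l \<longleftrightarrow> ?r")
  proof
    assume ?l
    show ?r
    proof
      fix y assume y: "y \<in> carrier Z'"
      have "B' #>\<^bsub>Z'\<^esub> y \<in> carrier (Z' Mod B')"
        by (subst car') (use y in blast)
      then have "B' #>\<^bsub>Z'\<^esub> y \<in> h ` carrier (Z Mod B)"
        by (subst \<open>?l\<close>)
      then obtain c where c: "c \<in> carrier (Z Mod B)" "B' #>\<^bsub>Z'\<^esub> y = h c"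
        by (rule imageE)
      obtain x where x: "x \<in> carrier Z" "c = B #>\<^bsub>Z\<^esub> x"
        using c(1)[unfolded car] by (rule bexE)
      have "y \<in> B' #>\<^bsub>Z'\<^esub> F x"
        using Z'.rcos_self[OF y B'.subgroup_axioms] unfolding c(2) x(2) f[OF x(1)] .
      then show "\<exists>x\<in>carrier Z. y \<in> B' #>\<^bsub>Z'\<^esub> F x"
        using x(1) by (rule bexI)
    qed
  next
    assume r: ?r
    have "c \<in> h ` carrier (Z Mod B)" if "c \<in> carrier (Z' Mod B')" for c
    proof -
      from that[unfolded car'] obtain y where y: "y \<in> carrier Z'" "c = B' #>\<^bsub>Z'\<^esub> y"
        by (rule bexE)
      obtain x where x: "x \<in> carrier Z" "y \<in> B' #>\<^bsub>Z'\<^esub> F x"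
        using bspec[OF r y(1)] by (rule bexE)
      have "c = B' #>\<^bsub>Z'\<^esub> F x"
        unfolding y(2) by (rule Z'.repr_independence[OF x(2) _ B'.subgroup_axioms, symmetric]) (use x in simp)
      then have "c = h (B #>\<^bsub>Z\<^esub> x)" using f[OF x(1)] by simp
      then show ?thesis by (rule image_eqI) (use x(1) in \<open>subst car, blast\<close>)
    qed
    moreover have "h ` carrier (Z Mod B) \<subseteq> carrier (Z' Mod B')"
      using f.hom_closed by blast
    ultimately show ?l by blast
  qed
  ultimately show ?thesis
    using hom unfolding h_def[symmetric] by (simp add: iso_def bij_betw_def)
qed

text \<open>In each degree the boundaries are a subgroup of the commutative group of cycles, so that
  \<open>iso_Mod_iff\<close> applies; the clauses are injectivity and surjectivity on
  homology.\<close>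

lemma quasi_iso_iff:
  assumes G: "\<And>n. comm_group (G n)" "\<And>n. d n \<in> hom (G n) (G (n - 1))"
      "\<And>n x. x \<in> carrier (G n) \<Longrightarrow> d (n - 1) (d n x) = \<one>\<^bsub>G (n - 1 - 1)\<^esub>"
    and G': "\<And>n. comm_group (G' n)" "\<And>n. d' n \<in> hom (G' n) (G' (n - 1))"
      "\<And>n x. x \<in> carrier (G' n) \<Longrightarrow> d' (n - 1) (d' n x) = \<one>\<^bsub>G' (n - 1 - 1)\<^esub>"
    and F: "\<And>n. F n \<in> hom (G n) (G' n)"
      "\<And>n x. x \<in> carrier (G n) \<Longrightarrow> F (n - 1) (d n x) = d' n (F n x)"
  shows "quasi_iso G d G' d' F \<longleftrightarrow> (\<forall>n.
    (\<forall>x\<in>kernel (G n) (G (n - 1)) (d n). F n x \<in> grp_boundaries G' d' n \<longrightarrow> x \<in> grp_boundaries G d n) \<and>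
    (\<forall>y\<in>kernel (G' n) (G' (n - 1)) (d' n). \<exists>x\<in>kernel (G n) (G (n - 1)) (d n).
        y \<in> grp_boundaries G' d' n #>\<^bsub>G' n\<^esub> F n x))"
proof -
  have cycles: "comm_group ((H n)\<lparr>carrier := kernel (H n) (H (n - 1)) (e n)\<rparr>) \<and>
      subgroup (grp_boundaries H e n) ((H n)\<lparr>carrier := kernel (H n) (H (n - 1)) (e n)\<rparr>)"
    if H: "\<And>n. comm_group (H n)" "\<And>n. e n \<in> hom (H n) (H (n - 1))"
      "\<And>n x. x \<in> carrier (H n) \<Longrightarrow> e (n - 1) (e n x) = \<one>\<^bsub>H (n - 1 - 1)\<^esub>"
    for H :: "int \<Rightarrow> 'c monoid" and e n
  proof -
    have gh: "group_hom (H n) (H (n - 1)) (e n)" for n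
      using H by (simp add: group_hom_def group_hom_axioms_def comm_group.axioms(2))
    interpret A: comm_group "H n" by (rule H)
    interpret e: group_hom "H n" "H (n - 1)" "e n" by (rule gh)
    interpret e1: group_hom "H (n + 1)" "H n" "e (n + 1)" using gh[of "n + 1"] by simp
    have K: "subgroup (kernel (H n) (H (n - 1)) (e n)) (H n)"
      by (rule e.subgroup_kernel)
    have B: "subgroup (grp_boundaries H e n) (H n)"
      unfolding grp_boundaries_def by (rule e1.img_is_subgroup)
    have "grp_boundaries H e n \<subseteq> kernel (H n) (H (n - 1)) (e n)"
    proof
      fix u assume "u \<in> grp_boundaries H e n"
      then obtain v where v: "v \<in> carrier (H (n + 1))" "u = e (n + 1) v"
        by (auto simp: grp_boundaries_def)
      then show "u \<in> kernel (H n) (H (n - 1)) (e n)"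
        using H(3)[of v "n + 1"] e1.hom_closed[of v] by (simp add: kernel_def)
    qed
    moreover have "comm_group ((H n)\<lparr>carrier := kernel (H n) (H (n - 1)) (e n)\<rparr>)"
      using subgroup.subgroup_is_group[OF K A.group_axioms] subgroup.subset[OF K]
      by (intro group.group_comm_groupI) (auto intro!: A.m_comm)
    ultimately show ?thesis
      using A.subgroup_incl[OF B K] by simp
  qed
  have "(\<lambda>c. \<Union>x\<in>c. grp_boundaries G' d' n #>\<^bsub>G' n\<^esub> F n x) \<in> iso (grp_homology G d n) (grp_homology G' d' n) \<longleftrightarrow>
    (\<forall>x\<in>kernel (G n) (G (n - 1)) (d n). F n x \<in> grp_boundaries G' d' n \<longrightarrow> x \<in> grp_boundaries G d n) \<and>
    (\<forall>y\<in>kernel (G' n) (G' (n - 1)) (d' n). \<exists>x\<in>kernel (G n) (G (n - 1)) (d n).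
        y \<in> grp_boundaries G' d' n #>\<^bsub>G' n\<^esub> F n x)" for n
  proof -
    let ?Z = "(G n)\<lparr>carrier := kernel (G n) (G (n - 1)) (d n)\<rparr>"
    let ?Z' = "(G' n)\<lparr>carrier := kernel (G' n) (G' (n - 1)) (d' n)\<rparr>"
    note cyc = cycles[of G d n, OF G] and cyc' = cycles[of G' d' n, OF G']
    have F1: "F n x \<in> carrier (G' n)" if "x \<in> carrier (G n)" for x n
      using F(1) that by (auto simp: hom_def)
    have "group_hom (G n) (G' n) (F n)" for n
      using F(1) G(1) G'(1) by (simp add: group_hom_def group_hom_axioms_def comm_group.axioms(2))
    then have F_one: "F n \<one>\<^bsub>G n\<^esub> = \<one>\<^bsub>G' n\<^esub>" for n
      by (rule group_hom.hom_one)
    have Fk: "F n x \<in> kernel (G' n) (G' (n - 1)) (d' n)" if "x \<in> kernel (G n) (G (n - 1)) (d n)" for x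
      using that F1 F(2)[of x n] F_one by (simp add: kernel_def)
    have "F n \<in> hom ?Z ?Z'"
    proof (rule homI)
      fix x y assume "x \<in> carrier ?Z" "y \<in> carrier ?Z"
      then show "F n (x \<otimes>\<^bsub>?Z\<^esub> y) = F n x \<otimes>\<^bsub>?Z'\<^esub> F n y"
        using F(1)[of n] by (auto simp: hom_def kernel_def)
    qed (use Fk in simp)
    moreover have "F n ` grp_boundaries G d n \<subseteq> grp_boundaries G' d' n"
    proof
      fix u assume "u \<in> F n ` grp_boundaries G d n"
      then obtain x where x: "x \<in> carrier (G (n + 1))" "u = F n (d (n + 1) x)"
        by (auto simp: grp_boundaries_def)
      then have "u = d' (n + 1) (F (n + 1) x)" using F(2)[of x "n + 1"] by simp
      then show "u \<in> grp_boundaries G' d' n" using F1 x by (auto simp: grp_boundaries_def)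
    qed
    ultimately have "(\<lambda>c. \<Union>x\<in>c. grp_boundaries G' d' n #>\<^bsub>?Z'\<^esub> F n x)
        \<in> iso (?Z Mod grp_boundaries G d n) (?Z' Mod grp_boundaries G' d' n) \<longleftrightarrow>
      (\<forall>x\<in>carrier ?Z. F n x \<in> grp_boundaries G' d' n \<longrightarrow> x \<in> grp_boundaries G d n) \<and>
      (\<forall>y\<in>carrier ?Z'. \<exists>x\<in>carrier ?Z. y \<in> grp_boundaries G' d' n #>\<^bsub>?Z'\<^esub> F n x)"
      using cyc cyc' by (intro iso_Mod_iff) auto
    moreover have "B #>\<^bsub>?Z'\<^esub> u = B #>\<^bsub>G' n\<^esub> u" for B u
      by (simp add: r_coset_def)
    ultimately show ?thesis
      by (simp add: grp_homology_def)
  qed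
  then show ?thesis by (simp add: quasi_iso_def)
qed

context base_cat begin

subsection \<open>Weak equivalences in terms of cocycles\<close>

text \<open>\<open>HOM\<close> from X into \<open>J\<close> placed in degree 0 has in degree
  \<open>- k\<close> the single nonzero component Hom(X_k, J). So a cochain is encoded as one arrow,
  labelled by the chain degree \<open>k\<close>, and the sign of the boundary is dropped, which
  changes neither kernel nor image.\<close>

definition cocycle :: "('o, 'm, 'z) chain_scheme \<Rightarrow> 'o \<Rightarrow> int \<Rightarrow> 'm \<Rightarrow> bool" where
  "cocycle X J k x \<longleftrightarrow> Dom C x = Ob X k \<and> Cod C x = J \<and> x \<cdot> Bd X (k + 1) = Zero C (Ob X (k + 1)) J"

definition coboundary :: "('o, 'm, 'z) chain_scheme \<Rightarrow> 'o \<Rightarrow> int \<Rightarrow> 'm \<Rightarrow> bool" where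
  "coboundary X J k x \<longleftrightarrow> (\<exists>y. Dom C y = Ob X (k - 1) \<and> Cod C y = J \<and> x = y \<cdot> Bd X k)"

lemma chain_complexD:
  assumes "chain_complex C X"
  shows "Dom C (Bd X n) = Ob X n" "Cod C (Bd X n) = Ob X (n - 1)"
    "Bd X (n - 1) \<cdot> Bd X n = Zero C (Ob X n) (Ob X (n - 2))"
  using assms by (simp_all add: chain_complex_def)

lemma Ob_in_degree_0: "Ob (in_degree_0 C J) n = (if n = 0 then J else zero_ob C)"
  by (simp add: in_degree_0_def)

lemma comm_group_HOM_group: "comm_group (HOM_group C X Y n)"
proof (rule comm_groupI)
  fix \<phi> assume "\<phi> \<in> carrier (HOM_group C X Y n)"
  then show "\<exists>\<psi>\<in>carrier (HOM_group C X Y n). \<psi> \<otimes>\<^bsub>HOM_group C X Y n\<^esub> \<phi> = \<one>\<^bsub>HOM_group C X Y n\<^esub>"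
    by (intro bexI[of _ "\<lambda>i. scale C (- 1) (\<phi> i)"]) (auto simp: HOM_group_def Plus_commute)
qed (auto simp: HOM_group_def Plus_ac)

definition HOM_of :: "('o, 'm, 'z) chain_scheme \<Rightarrow> int \<Rightarrow> 'm \<Rightarrow> int \<Rightarrow> 'm" where
  "HOM_of X k x i = (if i = k then x else Zero C (Ob X i) (zero_ob C))"

lemma HOM_mult: "\<phi> \<otimes>\<^bsub>HOM_group C X Y n\<^esub> \<psi> = (\<lambda>i. \<phi> i \<boxplus> \<psi> i)"
  by (simp add: HOM_group_def)

context
  fixes X :: "('o, 'm, 'z) chain_scheme" and J :: 'o
  assumes X: "chain_complex C X"
begin

abbreviation (input) "HX n \<equiv> HOM_group C X (in_degree_0 C J) n"

lemma HOM_carrier: "\<phi> \<in> carrier (HX n) \<longleftrightarrow>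
    (\<forall>i. Dom C (\<phi> i) = Ob X i \<and> Cod C (\<phi> i) = (if i = - n then J else zero_ob C))"
proof -
  have "i + n = 0 \<longleftrightarrow> i = - n" for i :: int by linarith
  then show ?thesis
    by (simp add: HOM_group_def Ob_in_degree_0 flip: eq_neg_iff_add_eq_0)
qed

text \<open>All components other than the one at \<open>- n\<close> have the zero object as
  target.\<close>

lemma HOM_eqI:
  assumes "\<phi> \<in> carrier (HX n)" "\<psi> \<in> carrier (HX n)" "\<phi> (- n) = \<psi> (- n)"
  shows "\<phi> = \<psi>"
proof
  fix i show "\<phi> i = \<psi> i"
    using assms zero_ob_arr_eq[OF is_zero_ob_zero_ob, of "\<phi> i" "\<psi> i"]
    by (cases "i = - n") (simp_all add: HOM_carrier)
qed

lemma HOM_of: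
  assumes "Dom C x = Ob X k" "Cod C x = J"
  shows "HOM_of X k x \<in> carrier (HX (- k))" "HOM_of X k x k = x"
  using assms by (simp_all add: HOM_carrier HOM_of_def)

lemma HOM_bd_eq:
  assumes "\<phi> \<in> carrier (HX n)"
  shows "HOM_bd C X (in_degree_0 C J) n \<phi> = (\<lambda>i. scale C (- (if even n then 1 else - 1)) (\<phi> (i - 1) \<cdot> Bd X i))"
proof
  fix i
  show "HOM_bd C X (in_degree_0 C J) n \<phi> i = scale C (- (if even n then 1 else - 1)) (\<phi> (i - 1) \<cdot> Bd X i)"
  proof -
    have e: "i + n = 0 \<longleftrightarrow> i = - n" "i + n - 1 = 0 \<longleftrightarrow> i - 1 = - n" by linarith+
    show ?thesis
      using assms chain_complexD[OF X, of i] unfolding HOM_carrier HOM_bd_def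
      by (simp add: in_degree_0_def Let_def e)
  qed
qed

lemma HOM_bd_closed:
  assumes "\<phi> \<in> carrier (HX n)"
  shows "HOM_bd C X (in_degree_0 C J) n \<phi> \<in> carrier (HX (n - 1))"
proof -
  have e: "i - 1 = - n \<longleftrightarrow> i = - (n - 1)" for i by linarith
  show ?thesis
    unfolding HOM_bd_eq[OF assms] using assms chain_complexD[OF X]
    by (auto simp: HOM_carrier e)
qed

lemma HOM_bd_hom: "HOM_bd C X (in_degree_0 C J) n \<in> hom (HX n) (HX (n - 1))"
proof (rule homI)
  fix \<phi> \<psi> assume *: "\<phi> \<in> carrier (HX n)" "\<psi> \<in> carrier (HX n)"
  then have "\<phi> \<otimes>\<^bsub>HX n\<^esub> \<psi> \<in> carrier (HX n)"
    using comm_group_HOM_group[of X "in_degree_0 C J" n] by (simp add: comm_group_def monoid.m_closed comm_monoid_def)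
  then show "HOM_bd C X (in_degree_0 C J) n (\<phi> \<otimes>\<^bsub>HX n\<^esub> \<psi>) =
      HOM_bd C X (in_degree_0 C J) n \<phi> \<otimes>\<^bsub>HX (n - 1)\<^esub> HOM_bd C X (in_degree_0 C J) n \<psi>"
    unfolding HOM_bd_eq[OF *(1)] HOM_bd_eq[OF *(2)]
    using * chain_complexD[OF X]
    by (subst HOM_bd_eq) (auto simp: HOM_carrier HOM_mult)
qed (rule HOM_bd_closed)

lemma HOM_bd_bd:
  assumes "\<phi> \<in> carrier (HX n)"
  shows "HOM_bd C X (in_degree_0 C J) (n - 1) (HOM_bd C X (in_degree_0 C J) n \<phi>) = \<one>\<^bsub>HX (n - 1 - 1)\<^esub>"
proof (rule HOM_eqI)
  show "HOM_bd C X (in_degree_0 C J) (n - 1) (HOM_bd C X (in_degree_0 C J) n \<phi>) \<in> carrier (HX (n - 1 - 1))"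
    by (intro HOM_bd_closed assms)
  show "\<one>\<^bsub>HX (n - 1 - 1)\<^esub> \<in> carrier (HX (n - 1 - 1))"
    using comm_group_HOM_group[of X "in_degree_0 C J" "n - 1 - 1"] by (simp add: comm_group_def monoid.one_closed comm_monoid_def)
  show "HOM_bd C X (in_degree_0 C J) (n - 1) (HOM_bd C X (in_degree_0 C J) n \<phi>) (- (n - 1 - 1)) =
      \<one>\<^bsub>HX (n - 1 - 1)\<^esub> (- (n - 1 - 1))"
    unfolding HOM_bd_eq[OF HOM_bd_closed[OF assms]]
    unfolding HOM_bd_eq[OF assms]
    using assms chain_complexD[OF X] chain_complexD(3)[OF X, of "2 - n"]
    by (simp add: HOM_carrier HOM_group_def Ob_in_degree_0)
qed

lemma HOM_kernel_iff:
  assumes "\<phi> \<in> carrier (HX n)"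
  shows "\<phi> \<in> kernel (HX n) (HX (n - 1)) (HOM_bd C X (in_degree_0 C J) n) \<longleftrightarrow> cocycle X J (- n) (\<phi> (- n))"
proof -
  let ?d = "HOM_bd C X (in_degree_0 C J) n \<phi>"
  have one: "\<one>\<^bsub>HX (n - 1)\<^esub> \<in> carrier (HX (n - 1))"
    using comm_group_HOM_group[of X "in_degree_0 C J" "n - 1"] by (simp add: comm_group_def monoid.one_closed comm_monoid_def)
  have "\<phi> \<in> kernel (HX n) (HX (n - 1)) (HOM_bd C X (in_degree_0 C J) n) \<longleftrightarrow> ?d = \<one>\<^bsub>HX (n - 1)\<^esub>"
    using assms by (simp add: kernel_def)
  also have "\<dots> \<longleftrightarrow> ?d (- (n - 1)) = \<one>\<^bsub>HX (n - 1)\<^esub> (- (n - 1))"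
    using HOM_eqI[OF HOM_bd_closed[OF assms] one] by auto
  also have "\<dots> \<longleftrightarrow> cocycle X J (- n) (\<phi> (- n))"
  proof -
    have *: "Dom C (\<phi> (- n)) = Ob X (- n)" "Cod C (\<phi> (- n)) = J" using assms by (simp_all add: HOM_carrier)
    have "scale C (- (if even n then 1 else - 1)) f = Zero C a b \<longleftrightarrow> f = Zero C a b"
      if "Dom C f = a" "Cod C f = b" for f a b
      using scale_eq_Zero_iff[OF that, of 1] by auto
    then show ?thesis
      unfolding HOM_bd_eq[OF assms] cocycle_def
      using * chain_complexD[OF X] by (simp add: HOM_group_def Ob_in_degree_0)
  qed
  finally show ?thesis .
qed

lemma HOM_boundary_iff:
  assumes "\<phi> \<in> carrier (HX n)"
  shows "\<phi> \<in> grp_boundaries HX (HOM_bd C X (in_degree_0 C J)) n \<longleftrightarrow> coboundary X J (- n) (\<phi> (- n))"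
proof
  assume "\<phi> \<in> grp_boundaries HX (HOM_bd C X (in_degree_0 C J)) n"
  then obtain \<psi> where \<psi>: "\<psi> \<in> carrier (HX (n + 1))" "\<phi> = HOM_bd C X (in_degree_0 C J) (n + 1) \<psi>"
    by (auto simp: grp_boundaries_def)
  then have "\<phi> (- n) = scale C (- (if even (n + 1) then 1 else - 1)) (\<psi> (- n - 1)) \<cdot> Bd X (- n)"
    using chain_complexD[OF X] by (subst \<psi>(2), subst HOM_bd_eq) (simp_all add: HOM_carrier)
  then show "coboundary X J (- n) (\<phi> (- n))"
    unfolding coboundary_def using \<psi>(1)
    by (intro exI[of _ "scale C (- (if even (n + 1) then 1 else - 1)) (\<psi> (- n - 1))"]) (simp add: HOM_carrier)
next
  assume "coboundary X J (- n) (\<phi> (- n))"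
  then obtain y where y: "Dom C y = Ob X (- n - 1)" "Cod C y = J" "\<phi> (- n) = y \<cdot> Bd X (- n)"
    by (auto simp: coboundary_def)
  \<comment> \<open>The sign that \<open>HOM_bd\<close> introduces in degree \<open>n + 1\<close>.
    It squares to 1, so that it can be compensated in the preimage.\<close>
  define s :: int where "s = - (if even (n + 1) then 1 else - 1)"
  have ss: "s * s = 1" by (simp add: s_def)
  define \<psi> where "\<psi> = HOM_of X (- n - 1) (scale C s y)"
  have \<psi>: "\<psi> \<in> carrier (HX (n + 1))" "\<psi> (- n - 1) = scale C s y"
    using HOM_of[of "scale C s y" "- n - 1"] y by (simp_all add: \<psi>_def add.commute)
  have "\<phi> = HOM_bd C X (in_degree_0 C J) (n + 1) \<psi>"
  proof (rule HOM_eqI)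
    show "HOM_bd C X (in_degree_0 C J) (n + 1) \<psi> \<in> carrier (HX n)"
      using HOM_bd_closed[OF \<psi>(1)] by simp
    show "\<phi> (- n) = HOM_bd C X (in_degree_0 C J) (n + 1) \<psi> (- n)"
      unfolding HOM_bd_eq[OF \<psi>(1)] s_def[symmetric]
      using \<psi>(2) y chain_complexD[OF X] ss by simp
  qed (fact assms)
  then show "\<phi> \<in> grp_boundaries HX (HOM_bd C X (in_degree_0 C J)) n"
    using \<psi> by (auto simp: grp_boundaries_def)
qed

end

text \<open>Restriction along \<open>f\<close> on the cohomology of Hom(-, J): the first clause is
  injectivity, the second surjectivity. The index \<open>k\<close> is the chain degree, that is,
  degree \<open>- k\<close> of \<open>HOM\<close>.\<close>

definition equiv_on :: "('o, 'm, 'y) chain_scheme \<Rightarrow> ('o, 'm, 'z) chain_scheme \<Rightarrow> (int \<Rightarrow> 'm) \<Rightarrow> 'o \<Rightarrow> bool" where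
  "equiv_on X Y f J \<longleftrightarrow> (\<forall>k.
     (\<forall>y. cocycle Y J k y \<longrightarrow> coboundary X J k (y \<cdot> f k) \<longrightarrow> coboundary Y J k y) \<and>
     (\<forall>x. cocycle X J k x \<longrightarrow> (\<exists>y u. cocycle Y J k y \<and> coboundary X J k u \<and> x = u \<boxplus> y \<cdot> f k)))"

lemma all_uminus_iff: "(\<forall>k. P k) \<longleftrightarrow> (\<forall>n. P (- n))" for P :: "int \<Rightarrow> bool"
  by (metis minus_minus)

lemma quasi_iso_iff_equiv_on:
  assumes f: "chain_map C X Y f"
  shows "quasi_iso (HOM_group C Y (in_degree_0 C J)) (HOM_bd C Y (in_degree_0 C J))
                  (HOM_group C X (in_degree_0 C J)) (HOM_bd C X (in_degree_0 C J))
                  (\<lambda>n \<phi> i. \<phi> i \<cdot> f i) \<longleftrightarrow> equiv_on X Y f J"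
proof -
  have X: "chain_complex C X" and Y: "chain_complex C Y"
    using f by (simp_all add: chain_map_def)
  note Xd = chain_complexD[OF X] and Yd = chain_complexD[OF Y]
  have ft [simp]: "Dom C (f n) = Ob X n" "Cod C (f n) = Ob Y n" for n
    using f by (simp_all add: chain_map_def)
  have fc: "Bd Y n \<cdot> f n = f (n - 1) \<cdot> Bd X n" for n
    using f by (simp add: chain_map_def)
  let ?GY = "HOM_group C Y (in_degree_0 C J)" and ?GX = "HOM_group C X (in_degree_0 C J)"
  let ?dY = "HOM_bd C Y (in_degree_0 C J)" and ?dX = "HOM_bd C X (in_degree_0 C J)"
  have pull: "(\<lambda>i. \<phi> i \<cdot> f i) \<in> carrier (?GX n)" if "\<phi> \<in> carrier (?GY n)" for \<phi> n
    using that by (simp add: HOM_carrier[OF X] HOM_carrier[OF Y])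
  have "quasi_iso ?GY ?dY ?GX ?dX (\<lambda>n \<phi> i. \<phi> i \<cdot> f i) \<longleftrightarrow> (\<forall>n.
    (\<forall>\<phi>\<in>kernel (?GY n) (?GY (n - 1)) (?dY n). (\<lambda>i. \<phi> i \<cdot> f i) \<in> grp_boundaries ?GX ?dX n \<longrightarrow>
       \<phi> \<in> grp_boundaries ?GY ?dY n) \<and>
    (\<forall>\<psi>\<in>kernel (?GX n) (?GX (n - 1)) (?dX n). \<exists>\<phi>\<in>kernel (?GY n) (?GY (n - 1)) (?dY n).
        \<psi> \<in> grp_boundaries ?GX ?dX n #>\<^bsub>?GX n\<^esub> (\<lambda>i. \<phi> i \<cdot> f i)))"
  proof (rule quasi_iso_iff)
    fix n \<phi> assume \<phi>: "\<phi> \<in> carrier (?GY n)"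
    show "(\<lambda>i. ?dY n \<phi> i \<cdot> f i) = ?dX n (\<lambda>i. \<phi> i \<cdot> f i)"
      unfolding HOM_bd_eq[OF Y \<phi>] HOM_bd_eq[OF X pull[OF \<phi>]]
      using \<phi> Xd Yd fc by (simp add: HOM_carrier[OF Y])
  next
    fix n show "(\<lambda>\<phi> i. \<phi> i \<cdot> f i) \<in> hom (?GY n) (?GX n)"
    proof (rule homI)
      fix \<phi> \<psi> assume "\<phi> \<in> carrier (?GY n)" "\<psi> \<in> carrier (?GY n)"
      then show "(\<lambda>i. (\<phi> \<otimes>\<^bsub>?GY n\<^esub> \<psi>) i \<cdot> f i) = (\<lambda>i. \<phi> i \<cdot> f i) \<otimes>\<^bsub>?GX n\<^esub> (\<lambda>i. \<psi> i \<cdot> f i)"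
        by (auto simp: HOM_group_def)
    qed (rule pull)
  qed (use comm_group_HOM_group HOM_bd_hom[OF X] HOM_bd_hom[OF Y] HOM_bd_bd[OF X] HOM_bd_bd[OF Y] in auto)
  moreover have "(\<forall>\<phi>\<in>kernel (?GY n) (?GY (n - 1)) (?dY n). (\<lambda>i. \<phi> i \<cdot> f i) \<in> grp_boundaries ?GX ?dX n \<longrightarrow>
       \<phi> \<in> grp_boundaries ?GY ?dY n) \<longleftrightarrow>
     (\<forall>y. cocycle Y J (- n) y \<longrightarrow> coboundary X J (- n) (y \<cdot> f (- n)) \<longrightarrow> coboundary Y J (- n) y)"
     (is "?l \<longleftrightarrow> ?r") for n
  proof
    assume l: ?l
    show ?r
    proof (intro allI impI)
      fix y assume y: "cocycle Y J (- n) y" "coboundary X J (- n) (y \<cdot> f (- n))"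
      define \<phi> where "\<phi> = HOM_of Y (- n) y"
      have \<phi>: "\<phi> \<in> carrier (?GY n)" "\<phi> (- n) = y"
        using HOM_of[OF Y, of y "- n" J] y(1) by (simp_all add: \<phi>_def cocycle_def)
      then have "\<phi> \<in> kernel (?GY n) (?GY (n - 1)) (?dY n)" "(\<lambda>i. \<phi> i \<cdot> f i) \<in> grp_boundaries ?GX ?dX n"
        using y pull by (simp_all add: HOM_kernel_iff[OF Y] HOM_boundary_iff[OF X])
      then have "\<phi> \<in> grp_boundaries ?GY ?dY n" using l by blast
      then show "coboundary Y J (- n) y" using \<phi> by (simp add: HOM_boundary_iff[OF Y])
    qed
  next
    assume r: ?r
    show ?l
    proof (intro ballI impI)
      fix \<phi> assume *: "\<phi> \<in> kernel (?GY n) (?GY (n - 1)) (?dY n)" "(\<lambda>i. \<phi> i \<cdot> f i) \<in> grp_boundaries ?GX ?dX n"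
      then have \<phi>: "\<phi> \<in> carrier (?GY n)" by (simp add: kernel_def)
      then show "\<phi> \<in> grp_boundaries ?GY ?dY n"
        using * r pull[OF \<phi>] by (simp add: HOM_kernel_iff[OF Y] HOM_boundary_iff[OF X] HOM_boundary_iff[OF Y])
    qed
  qed
  moreover have "(\<forall>\<psi>\<in>kernel (?GX n) (?GX (n - 1)) (?dX n). \<exists>\<phi>\<in>kernel (?GY n) (?GY (n - 1)) (?dY n).
        \<psi> \<in> grp_boundaries ?GX ?dX n #>\<^bsub>?GX n\<^esub> (\<lambda>i. \<phi> i \<cdot> f i)) \<longleftrightarrow>
     (\<forall>x. cocycle X J (- n) x \<longrightarrow>
       (\<exists>y u. cocycle Y J (- n) y \<and> coboundary X J (- n) u \<and> x = u \<boxplus> y \<cdot> f (- n)))"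
     (is "?l \<longleftrightarrow> ?r") for n
  proof
    assume l: ?l
    show ?r
    proof (intro allI impI)
      fix x assume x: "cocycle X J (- n) x"
      define \<psi> where "\<psi> = HOM_of X (- n) x"
      have \<psi>: "\<psi> \<in> carrier (?GX n)" "\<psi> (- n) = x"
        using HOM_of[OF X, of x "- n" J] x by (simp_all add: \<psi>_def cocycle_def)
      then have "\<psi> \<in> kernel (?GX n) (?GX (n - 1)) (?dX n)"
        using x by (simp add: HOM_kernel_iff[OF X])
      then obtain \<phi> where \<phi>: "\<phi> \<in> kernel (?GY n) (?GY (n - 1)) (?dY n)"
          "\<psi> \<in> grp_boundaries ?GX ?dX n #>\<^bsub>?GX n\<^esub> (\<lambda>i. \<phi> i \<cdot> f i)" using l by blast
      then have \<phi>': "\<phi> \<in> carrier (?GY n)" by (simp add: kernel_def)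
      obtain \<upsilon> where \<upsilon>: "\<upsilon> \<in> grp_boundaries ?GX ?dX n" "\<psi> = \<upsilon> \<otimes>\<^bsub>?GX n\<^esub> (\<lambda>i. \<phi> i \<cdot> f i)"
        using \<phi>(2) by (auto simp: r_coset_def)
      have \<upsilon>': "\<upsilon> \<in> carrier (?GX n)"
        using \<upsilon>(1) HOM_bd_closed[OF X, of _ J "n + 1"] by (auto simp: grp_boundaries_def)
      have "x = \<upsilon> (- n) \<boxplus> \<phi> (- n) \<cdot> f (- n)"
        using \<psi>(2) \<upsilon>(2) by (simp add: HOM_group_def)
      then show "\<exists>y u. cocycle Y J (- n) y \<and> coboundary X J (- n) u \<and> x = u \<boxplus> y \<cdot> f (- n)"
        using \<phi>(1) \<phi>' \<upsilon>(1) \<upsilon>' by (auto simp: HOM_kernel_iff[OF Y] HOM_boundary_iff[OF X])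
    qed
  next
    assume r: ?r
    show ?l
    proof (intro ballI impI)
      fix \<psi> assume *: "\<psi> \<in> kernel (?GX n) (?GX (n - 1)) (?dX n)"
      then have \<psi>: "\<psi> \<in> carrier (?GX n)" by (simp add: kernel_def)
      then have "cocycle X J (- n) (\<psi> (- n))" using * by (simp add: HOM_kernel_iff[OF X])
      then obtain y u where yu: "cocycle Y J (- n) y" "coboundary X J (- n) u" "\<psi> (- n) = u \<boxplus> y \<cdot> f (- n)"
        using r by blast
      have ut: "Dom C u = Ob X (- n)" "Cod C u = J"
        using yu(2) Xd by (auto simp: coboundary_def)
      have \<phi>: "HOM_of Y (- n) y \<in> carrier (?GY n)" "HOM_of Y (- n) y (- n) = y"
        using HOM_of[OF Y, of y "- n" J] yu(1) by (simp_all add: cocycle_def)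
      have \<upsilon>: "HOM_of X (- n) u \<in> carrier (?GX n)" "HOM_of X (- n) u (- n) = u"
        using HOM_of[OF X, of u "- n" J] ut by simp_all
      have k: "HOM_of Y (- n) y \<in> kernel (?GY n) (?GY (n - 1)) (?dY n)"
        using \<phi> yu by (simp add: HOM_kernel_iff[OF Y])
      have b: "HOM_of X (- n) u \<in> grp_boundaries ?GX ?dX n"
        using \<upsilon> yu by (simp add: HOM_boundary_iff[OF X])
      have "\<psi> = HOM_of X (- n) u \<otimes>\<^bsub>?GX n\<^esub> (\<lambda>i. HOM_of Y (- n) y i \<cdot> f i)"
      proof (rule HOM_eqI[OF X \<psi>])
        show "HOM_of X (- n) u \<otimes>\<^bsub>?GX n\<^esub> (\<lambda>i. HOM_of Y (- n) y i \<cdot> f i) \<in> carrier (?GX n)"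
          using comm_group_HOM_group[of X "in_degree_0 C J" n] \<upsilon>(1) pull[OF \<phi>(1)]
          by (simp add: comm_group_def monoid.m_closed comm_monoid_def)
        show "\<psi> (- n) = (HOM_of X (- n) u \<otimes>\<^bsub>?GX n\<^esub> (\<lambda>i. HOM_of Y (- n) y i \<cdot> f i)) (- n)"
          using \<phi>(2) \<upsilon>(2) yu(3) by (simp add: HOM_group_def)
      qed
      then show "\<exists>\<phi>\<in>kernel (?GY n) (?GY (n - 1)) (?dY n).
          \<psi> \<in> grp_boundaries ?GX ?dX n #>\<^bsub>?GX n\<^esub> (\<lambda>i. \<phi> i \<cdot> f i)"
        using k b by (auto simp: r_coset_def)
    qed
  qed
  moreover have "equiv_on X Y f J \<longleftrightarrow> (\<forall>n.
     (\<forall>y. cocycle Y J (- n) y \<longrightarrow> coboundary X J (- n) (y \<cdot> f (- n)) \<longrightarrow> coboundary Y J (- n) y) \<and>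
     (\<forall>x. cocycle X J (- n) x \<longrightarrow>
       (\<exists>y u. cocycle Y J (- n) y \<and> coboundary X J (- n) u \<and> x = u \<boxplus> y \<cdot> f (- n))))"
    unfolding equiv_on_def by (rule all_uminus_iff)
  ultimately show ?thesis
    by presburger
qed

lemma weak_equiv_iff:
  "weak_equiv C X Y f \<longleftrightarrow> chain_map C X Y f \<and> (\<forall>J. rel_injective C J \<longrightarrow> equiv_on X Y f J)"
  using quasi_iso_iff_equiv_on unfolding weak_equiv_def by blast

end

subsection \<open>Precyclic objects\<close>

text \<open>Only the faces \<open>d n j\<close> with \<open>j < n\<close> are given: the last face is \<open>d n 0 \<cdot> t\<close>.\<close>

locale precyclic = base_cat C for C :: "('o, 'm) tensor_cat" (structure) +
  fixes D :: "('o, 'm) cyc" and d :: "nat \<Rightarrow> nat \<Rightarrow> 'm"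
  assumes d_Hom [simp]: "j < n \<Longrightarrow> Dom C (d n j) = CX D n" "j < n \<Longrightarrow> Cod C (d n j) = CX D (n - 1)"
    and t_Hom [simp]: "Dom C (Ct D n) = CX D n" "Cod C (Ct D n) = CX D n"
    and d_d: "i < j \<Longrightarrow> j < n \<Longrightarrow> d (n - 1) i \<cdot> d n j = d (n - 1) (j - 1) \<cdot> d n i"
    and d_t: "0 < i \<Longrightarrow> i < n \<Longrightarrow> d n i \<cdot> Ct D n = Ct D (n - 1) \<cdot> d n (i - 1)"
    and t_power: "((\<lambda>g. Ct D n \<cdot> g) ^^ Suc n) (Idn C (CX D n)) = Idn C (CX D n)"
    and Cb'_eq: "0 < n \<Longrightarrow> Cb' D n =
      arr_sum C (CX D n) (CX D (n - 1)) (\<lambda>j. scale C ((- 1) ^ j) (d n j)) {..<n}"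
    and Cb_eq: "0 < n \<Longrightarrow> Cb D n = Cb' D n \<boxplus> scale C ((- 1) ^ n) (d n 0 \<cdot> Ct D n)"
begin

definition tp :: "nat \<Rightarrow> nat \<Rightarrow> 'm" where
  "tp n k = ((\<lambda>g. Ct D n \<cdot> g) ^^ k) (Idn C (CX D n))"

lemma tp_simps: "tp n 0 = Idn C (CX D n)" "tp n (Suc k) = Ct D n \<cdot> tp n k"
  by (simp_all add: tp_def)

lemma tp_Hom [simp]: "Dom C (tp n k) = CX D n" "Cod C (tp n k) = CX D n"
  by (induction k) (simp_all add: tp_simps)

lemma tp_add: "tp n (k + l) = tp n k \<cdot> tp n l"
  by (induction k) (simp_all add: tp_simps)

lemma tp_Suc': "tp n (Suc k) = tp n k \<cdot> Ct D n"
  using tp_add[of n k 1] by (simp add: tp_simps)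

lemma tp_period: "tp n (Suc n) = Idn C (CX D n)"
  using t_power by (simp add: tp_def)

lemma t_0: "Ct D 0 = Idn C (CX D 0)"
  using tp_period[of 0] by (simp add: tp_simps)

definition face :: "nat \<Rightarrow> nat \<Rightarrow> 'm" where
  "face n j = (if j < n then d n j else d n 0 \<cdot> Ct D n)"

lemma face_Hom [simp]:
  "0 < n \<Longrightarrow> Dom C (face n j) = CX D n" "0 < n \<Longrightarrow> Cod C (face n j) = CX D (n - 1)"
  by (simp_all add: face_def)

lemma face_t:
  assumes "0 < i" "i \<le> n" shows "face n i \<cdot> Ct D n = Ct D (n - 1) \<cdot> face n (i - 1)"
proof (cases "i < n")
  case True
  then have "i - 1 < n" by simp
  then show ?thesis using True assms d_t[of i n] by (simp add: face_def)
next
  case False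
  then have n: "i = n" "0 < n" using assms by simp_all
  have "k < n \<Longrightarrow> d n k \<cdot> tp n k = tp (n - 1) k \<cdot> d n 0" for k
  proof (induction k)
    case 0 then show ?case by (simp add: tp_simps)
  next
    case (Suc k)
    have "d n (Suc k) \<cdot> tp n (Suc k) = (d n (Suc k) \<cdot> Ct D n) \<cdot> tp n k"
      using Suc.prems by (simp add: tp_simps)
    also have "\<dots> = (Ct D (n - 1) \<cdot> d n k) \<cdot> tp n k"
      using Suc.prems d_t[of "Suc k" n] by simp
    also have "\<dots> = tp (n - 1) (Suc k) \<cdot> d n 0"
      using Suc by (simp add: tp_simps)
    finally show ?case .
  qed
  from this[of "n - 1"] have *: "d n (n - 1) \<cdot> tp n (n - 1) = tp (n - 1) (n - 1) \<cdot> d n 0"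
    using n by simp
  have "Ct D (n - 1) \<cdot> d n (n - 1) = Ct D (n - 1) \<cdot> (d n (n - 1) \<cdot> tp n (n - 1 + 2))"
    using n tp_period[of n] by simp
  also have "\<dots> = Ct D (n - 1) \<cdot> ((d n (n - 1) \<cdot> tp n (n - 1)) \<cdot> tp n 2)"
    using n by (subst tp_add) simp
  also have "\<dots> = tp (n - 1) (Suc (n - 1)) \<cdot> d n 0 \<cdot> tp n 2"
    unfolding * tp_simps(2) using n by simp
  also have "\<dots> = d n 0 \<cdot> Ct D n \<cdot> Ct D n"
    using n tp_period[of "n - 1"] by (simp add: tp_simps numeral_2_eq_2)
  finally show ?thesis
    using n by (simp add: face_def)
qed

lemma face_tp:
  assumes "i \<le> j" "j \<le> n" "0 < n" shows "face n j \<cdot> tp n i = tp (n - 1) i \<cdot> face n (j - i)"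
  using assms(1)
proof (induction i)
  case 0 then show ?case using assms by (simp add: tp_simps)
next
  case (Suc i)
  have "face n j \<cdot> tp n (Suc i) = (face n j \<cdot> tp n i) \<cdot> Ct D n"
    using assms by (simp add: tp_Suc')
  also have "\<dots> = tp (n - 1) i \<cdot> (face n (j - i) \<cdot> Ct D n)"
    using Suc assms by simp
  also have "\<dots> = tp (n - 1) (Suc i) \<cdot> face n (j - Suc i)"
    using Suc.prems assms by (subst face_t) (simp_all add: tp_Suc')
  finally show ?case .
qed

text \<open>Each rotation lowers the index of the face by one until it is 0. The next rotation is
  absorbed, since d_0 t is the last face; so one rotation fewer comes out, and the index continues
  downwards from \<open>n\<close>.\<close>

lemma face_tp_wrap:
  assumes "j < i" "i \<le> n" shows "face n j \<cdot> tp n i = tp (n - 1) (i - 1) \<cdot> face n (n + j + 1 - i)"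
proof -
  define k where "k = i - j - 1"
  have i: "i = j + Suc k" using assms by (simp add: k_def)
  have "face n j \<cdot> tp n i = (face n j \<cdot> tp n j) \<cdot> tp n (Suc k)"
    unfolding i tp_add using assms i by simp
  also have "\<dots> = tp (n - 1) j \<cdot> ((face n 0 \<cdot> Ct D n) \<cdot> tp n k)"
    using assms by (subst face_tp) (simp_all add: tp_simps)
  also have "face n 0 \<cdot> Ct D n = face n n" using assms by (simp add: face_def)
  also have "face n n \<cdot> tp n k = tp (n - 1) k \<cdot> face n (n - k)"
    using assms i by (intro face_tp) simp_all
  also have "tp (n - 1) j \<cdot> tp (n - 1) k \<cdot> face n (n - k) = tp (n - 1) (j + k) \<cdot> face n (n - k)"
    using assms by (simp add: tp_add)
  finally show ?thesis using assms i by simp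
qed

text \<open>Below the last face this is the axiom \<open>d_d\<close>. If \<open>j = n\<close>, the
  last face is d_0 t, and rotations are moved past faces until \<open>d_d\<close> with smaller index
  0 applies; the end cases \<open>i = 0\<close> and \<open>i = n - 1\<close> both come down to d_0
  d_1 = d_0 d_0.\<close>

lemma face_face:
  assumes "i < j" "j \<le> n" "2 \<le> n" shows "face (n - 1) i \<cdot> face n j = face (n - 1) (j - 1) \<cdot> face n i"
proof (cases "j < n")
  case True
  then have "j - 1 < n - 1" "i < n - 1" using assms by linarith+
  then show ?thesis using True assms d_d[of i j n] by (simp add: face_def)
next
  case False
  then have j: "j = n" using assms by simp
  have d01: "d (n - 1) 0 \<cdot> d n 1 = d (n - 1) 0 \<cdot> d n 0"
    using d_d[of 0 1 n] assms by simp
  have t1: "Ct D (n - 1) \<cdot> d n 0 = d n 1 \<cdot> Ct D n"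
    using d_t[of 1 n] assms by simp
  consider "i = 0" | "0 < i" "i < n - 1" | "i = n - 1" using assms j by linarith
  then show ?thesis
  proof cases
    case 1
    have "face (n - 1) (n - 1) \<cdot> face n 0 = d (n - 1) 0 \<cdot> (Ct D (n - 1) \<cdot> d n 0)"
      using assms by (simp add: face_def)
    also have "\<dots> = (d (n - 1) 0 \<cdot> d n 1) \<cdot> Ct D n"
      unfolding t1 using assms by simp
    also have "\<dots> = face (n - 1) 0 \<cdot> face n n"
      unfolding d01 using assms by (simp add: face_def)
    finally show ?thesis using 1 j by simp
  next
    case 2
    have "face (n - 1) i \<cdot> face n n = (d (n - 1) i \<cdot> d n 0) \<cdot> Ct D n"
      using 2 assms by (simp add: face_def)
    also have "d (n - 1) i \<cdot> d n 0 = d (n - 1) 0 \<cdot> d n (Suc i)"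
      using d_d[of 0 "Suc i" n] 2 by simp
    also have "(d (n - 1) 0 \<cdot> d n (Suc i)) \<cdot> Ct D n = d (n - 1) 0 \<cdot> Ct D (n - 1) \<cdot> d n i"
      using d_t[of "Suc i" n] 2 by simp
    also have "\<dots> = face (n - 1) (n - 1) \<cdot> face n i"
      using 2 assms by (simp add: face_def)
    finally show ?thesis using j by simp
  next
    case 3
    have "face (n - 1) (n - 1) \<cdot> face n n = d (n - 1) 0 \<cdot> (Ct D (n - 1) \<cdot> d n 0) \<cdot> Ct D n"
      using assms by (simp add: face_def)
    also have "\<dots> = (d (n - 1) 0 \<cdot> d n 1) \<cdot> (Ct D n \<cdot> Ct D n)"
      unfolding t1 using assms by simp
    also have "\<dots> = d (n - 1) 0 \<cdot> (face n n \<cdot> Ct D n)"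
      unfolding d01 using assms by (simp add: face_def)
    also have "\<dots> = face (n - 1) (n - 1) \<cdot> face n (n - 1)"
      using assms by (subst face_t) (simp_all add: face_def)
    finally show ?thesis using 3 j by simp
  qed
qed

text \<open>A partial alternating sum of faces: \<open>m = n\<close> gives the bar boundary and
  \<open>m = n + 1\<close> the Hochschild boundary, so that one computation shows that both square
  to zero.\<close>

definition bsum :: "nat \<Rightarrow> nat \<Rightarrow> 'm" where
  "bsum n m = arr_sum C (CX D n) (CX D (n - 1)) (\<lambda>j. scale C ((- 1) ^ j) (face n j)) {..<m}"

lemma bsum_Hom [simp]:
  "0 < n \<Longrightarrow> Dom C (bsum n m) = CX D n" "0 < n \<Longrightarrow> Cod C (bsum n m) = CX D (n - 1)"
  by (simp_all add: bsum_def)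

lemma Cb'_bsum: "0 < n \<Longrightarrow> Cb' D n = bsum n n"
  unfolding bsum_def Cb'_eq by (intro sum_cong) (simp_all add: face_def)

lemma bsum_Suc: "0 < n \<Longrightarrow> bsum n (Suc m) = bsum n m \<boxplus> scale C ((- 1) ^ m) (face n m)"
  by (simp add: bsum_def lessThan_Suc Plus_commute)

lemma Cb_bsum: "0 < n \<Longrightarrow> Cb D n = bsum n (Suc n)"
  by (simp add: bsum_Suc Cb_eq Cb'_bsum face_def)

lemma Cb_Hom [simp]:
  assumes "0 < n"
  shows "Dom C (Cb D n) = CX D n" "Cod C (Cb D n) = CX D (n - 1)"
    "Dom C (Cb' D n) = CX D n" "Cod C (Cb' D n) = CX D (n - 1)"
  using assms by (simp_all add: Cb_bsum Cb'_bsum)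

lemma bsum_bsum:
  assumes "1 \<le> m" "m \<le> Suc n" "2 \<le> n"
  shows "bsum (n - 1) (m - 1) \<cdot> bsum n m = Zero C (CX D n) (CX D (n - 2))"
proof -
  let ?a = "CX D n" and ?b = "CX D (n - 1 - 1)"
  define f where "f = (\<lambda>(i, j). scale C ((- 1) ^ (i + j)) (face (n - 1) i \<cdot> face n j))"
  define S T where "S = {p \<in> {..<m - 1} \<times> {..<m}. fst p < snd p}"
    and "T = {p \<in> {..<m - 1} \<times> {..<m}. snd p \<le> fst p}"
  have f [simp]: "Dom C (f p) = ?a" "Cod C (f p) = ?b" for p
    using assms by (simp_all add: f_def split_beta)
  have fin: "finite S" "finite T" by (auto simp: S_def T_def)
  have "bsum (n - 1) (m - 1) \<cdot> bsum n m =
      arr_sum C ?a ?b (\<lambda>i. arr_sum C ?a ?b (\<lambda>j. f (i, j)) {..<m}) {..<m - 1}"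
    unfolding bsum_def using assms
    by (subst sum_comp[where c = ?a], simp_all, intro sum_cong)
      (simp_all add: f_def comp_sum[where c = ?b] scale_sum power_add mult.commute)
  also have "\<dots> = arr_sum C ?a ?b (\<lambda>(i, j). f (i, j)) ({..<m - 1} \<times> {..<m})"
    by (intro sum_Sigma) simp_all
  also have "{..<m - 1} \<times> {..<m} = S \<union> T"
    unfolding S_def T_def by auto
  also have "arr_sum C ?a ?b (\<lambda>(i, j). f (i, j)) (S \<union> T) = arr_sum C ?a ?b f S \<boxplus> arr_sum C ?a ?b f T"
    using fin by (simp, intro sum_Un_disjoint) (auto simp: S_def T_def)
  \<comment> \<open>A pair (i, j) with \<open>j \<le> i\<close> is matched with (j, i + 1): the
    composite is the same by \<open>face_face\<close>, and the sign is opposite.\<close>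
  also have "arr_sum C ?a ?b f S = arr_sum C ?a ?b (\<lambda>p. scale C (- 1) (f p)) T"
  proof (rule sym, rule sum_reindex_bij[where h = "\<lambda>(i, j). (j, Suc i)"])
    show "bij_betw (\<lambda>(i, j). (j, Suc i)) T S"
      by (rule bij_betw_byWitness[where f' = "\<lambda>(i, j). (j - 1, i)"]) (auto simp: S_def T_def)
    fix p assume "p \<in> T"
    then obtain i j where p: "p = (i, j)" "i < m - 1" "j \<le> i" by (auto simp: T_def)
    then show "f (case p of (i, j) \<Rightarrow> (j, Suc i)) = scale C (- 1) (f p)"
      using assms face_face[of j "Suc i" n] by (simp add: f_def add.commute)
  qed simp
  also have "arr_sum C ?a ?b (\<lambda>p. scale C (- 1) (f p)) T \<boxplus> arr_sum C ?a ?b f T =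
      arr_sum C ?a ?b (\<lambda>p. scale C (- 1) (f p) \<boxplus> f p) T"
    by (rule sum_Plus[symmetric]) simp
  also have "\<dots> = Zero C ?a ?b"
    by (intro sum_zero) (simp add: Plus_commute)
  finally show ?thesis by (simp add: numeral_2_eq_2)
qed

lemma Cb_Cb: "2 \<le> n \<Longrightarrow> Cb D (n - 1) \<cdot> Cb D n = Zero C (CX D n) (CX D (n - 2))"
  and Cb'_Cb': "2 \<le> n \<Longrightarrow> Cb' D (n - 1) \<cdot> Cb' D n = Zero C (CX D n) (CX D (n - 2))"
  using bsum_bsum[of "Suc n" n] bsum_bsum[of n n] by (simp_all add: Cb_bsum Cb'_bsum)

subsubsection \<open>The norm\<close>

lemma norm_eq: "cyc_norm C D n = arr_sum C (CX D n) (CX D n) (\<lambda>i. scale C ((- 1) ^ (n * i)) (tp n i)) {..n}"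
  by (simp add: cyc_norm_def tp_def)

lemma norm_Hom [simp]: "Dom C (cyc_norm C D n) = CX D n" "Cod C (cyc_norm C D n) = CX D n"
  by (simp_all add: norm_eq)

text \<open>The operator 1 - t for the signed rotation t; it is the entry of the boundary of
  \<open>Om\<close> from summand 1 to summand 0.\<close>

definition \<omega> :: "nat \<Rightarrow> 'm" where
  "\<omega> n = Idn C (CX D n) \<boxplus> scale C ((- 1) ^ Suc n) (Ct D n)"

lemma \<omega>_Hom [simp]: "Dom C (\<omega> n) = CX D n" "Cod C (\<omega> n) = CX D n"
  by (simp_all add: \<omega>_def)

text \<open>Multiplication by the signed rotation permutes the summands of the norm
  cyclically.\<close>

lemma norm_shift:
  "arr_sum C (CX D n) (CX D n) (\<lambda>i. scale C ((- 1) ^ (n * Suc i)) (tp n (Suc i))) {..n} = cyc_norm C D n"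
  unfolding norm_eq
proof (rule sum_reindex_bij[where h = "\<lambda>i. if i = n then 0 else Suc i"])
  show "bij_betw (\<lambda>i. if i = n then 0 else Suc i) {..n} {..n}"
    by (rule bij_betw_byWitness[where f' = "\<lambda>i. if i = 0 then n else i - 1"]) auto
  \<comment> \<open>The last summand returns to the first one by the period of the rotation, and n
    (n + 1) being even it does so with sign +1.\<close>
  have "even (n * Suc n)" by simp
  then have "(- 1 :: int) ^ (n * Suc n) = 1" by (simp only: neg_one_even_power)
  then show "scale C ((- 1) ^ (n * (if i = n then 0 else Suc i))) (tp n (if i = n then 0 else Suc i)) =
      scale C ((- 1) ^ (n * Suc i)) (tp n (Suc i))" if "i \<in> {..n}" for i
    by (auto simp: tp_period tp_simps(1) simp del: mult_Suc_right)
qed simp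

lemma norm_t: "cyc_norm C D n \<cdot> scale C ((- 1) ^ n) (Ct D n) = cyc_norm C D n"
  and t_norm: "scale C ((- 1) ^ n) (Ct D n) \<cdot> cyc_norm C D n = cyc_norm C D n"
proof -
  have "cyc_norm C D n \<cdot> scale C ((- 1) ^ n) (Ct D n) =
      arr_sum C (CX D n) (CX D n) (\<lambda>i. scale C ((- 1) ^ (n * Suc i)) (tp n (Suc i))) {..n}"
    unfolding norm_eq
    by (subst sum_comp[where c = "CX D n"]) (simp_all add: tp_Suc' power_add mult.commute)
  then show "cyc_norm C D n \<cdot> scale C ((- 1) ^ n) (Ct D n) = cyc_norm C D n"
    by (simp only: norm_shift)
  have "scale C ((- 1) ^ n) (Ct D n) \<cdot> cyc_norm C D n =
      arr_sum C (CX D n) (CX D n) (\<lambda>i. scale C ((- 1) ^ (n * Suc i)) (tp n (Suc i))) {..n}"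
    unfolding norm_eq
    by (subst comp_sum[where c = "CX D n"]) (simp_all add: tp_simps power_add mult.commute)
  then show "scale C ((- 1) ^ n) (Ct D n) \<cdot> cyc_norm C D n = cyc_norm C D n"
    by (simp only: norm_shift)
qed

lemma norm_\<omega>: "cyc_norm C D n \<cdot> \<omega> n = Zero C (CX D n) (CX D n)"
  and \<omega>_norm: "\<omega> n \<cdot> cyc_norm C D n = Zero C (CX D n) (CX D n)"
proof -
  have w: "\<omega> n = Idn C (CX D n) \<boxplus> scale C (- 1) (scale C ((- 1) ^ n) (Ct D n))"
    by (simp add: \<omega>_def)
  show "cyc_norm C D n \<cdot> \<omega> n = Zero C (CX D n) (CX D n)"
    unfolding w using norm_t[of n] by (simp del: scale_scale)
  show "\<omega> n \<cdot> cyc_norm C D n = Zero C (CX D n) (CX D n)"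
    unfolding w using t_norm[of n] by (simp del: scale_scale scale_comp) (simp del: scale_scale)
qed

text \<open>For the unsigned rotation, b t = d_n - t b': the face d_0 t is the last one, and d_(j+1)
  t = t d_j shifts all signs by one. The last face then cancels in b (1 - t).\<close>

lemma Cb_\<omega>:
  assumes "0 < n" shows "Cb D n \<cdot> \<omega> n = \<omega> (n - 1) \<cdot> Cb' D n"
proof -
  let ?a = "CX D n" and ?b = "CX D (n - 1)"
  let ?g = "\<lambda>j. scale C ((- 1) ^ j) (face n j) \<cdot> Ct D n"
  have "bsum n (Suc n) \<cdot> Ct D n = arr_sum C ?a ?b ?g {..<Suc n}"
    unfolding bsum_def using assms by (intro sum_comp) simp_all
  also have "{..<Suc n} = insert 0 (Suc ` {..<n})"
    by (rule lessThan_Suc_eq_insert_0)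
  also have "arr_sum C ?a ?b ?g (insert 0 (Suc ` {..<n})) = ?g 0 \<boxplus> arr_sum C ?a ?b ?g (Suc ` {..<n})"
    using assms by (intro sum_insert) auto
  also have "arr_sum C ?a ?b ?g (Suc ` {..<n}) = arr_sum C ?a ?b (\<lambda>j. ?g (Suc j)) {..<n}"
    using assms by (intro sum_reindex) auto
  also have "\<dots> = arr_sum C ?a ?b (\<lambda>j. scale C (- 1) (Ct D (n - 1)) \<cdot> scale C ((- 1) ^ j) (face n j)) {..<n}"
    using assms by (intro sum_cong) (auto simp: face_t)
  also have "\<dots> = scale C (- 1) (Ct D (n - 1)) \<cdot> bsum n n"
    unfolding bsum_def using assms by (intro comp_sum[symmetric]) simp_all
  also have "?g 0 = face n n" using assms by (simp add: face_def)
  finally have *: "bsum n (Suc n) \<cdot> Ct D n = face n n \<boxplus> scale C (- 1) (Ct D (n - 1)) \<cdot> bsum n n" .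
  have "Cb D n \<cdot> \<omega> n = bsum n (Suc n) \<boxplus> scale C ((- 1) ^ Suc n) (bsum n (Suc n) \<cdot> Ct D n)"
    using assms by (simp add: \<omega>_def Cb_bsum)
  also have "\<dots> = (bsum n n \<boxplus> scale C ((- 1) ^ n) (face n n)) \<boxplus>
      (scale C (- 1) (scale C ((- 1) ^ n) (face n n)) \<boxplus> scale C ((- 1) ^ n) (Ct D (n - 1) \<cdot> bsum n n))"
    unfolding * using assms by (simp add: bsum_Suc)
  also have "\<dots> = bsum n n \<boxplus> ((scale C ((- 1) ^ n) (face n n) \<boxplus> scale C (- 1) (scale C ((- 1) ^ n) (face n n)))
       \<boxplus> scale C ((- 1) ^ n) (Ct D (n - 1) \<cdot> bsum n n))"
    using assms by (simp add: Plus_assoc del: scale_minus_Plus scale_scale)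
  also have "\<dots> = \<omega> (n - 1) \<cdot> Cb' D n"
    unfolding scale_minus_Plus using assms by (simp add: \<omega>_def Cb'_bsum)
  finally show ?thesis .
qed

lemma minus_one_power_add_even: "a + 2 * c = b \<Longrightarrow> (- 1 :: int) ^ a = (- 1) ^ b" for a b c :: nat
  by (auto simp: power_add)

text \<open>Every d_j t^i is t^m d_k for exactly one pair (m, k), by \<open>face_tp\<close> if
  \<open>i \<le> j\<close> and by \<open>face_tp_wrap\<close> otherwise. The two double sums have
  the same terms, with signs whose exponents differ by an even number.\<close>

lemma Cb'_norm:
  assumes "0 < n" shows "Cb' D n \<cdot> cyc_norm C D n = cyc_norm C D (n - 1) \<cdot> Cb D n"
proof -
  let ?a = "CX D n" and ?b = "CX D (n - 1)"
  define f where "f = (\<lambda>(j, i). scale C ((- 1) ^ (j + n * i)) (face n j \<cdot> tp n i))"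
  define g where "g = (\<lambda>(m, k). scale C ((- 1) ^ ((n - 1) * m + k)) (tp (n - 1) m \<cdot> face n k))"
  have f [simp]: "Dom C (f p) = ?a" "Cod C (f p) = ?b" for p
    using assms by (simp_all add: f_def split_beta)
  have g [simp]: "Dom C (g p) = ?a" "Cod C (g p) = ?b" for p
    using assms by (simp_all add: g_def split_beta)
  have "Cb' D n \<cdot> cyc_norm C D n = arr_sum C ?a ?b (\<lambda>j. arr_sum C ?a ?b (\<lambda>i. f (j, i)) {..n}) {..<n}"
    unfolding Cb'_bsum[OF assms] bsum_def norm_eq using assms
    by (subst sum_comp[where c = ?a], simp_all, intro sum_cong)
      (simp_all add: f_def comp_sum[where c = ?b] scale_sum power_add mult.commute)
  also have "\<dots> = arr_sum C ?a ?b (\<lambda>(i, j). f (i, j)) ({..<n} \<times> {..n})"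
    by (intro sum_Sigma) simp_all
  also have "\<dots> = arr_sum C ?a ?b f ({..<n} \<times> {..n})" by simp
  also have "\<dots> = arr_sum C ?a ?b g ({..<n} \<times> {..<Suc n})"
  proof (rule sum_reindex_bij[where h = "\<lambda>(j, i). if i \<le> j then (i, j - i) else (i - 1, n + j + 1 - i)"])
    show "bij_betw (\<lambda>(j, i). if i \<le> j then (i, j - i) else (i - 1, n + j + 1 - i))
        ({..<n} \<times> {..n}) ({..<n} \<times> {..<Suc n})"
      by (rule bij_betw_byWitness[where
            f' = "\<lambda>(m, k). if k + m < n then (k + m, m) else (k + m - n, m + 1)"])
        (auto split: if_splits)
    fix p assume "p \<in> {..<n} \<times> {..n}"
    then obtain j i where p: "p = (j, i)" "j < n" "i \<le> n" by auto
    show "g (case p of (j, i) \<Rightarrow> if i \<le> j then (i, j - i) else (i - 1, n + j + 1 - i)) = f p"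
    proof (cases "i \<le> j")
      case True
      have "(n - 1) * i + (j - i) + 2 * i = j + n * i"
        using True assms by (cases n) auto
      then have "(- 1 :: int) ^ ((n - 1) * i + (j - i)) = (- 1) ^ (j + n * i)"
        by (rule minus_one_power_add_even)
      then show ?thesis
        using True p assms face_tp[of i j n] by (simp add: f_def g_def)
    next
      case False
      then have "(n - 1) * (i - 1) + (n + j + 1 - i) + 2 * (i - 1) = j + n * i"
        using assms p by (cases n; cases i) auto
      then have "(- 1 :: int) ^ ((n - 1) * (i - 1) + (n + j + 1 - i)) = (- 1) ^ (j + n * i)"
        by (rule minus_one_power_add_even)
      then show ?thesis
        using False p assms face_tp_wrap[of j i n] by (simp add: f_def g_def)
    qed
  qed simp
  also have "\<dots> = arr_sum C ?a ?b (\<lambda>(i, j). g (i, j)) ({..<n} \<times> {..<Suc n})" by simp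
  also have "\<dots> = arr_sum C ?a ?b (\<lambda>m. arr_sum C ?a ?b (\<lambda>k. g (m, k)) {..<Suc n}) {..<n}"
    by (intro sum_Sigma[symmetric]) simp_all
  also have "\<dots> = cyc_norm C D (n - 1) \<cdot> Cb D n"
  proof -
    have "{..n - 1} = {..<n}" using assms by auto
    then show ?thesis
      unfolding Cb_bsum[OF assms] bsum_def norm_eq using assms
      by (subst sum_comp[where c = ?a], simp_all, intro sum_cong)
        (simp_all add: g_def comp_sum[where c = ?b] scale_sum power_add mult.commute)
  qed
  finally show ?thesis .
qed

end

subsection \<open>The mixed complex of a precyclic object\<close>

context base_cat begin

lemma finite_idx [simp]: "finite (Om_idx n)" "finite (BB_idx n)"
proof -
  have "Om_idx n \<subseteq> {..1}" by (auto simp: Om_idx_def)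
  then show "finite (Om_idx n)" by (rule finite_subset) simp
  have "BB_idx n \<subseteq> {..nat n}" by (auto simp: BB_idx_def)
  then show "finite (BB_idx n)" by (rule finite_subset) simp
qed

lemma Om_idx_simps:
  "n < 0 \<Longrightarrow> Om_idx n = {}" "Om_idx 0 = {0}" "0 < n \<Longrightarrow> Om_idx n = {0, 1}"
  by (auto simp: Om_idx_def)

lemma Om_idx_iff: "0 \<in> Om_idx n \<longleftrightarrow> 0 \<le> n" "Suc 0 \<in> Om_idx n \<longleftrightarrow> 0 < n"
  by (auto simp: Om_idx_def)

lemma zero_in_Om: "n < 0 \<Longrightarrow> is_zero_ob C (Ob (Om C D) n)"
  using dsum_empty_zero by (simp add: Om_def Om_idx_simps)

lemma sum_singleton [simp]:
  "Dom C (f i) = a \<Longrightarrow> Cod C (f i) = b \<Longrightarrow> arr_sum C a b f {i} = f i"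
  using sum_insert[of "{}" i f a b] by simp

lemma sum_pair [simp]:
  "i \<noteq> j \<Longrightarrow> Dom C (f i) = a \<Longrightarrow> Cod C (f i) = b \<Longrightarrow> Dom C (f j) = a \<Longrightarrow> Cod C (f j) = b \<Longrightarrow>
     arr_sum C a b f {i, j} = f i \<boxplus> f j"
  using sum_insert[of "{j}" i f a b] by simp

lemma mat_inj_sum:
  assumes "finite I" "finite J"
    and "\<And>i j. i \<in> I \<Longrightarrow> j \<in> J \<Longrightarrow> R i j \<Longrightarrow> Dom C (\<phi> i j) = X i \<and> Cod C (\<phi> i j) = Y j" "i \<in> I"
  shows "mat_arr C I X J Y R \<phi> \<cdot> dsum_inj C I X i =
    arr_sum C (X i) (dsum_ob C J Y) (\<lambda>j. dsum_inj C J Y j \<cdot> \<phi> i j) {j \<in> J. R i j}"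
proof -
  have "mat_arr C I X J Y R \<phi> \<cdot> dsum_inj C I X i =
      Idn C (dsum_ob C J Y) \<cdot> (mat_arr C I X J Y R \<phi> \<cdot> dsum_inj C I X i)"
    using assms by (simp add: mat_Hom)
  also have "\<dots> =
    arr_sum C (X i) (dsum_ob C J Y) (\<lambda>j. (Idn C (dsum_ob C J Y) \<cdot> dsum_inj C J Y j) \<cdot> \<phi> i j) {j \<in> J. R i j}"
    using comp_mat_inj[OF assms(1-3) assms(4) Dom_Idn] by (simp only: Cod_Idn)
  also have "\<dots> = arr_sum C (X i) (dsum_ob C J Y) (\<lambda>j. dsum_inj C J Y j \<cdot> \<phi> i j) {j \<in> J. R i j}"
    using assms by (intro sum_cong) auto
  finally show ?thesis .
qed

definition Om_in :: "('o, 'm) cyc \<Rightarrow> nat \<Rightarrow> nat \<Rightarrow> 'm" where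
  "Om_in D n s = dsum_inj C (Om_idx (int n)) (Om_smd D (int n)) s"

lemma Ob_Om: "Ob (Om C D) n = dsum_ob C (Om_idx n) (Om_smd D n)"
  by (simp add: Om_def)

lemma Om_in_Hom [simp]:
  "Dom C (Om_in D n 0) = CX D n" "Cod C (Om_in D n 0) = Ob (Om C D) (int n)"
  "Dom C (Om_in D (Suc n) (Suc 0)) = CX D n" "Cod C (Om_in D (Suc n) (Suc 0)) = Ob (Om C D) (int (Suc n))"
  by (simp_all add: Om_in_def Om_idx_iff Om_smd_def Om_def)

lemma Om_ext:
  assumes "Dom C f = Ob (Om C D) (int n)" "Dom C g = Ob (Om C D) (int n)" "Cod C f = Cod C g"
    and "f \<cdot> Om_in D n 0 = g \<cdot> Om_in D n 0" "\<And>m. n = Suc m \<Longrightarrow> f \<cdot> Om_in D n (Suc 0) = g \<cdot> Om_in D n (Suc 0)"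
  shows "f = g"
proof (rule dsum_ext_inj[of "Om_idx (int n)" f "Om_smd D (int n)" g])
  fix i assume "i \<in> Om_idx (int n)"
  then have "i = 0 \<or> i = Suc 0 \<and> 0 < n" by (auto simp: Om_idx_def)
  then show "f \<cdot> dsum_inj C (Om_idx (int n)) (Om_smd D (int n)) i = g \<cdot> dsum_inj C (Om_idx (int n)) (Om_smd D (int n)) i"
    using assms(4,5) unfolding Om_in_def by (cases n) auto
qed (use assms in \<open>simp_all add: Om_def\<close>)

lemma zero_ob_comp:
  assumes "is_zero_ob C z" "Cod C f = z" "Dom C g = z"
  shows "g \<cdot> f = Zero C (Dom C f) (Cod C g)"
proof -
  have "f = Zero C (Dom C f) z" by (rule zero_ob_Zero[OF assms(1)]) (use assms in auto)
  then have "g \<cdot> f = g \<cdot> Zero C (Dom C f) z" by (rule arg_cong)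
  then show ?thesis using assms by simp
qed

end

context precyclic begin

definition Om_entry :: "nat \<Rightarrow> nat \<Rightarrow> nat \<Rightarrow> 'm" where
  "Om_entry m s s' = (if s = 0 then Cb D (Suc m) else if s' = 0 then \<omega> m else scale C (- 1) (Cb' D m))"

lemma Om_Bd_mat:
  "Bd (Om C D) (int (Suc m)) = mat_arr C (Om_idx (int (Suc m))) (Om_smd D (int (Suc m)))
     (Om_idx (int m)) (Om_smd D (int m)) (\<lambda>s s'. s' \<le> s) (Om_entry m)"
proof -
  have "nat (1 + int m) = Suc m" by simp
  then show ?thesis
    by (simp add: Om_def Om_entry_def[abs_def] \<omega>_def cong: if_cong)
qed

lemma Om_entry_Hom:
  assumes "s \<in> Om_idx (int (Suc m))" "s' \<in> Om_idx (int m)" "s' \<le> s"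
  shows "Dom C (Om_entry m s s') = Om_smd D (int (Suc m)) s \<and> Cod C (Om_entry m s s') = Om_smd D (int m) s'"
proof -
  have "s = 0 \<and> s' = 0 \<or> s = 1 \<and> s' = 0 \<or> s = 1 \<and> s' = 1 \<and> 0 < m"
    using assms by (auto simp: Om_idx_def)
  moreover have "nat (int m - 1) = m - 1" "nat (1 + int m) = Suc m" by simp_all
  ultimately show ?thesis
    by (auto simp: Om_entry_def Om_smd_def)
qed

lemma Om_Bd_Hom [simp]:
  "Dom C (Bd (Om C D) n) = Ob (Om C D) n" "Cod C (Bd (Om C D) n) = Ob (Om C D) (n - 1)"
proof -
  have "Dom C (Bd (Om C D) n) = Ob (Om C D) n \<and> Cod C (Bd (Om C D) n) = Ob (Om C D) (n - 1)"
  proof (cases "0 < n")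
    case True
    then obtain m where "n = int (Suc m)" by (metis pos_int_cases gr0_conv_Suc)
    then show ?thesis
      by (simp only: Om_Bd_mat mat_Hom[OF finite_idx(1) finite_idx(1) Om_entry_Hom]) (simp add: Om_def)
  next
    case False
    then have "Om_idx (n - 1) = {}" by (simp add: Om_idx_simps)
    then show ?thesis
      unfolding Om_def by (simp, intro conjI mat_Hom) auto
  qed
  then show "Dom C (Bd (Om C D) n) = Ob (Om C D) n" "Cod C (Bd (Om C D) n) = Ob (Om C D) (n - 1)"
    by simp_all
qed

lemma Om_Bd_in:
  assumes "s \<in> Om_idx (int (Suc m))"
  shows "Bd (Om C D) (int (Suc m)) \<cdot> Om_in D (Suc m) s =
    arr_sum C (Om_smd D (int (Suc m)) s) (Ob (Om C D) (int m)) (\<lambda>s'. Om_in D m s' \<cdot> Om_entry m s s')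
      {s' \<in> Om_idx (int m). s' \<le> s}"
  unfolding Om_Bd_mat Om_in_def Ob_Om
  using assms by (intro mat_inj_sum Om_entry_Hom) simp_all

lemma Om_Bop_Hom [simp]:
  "Dom C (Bop (Om C D) n) = Ob (Om C D) n" "Cod C (Bop (Om C D) n) = Ob (Om C D) (n + 1)"
  unfolding Om_def by (simp_all, (rule mat_Hom; auto simp: Om_idx_def Om_smd_def)+)

lemma Om_Bd_0: "Bd (Om C D) (int (Suc n)) \<cdot> Om_in D (Suc n) 0 = Om_in D n 0 \<cdot> Cb D (Suc n)"
proof -
  have "{s' \<in> Om_idx (int n). s' \<le> 0} = {0}" by (auto simp: Om_idx_def)
  moreover have "nat (1 + int n) = Suc n" by simp
  ultimately show ?thesis
    using Om_Bd_in[of 0 n] by (simp add: Om_idx_iff Om_smd_def Om_entry_def)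
qed

lemma Om_Bd_1:
  "Bd (Om C D) (int (Suc (Suc n))) \<cdot> Om_in D (Suc (Suc n)) (Suc 0) =
     Om_in D (Suc n) 0 \<cdot> \<omega> (Suc n) \<boxplus> Om_in D (Suc n) (Suc 0) \<cdot> scale C (- 1) (Cb' D (Suc n))"
proof -
  have "{s' \<in> Om_idx (int (Suc n)). s' \<le> Suc 0} = {0, Suc 0}" by (auto simp: Om_idx_def)
  moreover have "nat (1 + int n) = Suc n" by simp
  ultimately show ?thesis
    using Om_Bd_in[of "Suc 0" "Suc n"] by (simp add: Om_idx_iff Om_smd_def Om_entry_def)
qed

lemma \<omega>_0: "\<omega> 0 = Zero C (CX D 0) (CX D 0)"
  using scale_minus_Plus[of "Idn C (CX D 0)"] by (simp add: \<omega>_def t_0)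

text \<open>The formula reads b(1 \<otimes> a) = a - a, since the rotation in degree 0 is the
  identity.\<close>

lemma Om_Bd_1': "Bd (Om C D) 1 \<cdot> Om_in D (Suc 0) (Suc 0) = Zero C (CX D 0) (Ob (Om C D) 0)"
proof -
  have "{s' \<in> Om_idx 0. s' \<le> Suc 0} = {0}" by (auto simp: Om_idx_def)
  then show ?thesis
    using Om_Bd_in[of "Suc 0" 0] Om_in_Hom(2)[of D 0] by (simp add: Om_idx_iff Om_smd_def Om_entry_def \<omega>_0)
qed

lemma Om_Bop_in:
  assumes "s \<in> Om_idx (int m)"
  shows "Bop (Om C D) (int m) \<cdot> Om_in D m s =
    arr_sum C (Om_smd D (int m) s) (Ob (Om C D) (int (Suc m))) (\<lambda>s'. Om_in D (Suc m) s' \<cdot> cyc_norm C D m)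
      {s' \<in> Om_idx (int (Suc m)). s = 0 \<and> s' = 1}"
proof -
  have "Bop (Om C D) (int m) = mat_arr C (Om_idx (int m)) (Om_smd D (int m))
     (Om_idx (int (Suc m))) (Om_smd D (int (Suc m))) (\<lambda>s s'. s = 0 \<and> s' = 1) (\<lambda>s s'. cyc_norm C D m)"
    by (simp add: Om_def add.commute)
  then show ?thesis
    unfolding Om_in_def Ob_Om using assms by (simp only:) (rule mat_inj_sum, auto simp: Om_smd_def)
qed

lemma Om_Bop_0: "Bop (Om C D) (int n) \<cdot> Om_in D n 0 = Om_in D (Suc n) (Suc 0) \<cdot> cyc_norm C D n"
proof -
  have "{s' \<in> Om_idx (int (Suc n)). (0 :: nat) = 0 \<and> s' = 1} = {Suc 0}" by (auto simp: Om_idx_def)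
  then show ?thesis
    using Om_Bop_in[of 0 n] by (simp add: Om_idx_iff Om_smd_def)
qed

lemma Om_Bop_1:
  "Bop (Om C D) (int (Suc n)) \<cdot> Om_in D (Suc n) (Suc 0) = Zero C (CX D n) (Ob (Om C D) (int (Suc (Suc n))))"
  using Om_Bop_in[of "Suc 0" "Suc n"] by (simp add: Om_idx_iff Om_smd_def)

text \<open>On summand 0 this is b b = 0; on summand 1 the two components are b \<omega> - \<omega>
  b' and b' b'.\<close>

lemma Om_Bd_Bd: "Bd (Om C D) (n - 1) \<cdot> Bd (Om C D) n = Zero C (Ob (Om C D) n) (Ob (Om C D) (n - 2))"
proof (cases "n < 2")
  case True
  then show ?thesis
    using zero_in_Om[of "n - 2" D] by (intro zero_ob_Zero) auto
next
  case False
  define m where "m = nat (n - 2)"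
  have n: "n = int (Suc (Suc m))" using False by (simp add: m_def)
  have n1: "n - 1 = int (Suc m)" "n - 2 = int m" using n by simp_all
  show ?thesis
    unfolding n1 unfolding n
  proof (rule Om_ext[where D = D and n = "Suc (Suc m)"])
    show "(Bd (Om C D) (int (Suc m)) \<cdot> Bd (Om C D) (int (Suc (Suc m)))) \<cdot> Om_in D (Suc (Suc m)) 0 =
        Zero C (Ob (Om C D) (int (Suc (Suc m)))) (Ob (Om C D) (int m)) \<cdot> Om_in D (Suc (Suc m)) 0"
    proof -
      have "Bd (Om C D) (int (Suc m)) \<cdot> (Bd (Om C D) (int (Suc (Suc m))) \<cdot> Om_in D (Suc (Suc m)) 0) =
          (Bd (Om C D) (int (Suc m)) \<cdot> Om_in D (Suc m) 0) \<cdot> Cb D (Suc (Suc m))"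
        unfolding Om_Bd_0[of "Suc m"] by simp
      also have "\<dots> = Zero C (CX D (Suc (Suc m))) (Ob (Om C D) (int m))"
        unfolding Om_Bd_0 using Cb_Cb[of "Suc (Suc m)"] by simp
      finally show ?thesis by simp
    qed
  next
    have "Bd (Om C D) (int (Suc m)) \<cdot> (Bd (Om C D) (int (Suc (Suc m))) \<cdot> Om_in D (Suc (Suc m)) (Suc 0)) =
        (Bd (Om C D) (int (Suc m)) \<cdot> Om_in D (Suc m) 0) \<cdot> \<omega> (Suc m) \<boxplus>
        (Bd (Om C D) (int (Suc m)) \<cdot> Om_in D (Suc m) (Suc 0)) \<cdot> scale C (- 1) (Cb' D (Suc m))"
      unfolding Om_Bd_1 by simp
    also have "\<dots> = Zero C (CX D (Suc m)) (Ob (Om C D) (int m))"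
    proof (cases m)
      case 0
      then show ?thesis
        using Om_Bd_1' Om_Bd_0[of 0] Cb_\<omega>[of "Suc 0"] \<omega>_0 by simp
    next
      case (Suc k)
      have "Om_in D m 0 \<cdot> Cb D (Suc m) \<cdot> \<omega> (Suc m) = Om_in D m 0 \<cdot> \<omega> m \<cdot> Cb' D (Suc m)"
        using Cb_\<omega>[of "Suc m"] by simp
      moreover have "Cb' D (Suc k) \<cdot> Cb' D (Suc (Suc k)) = Zero C (CX D (Suc (Suc k))) (CX D k)"
        using Cb'_Cb'[of "Suc (Suc k)"] by simp
      ultimately show ?thesis
        unfolding Suc Om_Bd_0 Om_Bd_1 by simp
    qed
    finally show "(Bd (Om C D) (int (Suc m)) \<cdot> Bd (Om C D) (int (Suc (Suc m)))) \<cdot> Om_in D (Suc (Suc m)) (Suc 0) =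
        Zero C (Ob (Om C D) (int (Suc (Suc m)))) (Ob (Om C D) (int m)) \<cdot> Om_in D (Suc (Suc m)) (Suc 0)"
      by simp
  qed simp_all
qed

lemma Om_chain_complex: "chain_complex C (Om C D)"
  by (simp add: chain_complex_def Om_Bd_Bd)

lemma Om_Bop_Bop: "Bop (Om C D) (n + 1) \<cdot> Bop (Om C D) n = Zero C (Ob (Om C D) n) (Ob (Om C D) (n + 2))"
proof (cases "n < 0")
  case True
  then show ?thesis
    using zero_in_Om[of n D] by (intro zero_ob_Zero) (auto simp: add.commute)
next
  case False
  then obtain m where n: "n = int m" by (metis nonneg_int_cases not_less)
  have n1: "int m + 1 = int (Suc m)" by simp
  show ?thesis
    unfolding n n1
  proof (rule Om_ext[where D = D and n = m])
    have "Bop (Om C D) (int (Suc m)) \<cdot> (Bop (Om C D) (int m) \<cdot> Om_in D m 0) =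
        (Bop (Om C D) (int (Suc m)) \<cdot> Om_in D (Suc m) (Suc 0)) \<cdot> cyc_norm C D m"
      unfolding Om_Bop_0 by (simp add: add.commute)
    also have "\<dots> = Zero C (CX D m) (Ob (Om C D) (int m + 2))"
      unfolding Om_Bop_1 by (simp add: add.commute)
    finally show "(Bop (Om C D) (int (Suc m)) \<cdot> Bop (Om C D) (int m)) \<cdot> Om_in D m 0 =
        Zero C (Ob (Om C D) (int m)) (Ob (Om C D) (int m + 2)) \<cdot> Om_in D m 0" by (simp add: add.commute)
  next
    fix k assume m: "m = Suc k"
    have "Bop (Om C D) (int (Suc m)) \<cdot> (Bop (Om C D) (int (Suc k)) \<cdot> Om_in D (Suc k) (Suc 0)) =
        Zero C (CX D k) (Ob (Om C D) (int m + 2))"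
      unfolding Om_Bop_1 m by (simp add: add.commute)
    then show "(Bop (Om C D) (int (Suc m)) \<cdot> Bop (Om C D) (int m)) \<cdot> Om_in D m (Suc 0) =
        Zero C (Ob (Om C D) (int m)) (Ob (Om C D) (int m + 2)) \<cdot> Om_in D m (Suc 0)"
      by (simp add: m add.commute)
  qed (simp_all add: add.commute)
qed

text \<open>With the norm N, the components on summand 0 are \<omega> N and N b - b' N, and on
  summand 1 the remaining one is N \<omega>.\<close>

lemma Om_Bd_Bop:
  "Bd (Om C D) (n + 1) \<cdot> Bop (Om C D) n \<boxplus> Bop (Om C D) (n - 1) \<cdot> Bd (Om C D) n = Zero C (Ob (Om C D) n) (Ob (Om C D) n)"
proof -
  let ?O = "Ob (Om C D)"
  consider "n < 0" | "n = 0" | m where "n = int (Suc m)"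
    by (metis linorder_neqE_linordered_idom pos_int_cases gr0_conv_Suc)
  then show ?thesis
  proof cases
    case 1
    then show ?thesis
      using zero_in_Om[of n D] by (intro zero_ob_Zero) auto
  next
    case 2
    have "Bop (Om C D) (- 1) \<cdot> Bd (Om C D) 0 = Zero C (?O 0) (?O 0)"
      using zero_ob_comp[of "?O (- 1)" "Bd (Om C D) 0" "Bop (Om C D) (- 1)"] zero_in_Om[of "- 1" D] by simp
    moreover have "Bd (Om C D) 1 \<cdot> Bop (Om C D) 0 = Zero C (?O 0) (?O 0)"
    proof (rule Om_ext[where D = D and n = 0])
      have "(Bd (Om C D) 1 \<cdot> Om_in D (Suc 0) (Suc 0)) \<cdot> cyc_norm C D 0 = Zero C (CX D 0) (?O 0)"
        unfolding Om_Bd_1' by simp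
      then show "(Bd (Om C D) 1 \<cdot> Bop (Om C D) 0) \<cdot> Om_in D 0 0 = Zero C (?O 0) (?O 0) \<cdot> Om_in D 0 0"
        using Om_Bop_0[of 0] by simp
    qed simp_all
    ultimately show ?thesis using 2 by simp
  next
    case (3 m)
    have n: "n = int (Suc m)" "n - 1 = int m" "n + 1 = int (Suc (Suc m))" using 3 by simp_all
    show ?thesis
      unfolding n(2,3) unfolding n(1)
    proof (rule Om_ext[where D = D and n = "Suc m"])
      have "(Bd (Om C D) (int (Suc (Suc m))) \<cdot> (Bop (Om C D) (int (Suc m)) \<cdot> Om_in D (Suc m) 0)) \<boxplus>
          (Bop (Om C D) (int m) \<cdot> (Bd (Om C D) (int (Suc m)) \<cdot> Om_in D (Suc m) 0)) =
          ((Bd (Om C D) (int (Suc (Suc m))) \<cdot> Om_in D (Suc (Suc m)) (Suc 0)) \<cdot> cyc_norm C D (Suc m)) \<boxplus>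
          ((Bop (Om C D) (int m) \<cdot> Om_in D m 0) \<cdot> Cb D (Suc m))"
        unfolding Om_Bop_0[of "Suc m"] Om_Bd_0[of m] by simp
      also have "\<dots> = Zero C (CX D (Suc m)) (?O (int (Suc m)))"
        unfolding Om_Bop_0 Om_Bd_1 using Cb'_norm[of "Suc m"] \<omega>_norm[of "Suc m"] by (simp add: Plus_commute)
      finally show "(Bd (Om C D) (int (Suc (Suc m))) \<cdot> Bop (Om C D) (int (Suc m)) \<boxplus>
            Bop (Om C D) (int m) \<cdot> Bd (Om C D) (int (Suc m))) \<cdot> Om_in D (Suc m) 0 =
          Zero C (?O (int (Suc m))) (?O (int (Suc m))) \<cdot> Om_in D (Suc m) 0"
        by (simp add: add.commute)
    next
      have "Bd (Om C D) (int (Suc (Suc m))) \<cdot> (Bop (Om C D) (int (Suc m)) \<cdot> Om_in D (Suc m) (Suc 0)) =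
          Zero C (CX D m) (?O (int (Suc m)))"
        unfolding Om_Bop_1 by (simp add: add.commute)
      moreover have "Bop (Om C D) (int m) \<cdot> (Bd (Om C D) (int (Suc m)) \<cdot> Om_in D (Suc m) (Suc 0)) =
          Zero C (CX D m) (?O (int (Suc m)))"
      proof (cases m)
        case 0
        then show ?thesis using Om_Bd_1' by simp
      next
        case (Suc k)
        have "Bop (Om C D) (int (Suc k)) \<cdot> (Bd (Om C D) (int (Suc (Suc k))) \<cdot> Om_in D (Suc (Suc k)) (Suc 0)) =
            ((Bop (Om C D) (int (Suc k)) \<cdot> Om_in D (Suc k) 0) \<cdot> \<omega> (Suc k)) \<boxplus>
            ((Bop (Om C D) (int (Suc k)) \<cdot> Om_in D (Suc k) (Suc 0)) \<cdot> scale C (- 1) (Cb' D (Suc k)))"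
          unfolding Om_Bd_1 by simp
        also have "\<dots> = Zero C (CX D (Suc k)) (?O (int (Suc (Suc k))))"
          unfolding Om_Bop_0 Om_Bop_1 using norm_\<omega>[of "Suc k"] by (simp add: add.commute)
        finally show ?thesis using Suc by simp
      qed
      ultimately show "(Bd (Om C D) (int (Suc (Suc m))) \<cdot> Bop (Om C D) (int (Suc m)) \<boxplus>
            Bop (Om C D) (int m) \<cdot> Bd (Om C D) (int (Suc m))) \<cdot> Om_in D (Suc m) (Suc 0) =
          Zero C (?O (int (Suc m))) (?O (int (Suc m))) \<cdot> Om_in D (Suc m) (Suc 0)"
        by (simp add: add.commute)
    qed (simp_all add: add.commute)
  qed
qed

lemma mixed_complex_Om: "mixed_complex C (Om C D)"
  by (simp add: mixed_complex_def Om_chain_complex Om_Bop_Bop Om_Bd_Bop)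

end

section \<open>Complexes concentrated in non-negative degrees\<close>

context base_cat begin

lemma Ob_nonneg: "Ob (nonneg_chain C X \<delta>) n = (if n < 0 then zero_ob C else X (nat n))"
  and Bd_nonneg: "Bd (nonneg_chain C X \<delta>) n = (if n \<le> 0
    then Zero C (Ob (nonneg_chain C X \<delta>) n) (Ob (nonneg_chain C X \<delta>) (n - 1)) else \<delta> (nat n))"
  by (simp_all add: nonneg_chain_def Let_def)

lemma nat_minus_1: "nat (n - 1) = nat n - 1"
  by linarith

lemma chain_complex_nonneg:
  assumes "\<And>n. 0 < n \<Longrightarrow> Dom C (\<delta> n) = X n \<and> Cod C (\<delta> n) = X (n - 1)"
    and "\<And>n. 2 \<le> n \<Longrightarrow> \<delta> (n - 1) \<cdot> \<delta> n = Zero C (X n) (X (n - 2))"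
  shows "chain_complex C (nonneg_chain C X \<delta>)"
  unfolding chain_complex_def
proof (intro allI conjI)
  fix n
  let ?N = "nonneg_chain C X \<delta>"
  show "Bd ?N n \<in> Hom C (Ob ?N n) (Ob ?N (n - 1))"
    using assms(1)[of "nat n"] by (simp add: Ob_nonneg Bd_nonneg nat_minus_1)
  show "Bd ?N (n - 1) \<cdot> Bd ?N n = Zero C (Ob ?N n) (Ob ?N (n - 2))"
  proof (cases "n \<le> 1")
    case True
    then show ?thesis using assms(1)[of "nat n"]
      by (cases "n = 1") (auto simp: Ob_nonneg Bd_nonneg)
  next
    case False
    then have "nat (n - 2) = nat n - 2" "2 \<le> nat n" by linarith+
    then show ?thesis
      using False assms(2)[of "nat n"] by (simp add: Ob_nonneg Bd_nonneg nat_minus_1)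
  qed
qed

lemma chain_map_nonneg:
  assumes "chain_complex C (nonneg_chain C X \<delta>)" "chain_complex C (nonneg_chain C X' \<delta>')"
    and "\<And>n. Dom C (g n) = X n \<and> Cod C (g n) = X' n"
    and "\<And>n. 0 < n \<Longrightarrow> \<delta>' n \<cdot> g n = g (n - 1) \<cdot> \<delta> n"
  shows "chain_map C (nonneg_chain C X \<delta>) (nonneg_chain C X' \<delta>') (nonneg_map C g)"
  unfolding chain_map_def
proof (intro allI conjI assms(1,2))
  fix n
  show *: "nonneg_map C g n \<in> Hom C (Ob (nonneg_chain C X \<delta>) n) (Ob (nonneg_chain C X' \<delta>') n)" for n
    using assms(3) by (simp add: Ob_nonneg nonneg_map_def)
  show "Bd (nonneg_chain C X' \<delta>') n \<cdot> nonneg_map C g n = nonneg_map C g (n - 1) \<cdot> Bd (nonneg_chain C X \<delta>) n"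
  proof (cases "n \<le> 0")
    case True
    then show ?thesis using *[of n] *[of "n - 1"] by (simp add: Bd_nonneg)
  next
    case False
    then show ?thesis using assms(4)[of "nat n"] by (simp add: Bd_nonneg nonneg_map_def nat_minus_1)
  qed
qed

subsection \<open>The S-complex of a mixed complex\<close>

definition BB_in :: "('o, 'm, 'z) mixed_scheme \<Rightarrow> int \<Rightarrow> nat \<Rightarrow> 'm" where
  "BB_in M n p = dsum_inj C (BB_idx n) (BB_smd M n) p"

lemma Ob_BB: "Ob (BB C M) n = dsum_ob C (BB_idx n) (BB_smd M n)"
  by (simp add: BB_def)

lemma BB_in_Hom [simp]:
  assumes "p \<in> BB_idx n"
  shows "Dom C (BB_in M n p) = Ob M (n - 2 * int p)" "Cod C (BB_in M n p) = Ob (BB C M) n"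
  using assms by (simp_all add: BB_in_def BB_smd_def Ob_BB)

lemma BB_ext:
  assumes "Dom C f = Ob (BB C M) n" "Dom C g = Ob (BB C M) n" "Cod C f = Cod C g"
    and "\<And>p. p \<in> BB_idx n \<Longrightarrow> f \<cdot> BB_in M n p = g \<cdot> BB_in M n p"
  shows "f = g"
  using assms unfolding Ob_BB BB_in_def by (intro dsum_ext_inj[of "BB_idx n" f "BB_smd M n" g]) simp_all

lemma zero_in_BB: "n < 0 \<Longrightarrow> is_zero_ob C (Ob (BB C M) n)"
proof -
  assume "n < 0"
  then have "BB_idx n = {}" by (auto simp: BB_idx_def)
  then show ?thesis using dsum_empty_zero by (simp add: Ob_BB)
qed

lemma BB_idx_iff: "p \<in> BB_idx n \<longleftrightarrow> 2 * int p \<le> n"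
  by (simp add: BB_idx_def)

end

text \<open>\<open>BB\<close> omits the summands of negative degree. By \<open>neg\<close> these are
  zero, so the omitted terms of the boundary vanish and the truncated formula still squares to
  zero.\<close>

locale mixed = base_cat C for C :: "('o, 'm) tensor_cat" (structure) +
  fixes M :: "('o, 'm, 'z) mixed_scheme"
  assumes mixed: "mixed_complex C M" and neg: "n < 0 \<Longrightarrow> is_zero_ob C (Ob M n)"
begin

lemma complex: "chain_complex C M"
  using mixed by (simp add: mixed_complex_def)

lemmas M_Bd [simp] = chain_complexD[OF complex]

lemma M_Bop [simp]: "Dom C (Bop M n) = Ob M n" "Cod C (Bop M n) = Ob M (n + 1)"
  and M_Bop_Bop: "Bop M (n + 1) \<cdot> Bop M n = Zero C (Ob M n) (Ob M (n + 2))"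
  and M_Bd_Bop: "Bd M (n + 1) \<cdot> Bop M n \<boxplus> Bop M (n - 1) \<cdot> Bd M n = Zero C (Ob M n) (Ob M n)"
  using mixed by (simp_all add: mixed_complex_def)

definition BB_entry :: "int \<Rightarrow> nat \<Rightarrow> nat \<Rightarrow> 'm" where
  "BB_entry n p q = (if p = q then Bd M (n - 2 * int p) else Bop M (n - 2 * int p))"

lemma Bd_BB: "Bd (BB C M) n = mat_arr C (BB_idx n) (BB_smd M n) (BB_idx (n - 1)) (BB_smd M (n - 1))
    (\<lambda>p q. p = q \<or> p = Suc q) (BB_entry n)"
  by (simp add: BB_def BB_entry_def[abs_def])

lemma BB_entry_Hom:
  "p = q \<or> p = Suc q \<Longrightarrow> Dom C (BB_entry n p q) = BB_smd M n p \<and> Cod C (BB_entry n p q) = BB_smd M (n - 1) q"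
  by (auto simp: BB_entry_def BB_smd_def algebra_simps)

lemma Bd_BB_Hom [simp]:
  "Dom C (Bd (BB C M) n) = Ob (BB C M) n" "Cod C (Bd (BB C M) n) = Ob (BB C M) (n - 1)"
  unfolding Bd_BB Ob_BB by (rule mat_Hom; use BB_entry_Hom in simp)+

lemma Sop_BB_Hom [simp]:
  "Dom C (Sop (BB C M) n) = Ob (BB C M) n" "Cod C (Sop (BB C M) n) = Ob (BB C M) (n - 2)"
  unfolding BB_def by (simp_all, (rule mat_Hom; auto simp: BB_smd_def algebra_simps)+)

text \<open>The degrees \<open>n'\<close> and \<open>m\<close> are variables tied down by equations,
  so that the formula can be used without rewriting differences of integers in the objects.\<close>

lemma Bd_BB_in:
  assumes "p \<in> BB_idx n" "n' = n - 1" "m = n - 2 * int p"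
  shows "Bd (BB C M) n \<cdot> BB_in M n p =
    (if p \<in> BB_idx n' then BB_in M n' p \<cdot> Bd M m else Zero C (Ob M m) (Ob (BB C M) n')) \<boxplus>
    (if 0 < p then BB_in M n' (p - 1) \<cdot> Bop M m else Zero C (Ob M m) (Ob (BB C M) n'))"
proof -
  define q where "q = p - 1"
  let ?f = "\<lambda>q. BB_in M n' q \<cdot> BB_entry n p q"
  have sum: "Bd (BB C M) n \<cdot> BB_in M n p =
      arr_sum C (Ob M m) (Ob (BB C M) n') ?f {q \<in> BB_idx n'. p = q \<or> p = Suc q}"
    using mat_inj_sum[where I = "BB_idx n" and J = "BB_idx n'" and X = "BB_smd M n" and
        Y = "BB_smd M n'" and R = "\<lambda>p q. p = q \<or> p = Suc q" and \<phi> = "BB_entry n" and i = p,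
        OF _ _ BB_entry_Hom[of _ _ n, folded assms(2)]] assms(1)
    by (simp add: Bd_BB BB_in_def Ob_BB BB_smd_def[of M n p] assms(2,3))
  have q: "q \<in> BB_idx n'" "n' - 2 * int q = m + 1" "p \<noteq> q" if "0 < p"
    using that assms by (auto simp: BB_idx_iff q_def)
  have p: "n' - 2 * int p = m - 1" using assms by simp
  have fp: "?f p = BB_in M n' p \<cdot> Bd M m" and fq: "0 < p \<Longrightarrow> ?f q = BB_in M n' q \<cdot> Bop M m"
    using q(3) by (simp_all add: BB_entry_def assms(3))
  have "{q \<in> BB_idx n'. p = q \<or> p = Suc q} =
      (if p \<in> BB_idx n' then {p} else {}) \<union> (if 0 < p then {q} else {})"
    using assms by (auto simp: BB_idx_iff q_def)
  then consider "p \<in> BB_idx n'" "0 < p" "{q \<in> BB_idx n'. p = q \<or> p = Suc q} = {p, q}"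
    | "p \<in> BB_idx n'" "p = 0" "{q \<in> BB_idx n'. p = q \<or> p = Suc q} = {p}"
    | "p \<notin> BB_idx n'" "0 < p" "{q \<in> BB_idx n'. p = q \<or> p = Suc q} = {q}"
    | "p \<notin> BB_idx n'" "p = 0" "{q \<in> BB_idx n'. p = q \<or> p = Suc q} = {}"
    by (cases "p = 0"; cases "p \<in> BB_idx n'") auto
  then show ?thesis
  proof cases
    case 1
    have "arr_sum C (Ob M m) (Ob (BB C M) n') ?f {p, q} = ?f p \<boxplus> ?f q"
      using q[OF 1(2)] p 1(1) fq[OF 1(2)] fp by (intro sum_pair) simp_all
    then show ?thesis
      unfolding sum 1(3) fp fq[OF 1(2)] using 1 by (simp add: q_def)
  next
    case 2
    have "arr_sum C (Ob M m) (Ob (BB C M) n') ?f {p} = ?f p"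
      using p 2(1) fp by (intro sum_singleton) simp_all
    then show ?thesis
      unfolding sum 2(3) fp using 2 p by simp
  next
    case 3
    have "arr_sum C (Ob M m) (Ob (BB C M) n') ?f {q} = ?f q"
      using q[OF 3(2)] 3(1) fq[OF 3(2)] by (intro sum_singleton) simp_all
    then show ?thesis
      unfolding sum 3(3) fq[OF 3(2)] q_def[symmetric] using 3(1,2) q[OF 3(2)] by simp
  next
    case 4
    then show ?thesis unfolding sum 4(3) by simp
  qed
qed

lemma Sop_BB_in:
  assumes "p \<in> BB_idx n" "n' = n - 2" "m = n - 2 * int p"
  shows "Sop (BB C M) n \<cdot> BB_in M n p =
    (if 0 < p then BB_in M n' (p - 1) else Zero C (Ob M m) (Ob (BB C M) n'))"
proof -
  define q where "q = p - 1"
  have q: "q \<in> BB_idx n'" "n' - 2 * int q = m" if "0 < p"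
    using that assms by (auto simp: BB_idx_iff q_def)
  have "Sop (BB C M) n = mat_arr C (BB_idx n) (BB_smd M n) (BB_idx n') (BB_smd M n') (\<lambda>p q. p = Suc q)
      (\<lambda>p q. Idn C (BB_smd M n p))"
    by (simp add: BB_def BB_smd_def[of M n] assms(2))
  moreover have "BB_smd M n (Suc j) = BB_smd M n' j" for j
    by (simp add: BB_smd_def assms(2) algebra_simps)
  ultimately have "Sop (BB C M) n \<cdot> BB_in M n p = arr_sum C (BB_smd M n p) (Ob (BB C M) n')
     (\<lambda>q. BB_in M n' q \<cdot> Idn C (BB_smd M n p)) {q \<in> BB_idx n'. p = Suc q}"
    unfolding BB_in_def Ob_BB using assms(1) by (simp only:) (rule mat_inj_sum, auto)
  moreover have "BB_smd M n p = Ob M m" by (simp add: BB_smd_def assms(3))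
  moreover have "{q \<in> BB_idx n'. p = Suc q} = (if 0 < p then {q} else {})"
    using assms by (auto simp: BB_idx_iff q_def)
  ultimately show ?thesis
    using q by (auto simp: q_def)
qed

text \<open>Summand \<open>p\<close> reaches \<open>p\<close>, \<open>p - 1\<close> and
  \<open>p - 2\<close>, through b b, b B + B b and B B respectively.\<close>

lemma Bd_Bd_BB: "Bd (BB C M) (n - 1) \<cdot> Bd (BB C M) n = Zero C (Ob (BB C M) n) (Ob (BB C M) (n - 2))"
proof (rule BB_ext[where M = M and n = n])
  fix p assume p: "p \<in> BB_idx n"
  define m n1 n2 q r where defs: "m = n - 2 * int p" "n1 = n - 1" "n2 = n - 2" "q = p - 1" "r = q - 1"
  have n2: "n2 = n1 - 1" by (simp add: defs)
  let ?B = "Bd (BB C M)" and ?z = "Zero C (Ob M m) (Ob (BB C M) n2)"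
  have m: "n1 - 2 * int p = m - 1" "n2 - 2 * int p = m - 2" by (simp_all add: defs)
  have mq: "n1 - 2 * int q = m + 1" "n2 - 2 * int q = m" "q \<in> BB_idx n1" "q \<in> BB_idx n2" if "0 < p"
    using that p by (simp_all add: BB_idx_iff defs)
  have mr: "n2 - 2 * int r = m + 2" "r \<in> BB_idx n2" if "0 < q"
    using that p by (simp_all add: BB_idx_iff defs)
  have d: "n - 1 = n1" "n1 - 1 = n2" "n - 2 = n2" by (simp_all add: defs)
  have B0: "?B n \<cdot> BB_in M n p =
      (if p \<in> BB_idx n1 then BB_in M n1 p \<cdot> Bd M m else Zero C (Ob M m) (Ob (BB C M) n1)) \<boxplus>
      (if 0 < p then BB_in M n1 q \<cdot> Bop M m else Zero C (Ob M m) (Ob (BB C M) n1))"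
    unfolding defs(4) using p by (intro Bd_BB_in) (simp_all add: defs)
  have B1: "?B n1 \<cdot> BB_in M n1 p =
      (if p \<in> BB_idx n2 then BB_in M n2 p \<cdot> Bd M (m - 1) else Zero C (Ob M (m - 1)) (Ob (BB C M) n2)) \<boxplus>
      (if 0 < p then BB_in M n2 q \<cdot> Bop M (m - 1) else Zero C (Ob M (m - 1)) (Ob (BB C M) n2))" if "p \<in> BB_idx n1"
    unfolding defs(4) using that by (intro Bd_BB_in) (simp_all add: defs)
  have B2: "?B n1 \<cdot> BB_in M n1 q =
      (if q \<in> BB_idx n2 then BB_in M n2 q \<cdot> Bd M (m + 1) else Zero C (Ob M (m + 1)) (Ob (BB C M) n2)) \<boxplus>
      (if 0 < q then BB_in M n2 r \<cdot> Bop M (m + 1) else Zero C (Ob M (m + 1)) (Ob (BB C M) n2))" if "0 < p"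
    unfolding defs(5) using mq[OF that] n2 by (intro Bd_BB_in) simp_all
  have tp: "p \<in> BB_idx n1 \<Longrightarrow> Dom C (BB_in M n1 p) = Ob M (m - 1)"
    "p \<in> BB_idx n2 \<Longrightarrow> Dom C (BB_in M n2 p) = Ob M (m - 2)"
    using m by simp_all
  have tq: "Dom C (BB_in M n1 q) = Ob M (m + 1)" "Dom C (BB_in M n2 q) = Ob M m"
    "q \<in> BB_idx n1" "q \<in> BB_idx n2" if "0 < p"
    using mq[OF that] by simp_all
  have tr: "Dom C (BB_in M n2 r) = Ob M (m + 2)" "r \<in> BB_idx n2" if "0 < q"
    using mr[OF that] by simp_all
  note d [simp]
  have A: "?B n1 \<cdot> (BB_in M n1 p \<cdot> Bd M m) =
      (if 0 < p then BB_in M n2 q \<cdot> (Bop M (m - 1) \<cdot> Bd M m) else ?z)"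
    if p1: "p \<in> BB_idx n1"
  proof -
    have "?B n1 \<cdot> (BB_in M n1 p \<cdot> Bd M m) = (?B n1 \<cdot> BB_in M n1 p) \<cdot> Bd M m"
      using p1 by (simp add: m)
    also have "\<dots> = (if 0 < p then BB_in M n2 q \<cdot> (Bop M (m - 1) \<cdot> Bd M m) else ?z)"
    proof (cases "0 < p")
      case True
      show ?thesis
        unfolding B1[OF p1] using tq[OF True] tp True by (cases "p \<in> BB_idx n2") simp_all
    next
      case False
      then show ?thesis
        unfolding B1[OF p1] using tp by (cases "p \<in> BB_idx n2") simp_all
    qed
    finally show ?thesis .
  qed
  have B: "?B n1 \<cdot> (BB_in M n1 q \<cdot> Bop M m) = BB_in M n2 q \<cdot> (Bd M (m + 1) \<cdot> Bop M m)" if p0: "0 < p"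
  proof -
    have "?B n1 \<cdot> (BB_in M n1 q \<cdot> Bop M m) = (?B n1 \<cdot> BB_in M n1 q) \<cdot> Bop M m"
      using tq[OF p0] by simp
    also have "\<dots> = BB_in M n2 q \<cdot> (Bd M (m + 1) \<cdot> Bop M m)"
      unfolding B2[OF p0] using tq[OF p0] tr M_Bop_Bop[of m]
      by (cases "0 < q") (simp_all add: add.assoc)
    finally show ?thesis .
  qed
  have "?B n1 \<cdot> (?B n \<cdot> BB_in M n p) = ?z"
  proof (cases "0 < p")
    case False
    show ?thesis
      unfolding B0 if_not_P[OF False] using A[unfolded if_not_P[OF False]]
      by (cases "p \<in> BB_idx n1") (simp_all add: m)
  next
    case True
    \<comment> \<open>If summand \<open>p\<close> has left the index set one degree below, then
      \<open>m - 1\<close> is negative; the term B b that is missing factors through a zero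
      object.\<close>
    have 1: "Bop M (m - 1) \<cdot> Bd M m = Zero C (Ob M m) (Ob M m)" if "p \<notin> BB_idx n1"
    proof -
      have "is_zero_ob C (Ob M (m - 1))" using that p by (intro neg) (simp add: BB_idx_iff defs del: d)
      then show ?thesis using zero_ob_comp[of "Ob M (m - 1)" "Bd M m" "Bop M (m - 1)"] by simp
    qed
    have "?B n1 \<cdot> (?B n \<cdot> BB_in M n p) = BB_in M n2 q \<cdot> (Bd M (m + 1) \<cdot> Bop M m \<boxplus> Bop M (m - 1) \<cdot> Bd M m)"
      unfolding B0 using A B 1 True tq[OF True] tp
      by (cases "p \<in> BB_idx n1") (simp_all add: Plus_commute)
    then show ?thesis
      using M_Bd_Bop[of m] tq[OF True] by simp
  qed
  then show "(?B (n - 1) \<cdot> ?B n) \<cdot> BB_in M n p = Zero C (Ob (BB C M) n) (Ob (BB C M) (n - 2)) \<cdot> BB_in M n p"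
    using p by (simp add: defs(1))
qed simp_all

lemma BB_chain_complex: "chain_complex C (BB C M)"
  by (simp add: chain_complex_def Bd_Bd_BB)

lemma BB_S_complex: "S_complex C (BB C M)"
  unfolding S_complex_def
proof (intro conjI allI)
  show "chain_complex C (BB C M)" by (rule BB_chain_complex)
  show "\<exists>m. \<forall>n<m. is_zero_ob C (Ob (BB C M) n)" using zero_in_BB by blast
  fix n
  show "Sop (BB C M) n \<in> Hom C (Ob (BB C M) n) (Ob (BB C M) (n - 2))" by simp
  show "Bd (BB C M) (n - 2) \<cdot> Sop (BB C M) n = Sop (BB C M) (n - 1) \<cdot> Bd (BB C M) n"
  proof (rule BB_ext[where M = M and n = n])
    fix p assume p: "p \<in> BB_idx n"
    define m n1 n2 n3 q r where defs: "m = n - 2 * int p" "n1 = n - 1" "n2 = n - 2" "n3 = n - 3" "q = p - 1" "r = q - 1"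
    let ?B = "Bd (BB C M)" and ?S = "Sop (BB C M)"
    have d: "n - 1 = n1" "n - 2 = n2" "n1 - 2 = n3" "n2 - 1 = n3" by (simp_all add: defs)
    have m: "n1 - 2 * int p = m - 1" by (simp add: defs)
    have mq: "n1 - 2 * int q = m + 1" "n2 - 2 * int q = m" "n3 - 2 * int q = m - 1"
      "q \<in> BB_idx n1" "q \<in> BB_idx n2" "q \<in> BB_idx n3 \<longleftrightarrow> p \<in> BB_idx n1" if "0 < p"
      using that p by (auto simp: BB_idx_iff defs)
    have mr: "n3 - 2 * int r = m + 1" "r \<in> BB_idx n3" if "0 < q"
      using that p by (auto simp: BB_idx_iff defs)
    have S0: "?S n \<cdot> BB_in M n p = (if 0 < p then BB_in M n2 q else Zero C (Ob M m) (Ob (BB C M) n2))"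
      unfolding defs(5) using p by (intro Sop_BB_in) (simp_all add: defs)
    have B0: "?B n \<cdot> BB_in M n p =
      (if p \<in> BB_idx n1 then BB_in M n1 p \<cdot> Bd M m else Zero C (Ob M m) (Ob (BB C M) n1)) \<boxplus>
      (if 0 < p then BB_in M n1 q \<cdot> Bop M m else Zero C (Ob M m) (Ob (BB C M) n1))"
      unfolding defs(5) using p by (intro Bd_BB_in) (simp_all add: defs)
    have S1: "?S n1 \<cdot> BB_in M n1 p = (if 0 < p then BB_in M n3 q else Zero C (Ob M (m - 1)) (Ob (BB C M) n3))"
      if "p \<in> BB_idx n1"
      unfolding defs(5) using that by (intro Sop_BB_in) (simp_all add: defs)
    have S2: "?S n1 \<cdot> BB_in M n1 q = (if 0 < q then BB_in M n3 r else Zero C (Ob M (m + 1)) (Ob (BB C M) n3))"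
      if "0 < p"
      unfolding defs(6) using mq[OF that] by (intro Sop_BB_in) (simp_all add: defs)
    have B2: "?B n2 \<cdot> BB_in M n2 q =
      (if q \<in> BB_idx n3 then BB_in M n3 q \<cdot> Bd M m else Zero C (Ob M m) (Ob (BB C M) n3)) \<boxplus>
      (if 0 < q then BB_in M n3 r \<cdot> Bop M m else Zero C (Ob M m) (Ob (BB C M) n3))" if "0 < p"
      unfolding defs(6) using mq[OF that] by (intro Bd_BB_in) (simp_all add: defs)
    have tp: "p \<in> BB_idx n1 \<Longrightarrow> Dom C (BB_in M n1 p) = Ob M (m - 1)"
      using m by simp
    have tq: "Dom C (BB_in M n1 q) = Ob M (m + 1)" "Dom C (BB_in M n2 q) = Ob M m"
      "q \<in> BB_idx n1" "q \<in> BB_idx n2" "q \<in> BB_idx n3 \<longleftrightarrow> p \<in> BB_idx n1"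
      "p \<in> BB_idx n1 \<Longrightarrow> Dom C (BB_in M n3 q) = Ob M (m - 1)" if "0 < p"
      using mq[OF that] by simp_all
    have tr: "Dom C (BB_in M n3 r) = Ob M (m + 1)" "r \<in> BB_idx n3" if "0 < q"
      using mr[OF that] by simp_all
    note d [simp]
    have A: "?S n1 \<cdot> (BB_in M n1 p \<cdot> Bd M m) =
        (if 0 < p then BB_in M n3 q \<cdot> Bd M m else Zero C (Ob M m) (Ob (BB C M) n3))"
      if p1: "p \<in> BB_idx n1"
    proof -
      have "?S n1 \<cdot> (BB_in M n1 p \<cdot> Bd M m) = (?S n1 \<cdot> BB_in M n1 p) \<cdot> Bd M m"
        using p1 by (simp add: m)
      then show ?thesis
        unfolding S1[OF p1] by simp
    qed
    have B: "?S n1 \<cdot> (BB_in M n1 q \<cdot> Bop M m) =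
        (if 0 < q then BB_in M n3 r \<cdot> Bop M m else Zero C (Ob M m) (Ob (BB C M) n3))"
      if p0: "0 < p"
    proof -
      have "?S n1 \<cdot> (BB_in M n1 q \<cdot> Bop M m) = (?S n1 \<cdot> BB_in M n1 q) \<cdot> Bop M m"
        using tq[OF p0] by simp
      then show ?thesis
        unfolding S2[OF p0] by simp
    qed
    have "?B n2 \<cdot> (?S n \<cdot> BB_in M n p) = ?S n1 \<cdot> (?B n \<cdot> BB_in M n p)"
    proof (cases "0 < p")
      case False
      show ?thesis
        unfolding S0 B0 if_not_P[OF False] using A[unfolded if_not_P[OF False]]
        by (cases "p \<in> BB_idx n1") (simp_all add: m)
    next
      case True
      show ?thesis
        unfolding S0 B0 using A B True tq[OF True] tp tr B2[OF True]
        by (cases "p \<in> BB_idx n1"; cases "0 < q") simp_all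
    qed
    then show "(?B (n - 2) \<cdot> ?S n) \<cdot> BB_in M n p = (?S (n - 1) \<cdot> ?B n) \<cdot> BB_in M n p"
      using p by simp
  qed (simp_all add: algebra_simps)
qed

end

subsection \<open>Relative acyclicity\<close>

context base_cat begin

text \<open>The first clause says that restriction of cochains along \<open>f\<close> is onto, the
  second that the subcomplex of cochains killed by \<open>f\<close> is acyclic. This is stronger
  than \<open>equiv_on\<close>, and in contrast to it can be verified summand by summand on a
  filtered complex.\<close>

definition rel_acyclic :: "('o, 'm, 'y) chain_scheme \<Rightarrow> ('o, 'm, 'z) chain_scheme \<Rightarrow> (int \<Rightarrow> 'm) \<Rightarrow> 'o \<Rightarrow> bool" where
  "rel_acyclic X Y f J \<longleftrightarrow> (\<forall>k.
     (\<forall>x. Dom C x = Ob X k \<longrightarrow> Cod C x = J \<longrightarrow> (\<exists>y. Dom C y = Ob Y k \<and> Cod C y = J \<and> y \<cdot> f k = x)) \<and>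
     (\<forall>y. cocycle Y J k y \<longrightarrow> y \<cdot> f k = Zero C (Ob X k) J \<longrightarrow>
       (\<exists>z. Dom C z = Ob Y (k - 1) \<and> Cod C z = J \<and> z \<cdot> f (k - 1) = Zero C (Ob X (k - 1)) J \<and> y = z \<cdot> Bd Y k)))"

text \<open>The long exact sequence of the short exact sequence of cochain complexes, carried out on
  representatives.\<close>

lemma rel_acyclic_equiv_on:
  assumes f: "chain_map C X Y f" and acyclic: "rel_acyclic X Y f J"
  shows "equiv_on X Y f J"
proof -
  have X: "chain_complex C X" and Y: "chain_complex C Y"
    using f by (simp_all add: chain_map_def)
  note [simp] = chain_complexD(1,2)[OF X] chain_complexD(1,2)[OF Y]
  have YY: "Bd Y k \<cdot> Bd Y (k + 1) = Zero C (Ob Y (k + 1)) (Ob Y (k - 1))" for k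
    using chain_complexD(3)[OF Y, of "k + 1"] by simp
  have ft [simp]: "Dom C (f n) = Ob X n" "Cod C (f n) = Ob Y n" for n
    using f by (simp_all add: chain_map_def)
  have fc: "Bd Y n \<cdot> f n = f (n - 1) \<cdot> Bd X n" for n
    using f by (simp add: chain_map_def)
  have ext: "\<exists>y. Dom C y = Ob Y k \<and> Cod C y = J \<and> y \<cdot> f k = x" if "Dom C x = Ob X k" "Cod C x = J" for x k
    using acyclic that unfolding rel_acyclic_def by blast
  have ker: "\<exists>z. Dom C z = Ob Y (k - 1) \<and> Cod C z = J \<and> z \<cdot> f (k - 1) = Zero C (Ob X (k - 1)) J \<and> y = z \<cdot> Bd Y k"
    if "cocycle Y J k y" "y \<cdot> f k = Zero C (Ob X k) J" for y k
    using acyclic that unfolding rel_acyclic_def by blast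
  show ?thesis
    unfolding equiv_on_def
  proof (intro allI conjI impI)
    fix k y assume y: "cocycle Y J k y" "coboundary X J k (y \<cdot> f k)"
    obtain u where u: "Dom C u = Ob X (k - 1)" "Cod C u = J" "y \<cdot> f k = u \<cdot> Bd X k"
      using y(2) by (auto simp: coboundary_def)
    obtain v where v: "Dom C v = Ob Y (k - 1)" "Cod C v = J" "v \<cdot> f (k - 1) = u"
      using ext u by blast
    \<comment> \<open>The primitive \<open>u\<close> of the restriction is extended to
      \<open>v\<close> on Y; subtracting its coboundary leaves a cocycle that is killed by
      \<open>f\<close>.\<close>
    define y' where "y' = y \<boxplus> scale C (- 1) (v \<cdot> Bd Y k)"
    have yt: "Dom C y = Ob Y k" "Cod C y = J" using y(1) by (simp_all add: cocycle_def)
    have c: "cocycle Y J k y'"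
      using y(1) yt v YY by (simp add: cocycle_def y'_def)
    have "v \<cdot> f (k - 1) \<cdot> Bd X k = u \<cdot> Bd X k"
      using v u by (simp flip: comp_assoc)
    then have "y' \<cdot> f k = Zero C (Ob X k) J"
      using yt v u fc[of k] by (simp add: y'_def)
    then obtain z where z: "Dom C z = Ob Y (k - 1)" "Cod C z = J" "y' = z \<cdot> Bd Y k"
      using ker c by blast
    have "y = y' \<boxplus> v \<cdot> Bd Y k"
      using yt v by (simp add: y'_def Plus_assoc Plus_commute[of "scale C (- 1) (v \<cdot> Bd Y k)"])
    also have "\<dots> = (z \<boxplus> v) \<cdot> Bd Y k"
      using z v by simp
    finally show "coboundary Y J k y"
      unfolding coboundary_def using z v by (intro exI[of _ "z \<boxplus> v"]) simp
  next
    fix k x assume x: "cocycle X J k x"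
    then have xt: "Dom C x = Ob X k" "Cod C x = J" "x \<cdot> Bd X (k + 1) = Zero C (Ob X (k + 1)) J"
      by (simp_all add: cocycle_def)
    obtain v where v: "Dom C v = Ob Y k" "Cod C v = J" "v \<cdot> f k = x"
      using ext xt by blast
    \<comment> \<open>The connecting homomorphism: \<open>v\<close> extends the cocycle
      \<open>x\<close>, its coboundary is killed by \<open>f\<close>, and by acyclicity it is the
      coboundary of some \<open>z\<close> killed by \<open>f\<close>. Then \<open>v - z\<close> is a
      cocycle that still restricts to \<open>x\<close>.\<close>
    have "cocycle Y J (k + 1) (v \<cdot> Bd Y (k + 1))"
      using v YY[of "k + 1"] by (simp add: cocycle_def add.commute)
    moreover have "(v \<cdot> Bd Y (k + 1)) \<cdot> f (k + 1) = Zero C (Ob X (k + 1)) J"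
      using v xt fc[of "k + 1"] by (simp flip: comp_assoc[of _ "f k" v])
    ultimately obtain z where z: "Dom C z = Ob Y k" "Cod C z = J" "z \<cdot> f k = Zero C (Ob X k) J"
      "v \<cdot> Bd Y (k + 1) = z \<cdot> Bd Y (k + 1)"
      using ker[of "k + 1" "v \<cdot> Bd Y (k + 1)"] by auto
    define y where "y = v \<boxplus> scale C (- 1) z"
    have "cocycle Y J k y"
      using v z by (simp add: cocycle_def y_def)
    moreover have "coboundary X J k (Zero C (Ob X k) J)"
      unfolding coboundary_def by (intro exI[of _ "Zero C (Ob X (k - 1)) J"]) simp
    moreover have "x = Zero C (Ob X k) J \<boxplus> y \<cdot> f k"
      using v z xt by (simp add: y_def)
    ultimately show "\<exists>y u. cocycle Y J k y \<and> coboundary X J k u \<and> x = u \<boxplus> y \<cdot> f k" by blast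
  qed
qed

text \<open>Acyclicity for a finite filtration in each degree: the boundary of Y sends summand
  \<open>p\<close> to summands \<open>q \<le> p\<close>, and the complexes formed by the diagonal
  entries are acyclic relative to the corresponding pieces of X. The alternative in the last
  hypothesis covers the degree in which the diagonal complex of summand \<open>p\<close> begins. It
  is applied to \<open>Om\<close>, with graded pieces the Hochschild and the bar complex, and to
  \<open>BB\<close>, with graded pieces shifted copies of the mixed complex.\<close>

lemma rel_acyclic_triangular:
  fixes I :: "int \<Rightarrow> nat set" and SX SY :: "int \<Rightarrow> nat \<Rightarrow> 'o"
  assumes f: "chain_map C X Y f"
    and fin: "\<And>n. finite (I n)" and mono: "\<And>n p. p \<in> I (n - 1) \<Longrightarrow> p \<in> I n"
    and ObX: "\<And>n. Ob X n = dsum_ob C (I n) (SX n)" and ObY: "\<And>n. Ob Y n = dsum_ob C (I n) (SY n)"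
    and g: "\<And>n p. p \<in> I n \<Longrightarrow> Dom C (g n p) = SX n p \<and> Cod C (g n p) = SY n p"
    and fg: "\<And>n p. p \<in> I n \<Longrightarrow> f n \<cdot> dsum_inj C (I n) (SX n) p = dsum_inj C (I n) (SY n) p \<cdot> g n p"
    and \<phi>: "\<And>n p q. p \<in> I n \<Longrightarrow> q \<in> I (n - 1) \<Longrightarrow> R p q \<Longrightarrow>
      Dom C (\<phi> n p q) = SY n p \<and> Cod C (\<phi> n p q) = SY (n - 1) q"
    and R: "\<And>p q. R p q \<Longrightarrow> q \<le> p" "\<And>p. R p p"
    and BdY: "\<And>n p. p \<in> I n \<Longrightarrow> Bd Y n \<cdot> dsum_inj C (I n) (SY n) p =
      arr_sum C (SY n p) (Ob Y (n - 1)) (\<lambda>q. dsum_inj C (I (n - 1)) (SY (n - 1)) q \<cdot> \<phi> n p q) {q \<in> I (n - 1). R p q}"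
    and ext: "\<And>n p x. p \<in> I n \<Longrightarrow> Dom C x = SX n p \<Longrightarrow> Cod C x = J \<Longrightarrow>
      \<exists>y. Dom C y = SY n p \<and> Cod C y = J \<and> y \<cdot> g n p = x"
    and acyc: "\<And>n p y. p \<in> I n \<Longrightarrow> Dom C y = SY n p \<Longrightarrow> Cod C y = J \<Longrightarrow>
      y \<cdot> \<phi> (n + 1) p p = Zero C (SY (n + 1) p) J \<Longrightarrow> y \<cdot> g n p = Zero C (SX n p) J \<Longrightarrow>
      (if p \<in> I (n - 1) then \<exists>z. Dom C z = SY (n - 1) p \<and> Cod C z = J \<and>
          z \<cdot> g (n - 1) p = Zero C (SX (n - 1) p) J \<and> y = z \<cdot> \<phi> n p p
        else y = Zero C (SY n p) J)"
  shows "rel_acyclic X Y f J"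
  unfolding rel_acyclic_def
proof (intro allI conjI impI)
  have Y: "chain_complex C Y" and ft [simp]: "Dom C (f n) = Ob X n" "Cod C (f n) = Ob Y n"
    and fc: "Bd Y n \<cdot> f n = f (n - 1) \<cdot> Bd X n" and X: "chain_complex C X" for n
    using f by (simp_all add: chain_map_def)
  note [simp] = chain_complexD(1,2)[OF Y] chain_complexD(1,2)[OF X]
  define iX iY pX pY where "iX = (\<lambda>n. dsum_inj C (I n) (SX n))" and "iY = (\<lambda>n. dsum_inj C (I n) (SY n))"
    and "pX = (\<lambda>n. dsum_prj C (I n) (SX n))" and "pY = (\<lambda>n. dsum_prj C (I n) (SY n))"
  note defs = iX_def iY_def pX_def pY_def
  have typs [simp]: "p \<in> I n \<Longrightarrow> Dom C (iX n p) = SX n p" "p \<in> I n \<Longrightarrow> Cod C (iX n p) = Ob X n"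
    "p \<in> I n \<Longrightarrow> Dom C (iY n p) = SY n p" "p \<in> I n \<Longrightarrow> Cod C (iY n p) = Ob Y n"
    "p \<in> I n \<Longrightarrow> Dom C (pX n p) = Ob X n" "p \<in> I n \<Longrightarrow> Cod C (pX n p) = SX n p"
    "p \<in> I n \<Longrightarrow> Dom C (pY n p) = Ob Y n" "p \<in> I n \<Longrightarrow> Cod C (pY n p) = SY n p"
    "p \<in> I n \<Longrightarrow> Dom C (g n p) = SX n p" "p \<in> I n \<Longrightarrow> Cod C (g n p) = SY n p" for n p
    using fin g by (simp_all add: defs ObX ObY)
  have fg: "f n \<cdot> iX n p = iY n p \<cdot> g n p" if "p \<in> I n" for n p
    using fg[OF that] by (simp add: defs)
  have extX: "u = v" if "Dom C u = Ob X n" "Dom C v = Ob X n" "Cod C u = Cod C v"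
    "\<And>p. p \<in> I n \<Longrightarrow> u \<cdot> iX n p = v \<cdot> iX n p" for u v n
    by (rule dsum_ext_inj[OF fin]) (use that in \<open>auto simp: ObX defs\<close>)
  have extY: "u = v" if "Dom C u = Ob Y n" "Dom C v = Ob Y n" "Cod C u = Cod C v"
    "\<And>p. p \<in> I n \<Longrightarrow> u \<cdot> iY n p = v \<cdot> iY n p" for u v n
    by (rule dsum_ext_inj[OF fin]) (use that in \<open>auto simp: ObY defs\<close>)
  have pi: "pY n p \<cdot> iY n q = (if q = p then Idn C (SY n q) else Zero C (SY n q) (SY n p))"
    if "p \<in> I n" "q \<in> I n" for n p q
    using that prj_inj[OF fin] by (simp add: defs)
  have Bd_in: "y \<cdot> (Bd Y n \<cdot> iY n p) =
      arr_sum C (SY n p) (Cod C y) (\<lambda>q. (y \<cdot> iY (n - 1) q) \<cdot> \<phi> n p q) {q \<in> I (n - 1). R p q}"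
    if "p \<in> I n" "Dom C y = Ob Y (n - 1)" for y n p
  proof -
    have "y \<cdot> (Bd Y n \<cdot> iY n p) =
        y \<cdot> arr_sum C (SY n p) (Ob Y (n - 1)) (\<lambda>q. iY (n - 1) q \<cdot> \<phi> n p q) {q \<in> I (n - 1). R p q}"
      using BdY[OF that(1)] by (simp add: defs)
    also have "\<dots> = arr_sum C (SY n p) (Cod C y) (\<lambda>q. y \<cdot> (iY (n - 1) q \<cdot> \<phi> n p q)) {q \<in> I (n - 1). R p q}"
      using that \<phi>[OF that(1)] by (intro comp_sum) auto
    also have "\<dots> = arr_sum C (SY n p) (Cod C y) (\<lambda>q. (y \<cdot> iY (n - 1) q) \<cdot> \<phi> n p q) {q \<in> I (n - 1). R p q}"
      using that \<phi>[OF that(1)] by (intro sum_cong) auto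
    finally show ?thesis .
  qed
  {
    fix k x assume x: "Dom C x = Ob X k" "Cod C x = J"
    have "\<exists>y. p \<in> I k \<longrightarrow> Dom C y = SY k p \<and> Cod C y = J \<and> y \<cdot> g k p = x \<cdot> iX k p" for p
      using ext[of p k "x \<cdot> iX k p"] x by (cases "p \<in> I k") auto
    then obtain y where y: "p \<in> I k \<Longrightarrow> Dom C (y p) = SY k p \<and> Cod C (y p) = J \<and> y p \<cdot> g k p = x \<cdot> iX k p" for p
      by metis
    define z where "z = arr_sum C (Ob Y k) J (\<lambda>p. y p \<cdot> pY k p) (I k)"
    have zt [simp]: "Dom C z = Ob Y k" "Cod C z = J"
      unfolding z_def using y by (auto intro!: Dom_sum Cod_sum)
    have zi: "z \<cdot> iY k p = y p" if p: "p \<in> I k" for p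
    proof -
      have "z \<cdot> iY k p = arr_sum C (SY k p) J (\<lambda>q. (y q \<cdot> pY k q) \<cdot> iY k p) (I k)"
        unfolding z_def using y p by (intro sum_comp) auto
      also have "\<dots> = (y p \<cdot> pY k p) \<cdot> iY k p"
        using y p by (intro sum_single fin) (auto simp: pi)
      finally show ?thesis using y p by (simp add: pi)
    qed
    have "z \<cdot> f k = x"
    proof (rule extX)
      fix p assume p: "p \<in> I k"
      have "(z \<cdot> f k) \<cdot> iX k p = (z \<cdot> iY k p) \<cdot> g k p"
        using p fg by simp
      then show "(z \<cdot> f k) \<cdot> iX k p = x \<cdot> iX k p"
        using zi[OF p] y[OF p] by simp
    qed (use x in simp_all)
    then show "\<exists>y. Dom C y = Ob Y k \<and> Cod C y = J \<and> y \<cdot> f k = x"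
      using zt by blast
  }
  {
    fix k y assume y: "cocycle Y J k y" "y \<cdot> f k = Zero C (Ob X k) J"
    then have yt [simp]: "Dom C y = Ob Y k" "Cod C y = J"
      and yc: "y \<cdot> Bd Y (k + 1) = Zero C (Ob Y (k + 1)) J"
      by (simp_all add: cocycle_def)
    have YY: "Bd Y k \<cdot> Bd Y (k + 1) = Zero C (Ob Y (k + 1)) (Ob Y (k - 1))"
      using chain_complexD(3)[OF Y, of "k + 1"] by simp
    \<comment> \<open>The primitive is built by induction on \<open>N\<close> so that its coboundary
      agrees with \<open>y\<close> on all summands below \<open>N\<close>.\<close>
    have "\<exists>z. Dom C z = Ob Y (k - 1) \<and> Cod C z = J \<and> z \<cdot> f (k - 1) = Zero C (Ob X (k - 1)) J \<and>
        (\<forall>p\<in>I k. p < N \<longrightarrow> (z \<cdot> Bd Y k) \<cdot> iY k p = y \<cdot> iY k p)" for N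
    proof (induction N)
      case 0
      show ?case by (intro exI[of _ "Zero C (Ob Y (k - 1)) J"]) simp
    next
      case (Suc N)
      then obtain z where z [simp]: "Dom C z = Ob Y (k - 1)" "Cod C z = J"
        and zf: "z \<cdot> f (k - 1) = Zero C (Ob X (k - 1)) J"
        and zp: "\<And>p. p \<in> I k \<Longrightarrow> p < N \<Longrightarrow> (z \<cdot> Bd Y k) \<cdot> iY k p = y \<cdot> iY k p"
        by blast
      show ?case
      proof (cases "N \<in> I k")
        case False
        then show ?thesis
          using z zf zp by (intro exI[of _ z] conjI ballI impI) (auto simp: less_Suc_eq)
      next
        case N: True
        then have N1: "N \<in> I (k + 1)" using mono[of N "k + 1"] by simp
        define y' where "y' = y \<boxplus> scale C (- 1) (z \<cdot> Bd Y k)"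
        have y't [simp]: "Dom C y' = Ob Y k" "Cod C y' = J" by (simp_all add: y'_def)
        have y'c: "y' \<cdot> Bd Y (k + 1) = Zero C (Ob Y (k + 1)) J"
          using yc YY by (simp add: y'_def)
        have "z \<cdot> f (k - 1) \<cdot> Bd X k = Zero C (Ob X k) J"
          using zf by (simp flip: comp_assoc)
        then have y'f: "y' \<cdot> f k = Zero C (Ob X k) J"
          using y fc[of k] by (simp add: y'_def)
        have y'p: "y' \<cdot> iY k p = Zero C (SY k p) J" if "p \<in> I k" "p < N" for p
          using zp[OF that] that by (simp add: y'_def)
        define u where "u = y' \<cdot> iY k N"
        have ut [simp]: "Dom C u = SY k N" "Cod C u = J" using N by (simp_all add: u_def)
        have \<phi>N: "Dom C (\<phi> (k + 1) N N) = SY (k + 1) N" "Cod C (\<phi> (k + 1) N N) = SY k N"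
          using \<phi>[of N "k + 1" N] N N1 R(2) by simp_all
        have "u \<cdot> \<phi> (k + 1) N N = y' \<cdot> (Bd Y (k + 1) \<cdot> iY (k + 1) N)"
        proof -
          have "y' \<cdot> (Bd Y (k + 1) \<cdot> iY (k + 1) N) =
              arr_sum C (SY (k + 1) N) J (\<lambda>q. (y' \<cdot> iY k q) \<cdot> \<phi> (k + 1) N q) {q \<in> I k. R N q}"
            using Bd_in[OF N1, of y'] by simp
          \<comment> \<open>Off the diagonal the boundary leads to summands below \<open>N\<close>,
            on which \<open>y'\<close> already vanishes. So the component \<open>u\<close> is a
            cocycle for the diagonal entry alone.\<close>
          also have "\<dots> = (y' \<cdot> iY k N) \<cdot> \<phi> (k + 1) N N"
          proof (rule sum_single)
            fix q assume q: "q \<in> {q \<in> I k. R N q}" "q \<noteq> N"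
            then have "q < N" using R(1)[of N q] by simp
            moreover have "Dom C (\<phi> (k + 1) N q) = SY (k + 1) N" "Cod C (\<phi> (k + 1) N q) = SY k q"
              using \<phi>[of N "k + 1" q] N1 q by simp_all
            ultimately show "(y' \<cdot> iY k q) \<cdot> \<phi> (k + 1) N q = Zero C (SY (k + 1) N) J"
              using q y'p[of q] by simp
          qed (use fin N R(2) \<phi>N in auto)
          finally show ?thesis by (simp add: u_def)
        qed
        then have c1: "u \<cdot> \<phi> (k + 1) N N = Zero C (SY (k + 1) N) J"
          using y'c N1 by (simp flip: comp_assoc)
        have "u \<cdot> g k N = (y' \<cdot> f k) \<cdot> iX k N"
          using N fg[OF N] by (simp add: u_def)
        then have c2: "u \<cdot> g k N = Zero C (SX k N) J"
          using N by (simp add: y'f)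
        note a = acyc[OF N ut c1 c2]
        show ?thesis
        \<comment> \<open>If \<open>N\<close> is no index one degree below, the diagonal complex
          begins in degree \<open>k\<close>; then \<open>u\<close> is zero and \<open>z\<close>
          already agrees with \<open>y\<close> on summand \<open>N\<close>.\<close>
        proof (cases "N \<in> I (k - 1)")
          case False
          then have "u = Zero C (SY k N) J" using a by simp
          then have "y \<cdot> iY k N \<boxplus> scale C (- 1) ((z \<cdot> Bd Y k) \<cdot> iY k N) = Zero C (SY k N) J"
            using N by (simp add: u_def y'_def)
          then have "(z \<cdot> Bd Y k) \<cdot> iY k N = y \<cdot> iY k N"
            using scale_minus_one_eq_iff[of "y \<cdot> iY k N" "(z \<cdot> Bd Y k) \<cdot> iY k N"] N by simp
          then show ?thesis
            using z zf zp by (intro exI[of _ z] conjI ballI impI) (auto simp: less_Suc_eq)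
        next
          case N0: True
          then obtain w where w [simp]: "Dom C w = SY (k - 1) N" "Cod C w = J"
            and wg: "w \<cdot> g (k - 1) N = Zero C (SX (k - 1) N) J" and uw: "u = w \<cdot> \<phi> k N N"
            using a by auto
          define z' where "z' = z \<boxplus> w \<cdot> pY (k - 1) N"
          have z't [simp]: "Dom C z' = Ob Y (k - 1)" "Cod C z' = J" using N0 by (simp_all add: z'_def)
          have "(w \<cdot> pY (k - 1) N) \<cdot> f (k - 1) = Zero C (Ob X (k - 1)) J"
          proof (rule extX)
            fix p assume p: "p \<in> I (k - 1)"
            have "((w \<cdot> pY (k - 1) N) \<cdot> f (k - 1)) \<cdot> iX (k - 1) p = w \<cdot> (pY (k - 1) N \<cdot> iY (k - 1) p) \<cdot> g (k - 1) p"
              using p N0 fg[OF p] by simp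
            also have "\<dots> = Zero C (SX (k - 1) p) J"
              using wg p N0 by (simp add: pi)
            finally show "((w \<cdot> pY (k - 1) N) \<cdot> f (k - 1)) \<cdot> iX (k - 1) p = Zero C (Ob X (k - 1)) J \<cdot> iX (k - 1) p"
              using p by simp
          qed (use N0 in simp_all)
          then have z'f: "z' \<cdot> f (k - 1) = Zero C (Ob X (k - 1)) J"
            using zf N0 by (simp add: z'_def)
          \<comment> \<open>The correction is supported on summand \<open>N\<close>. A summand
            \<open>p < N\<close> reaches only \<open>q \<le> p\<close>, so that the agreement
            obtained so far is kept.\<close>
          have wB: "(w \<cdot> pY (k - 1) N) \<cdot> (Bd Y k \<cdot> iY k p) = (if p = N then u else Zero C (SY k p) J)"
            if p: "p \<in> I k" "p \<le> N" for p
          proof -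
            let ?h = "\<lambda>q. ((w \<cdot> pY (k - 1) N) \<cdot> iY (k - 1) q) \<cdot> \<phi> k p q"
            have B: "(w \<cdot> pY (k - 1) N) \<cdot> (Bd Y k \<cdot> iY k p) = arr_sum C (SY k p) J ?h {q \<in> I (k - 1). R p q}"
              using Bd_in[OF p(1), of "w \<cdot> pY (k - 1) N"] N0 by simp
            have h0: "?h q = Zero C (SY k p) J" if q: "q \<in> I (k - 1)" "R p q" "q \<noteq> N" for q
              using \<phi>[OF p(1) q(1,2)] q N0 by (simp add: pi)
            show ?thesis
            proof (cases "p = N")
              case True
              have \<phi>': "Dom C (\<phi> k N N) = SY k N" "Cod C (\<phi> k N N) = SY (k - 1) N"
                using \<phi>[OF N N0 R(2)] by simp_all
              have "arr_sum C (SY k p) J ?h {q \<in> I (k - 1). R p q} = ?h N"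
                using fin N0 R(2) h0 \<phi>' True by (intro sum_single) auto
              then show ?thesis
                using True B N0 \<phi>' uw by (simp add: pi)
            next
              case False
              have "arr_sum C (SY k p) J ?h {q \<in> I (k - 1). R p q} = Zero C (SY k p) J"
                using h0 R(1)[of p] p(2) False by (intro sum_zero) force
              then show ?thesis using False B by simp
            qed
          qed
          have "(z' \<cdot> Bd Y k) \<cdot> iY k p = y \<cdot> iY k p" if p: "p \<in> I k" "p < Suc N" for p
          proof -
            have "(z' \<cdot> Bd Y k) \<cdot> iY k p = (z \<cdot> Bd Y k) \<cdot> iY k p \<boxplus> (w \<cdot> pY (k - 1) N) \<cdot> (Bd Y k \<cdot> iY k p)"
              using p N0 by (simp add: z'_def)
            also have "\<dots> = y \<cdot> iY k p"
            proof (cases "p = N")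
              case True
              have "(z \<cdot> Bd Y k) \<cdot> iY k N \<boxplus> (y \<cdot> iY k N \<boxplus> scale C (- 1) ((z \<cdot> Bd Y k) \<cdot> iY k N)) = y \<cdot> iY k N"
                using N by (simp add: Plus_left_commute)
              then show ?thesis
                using wB[of N] N True by (simp add: u_def y'_def)
            next
              case False
              then show ?thesis using wB[OF p(1)] zp[OF p(1)] p by simp
            qed
            finally show ?thesis .
          qed
          then show ?thesis
            using z't z'f by blast
        qed
      qed
    qed
    \<comment> \<open>This bound exceeds every index of degree \<open>k\<close>; for an empty index
      set the condition is vacuous whatever \<open>Max\<close> returns.\<close>
    from this[of "Suc (Max (I k))"] obtain z where z: "Dom C z = Ob Y (k - 1)" "Cod C z = J"
      "z \<cdot> f (k - 1) = Zero C (Ob X (k - 1)) J"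
      "\<And>p. p \<in> I k \<Longrightarrow> (z \<cdot> Bd Y k) \<cdot> iY k p = y \<cdot> iY k p"
      using fin Max_ge[OF fin] by (metis le_imp_less_Suc)
    have "z \<cdot> Bd Y k = y"
      by (rule extY) (use z(1,2) in simp, simp, use z(1,2) in simp, rule z(4))
    then show "\<exists>z. Dom C z = Ob Y (k - 1) \<and> Cod C z = J \<and>
        z \<cdot> f (k - 1) = Zero C (Ob X (k - 1)) J \<and> y = z \<cdot> Bd Y k"
      using z by blast
  }
qed


end

subsection \<open>Maps of precyclic objects\<close>

locale precyclic_map = base_cat C + D: precyclic C D d + D': precyclic C D' d'
  for C :: "('o, 'm) tensor_cat" (structure) and D d D' d' +
  fixes g :: "nat \<Rightarrow> 'm"
  assumes g_Hom [simp]: "Dom C (g n) = CX D n" "Cod C (g n) = CX D' n"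
    and g_d: "j < n \<Longrightarrow> d' n j \<cdot> g n = g (n - 1) \<cdot> d n j"
    and g_t: "Ct D' n \<cdot> g n = g n \<cdot> Ct D n"
begin

lemma g_tp: "D'.tp n k \<cdot> g n = g n \<cdot> D.tp n k"
proof (induction k)
  case 0 then show ?case by (simp add: D.tp_simps D'.tp_simps)
next
  case (Suc k)
  have "D'.tp n (Suc k) \<cdot> g n = Ct D' n \<cdot> (D'.tp n k \<cdot> g n)"
    by (simp add: D'.tp_simps)
  also have "\<dots> = (Ct D' n \<cdot> g n) \<cdot> D.tp n k"
    unfolding Suc by simp
  also have "\<dots> = g n \<cdot> D.tp n (Suc k)"
    unfolding g_t by (simp add: D.tp_simps)
  finally show ?case .
qed

lemma g_norm: "cyc_norm C D' n \<cdot> g n = g n \<cdot> cyc_norm C D n"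
  unfolding D.norm_eq D'.norm_eq
  by (subst sum_comp[where c = "CX D n"], simp_all, subst comp_sum[where c = "CX D' n"], simp_all add: g_tp)

lemma g_\<omega>: "D'.\<omega> n \<cdot> g n = g n \<cdot> D.\<omega> n"
  by (simp add: D.\<omega>_def D'.\<omega>_def g_t)

lemma g_Cb':
  assumes "0 < n" shows "Cb' D' n \<cdot> g n = g (n - 1) \<cdot> Cb' D n"
proof -
  have "Cb' D' n \<cdot> g n = arr_sum C (CX D n) (CX D' (n - 1)) (\<lambda>j. scale C ((- 1) ^ j) (d' n j) \<cdot> g n) {..<n}"
    unfolding D'.Cb'_eq[OF assms] by (intro sum_comp) simp_all
  also have "\<dots> = arr_sum C (CX D n) (CX D' (n - 1)) (\<lambda>j. g (n - 1) \<cdot> scale C ((- 1) ^ j) (d n j)) {..<n}"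
    by (intro sum_cong) (simp_all add: g_d)
  also have "\<dots> = g (n - 1) \<cdot> Cb' D n"
    unfolding D.Cb'_eq[OF assms] by (intro comp_sum[symmetric]) simp_all
  finally show ?thesis .
qed

lemma g_Cb:
  assumes "0 < n" shows "Cb D' n \<cdot> g n = g (n - 1) \<cdot> Cb D n"
proof -
  have "d' n 0 \<cdot> Ct D' n \<cdot> g n = (d' n 0 \<cdot> g n) \<cdot> Ct D n"
    using assms by (simp add: g_t)
  also have "\<dots> = g (n - 1) \<cdot> d n 0 \<cdot> Ct D n"
    using assms by (simp add: g_d)
  finally show ?thesis
    using assms g_Cb'[OF assms] by (simp add: D.Cb_eq D'.Cb_eq)
qed

lemma Hoch_chain_map: "chain_map C (Hoch C D) (Hoch C D') (nonneg_map C g)"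
  unfolding Hoch_def
  by (intro chain_map_nonneg chain_complex_nonneg D.Cb_Cb D'.Cb_Cb g_Cb) simp_all

lemma Bar_chain_map: "chain_map C (Bar C D) (Bar C D') (nonneg_map C g)"
  unfolding Bar_def
  by (intro chain_map_nonneg chain_complex_nonneg D.Cb'_Cb' D'.Cb'_Cb' g_Cb') simp_all

abbreviation "G \<equiv> Om_map C D D' g"

lemma Om_map_Hom [simp]: "Dom C (G n) = Ob (Om C D) n" "Cod C (G n) = Ob (Om C D') n"
  unfolding Om_map_def Ob_Om by (intro mat_Hom; simp add: Om_smd_def)+

lemma Om_map_in:
  assumes "s \<in> Om_idx (int n)"
  shows "G (int n) \<cdot> Om_in D n s = Om_in D' n s \<cdot> g (nat (int n - int s))"
  unfolding Om_map_def Om_in_def using assms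
  by (intro mat_inj_diag) (simp_all add: Om_smd_def)

lemma Om_map_0: "G (int n) \<cdot> Om_in D n 0 = Om_in D' n 0 \<cdot> g n"
  and Om_map_1: "G (int (Suc n)) \<cdot> Om_in D (Suc n) (Suc 0) = Om_in D' (Suc n) (Suc 0) \<cdot> g n"
  using Om_map_in[of 0 n] Om_map_in[of "Suc 0" "Suc n"] by (simp_all add: Om_idx_iff)

lemma Om_chain_map: "chain_map C (Om C D) (Om C D') G"
  unfolding chain_map_def
proof (intro conjI allI)
  fix n
  show "Bd (Om C D') n \<cdot> G n = G (n - 1) \<cdot> Bd (Om C D) n"
  proof (cases "n \<le> 0")
    case True
    then have "is_zero_ob C (Ob (Om C D') (n - 1))" by (intro zero_in_Om) simp
    then show ?thesis by (rule zero_ob_arr_eq) simp_all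
  next
    case False
    then obtain m where n: "n = int (Suc m)" by (metis not_le pos_int_cases gr0_conv_Suc)
    have n1: "n - 1 = int m" using n by simp
    show ?thesis
      unfolding n1 unfolding n
    proof (rule Om_ext[where D = D and n = "Suc m"])
      have "Bd (Om C D') (int (Suc m)) \<cdot> (G (int (Suc m)) \<cdot> Om_in D (Suc m) 0) =
          (Bd (Om C D') (int (Suc m)) \<cdot> Om_in D' (Suc m) 0) \<cdot> g (Suc m)"
        unfolding Om_map_0 by simp
      also have "\<dots> = (G (int m) \<cdot> Om_in D m 0) \<cdot> Cb D (Suc m)"
        unfolding D'.Om_Bd_0 Om_map_0 using g_Cb[of "Suc m"] by simp
      also have "\<dots> = G (int m) \<cdot> (Bd (Om C D) (int (Suc m)) \<cdot> Om_in D (Suc m) 0)"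
        unfolding D.Om_Bd_0 by simp
      finally show "(Bd (Om C D') (int (Suc m)) \<cdot> G (int (Suc m))) \<cdot> Om_in D (Suc m) 0 =
          (G (int m) \<cdot> Bd (Om C D) (int (Suc m))) \<cdot> Om_in D (Suc m) 0" by simp
    next
      have "Bd (Om C D') (int (Suc m)) \<cdot> (G (int (Suc m)) \<cdot> Om_in D (Suc m) (Suc 0)) =
          (Bd (Om C D') (int (Suc m)) \<cdot> Om_in D' (Suc m) (Suc 0)) \<cdot> g m"
        unfolding Om_map_1 by simp
      also have "\<dots> = G (int m) \<cdot> (Bd (Om C D) (int (Suc m)) \<cdot> Om_in D (Suc m) (Suc 0))"
      proof (cases m)
        case 0
        then show ?thesis using D.Om_Bd_1' D'.Om_Bd_1' by simp
      next
        case (Suc k)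
        have "(Bd (Om C D') (int (Suc (Suc k))) \<cdot> Om_in D' (Suc (Suc k)) (Suc 0)) \<cdot> g (Suc k) =
            (Om_in D' (Suc k) 0 \<cdot> g (Suc k)) \<cdot> D.\<omega> (Suc k) \<boxplus>
            (Om_in D' (Suc k) (Suc 0) \<cdot> g k) \<cdot> scale C (- 1) (Cb' D (Suc k))"
          unfolding D'.Om_Bd_1 using g_Cb'[of "Suc k"] g_\<omega>[of "Suc k"] by simp
        also have "\<dots> = G (int (Suc k)) \<cdot> (Bd (Om C D) (int (Suc (Suc k))) \<cdot> Om_in D (Suc (Suc k)) (Suc 0))"
          unfolding D.Om_Bd_1 Om_map_0[symmetric] Om_map_1[symmetric] by simp
        finally show ?thesis unfolding Suc .
      qed
      finally show "(Bd (Om C D') (int (Suc m)) \<cdot> G (int (Suc m))) \<cdot> Om_in D (Suc m) (Suc 0) =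
          (G (int m) \<cdot> Bd (Om C D) (int (Suc m))) \<cdot> Om_in D (Suc m) (Suc 0)" by simp
    qed simp_all
  qed
qed (simp_all add: D.Om_chain_complex D'.Om_chain_complex)

lemma Om_map_Bop: "Bop (Om C D') n \<cdot> G n = G (n + 1) \<cdot> Bop (Om C D) n"
proof (cases "n < 0")
  case True
  then have "is_zero_ob C (Ob (Om C D) n)" by (intro zero_in_Om) simp
  then show ?thesis by (rule zero_ob_arr_eq) simp_all
next
  case False
  then obtain m where n: "n = int m" by (metis nonneg_int_cases not_less)
  have n1: "n + 1 = int (Suc m)" using n by simp
  show ?thesis
    unfolding n1 unfolding n
  proof (rule Om_ext[where D = D and n = m])
    have "Bop (Om C D') (int m) \<cdot> (G (int m) \<cdot> Om_in D m 0) = (Bop (Om C D') (int m) \<cdot> Om_in D' m 0) \<cdot> g m"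
      unfolding Om_map_0 by simp
    also have "\<dots> = (G (int (Suc m)) \<cdot> Om_in D (Suc m) (Suc 0)) \<cdot> cyc_norm C D m"
      unfolding D'.Om_Bop_0 Om_map_1 using g_norm[of m] by simp
    also have "\<dots> = G (int (Suc m)) \<cdot> (Bop (Om C D) (int m) \<cdot> Om_in D m 0)"
      unfolding D.Om_Bop_0 by simp
    finally show "(Bop (Om C D') (int m) \<cdot> G (int m)) \<cdot> Om_in D m 0 =
        (G (int (Suc m)) \<cdot> Bop (Om C D) (int m)) \<cdot> Om_in D m 0"
      by (simp add: add.commute)
  next
    fix k assume m: "m = Suc k"
    have "Bop (Om C D') (int m) \<cdot> (G (int m) \<cdot> Om_in D m (Suc 0)) = (Bop (Om C D') (int m) \<cdot> Om_in D' m (Suc 0)) \<cdot> g k"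
      unfolding m Om_map_1 by simp
    also have "\<dots> = Zero C (CX D k) (Ob (Om C D') (int (Suc m)))"
      unfolding m D'.Om_Bop_1 by simp
    also have "\<dots> = G (int (Suc m)) \<cdot> (Bop (Om C D) (int m) \<cdot> Om_in D m (Suc 0))"
      unfolding m D.Om_Bop_1 by simp
    finally show "(Bop (Om C D') (int m) \<cdot> G (int m)) \<cdot> Om_in D m (Suc 0) =
        (G (int (Suc m)) \<cdot> Bop (Om C D) (int m)) \<cdot> Om_in D m (Suc 0)"
      by (simp add: m add.commute)
  qed (simp_all add: add.commute)
qed

text \<open>The diagonal entries of the boundary are \<open>b\<close> on summand 0 and
  \<open>- b'\<close>, one degree lower, on summand 1; the entry \<omega> from 1 to 0 lies below the
  diagonal.\<close>

lemma rel_acyclic_Om: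
  assumes Hoch: "rel_acyclic (Hoch C D) (Hoch C D') (nonneg_map C g) J"
    and Bar: "rel_acyclic (Bar C D) (Bar C D') (nonneg_map C g) J"
  shows "rel_acyclic (Om C D) (Om C D') G J"
proof (rule rel_acyclic_triangular[where I = Om_idx and SX = "Om_smd D" and SY = "Om_smd D'"
      and g = "\<lambda>n s. g (nat (n - int s))" and R = "\<lambda>s s'. s' \<le> s" and \<phi> = "\<lambda>n. D'.Om_entry (nat (n - 1))"])
  show "chain_map C (Om C D) (Om C D') G" by (rule Om_chain_map)
  show "p \<in> Om_idx (n - 1) \<Longrightarrow> p \<in> Om_idx n" for n p by (auto simp: Om_idx_def)
  show "G n \<cdot> dsum_inj C (Om_idx n) (Om_smd D n) p = dsum_inj C (Om_idx n) (Om_smd D' n) p \<cdot> g (nat (n - int p))"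
    if "p \<in> Om_idx n" for n p
    unfolding Om_map_def using that by (intro mat_inj_diag) (simp_all add: Om_smd_def)
  have pos: "n = int (Suc (nat (n - 1)))" if "q \<in> Om_idx (n - 1)" for n q
    using that by (auto simp: Om_idx_def)
  show "Dom C (D'.Om_entry (nat (n - 1)) p q) = Om_smd D' n p \<and> Cod C (D'.Om_entry (nat (n - 1)) p q) = Om_smd D' (n - 1) q"
    if "p \<in> Om_idx n" "q \<in> Om_idx (n - 1)" "q \<le> p" for n p q
  proof -
    define m where "m = nat (n - 1)"
    have n: "n = int (Suc m)" "n - 1 = int m" using pos[OF that(2)] by (simp_all add: m_def)
    show ?thesis
      using D'.Om_entry_Hom[of p m q] that unfolding n(2) nat_int unfolding n(1) by simp
  qed
  show "Bd (Om C D') n \<cdot> dsum_inj C (Om_idx n) (Om_smd D' n) p =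
      arr_sum C (Om_smd D' n p) (Ob (Om C D') (n - 1))
        (\<lambda>q. dsum_inj C (Om_idx (n - 1)) (Om_smd D' (n - 1)) q \<cdot> D'.Om_entry (nat (n - 1)) p q)
        {q \<in> Om_idx (n - 1). q \<le> p}" if p: "p \<in> Om_idx n" for n p
  proof (cases "n \<le> 0")
    case True
    then have "is_zero_ob C (Ob (Om C D') (n - 1))" "{q \<in> Om_idx (n - 1). q \<le> p} = {}"
      by (auto intro!: zero_in_Om simp: Om_idx_def)
    then have z: "is_zero_ob C (Ob (Om C D') (n - 1))" and e: "{q \<in> Om_idx (n - 1). q \<le> p} = {}"
      by blast+
    have "Cod C (dsum_inj C (Om_idx n) (Om_smd D' n) p) = Dom C (Bd (Om C D') n)"
      "Dom C (dsum_inj C (Om_idx n) (Om_smd D' n) p) = Om_smd D' n p"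
      using p by (simp_all add: Ob_Om)
    then show ?thesis
      unfolding e sum_empty using z by (intro zero_ob_Zero[OF z]) simp_all
  next
    case False
    define m where "m = nat (n - 1)"
    have n: "n = int (Suc m)" "n - 1 = int m" using False by (simp_all add: m_def)
    show ?thesis
      using D'.Om_Bd_in[of p m] p unfolding n(2) nat_int unfolding n(1) Om_in_def .
  qed
  show "\<exists>y. Dom C y = Om_smd D' n p \<and> Cod C y = J \<and> y \<cdot> g (nat (n - int p)) = x"
    if "p \<in> Om_idx n" "Dom C x = Om_smd D n p" "Cod C x = J" for n p x
  proof -
    have "\<not> n - int p < 0" using that by (auto simp: Om_idx_def)
    then show ?thesis
      using conjunct1[OF spec[OF Hoch[unfolded rel_acyclic_def], of "n - int p"]] that
      by (simp add: Om_smd_def Hoch_def Ob_nonneg nonneg_map_def)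
  qed
  show "if p \<in> Om_idx (n - 1) then \<exists>z. Dom C z = Om_smd D' (n - 1) p \<and> Cod C z = J \<and>
          z \<cdot> g (nat (n - 1 - int p)) = Zero C (Om_smd D (n - 1) p) J \<and> y = z \<cdot> D'.Om_entry (nat (n - 1)) p p
        else y = Zero C (Om_smd D' n p) J"
    if p: "p \<in> Om_idx n" and y: "Dom C y = Om_smd D' n p" "Cod C y = J"
      and c: "y \<cdot> D'.Om_entry (nat (n + 1 - 1)) p p = Zero C (Om_smd D' (n + 1) p) J"
      and 0: "y \<cdot> g (nat (n - int p)) = Zero C (Om_smd D n p) J" for n p y
  proof -
    consider m where "n = int m" "p = 0" | m where "n = int (Suc m)" "p = 1"
    proof -
      have "p = 0 \<and> n = int (nat n) \<or> p = 1 \<and> n = int (Suc (nat (n - 1)))"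
        using p by (auto simp: Om_idx_def)
      then show thesis using that by blast
    qed
    then show ?thesis
    proof cases
      case (1 m)
      have n: "nat (1 + int m) = Suc m" "nat (int m - 1) = m - 1" "nat (1 + int k) = Suc k" for k by simp_all
      have "cocycle (Hoch C D') J (int m) y"
        using 1 y c n by (simp add: cocycle_def Hoch_def Ob_nonneg Bd_nonneg Om_smd_def D'.Om_entry_def add.commute)
      moreover have "y \<cdot> nonneg_map C g (int m) = Zero C (Ob (Hoch C D) (int m)) J"
        using 1 0 by (simp add: Hoch_def Ob_nonneg nonneg_map_def Om_smd_def)
      ultimately obtain z where z: "Dom C z = Ob (Hoch C D') (int m - 1)" "Cod C z = J"
        "z \<cdot> nonneg_map C g (int m - 1) = Zero C (Ob (Hoch C D) (int m - 1)) J" "y = z \<cdot> Bd (Hoch C D') (int m)"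
        using Hoch unfolding rel_acyclic_def by blast
      show ?thesis
      proof (cases m)
        case 0
        then have "y = Zero C (Om_smd D' n p) J"
          using z 1 by (simp add: Hoch_def Ob_nonneg Bd_nonneg Om_smd_def)
        then show ?thesis using 0 1 by (simp add: Om_idx_iff)
      next
        case (Suc k)
        then have "Dom C z = CX D' k" "z \<cdot> g k = Zero C (CX D k) J" "y = z \<cdot> Cb D' (Suc k)"
          using z n(3)[of k] by (simp_all add: Hoch_def Ob_nonneg Bd_nonneg nonneg_map_def nat_minus_1)
        then show ?thesis
          using z(2) 1 Suc by (auto simp: Om_smd_def Om_idx_iff D'.Om_entry_def)
      qed
    next
      case (2 m)
      have n: "nat (1 + int m) = Suc m" "nat (int m - 1) = m - 1" "nat (1 + int k) = Suc k" for k by simp_all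
      have Cb': "Dom C (Cb' D' (Suc m)) = CX D' (Suc m)" "Cod C (Cb' D' (Suc m)) = CX D' m" by simp_all
      have yt: "Dom C y = CX D' m" using 2 y by (simp add: Om_smd_def)
      have "scale C (- 1) (y \<cdot> Cb' D' (Suc m)) = Zero C (CX D' (Suc m)) J"
        using 2 y yt c n by (simp add: Om_smd_def D'.Om_entry_def)
      then have "y \<cdot> Cb' D' (Suc m) = Zero C (CX D' (Suc m)) J"
        using scale_eq_Zero_iff[of "y \<cdot> Cb' D' (Suc m)" _ _ 1] yt y by simp
      then have "cocycle (Bar C D') J (int m) y"
        using y yt n by (simp add: cocycle_def Bar_def Ob_nonneg Bd_nonneg add.commute)
      moreover have "y \<cdot> nonneg_map C g (int m) = Zero C (Ob (Bar C D) (int m)) J"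
        using 2 0 by (simp add: Bar_def Ob_nonneg nonneg_map_def Om_smd_def)
      ultimately obtain z where z: "Dom C z = Ob (Bar C D') (int m - 1)" "Cod C z = J"
        "z \<cdot> nonneg_map C g (int m - 1) = Zero C (Ob (Bar C D) (int m - 1)) J" "y = z \<cdot> Bd (Bar C D') (int m)"
        using Bar unfolding rel_acyclic_def by blast
      show ?thesis
      proof (cases m)
        case 0
        then have "y = Zero C (Om_smd D' n p) J"
          using z 2 by (simp add: Bar_def Ob_nonneg Bd_nonneg Om_smd_def)
        then show ?thesis using 0 2 by (simp add: Om_idx_iff)
      next
        case (Suc k)
        then have "Dom C z = CX D' k" "z \<cdot> g k = Zero C (CX D k) J" "y = z \<cdot> Cb' D' (Suc k)"
          using z n(3)[of k] by (simp_all add: Bar_def Ob_nonneg Bd_nonneg nonneg_map_def nat_minus_1)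
        \<comment> \<open>The diagonal entry is \<open>- b'\<close>, hence the sign of the
          primitive.\<close>
        then show ?thesis
          using z(2) 2 Suc n(3)[of k] by (auto simp: Om_smd_def Om_idx_iff D'.Om_entry_def intro!: exI[of _ "scale C (- 1) z"])
      qed
    qed
  qed
qed (simp_all add: Ob_Om Om_smd_def)

end

locale mixed_map = base_cat C + M: mixed C M + N: mixed C N
  for C :: "('o, 'm) tensor_cat" (structure) and M :: "('o, 'm, 'y) mixed_scheme" and N :: "('o, 'm, 'z) mixed_scheme" +
  fixes f :: "int \<Rightarrow> 'm"
  assumes f_chain_map: "chain_map C M N f"
    and f_Bop: "Bop N n \<cdot> f n = f (n + 1) \<cdot> Bop M n"
begin

lemma f_Hom [simp]: "Dom C (f n) = Ob M n" "Cod C (f n) = Ob N n"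
  and f_Bd: "Bd N n \<cdot> f n = f (n - 1) \<cdot> Bd M n"
  using f_chain_map by (simp_all add: chain_map_def)

abbreviation "F \<equiv> BB_map C M N f"

lemma BB_map_Hom [simp]: "Dom C (F n) = Ob (BB C M) n" "Cod C (F n) = Ob (BB C N) n"
  unfolding BB_map_def Ob_BB by (intro mat_Hom; simp add: BB_smd_def)+

lemma BB_map_in:
  assumes "p \<in> BB_idx n" "m = n - 2 * int p"
  shows "F n \<cdot> BB_in M n p = BB_in N n p \<cdot> f m"
  unfolding BB_map_def BB_in_def assms(2) using assms(1)
  by (intro mat_inj_diag) (simp_all add: BB_smd_def)

lemma BB_chain_map: "chain_map C (BB C M) (BB C N) F"
  unfolding chain_map_def
proof (intro conjI allI)
  fix n
  show "Bd (BB C N) n \<cdot> F n = F (n - 1) \<cdot> Bd (BB C M) n"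
  proof (rule BB_ext[where M = M and n = n])
    fix p assume p: "p \<in> BB_idx n"
    define m n1 q where defs: "m = n - 2 * int p" "n1 = n - 1" "q = p - 1"
    have q: "q \<in> BB_idx n1" "m + 1 = n1 - 2 * int q" if "0 < p"
      using that p by (auto simp: BB_idx_iff defs)
    have BM: "Bd (BB C M) n \<cdot> BB_in M n p =
      (if p \<in> BB_idx n1 then BB_in M n1 p \<cdot> Bd M m else Zero C (Ob M m) (Ob (BB C M) n1)) \<boxplus>
      (if 0 < p then BB_in M n1 q \<cdot> Bop M m else Zero C (Ob M m) (Ob (BB C M) n1))"
      unfolding defs(3) using p by (intro M.Bd_BB_in) (simp_all add: defs)
    have BN: "Bd (BB C N) n \<cdot> BB_in N n p =
      (if p \<in> BB_idx n1 then BB_in N n1 p \<cdot> Bd N m else Zero C (Ob N m) (Ob (BB C N) n1)) \<boxplus>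
      (if 0 < p then BB_in N n1 q \<cdot> Bop N m else Zero C (Ob N m) (Ob (BB C N) n1))"
      unfolding defs(3) using p by (intro N.Bd_BB_in) (simp_all add: defs)
    have Fp: "F n \<cdot> BB_in M n p = BB_in N n p \<cdot> f m" by (rule BB_map_in[OF p]) (simp add: defs)
    have F1: "F n1 \<cdot> BB_in M n1 p = BB_in N n1 p \<cdot> f (m - 1)" if "p \<in> BB_idx n1"
      by (rule BB_map_in[OF that]) (simp add: defs)
    have F2: "F n1 \<cdot> BB_in M n1 q = BB_in N n1 q \<cdot> f (m + 1)" if "0 < p"
      by (rule BB_map_in[OF q[OF that]])
    have tp: "Dom C (BB_in M n1 p) = Ob M (m - 1)" "Dom C (BB_in N n1 p) = Ob N (m - 1)"
      "Cod C (BB_in M n1 p) = Ob (BB C M) n1" "Cod C (BB_in N n1 p) = Ob (BB C N) n1" if "p \<in> BB_idx n1"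
      using that by (simp_all add: defs algebra_simps)
    have tq: "Dom C (BB_in M n1 q) = Ob M (m + 1)" "Dom C (BB_in N n1 q) = Ob N (m + 1)"
      "Cod C (BB_in M n1 q) = Ob (BB C M) n1" "Cod C (BB_in N n1 q) = Ob (BB C N) n1" if "0 < p"
      using q[OF that] by simp_all
    have tn: "Dom C (BB_in N n p) = Ob N m" "Cod C (BB_in N n p) = Ob (BB C N) n"
      using p by (simp_all add: defs)
    note BB_in_Hom [simp del]
    let ?z = "Zero C (Ob M m) (Ob (BB C N) n1)"
    have A: "(BB_in N n1 p \<cdot> Bd N m) \<cdot> f m = F n1 \<cdot> (BB_in M n1 p \<cdot> Bd M m)" if "p \<in> BB_idx n1"
    proof -
      have "(BB_in N n1 p \<cdot> Bd N m) \<cdot> f m = (BB_in N n1 p \<cdot> f (m - 1)) \<cdot> Bd M m"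
        using tp[OF that] by (simp add: f_Bd)
      also have "\<dots> = F n1 \<cdot> (BB_in M n1 p \<cdot> Bd M m)"
        unfolding F1[OF that, symmetric] using tp[OF that] by simp
      finally show ?thesis .
    qed
    have B: "(BB_in N n1 q \<cdot> Bop N m) \<cdot> f m = F n1 \<cdot> (BB_in M n1 q \<cdot> Bop M m)" if "0 < p"
    proof -
      have "(BB_in N n1 q \<cdot> Bop N m) \<cdot> f m = (BB_in N n1 q \<cdot> f (m + 1)) \<cdot> Bop M m"
        using tq[OF that] by (simp add: f_Bop)
      also have "\<dots> = F n1 \<cdot> (BB_in M n1 q \<cdot> Bop M m)"
        unfolding F2[OF that, symmetric] using tq[OF that] by simp
      finally show ?thesis .
    qed
    have "Bd (BB C N) n \<cdot> (F n \<cdot> BB_in M n p) = (Bd (BB C N) n \<cdot> BB_in N n p) \<cdot> f m"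
      unfolding Fp using tn by simp
    also have "\<dots> = F n1 \<cdot> (Bd (BB C M) n \<cdot> BB_in M n p)"
      unfolding BN BM using A B tp tq
      by (cases "p \<in> BB_idx n1"; cases "0 < p") (simp_all del: comp_assoc)
    finally have "Bd (BB C N) n \<cdot> (F n \<cdot> BB_in M n p) = F n1 \<cdot> (Bd (BB C M) n \<cdot> BB_in M n p)" .
    then show "(Bd (BB C N) n \<cdot> F n) \<cdot> BB_in M n p = (F (n - 1) \<cdot> Bd (BB C M) n) \<cdot> BB_in M n p"
      using p by (simp add: defs BB_in_Hom)
  qed simp_all
qed (simp_all add: M.BB_chain_complex N.BB_chain_complex)

lemma BB_map_Sop: "Sop (BB C N) n \<cdot> F n = F (n - 2) \<cdot> Sop (BB C M) n"
proof (rule BB_ext[where M = M and n = n])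
  fix p assume p: "p \<in> BB_idx n"
  define m n2 q where defs: "m = n - 2 * int p" "n2 = n - 2" "q = p - 1"
  have q: "q \<in> BB_idx n2" "m = n2 - 2 * int q" if "0 < p"
    using that p by (auto simp: BB_idx_iff defs)
  have SM: "Sop (BB C M) n \<cdot> BB_in M n p = (if 0 < p then BB_in M n2 q else Zero C (Ob M m) (Ob (BB C M) n2))"
    unfolding defs(3) using p by (intro M.Sop_BB_in) (simp_all add: defs)
  have SN: "Sop (BB C N) n \<cdot> BB_in N n p = (if 0 < p then BB_in N n2 q else Zero C (Ob N m) (Ob (BB C N) n2))"
    unfolding defs(3) using p by (intro N.Sop_BB_in) (simp_all add: defs)
  have Fp: "F n \<cdot> BB_in M n p = BB_in N n p \<cdot> f m" by (rule BB_map_in[OF p]) (simp add: defs)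
  have F2: "F n2 \<cdot> BB_in M n2 q = BB_in N n2 q \<cdot> f m" if "0 < p"
    by (rule BB_map_in[OF q[OF that]])
  have tn: "Dom C (BB_in N n p) = Ob N m" "Cod C (BB_in N n p) = Ob (BB C N) n"
    using p by (simp_all add: defs)
  have "Sop (BB C N) n \<cdot> (F n \<cdot> BB_in M n p) = (Sop (BB C N) n \<cdot> BB_in N n p) \<cdot> f m"
    unfolding Fp using tn by (simp del: BB_in_Hom)
  also have "\<dots> = F n2 \<cdot> (Sop (BB C M) n \<cdot> BB_in M n p)"
    unfolding SN SM using F2 by (cases "0 < p") simp_all
  finally show "(Sop (BB C N) n \<cdot> F n) \<cdot> BB_in M n p = (F (n - 2) \<cdot> Sop (BB C M) n) \<cdot> BB_in M n p"
    using p by (simp add: defs)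
qed simp_all

text \<open>Summand \<open>p\<close> in degree \<open>n\<close> is the mixed complex in degree
  \<open>n - 2 p\<close> with diagonal entry \<open>b\<close>; the operator B leads from
  \<open>p\<close> to \<open>p - 1\<close>, below the diagonal.\<close>

lemma rel_acyclic_BB:
  assumes f: "rel_acyclic M N f J"
  shows "rel_acyclic (BB C M) (BB C N) F J"
proof (rule rel_acyclic_triangular[where I = BB_idx and SX = "BB_smd M" and SY = "BB_smd N"
      and g = "\<lambda>n p. f (n - 2 * int p)" and R = "\<lambda>p q. p = q \<or> p = Suc q" and \<phi> = N.BB_entry])
  show "chain_map C (BB C M) (BB C N) F" by (rule BB_chain_map)
  show "p \<in> BB_idx (n - 1) \<Longrightarrow> p \<in> BB_idx n" for n p by (simp add: BB_idx_iff)
  show "F n \<cdot> dsum_inj C (BB_idx n) (BB_smd M n) p = dsum_inj C (BB_idx n) (BB_smd N n) p \<cdot> f (n - 2 * int p)"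
    if "p \<in> BB_idx n" for n p
    using BB_map_in[OF that] by (simp add: BB_in_def)
  show "Dom C (N.BB_entry n p q) = BB_smd N n p \<and> Cod C (N.BB_entry n p q) = BB_smd N (n - 1) q"
    if "p = q \<or> p = Suc q" for n p q
    by (rule N.BB_entry_Hom[OF that])
  show "Bd (BB C N) n \<cdot> dsum_inj C (BB_idx n) (BB_smd N n) p =
      arr_sum C (BB_smd N n p) (Ob (BB C N) (n - 1))
        (\<lambda>q. dsum_inj C (BB_idx (n - 1)) (BB_smd N (n - 1)) q \<cdot> N.BB_entry n p q)
        {q \<in> BB_idx (n - 1). p = q \<or> p = Suc q}" if "p \<in> BB_idx n" for n p
    unfolding N.Bd_BB Ob_BB using that by (intro mat_inj_sum N.BB_entry_Hom) simp_all
  show "\<exists>y. Dom C y = BB_smd N n p \<and> Cod C y = J \<and> y \<cdot> f (n - 2 * int p) = x"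
    if "Dom C x = BB_smd M n p" "Cod C x = J" for n p x
    using f that unfolding rel_acyclic_def BB_smd_def by blast
  show "if p \<in> BB_idx (n - 1) then \<exists>z. Dom C z = BB_smd N (n - 1) p \<and> Cod C z = J \<and>
          z \<cdot> f (n - 1 - 2 * int p) = Zero C (BB_smd M (n - 1) p) J \<and> y = z \<cdot> N.BB_entry n p p
        else y = Zero C (BB_smd N n p) J"
    if p: "p \<in> BB_idx n" and y: "Dom C y = BB_smd N n p" "Cod C y = J"
      and c: "y \<cdot> N.BB_entry (n + 1) p p = Zero C (BB_smd N (n + 1) p) J"
      and 0: "y \<cdot> f (n - 2 * int p) = Zero C (BB_smd M n p) J" for n p y
  proof -
    define m where "m = n - 2 * int p"
    have m: "n - 1 - 2 * int p = m - 1" "n + 1 - 2 * int p = m + 1" by (simp_all add: m_def)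
    have "cocycle N J m y"
      using y c by (simp add: cocycle_def BB_smd_def N.BB_entry_def m m_def[symmetric])
    moreover have "y \<cdot> f m = Zero C (Ob M m) J"
      using 0 by (simp add: BB_smd_def m_def)
    ultimately obtain z where z: "Dom C z = Ob N (m - 1)" "Cod C z = J" "z \<cdot> f (m - 1) = Zero C (Ob M (m - 1)) J"
      "y = z \<cdot> Bd N m"
      using f unfolding rel_acyclic_def by blast
    show ?thesis
    proof (cases "p \<in> BB_idx (n - 1)")
      case True
      then show ?thesis
        using z by (auto simp: BB_smd_def N.BB_entry_def m m_def[symmetric])
    next
      case False
      \<comment> \<open>Summand \<open>p\<close> is absent one degree below only if
        \<open>m - 1\<close> is negative; then \<open>y\<close> factors through a zero
        object.\<close>
      then have "is_zero_ob C (Ob N (m - 1))"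
        using p by (intro N.neg) (simp add: BB_idx_iff m_def)
      then have "y = Zero C (Ob N m) J"
        using zero_ob_comp[of "Ob N (m - 1)" "Bd N m" z] z by simp
      then show ?thesis using False by (simp add: BB_smd_def m_def)
    qed
  qed
qed (auto simp: Ob_BB BB_smd_def)

end

subsection \<open>Words in an ideal and its algebra\<close>

context base_cat begin

lemma tens_obs_append [simp]: "tens_obs C (xs @ ys) = tens_obs C xs \<odot> tens_obs C ys"
  by (induction xs) simp_all

lemma sandwich:
  "Cod C g = Dom C f \<Longrightarrow> (Idn C a \<boxtimes> f \<boxtimes> Idn C b) \<cdot> (Idn C a \<boxtimes> g \<boxtimes> Idn C b) = Idn C a \<boxtimes> (f \<cdot> g) \<boxtimes> Idn C b"
  by (simp add: interchange)

lemma monic_Idn: "monic C (Idn C a)"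
  unfolding monic_def by (metis Dom_Idn Idn_comp)

lemma monicD:
  "\<lbrakk>monic C f; Cod C g = Dom C f; Cod C h = Dom C f; Dom C g = Dom C h; f \<cdot> g = f \<cdot> h\<rbrakk> \<Longrightarrow> g = h"
  unfolding monic_def by blast

text \<open>Inverting all symmetries in the assumed hexagon gives the other one.\<close>

lemma Symm_tensor_left:
  "Symm C (a \<odot> b) c = (Symm C a c \<boxtimes> Idn C b) \<cdot> (Idn C a \<boxtimes> Symm C b c)"
proof -
  let ?g = "(Symm C a c \<boxtimes> Idn C b) \<cdot> (Idn C a \<boxtimes> Symm C b c)"
  let ?h = "Symm C c (a \<odot> b)"
  have h: "?h = (Idn C a \<boxtimes> Symm C c b) \<cdot> (Symm C c a \<boxtimes> Idn C b)"
    by (rule Symm_tensor)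
  have "?h \<cdot> ?g = (Idn C a \<boxtimes> Symm C c b) \<cdot> (((Symm C c a \<boxtimes> Idn C b) \<cdot> (Symm C a c \<boxtimes> Idn C b)) \<cdot>
      (Idn C a \<boxtimes> Symm C b c))"
    unfolding h by simp
  also have "\<dots> = Idn C (a \<odot> b \<odot> c)"
    by (simp add: interchange Idn_tensor)
  finally have hg: "?h \<cdot> ?g = Idn C (a \<odot> b \<odot> c)" .
  have "Symm C (a \<odot> b) c = Symm C (a \<odot> b) c \<cdot> Idn C (a \<odot> b \<odot> c)"
    by (rule comp_Idn[symmetric]) simp
  also have "\<dots> = (Symm C (a \<odot> b) c \<cdot> ?h) \<cdot> ?g"
    unfolding hg[symmetric] by (rule comp_assoc[symmetric]) simp_all
  also have "\<dots> = ?g"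
    unfolding Symm_Symm by (rule Idn_comp) simp
  finally show ?thesis .
qed

text \<open>The induction step for powers of the rotation: moving the last factor to the front, and
  then the one that has become last, moves both at once. It follows from both hexagons and
  naturality of the symmetry.\<close>

lemma Symm_shift:
  "Symm C (c \<odot> a) b \<cdot> Symm C (a \<odot> b) c = Symm C a (b \<odot> c)"
proof -
  have "Symm C (c \<odot> a) b \<cdot> Symm C (a \<odot> b) c =
      ((Symm C c b \<boxtimes> Idn C a) \<cdot> (Idn C c \<boxtimes> Symm C a b)) \<cdot> Symm C (a \<odot> b) c"
    by (simp only: Symm_tensor_left)
  also have "\<dots> = (Symm C c b \<boxtimes> Idn C a) \<cdot> ((Idn C c \<boxtimes> Symm C a b) \<cdot> Symm C (a \<odot> b) c)"
    by simp
  also have "(Idn C c \<boxtimes> Symm C a b) \<cdot> Symm C (a \<odot> b) c = Symm C (b \<odot> a) c \<cdot> (Symm C a b \<boxtimes> Idn C c)"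
    by (rule Symm_natural[symmetric]) simp_all
  also have "(Symm C c b \<boxtimes> Idn C a) \<cdot> (Symm C (b \<odot> a) c \<cdot> (Symm C a b \<boxtimes> Idn C c)) =
      (((Symm C c b \<boxtimes> Idn C a) \<cdot> (Symm C b c \<boxtimes> Idn C a)) \<cdot> (Idn C b \<boxtimes> Symm C a c)) \<cdot> (Symm C a b \<boxtimes> Idn C c)"
    unfolding Symm_tensor_left[of b a c] by simp
  also have "\<dots> = (Idn C b \<boxtimes> Symm C a c) \<cdot> (Symm C a b \<boxtimes> Idn C c)"
    by (simp add: interchange Idn_tensor)
  also have "\<dots> = Symm C a (b \<odot> c)" by (rule Symm_tensor[symmetric])
  finally show ?thesis .
qed

end

lemma length_merge [simp]: "Suc j < length w \<Longrightarrow> length (merge j w) = length w - 1"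
  by (simp add: merge_def)

locale cof_pair = base_cat C for C :: "('o, 'm) tensor_cat" (structure) +
  fixes K A :: "('o, 'm) alg" and i :: 'm
  assumes cof_ideal: "cof_ideal C K A i"
begin

lemma ideal: "two_sided_ideal C K A i" and i_cof: "cofibration C i" and i_map: "algebra_map C K A i"
  and i_monic: "monic C i"
  using cof_ideal by (simp_all add: cof_ideal_def two_sided_ideal_def)

lemma algK: "algebra C K" and algA: "algebra C A" and i_Mul: "i \<cdot> Mul K = Mul A \<cdot> (i \<boxtimes> i)"
  using i_map by (simp_all add: algebra_map_def)

lemma i_Hom [simp]: "Dom C i = Und K" "Cod C i = Und A"
  using i_map by (simp_all add: algebra_map_def)

lemma Mul_Hom [simp]: "Dom C (Mul K) = Und K \<odot> Und K" "Cod C (Mul K) = Und K"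
  "Dom C (Mul A) = Und A \<odot> Und A" "Cod C (Mul A) = Und A"
  using algK algA by (simp_all add: algebra_def)

abbreviation "ob \<equiv> pair_ob K A"
abbreviation "mu \<equiv> pair_mul C K A i"
abbreviation "W \<equiv> word_ob C K A"
abbreviation "incl \<equiv> word_incl C K A i"
abbreviation "wface \<equiv> word_face C K A i"
abbreviation "wrot \<equiv> word_rot C K A"

definition inc :: "bool \<Rightarrow> bool \<Rightarrow> 'm" where
  "inc u v = (if u = v then Idn C (ob u) else i)"

lemma ob_simps [simp]: "ob True = Und A" "ob False = Und K"
  by (simp_all add: pair_ob_def)

lemma inc_Hom [simp]: "u \<le> v \<Longrightarrow> Dom C (inc u v) = ob u" "u \<le> v \<Longrightarrow> Cod C (inc u v) = ob v"
  by (cases u; cases v; simp add: inc_def)+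

lemma inc_refl [simp]: "inc u u = Idn C (ob u)"
  by (simp add: inc_def)

lemma inc_inc: "u \<le> v \<Longrightarrow> v \<le> w \<Longrightarrow> inc v w \<cdot> inc u v = inc u w"
  by (cases u; cases v; cases w; simp add: inc_def)

lemma inc_monic: "u \<le> v \<Longrightarrow> monic C (inc u v)"
  by (cases u; cases v; simp add: inc_def i_monic monic_Idn)

lemma is_left_mult_THE: "is_left_mult C K A i (THE l. is_left_mult C K A i l)"
proof (rule theI')
  obtain l where l: "is_left_mult C K A i l"
    using ideal unfolding two_sided_ideal_def by blast
  moreover have "l' = l" if "is_left_mult C K A i l'" for l'
    using that l unfolding is_left_mult_def by - (rule monicD[OF i_monic], simp_all)
  ultimately show "\<exists>!l. is_left_mult C K A i l" by blast
qed

lemma is_right_mult_THE: "is_right_mult C K A i (THE r. is_right_mult C K A i r)"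
proof (rule theI')
  obtain r where r: "is_right_mult C K A i r"
    using ideal unfolding two_sided_ideal_def by blast
  moreover have "r' = r" if "is_right_mult C K A i r'" for r'
    using that r unfolding is_right_mult_def by - (rule monicD[OF i_monic], simp_all)
  ultimately show "\<exists>!r. is_right_mult C K A i r" by blast
qed

lemma mu_same: "mu True True = Mul A" "mu False False = Mul K"
  by (simp_all add: pair_mul_def)

lemma mu_left: "is_left_mult C K A i (mu True False)" and mu_right: "is_right_mult C K A i (mu False True)"
  using is_left_mult_THE is_right_mult_THE by (simp_all add: pair_mul_def)

lemma mu_mixed:
  "Dom C (mu True False) = Und A \<odot> Und K" "Cod C (mu True False) = Und K"
  "i \<cdot> mu True False = Mul A \<cdot> (Idn C (Und A) \<boxtimes> i)"
  "Dom C (mu False True) = Und K \<odot> Und A" "Cod C (mu False True) = Und K"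
  "i \<cdot> mu False True = Mul A \<cdot> (i \<boxtimes> Idn C (Und A))"
  using mu_left mu_right unfolding is_left_mult_def is_right_mult_def in_Hom by blast+

lemma mu_Hom [simp]: "Dom C (mu u v) = ob u \<odot> ob v" "Cod C (mu u v) = ob (u \<and> v)"
  by (cases u; cases v; simp add: mu_same mu_mixed)+

text \<open>After inclusion into \<open>A\<close> all four multiplications become that of
  \<open>A\<close>. Since the inclusion is monic, naturality (\<open>inc_mu\<close>) and mixed
  associativity (\<open>mu_assoc\<close>) reduce to identities in \<open>A\<close>.\<close>

lemma top_mu: "inc (u \<and> v) True \<cdot> mu u v = Mul A \<cdot> (inc u True \<boxtimes> inc v True)"
  by (cases u; cases v; simp add: mu_same mu_mixed i_Mul inc_def Idn_tensor)

lemma inc_mu: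
  assumes "u \<le> u'" "v \<le> v'"
  shows "inc (u \<and> v) (u' \<and> v') \<cdot> mu u v = mu u' v' \<cdot> (inc u u' \<boxtimes> inc v v')"
proof (rule monicD[OF inc_monic[of "u' \<and> v'" True]])
  have le: "(u \<and> v) \<le> (u' \<and> v')" using assms by auto
  have "inc (u' \<and> v') True \<cdot> inc (u \<and> v) (u' \<and> v') \<cdot> mu u v = (inc (u' \<and> v') True \<cdot> inc (u \<and> v) (u' \<and> v')) \<cdot> mu u v"
    using le by simp
  also have "\<dots> = Mul A \<cdot> (inc u True \<boxtimes> inc v True)"
    using le by (simp add: inc_inc top_mu)
  also have "inc u True \<boxtimes> inc v True = (inc u' True \<boxtimes> inc v' True) \<cdot> (inc u u' \<boxtimes> inc v v')"
    using assms by (simp add: interchange inc_inc)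
  also have "Mul A \<cdot> \<dots> = (Mul A \<cdot> (inc u' True \<boxtimes> inc v' True)) \<cdot> (inc u u' \<boxtimes> inc v v')"
    using assms by simp
  also have "\<dots> = inc (u' \<and> v') True \<cdot> mu u' v' \<cdot> (inc u u' \<boxtimes> inc v v')"
    unfolding top_mu[symmetric] using assms by simp
  finally show "inc (u' \<and> v') True \<cdot> inc (u \<and> v) (u' \<and> v') \<cdot> mu u v =
      inc (u' \<and> v') True \<cdot> mu u' v' \<cdot> (inc u u' \<boxtimes> inc v v')" .
qed (use assms in auto)

lemma MulA_assoc: "Mul A \<cdot> (Mul A \<boxtimes> Idn C (Und A)) = Mul A \<cdot> (Idn C (Und A) \<boxtimes> Mul A)"
  using algA by (simp add: algebra_def)

lemma mu_assoc: "mu (u \<and> v) w \<cdot> (mu u v \<boxtimes> Idn C (ob w)) = mu u (v \<and> w) \<cdot> (Idn C (ob u) \<boxtimes> mu v w)"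
proof (rule monicD[OF inc_monic[of "u \<and> v \<and> w" True]])
  let ?t = "\<lambda>u. inc u True"
  have "?t (u \<and> v \<and> w) \<cdot> mu (u \<and> v) w \<cdot> (mu u v \<boxtimes> Idn C (ob w)) =
      (?t ((u \<and> v) \<and> w) \<cdot> mu (u \<and> v) w) \<cdot> (mu u v \<boxtimes> Idn C (ob w))"
    by (simp add: conj_assoc)
  also have "\<dots> = Mul A \<cdot> ((?t (u \<and> v) \<boxtimes> ?t w) \<cdot> (mu u v \<boxtimes> Idn C (ob w)))"
    unfolding top_mu by simp
  also have "(?t (u \<and> v) \<boxtimes> ?t w) \<cdot> (mu u v \<boxtimes> Idn C (ob w)) = (Mul A \<boxtimes> Idn C (Und A)) \<cdot> ((?t u \<boxtimes> ?t v) \<boxtimes> ?t w)"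
    by (subst (1 2) interchange) (simp_all add: top_mu)
  also have "Mul A \<cdot> \<dots> = (Mul A \<cdot> (Mul A \<boxtimes> Idn C (Und A))) \<cdot> (?t u \<boxtimes> ?t v \<boxtimes> ?t w)"
    by simp
  also have "\<dots> = Mul A \<cdot> ((Idn C (Und A) \<boxtimes> Mul A) \<cdot> (?t u \<boxtimes> (?t v \<boxtimes> ?t w)))"
    unfolding MulA_assoc by simp
  also have "(Idn C (Und A) \<boxtimes> Mul A) \<cdot> (?t u \<boxtimes> (?t v \<boxtimes> ?t w)) = (?t u \<boxtimes> ?t (v \<and> w)) \<cdot> (Idn C (ob u) \<boxtimes> mu v w)"
    by (subst (1 2) interchange) (simp_all add: top_mu)
  also have "Mul A \<cdot> \<dots> = (?t (u \<and> v \<and> w) \<cdot> mu u (v \<and> w)) \<cdot> (Idn C (ob u) \<boxtimes> mu v w)"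
    unfolding top_mu by simp
  also have "\<dots> = ?t (u \<and> v \<and> w) \<cdot> mu u (v \<and> w) \<cdot> (Idn C (ob u) \<boxtimes> mu v w)"
    by simp
  finally show "?t (u \<and> v \<and> w) \<cdot> mu (u \<and> v) w \<cdot> (mu u v \<boxtimes> Idn C (ob w)) =
      ?t (u \<and> v \<and> w) \<cdot> mu u (v \<and> w) \<cdot> (Idn C (ob u) \<boxtimes> mu v w)" .
qed (simp_all add: conj_assoc)

subsubsection \<open>Operators on words\<close>

lemma W_simps [simp]: "W [] = Unit C" "W (u # w) = ob u \<odot> W w" "W (v @ w) = W v \<odot> W w"
  by (simp_all add: word_ob_def word_obs_def)

lemma incl_Nil [simp]: "incl [] [] = Idn C (Unit C)"
  by (simp add: word_incl_def)

lemma incl_Cons [simp]: "incl (u # w) (v # w') = inc u v \<boxtimes> incl w w'"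
  by (simp add: word_incl_def inc_def)

lemma incl_append: "length v = length v' \<Longrightarrow> incl (v @ w) (v' @ w') = incl v v' \<boxtimes> incl w w'"
  by (induction v v' rule: list_induct2) simp_all

lemma incl_Hom [simp]:
  assumes "list_all2 (\<le>) w w'" shows "Dom C (incl w w') = W w" "Cod C (incl w w') = W w'"
  using assms by (induction rule: list_all2_induct) simp_all

lemma incl_refl [simp]: "incl w w = Idn C (W w)"
  by (induction w) (simp_all add: Idn_tensor)

lemma incl_incl:
  assumes "list_all2 (\<le>) w w'" "list_all2 (\<le>) w' w''"
  shows "incl w' w'' \<cdot> incl w w' = incl w w''"
  using assms
proof (induction arbitrary: w'' rule: list_all2_induct)
  case (Cons u w v w')
  then obtain x y where "w'' = x # y" "v \<le> x" "list_all2 (\<le>) w' y"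
    unfolding list_all2_Cons1 by blast
  then show ?case using Cons by (simp add: interchange inc_inc)
qed simp

lemma all2_le_refl [simp]: "list_all2 (\<le>) w w" for w :: "bool list"
  by (simp add: list_all2_refl)

lemma all2_le_trans: "list_all2 (\<le>) w w' \<Longrightarrow> list_all2 (\<le>) w' w'' \<Longrightarrow> list_all2 (\<le>) w w''" for w :: "bool list"
  by (rule list_all2_trans[of "(\<le>)" "(\<le>)" "(\<le>)"]) auto

lemma split_word:
  assumes "Suc j < length w"
  obtains a u v b where "w = a @ u # v # b" "length a = j"
  using assms id_take_nth_drop[of j w] Cons_nth_drop_Suc[of "Suc j" w]
  by (metis length_take less_SucI less_imp_le_nat min.absorb2 Suc_lessD)

lemma wface_split: "wface (a @ u # v # b) (length a) = Idn C (W a) \<boxtimes> mu u v \<boxtimes> Idn C (W b)"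
  by (simp add: word_face_def face_arr_def word_ob_def word_obs_def nth_append)

lemma merge_split: "merge (length a) (a @ u # v # b) = a @ (u \<and> v) # b"
  by (simp add: merge_def nth_append)

lemma length_rot [simp]: "w \<noteq> [] \<Longrightarrow> length (rot w) = length w"
  by (simp add: rot_def)

lemma wface_Hom [simp]:
  assumes "Suc j < length w" shows "Dom C (wface w j) = W w" "Cod C (wface w j) = W (merge j w)"
proof -
  obtain a u v b where w: "w = a @ u # v # b" "length a = j" using assms by (rule split_word)
  show "Dom C (wface w j) = W w" "Cod C (wface w j) = W (merge j w)"
    using wface_split[of a u v b] merge_split[of a u v b] w by simp_all
qed

text \<open>If the two pairs of letters overlap, this is associativity of the mixed multiplications;
  otherwise the faces act on disjoint factors and commute by interchange.\<close>

lemma wface_wface: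
  assumes "k < j" "Suc j < length w"
  shows "merge k (merge j w) = merge (j - 1) (merge k w)"
    and "wface (merge j w) k \<cdot> wface w j = wface (merge k w) (j - 1) \<cdot> wface w k"
proof -
  obtain a u v b where w: "w = a @ u # v # b" "length a = j" using assms by - (rule split_word)
  have "merge k (merge j w) = merge (j - 1) (merge k w) \<and>
      wface (merge j w) k \<cdot> wface w j = wface (merge k w) (j - 1) \<cdot> wface w k"
  proof (cases "Suc k = j")
    case True
    then obtain a' x where a: "a = a' @ [x]" "length a' = k"
      using w by (metis length_0_conv length_append_singleton nat.inject neq_Nil_conv rev_exhaust nat.distinct(1))
    have m1: "merge j w = a' @ x # (u \<and> v) # b" and m2: "merge k w = a' @ (x \<and> u) # v # b"
      using merge_split[of "a' @ [x]" u v b] merge_split[of a' x u "v # b"] w a True by simp_all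
    have f1: "wface w j = Idn C (W a') \<boxtimes> (Idn C (ob x) \<boxtimes> mu u v) \<boxtimes> Idn C (W b)"
      using wface_split[of "a' @ [x]" u v b] w a True by (simp flip: Idn_tensor)
    have f2: "wface w k = Idn C (W a') \<boxtimes> (mu x u \<boxtimes> Idn C (ob v)) \<boxtimes> Idn C (W b)"
      using wface_split[of a' x u "v # b"] w a by (simp flip: Idn_tensor)
    have f3: "wface (merge j w) k = Idn C (W a') \<boxtimes> mu x (u \<and> v) \<boxtimes> Idn C (W b)"
      using wface_split[of a' x "u \<and> v" b] a by (simp add: m1)
    have f4: "wface (merge k w) (j - 1) = Idn C (W a') \<boxtimes> mu (x \<and> u) v \<boxtimes> Idn C (W b)"
      using wface_split[of a' "x \<and> u" v b] a by (simp add: m2 flip: True)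
    have "merge k (merge j w) = merge (j - 1) (merge k w)"
    proof -
      have "j - 1 = k" using True by simp
      then show ?thesis
        unfolding m1 m2 using merge_split[of a' x "u \<and> v" b] merge_split[of a' "x \<and> u" v b] a
        by (simp add: conj_assoc)
    qed
    moreover have "wface (merge j w) k \<cdot> wface w j = wface (merge k w) (j - 1) \<cdot> wface w k"
    proof -
      have "wface (merge j w) k \<cdot> wface w j = Idn C (W a') \<boxtimes> (mu x (u \<and> v) \<cdot> (Idn C (ob x) \<boxtimes> mu u v)) \<boxtimes> Idn C (W b)"
        unfolding f1 f3 by (rule sandwich) simp
      also have "\<dots> = wface (merge k w) (j - 1) \<cdot> wface w k"
        unfolding f2 f4 mu_assoc[symmetric] by (rule sandwich[symmetric]) simp
      finally show ?thesis .
    qed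
    ultimately show ?thesis ..
  next
    case False
    then have "Suc k < length a" using assms w by simp
    then obtain c x y m where a: "a = c @ x # y # m" "length c = k" by (rule split_word)
    have m1: "merge j w = c @ x # y # m @ (u \<and> v) # b" and m2: "merge k w = c @ (x \<and> y) # m @ u # v # b"
      using merge_split[of a u v b] merge_split[of c x y "m @ u # v # b"] w a by simp_all
    have lj: "j - 1 = length (c @ (x \<and> y) # m)" using w a by simp
    have f1: "wface w j = Idn C (W c) \<boxtimes> Idn C (ob x \<odot> ob y) \<boxtimes> Idn C (W m) \<boxtimes> mu u v \<boxtimes> Idn C (W b)"
      using wface_split[of a u v b] w a by (simp flip: Idn_tensor)
    have f2: "wface w k = Idn C (W c) \<boxtimes> mu x y \<boxtimes> Idn C (W m) \<boxtimes> Idn C (ob u \<odot> ob v) \<boxtimes> Idn C (W b)"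
      using wface_split[of c x y "m @ u # v # b"] w a by (simp flip: Idn_tensor)
    have f3: "wface (merge j w) k = Idn C (W c) \<boxtimes> mu x y \<boxtimes> Idn C (W m) \<boxtimes> Idn C (ob (u \<and> v)) \<boxtimes> Idn C (W b)"
      using wface_split[of c x y "m @ (u \<and> v) # b"] a by (simp add: m1 flip: Idn_tensor)
    have f4: "wface (merge k w) (j - 1) = Idn C (W c) \<boxtimes> Idn C (ob (x \<and> y)) \<boxtimes> Idn C (W m) \<boxtimes> mu u v \<boxtimes> Idn C (W b)"
      using wface_split[of "c @ (x \<and> y) # m" u v b] unfolding m2 lj by (simp flip: Idn_tensor)
    have "merge k (merge j w) = merge (j - 1) (merge k w)"
      using merge_split[of c x y "m @ (u \<and> v) # b"] merge_split[of "c @ (x \<and> y) # m" u v b] a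
      unfolding m1 m2 lj by simp
    moreover have "wface (merge j w) k \<cdot> wface w j = wface (merge k w) (j - 1) \<cdot> wface w k"
      unfolding f1 f2 f3 f4 by (simp add: interchange)
    ultimately show ?thesis ..
  qed
  then show "merge k (merge j w) = merge (j - 1) (merge k w)"
    "wface (merge j w) k \<cdot> wface w j = wface (merge k w) (j - 1) \<cdot> wface w k" by simp_all
qed

text \<open>Naturality of the faces in the word, by which they descend to the colimit.\<close>

lemma wface_incl:
  assumes "list_all2 (\<le>) w w'" "Suc j < length w"
  shows "list_all2 (\<le>) (merge j w) (merge j w')"
    and "wface w' j \<cdot> incl w w' = incl (merge j w) (merge j w') \<cdot> wface w j"
proof -
  obtain a u v b where w: "w = a @ u # v # b" "length a = j" using assms by - (rule split_word)
  have "Suc j < length w'" using assms list_all2_lengthD by metis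
  then obtain a' u' v' b' where w': "w' = a' @ u' # v' # b'" "length a' = j" by (rule split_word)
  have le: "list_all2 (\<le>) a a'" "u \<le> u'" "v \<le> v'" "list_all2 (\<le>) b b'"
    using assms(1) w w' by (auto simp: list_all2_append)
  have m: "merge j w = a @ (u \<and> v) # b" "merge j w' = a' @ (u' \<and> v') # b'"
    using merge_split[of a u v b] merge_split[of a' u' v' b'] w w' by simp_all
  have le': "(u \<and> v) \<le> (u' \<and> v')" using le by auto
  then show "list_all2 (\<le>) (merge j w) (merge j w')"
    using le by (auto simp: m intro!: list_all2_appendI)
  have f: "wface w j = Idn C (W a) \<boxtimes> mu u v \<boxtimes> Idn C (W b)" "wface w' j = Idn C (W a') \<boxtimes> mu u' v' \<boxtimes> Idn C (W b')"
    using wface_split[of a u v b] wface_split[of a' u' v' b'] w w' by simp_all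
  have "incl w w' = incl a a' \<boxtimes> (inc u u' \<boxtimes> inc v v') \<boxtimes> incl b b'"
    using w w' by (simp add: incl_append)
  moreover have "incl (merge j w) (merge j w') = incl a a' \<boxtimes> inc (u \<and> v) (u' \<and> v') \<boxtimes> incl b b'"
    using w w' unfolding m by (subst incl_append) simp_all
  moreover have "(mu u' v' \<boxtimes> Idn C (W b')) \<cdot> ((inc u u' \<boxtimes> inc v v') \<boxtimes> incl b b') =
      (inc (u \<and> v) (u' \<and> v') \<boxtimes> incl b b') \<cdot> (mu u v \<boxtimes> Idn C (W b))"
    using le le' inc_mu[OF le(2,3)] by (subst (1 2) interchange) simp_all
  ultimately show "wface w' j \<cdot> incl w w' = incl (merge j w) (merge j w') \<cdot> wface w j"
    unfolding f using le le' by (simp only: interchange Dom_Idn Cod_Idn Dom_tensor Cod_tensor incl_Hom inc_Hom mu_Hom Idn_comp comp_Idn)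
qed

lemma wrot_snoc: "wrot (b @ [z]) = Symm C (W b) (ob z)" "rot (b @ [z]) = z # b"
  by (simp_all add: word_rot_def rot_arr_def word_obs_def word_ob_def butlast_append rot_def)

lemma wrot_Hom [simp]:
  assumes "w \<noteq> []" shows "Dom C (wrot w) = W w" "Cod C (wrot w) = W (rot w)"
  using assms by (cases w rule: rev_cases; simp add: wrot_snoc)+

lemma wrot_incl:
  assumes "list_all2 (\<le>) w w'" "w \<noteq> []"
  shows "list_all2 (\<le>) (rot w) (rot w')" and "wrot w' \<cdot> incl w w' = incl (rot w) (rot w') \<cdot> wrot w"
proof -
  obtain b z where w: "w = b @ [z]" using assms(2) by (metis rev_exhaust)
  have "w' \<noteq> []" using assms by auto
  then obtain b' z' where w': "w' = b' @ [z']" by (metis rev_exhaust)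
  have "length b = length b'" using list_all2_lengthD[OF assms(1)] w w' by simp
  then have le: "list_all2 (\<le>) b b'" "z \<le> z'" using assms(1) w w' by (auto simp: list_all2_append)
  then show "list_all2 (\<le>) (rot w) (rot w')" by (simp add: w w' wrot_snoc)
  show "wrot w' \<cdot> incl w w' = incl (rot w) (rot w') \<cdot> wrot w"
    using le \<open>length b = length b'\<close> by (simp add: w w' wrot_snoc incl_append Symm_natural)
qed

text \<open>The face acts inside the block that the last factor is moved past, so this is naturality
  of the symmetry.\<close>

lemma wface_wrot:
  assumes "0 < j" "Suc j < length w"
  shows "merge j (rot w) = rot (merge (j - 1) w)"
    and "wface (rot w) j \<cdot> wrot w = wrot (merge (j - 1) w) \<cdot> wface w (j - 1)"
proof -
  have "w \<noteq> []" using assms by auto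
  then obtain c z where wz: "w = c @ [z]" by (metis rev_exhaust)
  have "Suc (j - 1) < length c" using assms wz by simp
  then obtain a u v b where c: "c = a @ u # v # b" "length a = j - 1" by (rule split_word)
  have j: "j = length (z # a)" using c assms by simp
  have m: "merge (j - 1) w = (a @ (u \<and> v) # b) @ [z]"
    using merge_split[of a u v "b @ [z]"] c wz by simp
  have r: "rot w = (z # a) @ u # v # b" by (simp add: wz rot_def butlast_append c)
  show "merge j (rot w) = rot (merge (j - 1) w)"
  proof -
    have "merge j (rot w) = (z # a) @ (u \<and> v) # b" unfolding r j by (rule merge_split)
    then show ?thesis unfolding m wrot_snoc by simp
  qed
  have f1: "wface (rot w) j = Idn C (ob z) \<boxtimes> (Idn C (W a) \<boxtimes> mu u v \<boxtimes> Idn C (W b))"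
    unfolding r j wface_split by (simp flip: Idn_tensor)
  have f2: "wface w (j - 1) = (Idn C (W a) \<boxtimes> mu u v \<boxtimes> Idn C (W b)) \<boxtimes> Idn C (ob z)"
    using wface_split[of a u v "b @ [z]"] c wz by (simp flip: Idn_tensor)
  have r1: "wrot w = Symm C (W a \<odot> (ob u \<odot> ob v) \<odot> W b) (ob z)"
    using wrot_snoc(1)[of "a @ u # v # b" z] by (simp add: wz c)
  have r2: "wrot (merge (j - 1) w) = Symm C (W a \<odot> ob (u \<and> v) \<odot> W b) (ob z)"
    unfolding m wrot_snoc by simp
  show "wface (rot w) j \<cdot> wrot w = wrot (merge (j - 1) w) \<cdot> wface w (j - 1)"
    unfolding f1 f2 r1 r2 by (rule Symm_natural[symmetric]) simp_all
qed

text \<open>A power of the rotation on a word. The word, and with it the object, changes at each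
  step, so this is no power of a single arrow.\<close>

fun rots :: "nat \<Rightarrow> bool list \<Rightarrow> 'm" where
  "rots 0 w = Idn C (W w)"
| "rots (Suc k) w = wrot ((rot ^^ k) w) \<cdot> rots k w"

text \<open>By \<open>Symm_shift\<close> successive rotations amount to one exchange of blocks. For
  an empty block \<open>p\<close> the symmetry is the identity, which is the period of the
  rotation.\<close>

lemma rots_append: "length q = k \<Longrightarrow> (rot ^^ k) (p @ q) = q @ p \<and> rots k (p @ q) = Symm C (W p) (W q)"
proof (induction k arbitrary: p q)
  case 0 then show ?case by simp
next
  case (Suc k)
  then obtain z q' where q: "q = z # q'" "length q' = k" by (metis length_Suc_conv)
  have IH: "(rot ^^ k) ((p @ [z]) @ q') = q' @ (p @ [z])" "rots k ((p @ [z]) @ q') = Symm C (W (p @ [z])) (W q')"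
    using Suc.IH[OF q(2)] by blast+
  have "(rot ^^ Suc k) (p @ q) = q @ p"
    using IH(1) wrot_snoc(2)[of "q' @ p" z] q by simp
  moreover have "rots (Suc k) (p @ q) = Symm C (W q' \<odot> W p) (ob z) \<cdot> Symm C (W p \<odot> ob z) (W q')"
    using IH wrot_snoc(1)[of "q' @ p" z] q by simp
  ultimately show ?case
    using Symm_shift[of "W q'" "W p" "ob z"] q by simp
qed

lemma rots_length: "(rot ^^ length w) w = w" "rots (length w) w = Idn C (W w)"
  using rots_append[of w "length w" "[]"] by simp_all

end

lemma eq_replicate_True_iff: "w = replicate m True \<longleftrightarrow> length w = m \<and> False \<notin> set w"
  by (induction w arbitrary: m) (auto simp: length_Suc_conv Cons_replicate_eq)

lemma in_words_iff: "w \<in> words n \<longleftrightarrow> length w = Suc n \<and> False \<in> set w"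
  unfolding words_def by (auto simp: eq_replicate_True_iff simp del: replicate_Suc)

lemma Ex1_unique: "\<exists>!x. P x \<Longrightarrow> P a \<Longrightarrow> P b \<Longrightarrow> a = b"
  by blast

lemma finite_words: "finite (words n)"
  by (rule finite_subset[OF _ finite_lists_length_eq[of UNIV "Suc n"]]) (auto simp: in_words_iff)

context cof_pair begin

lemma merge_words:
  assumes "w \<in> words n" "j < n" shows "merge j w \<in> words (n - 1)"
proof -
  have "Suc j < length w" using assms by (simp add: in_words_iff)
  then obtain a u v b where w: "w = a @ u # v # b" "length a = j" by (rule split_word)
  then show ?thesis
    using assms merge_split[of a u v b] by (auto simp: in_words_iff)
qed

lemma rot_words: "w \<in> words n \<Longrightarrow> rot w \<in> words n"
  by (cases w rule: rev_cases) (auto simp: in_words_iff wrot_snoc)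

lemma words_nonempty: "w \<in> words n \<Longrightarrow> w \<noteq> []"
  by (auto simp: in_words_iff)

subsection \<open>The relative complex\<close>

abbreviation "rob \<equiv> rel_ob C K A i"
abbreviation "rin \<equiv> rel_in C K A i"

lemma rel_colim: "is_colimit C (words n) W (word_edges C K A i n) (rob n) (rin n)"
proof -
  have "word_edges C K A i n \<subseteq> (\<lambda>(w, w'). (w, incl w w', w')) ` (words n \<times> words n)"
    by (auto simp: word_edges_def)
  then have "finite (word_edges C K A i n)"
    by (rule finite_subset) (simp add: finite_words)
  moreover have "diagram C (words n) W (word_edges C K A i n)"
    unfolding diagram_def word_edges_def in_Hom using incl_Hom by blast
  ultimately have "\<exists>p. case p of (P, c) \<Rightarrow> is_colimit C (words n) W (word_edges C K A i n) P c"
    using finite_colimit[OF finite_words] by auto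
  then have "case rel_colim C K A i n of (P, c) \<Rightarrow> is_colimit C (words n) W (word_edges C K A i n) P c"
    unfolding rel_colim_def by (rule someI_ex)
  then show ?thesis by (simp add: rel_ob_def rel_in_def split_beta)
qed

lemma cocone_iff:
  "cocone C (words n) W (word_edges C K A i n) Q u \<longleftrightarrow>
    (\<forall>w\<in>words n. Dom C (u w) = W w \<and> Cod C (u w) = Q) \<and>
    (\<forall>w\<in>words n. \<forall>w'\<in>words n. list_all2 (\<le>) w w' \<longrightarrow> u w' \<cdot> incl w w' = u w)"
  unfolding cocone_def word_edges_def in_Hom by blast

lemma rin_Hom [simp]: "w \<in> words n \<Longrightarrow> Dom C (rin n w) = W w" "w \<in> words n \<Longrightarrow> Cod C (rin n w) = rob n"
  and rin_incl: "w \<in> words n \<Longrightarrow> w' \<in> words n \<Longrightarrow> list_all2 (\<le>) w w' \<Longrightarrow> rin n w' \<cdot> incl w w' = rin n w"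
  using rel_colim[of n] unfolding is_colimit_def cocone_iff by blast+

lemma rel_universal:
  "cocone C (words n) W (word_edges C K A i n) Q u \<Longrightarrow>
    \<exists>!h. h \<in> Hom C (rob n) Q \<and> (\<forall>w\<in>words n. h \<cdot> rin n w = u w)"
  using rel_colim[of n] unfolding is_colimit_def by (elim conjE allE impE)

lemma rel_desc:
  assumes "\<And>w. w \<in> words n \<Longrightarrow> Dom C (u w) = W w \<and> Cod C (u w) = Q"
    and "\<And>w w'. w \<in> words n \<Longrightarrow> w' \<in> words n \<Longrightarrow> list_all2 (\<le>) w w' \<Longrightarrow> u w' \<cdot> incl w w' = u w"
  obtains h where "Dom C h = rob n" "Cod C h = Q" "\<And>w. w \<in> words n \<Longrightarrow> h \<cdot> rin n w = u w"
proof -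
  have "cocone C (words n) W (word_edges C K A i n) Q u"
    unfolding cocone_iff
  proof (intro conjI ballI impI)
    fix w assume w: "w \<in> words n"
    show "Dom C (u w) = W w" "Cod C (u w) = Q" using assms(1)[OF w] by simp_all
  qed (rule assms(2))
  from ex1_implies_ex[OF rel_universal[OF this]]
  obtain h where h: "h \<in> Hom C (rob n) Q" "\<forall>w\<in>words n. h \<cdot> rin n w = u w"
    by (elim exE conjE)
  show thesis
    by (rule that[of h]) (use h(1) in simp, use h(1) in simp, rule bspec[OF h(2)])
qed

lemma rel_ext:
  assumes "Dom C f = rob n" "Dom C g = rob n" "Cod C f = Cod C g"
    and "\<And>w. w \<in> words n \<Longrightarrow> f \<cdot> rin n w = g \<cdot> rin n w"
  shows "f = g"
proof -
  have "cocone C (words n) W (word_edges C K A i n) (Cod C g) (\<lambda>w. g \<cdot> rin n w)"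
    unfolding cocone_iff
  proof (intro conjI ballI impI)
    fix w w' assume w: "w \<in> words n" "w' \<in> words n" "list_all2 (\<le>) w w'"
    show "(g \<cdot> rin n w') \<cdot> incl w w' = g \<cdot> rin n w"
      using assms(2) w(1,2) incl_Hom[OF w(3)] rin_incl[OF w] by simp
  qed (use assms(2) in simp_all)
  note u = rel_universal[OF this]
  have f: "f \<in> Hom C (rob n) (Cod C g)" and g: "g \<in> Hom C (rob n) (Cod C g)"
    unfolding in_Hom by (rule conjI, fact, fact, rule conjI, fact, rule refl)
  show ?thesis
    by (rule Ex1_unique[OF u conjI[OF f ballI[OF assms(4)]] conjI[OF g ballI[OF refl]]])
qed

lemma rel_induced_eqI:
  assumes "Dom C h = rob n" "Cod C h = rob m" "\<And>w. w \<in> words n \<Longrightarrow> h \<cdot> rin n w = u w"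
  shows "rel_induced C K A i n m u = h"
  unfolding rel_induced_def
proof (rule the_equality)
  show "h \<in> Hom C (rob n) (rob m) \<and> (\<forall>w\<in>words n. h \<cdot> rin n w = u w)" using assms by simp
  fix h' assume h': "h' \<in> Hom C (rob n) (rob m) \<and> (\<forall>w\<in>words n. h' \<cdot> rin n w = u w)"
  show "h' = h"
    by (rule rel_ext[where n = n]) (use h' assms in auto)
qed

lemma rel_induced:
  assumes "\<And>w. w \<in> words n \<Longrightarrow> Dom C (u w) = W w \<and> Cod C (u w) = rob m"
    and "\<And>w w'. w \<in> words n \<Longrightarrow> w' \<in> words n \<Longrightarrow> list_all2 (\<le>) w w' \<Longrightarrow> u w' \<cdot> incl w w' = u w"
  shows "Dom C (rel_induced C K A i n m u) = rob n" "Cod C (rel_induced C K A i n m u) = rob m"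
    "w \<in> words n \<Longrightarrow> rel_induced C K A i n m u \<cdot> rin n w = u w"
proof -
  obtain h where h: "Dom C h = rob n" "Cod C h = rob m" "\<And>w. w \<in> words n \<Longrightarrow> h \<cdot> rin n w = u w"
    using rel_desc[OF assms] by blast
  then have "rel_induced C K A i n m u = h" by (rule rel_induced_eqI)
  then show "Dom C (rel_induced C K A i n m u) = rob n" "Cod C (rel_induced C K A i n m u) = rob m"
    "w \<in> words n \<Longrightarrow> rel_induced C K A i n m u \<cdot> rin n w = u w" using h by simp_all
qed

definition rface :: "nat \<Rightarrow> nat \<Rightarrow> 'm" where
  "rface n j = rel_induced C K A i n (n - 1) (\<lambda>w. rin (n - 1) (merge j w) \<cdot> wface w j)"

lemma words_length: "w \<in> words n \<Longrightarrow> j < n \<Longrightarrow> Suc j < length w"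
  by (simp add: in_words_iff)

lemma
  assumes "j < n"
  shows rface_Hom [simp]: "Dom C (rface n j) = rob n" "Cod C (rface n j) = rob (n - 1)"
    and rface_in: "w \<in> words n \<Longrightarrow> rface n j \<cdot> rin n w = rin (n - 1) (merge j w) \<cdot> wface w j"
proof -
  let ?u = "\<lambda>w. rin (n - 1) (merge j w) \<cdot> wface w j"
  have 1: "Dom C (?u w) = W w \<and> Cod C (?u w) = rob (n - 1)" if "w \<in> words n" for w
    using words_length[OF that assms] merge_words[OF that assms] by simp
  have 2: "?u w' \<cdot> incl w w' = ?u w" if w: "w \<in> words n" "w' \<in> words n" and le: "list_all2 (\<le>) w w'" for w w'
  proof -
    note l = words_length[OF w(1) assms] words_length[OF w(2) assms]
    note m = merge_words[OF w(1) assms] merge_words[OF w(2) assms]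
    note f = wface_incl[OF le l(1)]
    have "?u w' \<cdot> incl w w' = rin (n - 1) (merge j w') \<cdot> (wface w' j \<cdot> incl w w')"
      using l m incl_Hom[OF le] by simp
    also have "\<dots> = (rin (n - 1) (merge j w') \<cdot> incl (merge j w) (merge j w')) \<cdot> wface w j"
      unfolding f(2) using l m incl_Hom[OF f(1)] by simp
    also have "\<dots> = ?u w" unfolding rin_incl[OF m f(1)] ..
    finally show ?thesis .
  qed
  show "Dom C (rface n j) = rob n" "Cod C (rface n j) = rob (n - 1)"
    "w \<in> words n \<Longrightarrow> rface n j \<cdot> rin n w = rin (n - 1) (merge j w) \<cdot> wface w j"
    unfolding rface_def by (rule rel_induced[OF 1 2]; assumption?)+
qed

abbreviation "rrot \<equiv> rel_rot C K A i"

lemma rrot_Hom [simp]: "Dom C (rrot n) = rob n" "Cod C (rrot n) = rob n"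
  and rrot_in: "w \<in> words n \<Longrightarrow> rrot n \<cdot> rin n w = rin n (rot w) \<cdot> wrot w"
proof -
  let ?u = "\<lambda>w. rin n (rot w) \<cdot> wrot w"
  have 1: "Dom C (?u w) = W w \<and> Cod C (?u w) = rob n" if "w \<in> words n" for w
    using rot_words[OF that] words_nonempty[OF that] by simp
  have 2: "?u w' \<cdot> incl w w' = ?u w" if w: "w \<in> words n" "w' \<in> words n" and le: "list_all2 (\<le>) w w'" for w w'
  proof -
    note m = rot_words[OF w(1)] rot_words[OF w(2)]
    note f = wrot_incl[OF le words_nonempty[OF w(1)]]
    have "?u w' \<cdot> incl w w' = rin n (rot w') \<cdot> (wrot w' \<cdot> incl w w')"
      using words_nonempty[OF w(2)] m incl_Hom[OF le] by simp
    also have "\<dots> = (rin n (rot w') \<cdot> incl (rot w) (rot w')) \<cdot> wrot w"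
      unfolding f(2) using words_nonempty[OF w(1)] m incl_Hom[OF f(1)] by simp
    also have "\<dots> = ?u w" unfolding rin_incl[OF m f(1)] ..
    finally show ?thesis .
  qed
  show "Dom C (rrot n) = rob n" "Cod C (rrot n) = rob n"
    "w \<in> words n \<Longrightarrow> rrot n \<cdot> rin n w = rin n (rot w) \<cdot> wrot w"
    unfolding rel_rot_def by (rule rel_induced[OF 1 2]; assumption?)+
qed

abbreviation "rel \<equiv> cyc_rel C K A i"

lemma rel_simps [simp]: "CX rel = rob" "Ct rel = rrot"
  by (simp_all add: cyc_rel_def)

text \<open>For identities of arrows out of a colimit: if \<open>g\<close> sends the leg of
  \<open>w\<close> to the leg of \<open>v\<close> along \<open>h\<close>, a further arrow
  \<open>f\<close> can be evaluated on the leg of \<open>v\<close>.\<close>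

lemma comp_in:
  assumes "w \<in> words n" "g \<cdot> rin n w = rin m v \<cdot> h" "v \<in> words m" "Cod C h = W v"
    and "Dom C f = rob m" "Dom C g = rob n" "Cod C g = rob m" "Dom C h = W w"
  shows "(f \<cdot> g) \<cdot> rin n w = (f \<cdot> rin m v) \<cdot> h"
  using assms by simp

lemma rsum_Hom:
  "Dom C (arr_sum C (rob n) (rob (n - 1)) (\<lambda>j. scale C ((- 1) ^ j) (rface n j)) {..<n}) = rob n"
  "Cod C (arr_sum C (rob n) (rob (n - 1)) (\<lambda>j. scale C ((- 1) ^ j) (rface n j)) {..<n}) = rob (n - 1)"
  by (rule Dom_sum Cod_sum; simp)+

lemma rsum_in:
  assumes w: "w \<in> words n" and n: "0 < n"
  shows "arr_sum C (rob n) (rob (n - 1)) (\<lambda>j. scale C ((- 1) ^ j) (rface n j)) {..<n} \<cdot> rin n w =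
    word_b' C K A i n w"
proof -
  have "arr_sum C (rob n) (rob (n - 1)) (\<lambda>j. scale C ((- 1) ^ j) (rface n j)) {..<n} \<cdot> rin n w =
      arr_sum C (W w) (rob (n - 1)) (\<lambda>j. scale C ((- 1) ^ j) (rface n j) \<cdot> rin n w) {..<n}"
    using w by (intro sum_comp) simp_all
  also have "\<dots> = word_b' C K A i n w"
    unfolding word_b'_def
  proof (rule sum_cong[OF refl])
    fix j assume "j \<in> {..<n}"
    then have j: "j < n" by simp
    note l = words_length[OF w j] and m = merge_words[OF w j]
    show "scale C ((- 1) ^ j) (rface n j) \<cdot> rin n w = scale C ((- 1) ^ j) (rin (n - 1) (merge j w) \<cdot> wface w j)"
      using rface_in[OF j w] w j by simp
    show "Dom C (scale C ((- 1) ^ j) (rin (n - 1) (merge j w) \<cdot> wface w j)) = W w"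
      "Cod C (scale C ((- 1) ^ j) (rin (n - 1) (merge j w) \<cdot> wface w j)) = rob (n - 1)"
      using l m by simp_all
  qed
  finally show ?thesis .
qed

text \<open>Every identity is one of arrows out of a colimit and is checked on the legs, where it
  becomes the corresponding identity for words.\<close>

sublocale R: precyclic C rel rface
proof
  fix k j n :: nat assume kj: "k < j" "j < n"
  have n1: "k < n - 1" "j - 1 < n - 1" "k < n" using kj by linarith+
  show "rface (n - 1) k \<cdot> rface n j = rface (n - 1) (j - 1) \<cdot> rface n k"
  proof (rule rel_ext[where n = n])
    fix w assume w: "w \<in> words n"
    note l = words_length[OF w kj(2)] words_length[OF w n1(3)]
    note m = merge_words[OF w kj(2)] merge_words[OF w n1(3)]
    note l' = words_length[OF m(1) n1(1)] words_length[OF m(2) n1(2)]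
    note m' = merge_words[OF m(1) n1(1)] merge_words[OF m(2) n1(2)]
    have "(rface (n - 1) k \<cdot> rface n j) \<cdot> rin n w = (rface (n - 1) k \<cdot> rin (n - 1) (merge j w)) \<cdot> wface w j"
      by (rule comp_in[OF w rface_in[OF kj(2) w] m(1)]) (use l kj n1 in simp_all)
    also have "\<dots> = rin (n - 1 - 1) (merge k (merge j w)) \<cdot> (wface (merge j w) k \<cdot> wface w j)"
      unfolding rface_in[OF n1(1) m(1)] using l l' m' by simp
    also have "\<dots> = rin (n - 1 - 1) (merge (j - 1) (merge k w)) \<cdot> (wface (merge k w) (j - 1) \<cdot> wface w k)"
      by (simp only: wface_wface[OF kj(1) l(1)])
    also have "\<dots> = (rface (n - 1) (j - 1) \<cdot> rin (n - 1) (merge k w)) \<cdot> wface w k"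
      unfolding rface_in[OF n1(2) m(2)] using l l' m' by simp
    also have "\<dots> = (rface (n - 1) (j - 1) \<cdot> rface n k) \<cdot> rin n w"
      by (rule comp_in[OF w rface_in[OF n1(3) w] m(2), symmetric]) (use l kj n1 in simp_all)
    finally show "(rface (n - 1) k \<cdot> rface n j) \<cdot> rin n w = (rface (n - 1) (j - 1) \<cdot> rface n k) \<cdot> rin n w" .
  qed (use kj n1 in simp_all)
next
  fix k n :: nat assume k: "0 < k" "k < n"
  then have k1: "k - 1 < n" by simp
  show "rface n k \<cdot> Ct rel n = Ct rel (n - 1) \<cdot> rface n (k - 1)"
  proof (rule rel_ext[where n = n])
    fix w assume w: "w \<in> words n"
    note r = rot_words[OF w]
    note l = words_length[OF w k(2)] words_length[OF r k(2)] words_length[OF w k1]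
    note m = merge_words[OF r k(2)] merge_words[OF w k1]
    have "(rface n k \<cdot> rrot n) \<cdot> rin n w = (rface n k \<cdot> rin n (rot w)) \<cdot> wrot w"
      by (rule comp_in[OF w rrot_in[OF w] r]) (use words_nonempty[OF w] k in simp_all)
    also have "\<dots> = rin (n - 1) (merge k (rot w)) \<cdot> (wface (rot w) k \<cdot> wrot w)"
      unfolding rface_in[OF k(2) r] using words_nonempty[OF w] l m by simp
    also have "\<dots> = rin (n - 1) (rot (merge (k - 1) w)) \<cdot> (wrot (merge (k - 1) w) \<cdot> wface w (k - 1))"
      by (simp only: wface_wrot[OF k(1) l(1)])
    also have "\<dots> = (rrot (n - 1) \<cdot> rin (n - 1) (merge (k - 1) w)) \<cdot> wface w (k - 1)"
      unfolding rrot_in[OF m(2)] using l m rot_words[OF m(2)] words_nonempty[OF m(2)] by simp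
    also have "\<dots> = (rrot (n - 1) \<cdot> rface n (k - 1)) \<cdot> rin n w"
      by (rule comp_in[OF w rface_in[OF k1 w] m(2), symmetric]) (use l k k1 in simp_all)
    finally show "(rface n k \<cdot> Ct rel n) \<cdot> rin n w = (Ct rel (n - 1) \<cdot> rface n (k - 1)) \<cdot> rin n w" by simp
  qed (use k k1 in simp_all)
next
  fix n
  let ?T = "\<lambda>k. ((\<lambda>g. Ct rel n \<cdot> g) ^^ k) (Idn C (CX rel n))"
  have T: "Dom C (?T k) = rob n \<and> Cod C (?T k) = rob n" for k
    by (induction k) simp_all
  \<comment> \<open>On the leg of \<open>w\<close>, powers of the induced rotation are given by
    \<open>rots\<close>, at the leg of the rotated word; after \<open>n + 1\<close> steps both
    return to the identity.\<close>
  have step: "(rot ^^ k) w \<in> words n \<and> Dom C (rots k w) = W w \<and> Cod C (rots k w) = W ((rot ^^ k) w) \<and>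
      ?T k \<cdot> rin n w = rin n ((rot ^^ k) w) \<cdot> rots k w" if w: "w \<in> words n" for k w
  proof (induction k)
    case 0 then show ?case using w by simp
  next
    case (Suc k)
    have "?T (Suc k) \<cdot> rin n w = rrot n \<cdot> (?T k \<cdot> rin n w)"
      using T w by simp
    also have "\<dots> = (rrot n \<cdot> rin n ((rot ^^ k) w)) \<cdot> rots k w"
      using Suc by simp
    also have "\<dots> = rin n ((rot ^^ Suc k) w) \<cdot> rots (Suc k) w"
      using Suc rrot_in[of "(rot ^^ k) w" n] rot_words[of "(rot ^^ k) w" n] words_nonempty[of "(rot ^^ k) w" n]
      by simp
    finally show ?case using Suc rot_words[of "(rot ^^ k) w" n] words_nonempty[of "(rot ^^ k) w" n] by simp
  qed
  show "?T (Suc n) = Idn C (CX rel n)"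
  proof (rule rel_ext[where n = n])
    fix w assume w: "w \<in> words n"
    then have "length w = Suc n" by (simp add: in_words_iff)
    then show "?T (Suc n) \<cdot> rin n w = Idn C (CX rel n) \<cdot> rin n w"
      using step[OF w, of "Suc n"] rots_length[of w] w by simp
  qed (use T[of "Suc n"] in simp_all)
next
  fix n :: nat assume n: "0 < n"
  show S: "Cb' rel n = arr_sum C (CX rel n) (CX rel (n - 1)) (\<lambda>j. scale C ((- 1) ^ j) (rface n j)) {..<n}"
    unfolding rel_simps by (simp only: cyc_rel_def cyc.simps, rule rel_induced_eqI[OF rsum_Hom rsum_in[OF _ n]])
  show "Cb rel n = Cb' rel n \<boxplus> scale C ((- 1) ^ n) (rface n 0 \<cdot> Ct rel n)"
  proof -
    have b': "Cb' rel n \<cdot> rin n w = word_b' C K A i n w" if w: "w \<in> words n" for w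
      using rsum_in[OF w n] unfolding S rel_simps .
    have t': "Dom C (Cb' rel n) = rob n" "Cod C (Cb' rel n) = rob (n - 1)"
      unfolding S rel_simps by (rule rsum_Hom)+
    have "rel_induced C K A i n (n - 1) (word_b C K A i n) =
        Cb' rel n \<boxplus> scale C ((- 1) ^ n) (rface n 0 \<cdot> rrot n)"
    proof (rule rel_induced_eqI)
      fix w assume w: "w \<in> words n"
      note r = rot_words[OF w]
      note l = words_length[OF r n] and m = merge_words[OF r n]
      have "(rface n 0 \<cdot> rrot n) \<cdot> rin n w = (rface n 0 \<cdot> rin n (rot w)) \<cdot> wrot w"
        by (rule comp_in[OF w rrot_in[OF w] r]) (use words_nonempty[OF w] n in simp_all)
      also have "\<dots> = rin (n - 1) (merge 0 (rot w)) \<cdot> wface (rot w) 0 \<cdot> wrot w"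
        unfolding rface_in[OF n r] using words_nonempty[OF w] l m by simp
      finally show "(Cb' rel n \<boxplus> scale C ((- 1) ^ n) (rface n 0 \<cdot> rrot n)) \<cdot> rin n w = word_b C K A i n w"
        using b'[OF w] w n t' by (simp add: word_b_def)
    qed (use n t' in simp_all)
    then show ?thesis by (simp add: cyc_rel_def)
  qed
qed simp_all

subsection \<open>The algebras as complexes of constant words\<close>

lemma W_replicate: "W (replicate m u) = tens_obs C (replicate m (ob u))"
  by (simp add: word_ob_def word_obs_def)

lemma merge_replicate: "j < n \<Longrightarrow> merge j (replicate (Suc n) u) = replicate n u"
proof -
  assume "j < n"
  then have "Suc n = j + Suc (Suc (n - j - 1))" "n = j + Suc (n - j - 1)" by simp_all
  then have "replicate (Suc n) u = replicate j u @ u # u # replicate (n - j - 1) u"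
    and "replicate n u = replicate j u @ u # replicate (n - j - 1) u"
    by (metis replicate_add replicate_Suc)+
  then show ?thesis using merge_split[of "replicate j u" u u "replicate (n - j - 1) u"] by (simp del: replicate_Suc)
qed

lemma rot_replicate: "rot (replicate (Suc n) u) = replicate (Suc n) u"
  using wrot_snoc(2)[of "replicate n u" u] by (simp add: replicate_append_same)

context
  fixes u :: bool and B :: "('o, 'm) alg"
  assumes B: "B = (if u then A else K)"
begin

lemma alg_ob_W: "alg_ob C B n = W (replicate (Suc n) u)"
  unfolding W_replicate by (simp add: alg_ob_def B)

lemma alg_face_wface: "j < n \<Longrightarrow> alg_face C B n j = wface (replicate (Suc n) u) j"
  by (simp add: alg_face_def word_face_def word_obs_def B mu_same nth_Cons' del: replicate_Suc)

lemma alg_rot_wrot: "alg_rot C B n = wrot (replicate (Suc n) u)"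
  by (simp add: alg_rot_def word_rot_def word_obs_def B del: replicate_Suc)

text \<open>\<open>K\<close> and \<open>A\<close> are handled at once as constant words, whose faces
  and rotations stay among the constant words; the identities are then instances of those for
  words.\<close>

lemma precyclic_alg: "precyclic C (cyc_of C B) (alg_face C B)"
proof
  let ?w = "\<lambda>n. replicate (Suc n) u"
  have D: "CX (cyc_of C B) n = W (?w n)" "Ct (cyc_of C B) n = wrot (?w n)"
    "Cb' (cyc_of C B) n = alg_b' C B n" "Cb (cyc_of C B) n = alg_b C B n" for n
    by (simp_all add: cyc_of_def alg_ob_W alg_rot_wrot del: replicate_Suc)
  have m: "merge j (?w n) = ?w (n - 1)" if "j < n" for j n
    using merge_replicate[OF that] that by (simp del: replicate_Suc)
  show f1: "Dom C (alg_face C B n j) = CX (cyc_of C B) n" and f2: "Cod C (alg_face C B n j) = CX (cyc_of C B) (n - 1)"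
    if "j < n" for n j
    unfolding D using that m[OF that] by (simp_all add: alg_face_wface del: replicate_Suc W_simps)
  show t: "Dom C (Ct (cyc_of C B) n) = CX (cyc_of C B) n" "Cod C (Ct (cyc_of C B) n) = CX (cyc_of C B) n" for n
    unfolding D by (simp_all add: rot_replicate del: replicate_Suc W_simps)
  show "alg_face C B (n - 1) k \<cdot> alg_face C B n j = alg_face C B (n - 1) (j - 1) \<cdot> alg_face C B n k"
    if "k < j" "j < n" for k j n
  proof -
    have "k < n - 1" "j - 1 < n - 1" "k < n" using that by linarith+
    then show ?thesis
      using wface_wface(2)[of k j "?w n"] m[of j n] m[of k n] that
      by (simp add: alg_face_wface del: replicate_Suc)
  qed
  show "alg_face C B n k \<cdot> Ct (cyc_of C B) n = Ct (cyc_of C B) (n - 1) \<cdot> alg_face C B n (k - 1)"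
    if "0 < k" "k < n" for k n
  proof -
    have "k - 1 < n" using that by simp
    then show ?thesis
      using wface_wrot(2)[of k "?w n"] m[of "k - 1" n] that
      by (simp add: alg_face_wface D rot_replicate del: replicate_Suc)
  qed
  show "((\<lambda>g. Ct (cyc_of C B) n \<cdot> g) ^^ Suc n) (Idn C (CX (cyc_of C B) n)) = Idn C (CX (cyc_of C B) n)" for n
  proof -
    have r: "(rot ^^ k) (?w n) = ?w n" for k
      by (induction k) (simp_all add: rot_replicate del: replicate_Suc)
    have "((\<lambda>g. wrot (?w n) \<cdot> g) ^^ k) (Idn C (W (?w n))) = rots k (?w n)" for k
      by (induction k) (simp_all add: r del: replicate_Suc W_simps)
    then show ?thesis
      using rots_length(2)[of "?w n"] by (simp only: D length_replicate)
  qed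
  fix n :: nat assume n: "0 < n"
  show "Cb' (cyc_of C B) n =
      arr_sum C (CX (cyc_of C B) n) (CX (cyc_of C B) (n - 1)) (\<lambda>j. scale C ((- 1) ^ j) (alg_face C B n j)) {..<n}"
    by (simp add: cyc_of_def alg_b'_def)
  show "Cb (cyc_of C B) n = Cb' (cyc_of C B) n \<boxplus> scale C ((- 1) ^ n) (alg_face C B n 0 \<cdot> Ct (cyc_of C B) n)"
    by (simp add: cyc_of_def alg_b_def)
qed

end

sublocale cK: precyclic C "cyc_of C K" "alg_face C K"
  by (rule precyclic_alg[of K False]) simp

sublocale cA: precyclic C "cyc_of C A" "alg_face C A"
  by (rule precyclic_alg[of A True]) simp

abbreviation "Ks n \<equiv> replicate (Suc n) False"
abbreviation "As n \<equiv> replicate (Suc n) True"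

lemma Ks_words [simp]: "Ks n \<in> words n"
  by (simp add: in_words_iff)

lemma CX_K: "CX (cyc_of C K) n = W (Ks n)" and CX_A: "CX (cyc_of C A) n = W (As n)"
  using alg_ob_W[of K False] alg_ob_W[of A True] by (simp_all add: cyc_of_def del: replicate_Suc)

sublocale nat: precyclic_map C "cyc_of C K" "alg_face C K" rel rface "rel_nat C K A i"
proof
  fix n
  show "Dom C (rel_nat C K A i n) = CX (cyc_of C K) n" "Cod C (rel_nat C K A i n) = CX rel n"
    using rin_Hom[OF Ks_words] by (simp_all add: rel_nat_def CX_K)
  show "Ct rel n \<cdot> rel_nat C K A i n = rel_nat C K A i n \<cdot> Ct (cyc_of C K) n"
    using rrot_in[OF Ks_words] alg_rot_wrot[of K False n] rot_replicate[of n False]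
    by (simp add: rel_nat_def cyc_of_def del: replicate_Suc)
  fix j assume j: "j < n"
  then show "rface n j \<cdot> rel_nat C K A i n = rel_nat C K A i (n - 1) \<cdot> alg_face C K n j"
    using rface_in[OF j Ks_words] alg_face_wface[of K False j n] merge_replicate[OF j, of False]
    by (simp add: rel_nat_def del: replicate_Suc)
qed

lemma all2_top: "length w = Suc n \<Longrightarrow> list_all2 (\<le>) w (As n)" for w :: "bool list"
  by (simp add: list_all2_conv_all_nth del: replicate_Suc)

text \<open>The canonical map from C_n(K:A) to the (n+1)-fold tensor power of A, given on each word
  by its inclusion. It produces relative cochains from arrows on that tensor power.\<close>

definition \<theta> :: "nat \<Rightarrow> 'm" where
  "\<theta> n = (SOME h. Dom C h = rob n \<and> Cod C h = W (As n) \<and> (\<forall>w\<in>words n. h \<cdot> rin n w = incl w (As n)))"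

lemma \<theta>_Hom [simp]: "Dom C (\<theta> n) = rob n" "Cod C (\<theta> n) = W (As n)"
  and \<theta>_in: "w \<in> words n \<Longrightarrow> \<theta> n \<cdot> rin n w = incl w (As n)"
proof -
  have "\<exists>h. Dom C h = rob n \<and> Cod C h = W (As n) \<and> (\<forall>w\<in>words n. h \<cdot> rin n w = incl w (As n))"
    using rel_desc[of n "\<lambda>w. incl w (As n)" "W (As n)"] incl_Hom[OF all2_top] incl_incl[OF _ all2_top]
    by (metis in_words_iff)
  from someI_ex[OF this] show "Dom C (\<theta> n) = rob n" "Cod C (\<theta> n) = W (As n)"
    "w \<in> words n \<Longrightarrow> \<theta> n \<cdot> rin n w = incl w (As n)"
    unfolding \<theta>_def by blast+
qed

sublocale \<theta>: precyclic_map C rel rface "cyc_of C A" "alg_face C A" \<theta>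
proof
  fix n
  show "Dom C (\<theta> n) = CX rel n" "Cod C (\<theta> n) = CX (cyc_of C A) n"
    by (simp_all add: CX_A del: replicate_Suc W_simps)
  have fA: "Dom C (alg_face C A n j) = W (As n)" "Cod C (alg_face C A n j) = W (As (n - 1))" if "j < n" for j
    using cA.d_Hom[OF that] unfolding CX_A .
  have tA: "Dom C (Ct (cyc_of C A) n) = W (As n)" "Cod C (Ct (cyc_of C A) n) = W (As n)"
    using cA.t_Hom unfolding CX_A .
  have le: "list_all2 (\<le>) w (As n)" if "w \<in> words n" for w n
    using that by (intro all2_top) (simp add: in_words_iff)
  show "Ct (cyc_of C A) n \<cdot> \<theta> n = \<theta> n \<cdot> Ct rel n"
  proof (rule rel_ext[where n = n])
    fix w assume w: "w \<in> words n"
    have "(Ct (cyc_of C A) n \<cdot> \<theta> n) \<cdot> rin n w = Ct (cyc_of C A) n \<cdot> (\<theta> n \<cdot> rin n w)"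
      using w tA by (simp del: replicate_Suc W_simps)
    also have "\<dots> = wrot (As n) \<cdot> incl w (As n)"
      using alg_rot_wrot[of A True n] \<theta>_in[OF w] by (simp add: cyc_of_def del: replicate_Suc)
    also have "\<dots> = incl (rot w) (As n) \<cdot> wrot w"
      using wrot_incl(2)[OF le[OF w] words_nonempty[OF w]] unfolding rot_replicate .
    also have "\<dots> = (\<theta> n \<cdot> rin n (rot w)) \<cdot> wrot w"
      unfolding \<theta>_in[OF rot_words[OF w]] ..
    also have "\<dots> = (\<theta> n \<cdot> Ct rel n) \<cdot> rin n w"
      unfolding rel_simps by (rule comp_in[OF w rrot_in[OF w] rot_words[OF w], symmetric]) (use words_nonempty[OF w] in simp_all)
    finally show "(Ct (cyc_of C A) n \<cdot> \<theta> n) \<cdot> rin n w = (\<theta> n \<cdot> Ct rel n) \<cdot> rin n w" .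
  qed (use tA in \<open>simp_all del: replicate_Suc W_simps\<close>)
  fix j assume j: "j < n"
  show "alg_face C A n j \<cdot> \<theta> n = \<theta> (n - 1) \<cdot> rface n j"
  proof (rule rel_ext[where n = n])
    fix w assume w: "w \<in> words n"
    note l = words_length[OF w j] and m = merge_words[OF w j]
    have mt: "merge j (As n) = As (n - 1)"
      using merge_replicate[OF j] j by (simp del: replicate_Suc)
    have "(alg_face C A n j \<cdot> \<theta> n) \<cdot> rin n w = alg_face C A n j \<cdot> (\<theta> n \<cdot> rin n w)"
      using w fA[OF j] by (simp del: replicate_Suc W_simps)
    also have "\<dots> = wface (As n) j \<cdot> incl w (As n)"
      using alg_face_wface[of A True j n] j \<theta>_in[OF w] by (simp del: replicate_Suc)
    also have "\<dots> = incl (merge j w) (As (n - 1)) \<cdot> wface w j"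
      using wface_incl(2)[OF le[OF w] l] unfolding mt .
    also have "\<dots> = (\<theta> (n - 1) \<cdot> rin (n - 1) (merge j w)) \<cdot> wface w j"
      unfolding \<theta>_in[OF m] ..
    also have "\<dots> = (\<theta> (n - 1) \<cdot> rface n j) \<cdot> rin n w"
      by (rule comp_in[OF w rface_in[OF j w] m, symmetric]) (use l j in simp_all)
    finally show "(alg_face C A n j \<cdot> \<theta> n) \<cdot> rin n w = (\<theta> (n - 1) \<cdot> rface n j) \<cdot> rin n w" .
  qed (use j fA[OF j] in \<open>simp_all del: replicate_Suc W_simps\<close>)
qed

end

context cof_pair begin

subsection \<open>Extension of compatible families\<close>

text \<open>The projection from A to A/K; its tensor products with identities on both sides are
  again cokernels.\<close>

definition q :: 'm where "q = (SOME q. is_cokernel C i q)"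

lemma q: "is_cokernel C i q"
  unfolding q_def using cokernel_exists by (rule someI_ex)

lemma q_Hom [simp]: "Dom C q = Und A" and q_i [simp]: "q \<cdot> i = Zero C (Und K) (Cod C q)"
  using is_cokernelD[OF q] by simp_all

lemma q_tensor: "is_cokernel C (Idn C V \<boxtimes> i \<boxtimes> Idn C X) (Idn C V \<boxtimes> q \<boxtimes> Idn C X)"
  by (intro is_cokernel_tensor q)

lemma q_factor:
  assumes "Dom C f = V \<odot> Und A \<odot> X" "f \<cdot> (Idn C V \<boxtimes> i \<boxtimes> Idn C X) = Zero C (V \<odot> Und K \<odot> X) (Cod C f)"
  obtains h where "Dom C h = V \<odot> Cod C q \<odot> X" "Cod C h = Cod C f" "h \<cdot> (Idn C V \<boxtimes> q \<boxtimes> Idn C X) = f"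
  using assms by - (rule cokernel_factor[OF q_tensor[of V X], of f], simp_all)

lemma q_epi:
  assumes "Dom C f = V \<odot> Cod C q \<odot> X" "Dom C g = V \<odot> Cod C q \<odot> X" "Cod C f = Cod C g"
    "f \<cdot> (Idn C V \<boxtimes> q \<boxtimes> Idn C X) = g \<cdot> (Idn C V \<boxtimes> q \<boxtimes> Idn C X)"
  shows "f = g"
  by (rule cokernel_epi[OF q_tensor[of V X]]) (use assms in simp_all)

text \<open>Arrows acting on different tensor factors commute.\<close>

lemma slide:
  assumes "Dom C e = a" "Cod C e = b" "Dom C o' = R" "Cod C o' = R'"
  shows "(Idn C V \<boxtimes> e \<boxtimes> Idn C R') \<cdot> (Idn C V \<boxtimes> Idn C a \<boxtimes> o') =
    (Idn C V \<boxtimes> Idn C b \<boxtimes> o') \<cdot> (Idn C V \<boxtimes> e \<boxtimes> Idn C R)"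
  using assms by (simp add: interchange)

abbreviation "T n \<equiv> replicate n True"

text \<open>Induction on the length of the words, treating the first factor and absorbing it into
  \<open>V\<close>, which therefore has to be arbitrary. The tensor powers of K and A come with no
  direct sum decomposition, so the family is extended in two rounds: along the cofibration K
  \<rightarrow> A on the first factor, and then by a correction that factors through A/K
  there.\<close>

lemma extend_family:
  assumes J: "rel_injective C J"
    and S: "\<And>w. w \<in> S \<Longrightarrow> length w = N" "\<And>w w'. w' \<in> S \<Longrightarrow> list_all2 (\<le>) w w' \<Longrightarrow> w \<in> S"
    and \<phi>: "\<And>w. w \<in> S \<Longrightarrow> Dom C (\<phi> w) = V \<odot> W w \<and> Cod C (\<phi> w) = J"
    and compat: "\<And>w w'. w' \<in> S \<Longrightarrow> list_all2 (\<le>) w w' \<Longrightarrow> \<phi> w' \<cdot> (Idn C V \<boxtimes> incl w w') = \<phi> w"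
  shows "\<exists>\<Phi>. Dom C \<Phi> = V \<odot> W (T N) \<and> Cod C \<Phi> = J \<and> (\<forall>w\<in>S. \<Phi> \<cdot> (Idn C V \<boxtimes> incl w (T N)) = \<phi> w)"
  using S \<phi> compat
proof (induction N arbitrary: V S \<phi>)
  case 0
  show ?case
  proof (cases "[] \<in> S")
    case True
    have "w = []" if "w \<in> S" for w using "0.prems"(1)[OF that] by simp
    then have "S = {[]}" using True by blast
    moreover have "Dom C (\<phi> []) = V" "Cod C (\<phi> []) = J" using "0.prems"(3)[OF True] by simp_all
    ultimately show ?thesis by (intro exI[of _ "\<phi> []"]) simp
  next
    case False
    have "w = []" if "w \<in> S" for w using "0.prems"(1)[OF that] by simp
    then have "S = {}" using False by blast
    then show ?thesis by (intro exI[of _ "Zero C V J"]) simp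
  qed
next
  case (Suc N)
  note S = Suc.prems(1,2) and \<phi> = Suc.prems(3) and compat = Suc.prems(4)
  let ?t = "T N" and ?Q = "Cod C q"
  let ?S0 = "{v. False # v \<in> S}" and ?S1 = "{v. True # v \<in> S}"
  have len: "length v = N" if "u # v \<in> S" for u v using S(1)[OF that] by simp
  have le_t: "list_all2 (\<le>) v ?t" if "u # v \<in> S" for u v
    using len[OF that] by (auto simp: list_all2_conv_all_nth)
  have S10: "False # v \<in> S" if "True # v \<in> S" for v
    by (rule S(2)[OF that]) (simp add: list_all2_refl)
  have t\<phi>: "Dom C (\<phi> (u # v)) = V \<odot> ob u \<odot> W v" "Cod C (\<phi> (u # v)) = J" if "u # v \<in> S" for u v
    using \<phi>[OF that] by simp_all
  \<comment> \<open>Words beginning with K, with this factor absorbed into \<open>V\<close>.\<close>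
  have "\<exists>g. Dom C g = (V \<odot> Und K) \<odot> W ?t \<and> Cod C g = J \<and>
      (\<forall>v\<in>?S0. g \<cdot> (Idn C (V \<odot> Und K) \<boxtimes> incl v ?t) = \<phi> (False # v))"
  proof (rule Suc.IH)
    fix v v' assume v: "v' \<in> ?S0" "list_all2 (\<le>) v v'"
    then have le: "list_all2 (\<le>) (False # v) (False # v')" by simp
    show "v \<in> ?S0" using S(2)[OF _ le] v(1) by simp
    show "\<phi> (False # v') \<cdot> (Idn C (V \<odot> Und K) \<boxtimes> incl v v') = \<phi> (False # v)"
      using compat[OF _ le] v(1) by (simp flip: Idn_tensor)
  qed (use len t\<phi> in auto)
  then obtain g where g: "Dom C g = V \<odot> Und K \<odot> W ?t" "Cod C g = J"
    and g\<phi>: "\<And>v. False # v \<in> S \<Longrightarrow> g \<cdot> (Idn C V \<boxtimes> Idn C (Und K) \<boxtimes> incl v ?t) = \<phi> (False # v)"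
    by (auto simp flip: Idn_tensor)
  have "cofibration C (Idn C V \<boxtimes> i \<boxtimes> Idn C (W ?t))"
    by (intro cofibration_tensor i_cof)
  then obtain e where e: "Dom C e = V \<odot> Und A \<odot> W ?t" "Cod C e = J"
    and eg: "e \<cdot> (Idn C V \<boxtimes> i \<boxtimes> Idn C (W ?t)) = g"
    using cofibration_extend[OF _ J, of "Idn C V \<boxtimes> i \<boxtimes> Idn C (W ?t)" g] g by auto
  \<comment> \<open>What \<open>e\<close> misses on words beginning with A. As \<open>S\<close> is
    closed downwards, it contains the same words with first letter K, where \<open>e\<close> is
    already right; so the defect kills K in the first factor.\<close>
  define \<psi> where "\<psi> v = \<phi> (True # v) \<boxplus> scale C (- 1) (e \<cdot> (Idn C V \<boxtimes> Idn C (Und A) \<boxtimes> incl v ?t))" for v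
  have \<psi>t: "Dom C (\<psi> v) = V \<odot> Und A \<odot> W v" "Cod C (\<psi> v) = J" if "True # v \<in> S" for v
    using t\<phi>[OF that] e incl_Hom[OF le_t[OF that]] by (simp_all add: \<psi>_def)
  have \<psi>i: "\<psi> v \<cdot> (Idn C V \<boxtimes> i \<boxtimes> Idn C (W v)) = Zero C (V \<odot> Und K \<odot> W v) (Cod C (\<psi> v))" if v: "True # v \<in> S" for v
  proof -
    note lt = incl_Hom[OF le_t[OF v]]
    have "\<phi> (True # v) \<cdot> (Idn C V \<boxtimes> i \<boxtimes> Idn C (W v)) = \<phi> (False # v)"
      using compat[OF v, of "False # v"] by (simp add: inc_def list_all2_refl)
    moreover have "(Idn C V \<boxtimes> Idn C (Und A) \<boxtimes> incl v ?t) \<cdot> (Idn C V \<boxtimes> i \<boxtimes> Idn C (W v)) =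
        (Idn C V \<boxtimes> i \<boxtimes> Idn C (W ?t)) \<cdot> (Idn C V \<boxtimes> Idn C (Und K) \<boxtimes> incl v ?t)"
      by (rule slide[symmetric]) (use lt in simp_all)
    then have "(e \<cdot> (Idn C V \<boxtimes> Idn C (Und A) \<boxtimes> incl v ?t)) \<cdot> (Idn C V \<boxtimes> i \<boxtimes> Idn C (W v)) =
        (e \<cdot> (Idn C V \<boxtimes> i \<boxtimes> Idn C (W ?t))) \<cdot> (Idn C V \<boxtimes> Idn C (Und K) \<boxtimes> incl v ?t)"
      using e lt by simp
    then have "(e \<cdot> (Idn C V \<boxtimes> Idn C (Und A) \<boxtimes> incl v ?t)) \<cdot> (Idn C V \<boxtimes> i \<boxtimes> Idn C (W v)) = \<phi> (False # v)"
      unfolding eg g\<phi>[OF S10[OF v]] .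
    ultimately show ?thesis
      unfolding \<psi>_def using t\<phi>[OF v] t\<phi>[OF S10[OF v]] e lt by (simp del: comp_assoc)
  qed
  have "\<exists>h. True # v \<in> S \<longrightarrow> Dom C h = V \<odot> ?Q \<odot> W v \<and> Cod C h = J \<and> h \<cdot> (Idn C V \<boxtimes> q \<boxtimes> Idn C (W v)) = \<psi> v" for v
  proof (cases "True # v \<in> S")
    case True
    then show ?thesis
      using q_factor[OF \<psi>t(1) \<psi>i] \<psi>t(2) by metis
  qed simp
  then obtain h where h: "\<And>v. True # v \<in> S \<Longrightarrow> Dom C (h v) = V \<odot> ?Q \<odot> W v"
    "\<And>v. True # v \<in> S \<Longrightarrow> Cod C (h v) = J"
    "\<And>v. True # v \<in> S \<Longrightarrow> h v \<cdot> (Idn C V \<boxtimes> q \<boxtimes> Idn C (W v)) = \<psi> v"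
    by metis
  \<comment> \<open>Words beginning with A, where the defect has been factored through A/K and this
    quotient is absorbed into \<open>V\<close>.\<close>
  have "\<exists>H. Dom C H = (V \<odot> ?Q) \<odot> W ?t \<and> Cod C H = J \<and>
      (\<forall>v\<in>?S1. H \<cdot> (Idn C (V \<odot> ?Q) \<boxtimes> incl v ?t) = h v)"
  proof (rule Suc.IH)
    fix v v' assume v: "v' \<in> ?S1" "list_all2 (\<le>) v v'"
    then have le: "list_all2 (\<le>) (True # v) (True # v')" by simp
    have vS: "True # v \<in> S" and v'S: "True # v' \<in> S" using S(2)[OF _ le] v(1) by simp_all
    then show "v \<in> ?S1" by simp
    note lt = incl_Hom[OF v(2)] incl_Hom[OF le_t[OF v'S]]
    have "h v' \<cdot> (Idn C V \<boxtimes> Idn C ?Q \<boxtimes> incl v v') = h v"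
    proof (rule q_epi[of _ V "W v"])
      have "(h v' \<cdot> (Idn C V \<boxtimes> Idn C ?Q \<boxtimes> incl v v')) \<cdot> (Idn C V \<boxtimes> q \<boxtimes> Idn C (W v)) =
          h v' \<cdot> ((Idn C V \<boxtimes> Idn C ?Q \<boxtimes> incl v v') \<cdot> (Idn C V \<boxtimes> q \<boxtimes> Idn C (W v)))"
        using h[OF v'S] lt by simp
      also have "(Idn C V \<boxtimes> Idn C ?Q \<boxtimes> incl v v') \<cdot> (Idn C V \<boxtimes> q \<boxtimes> Idn C (W v)) =
          (Idn C V \<boxtimes> q \<boxtimes> Idn C (W v')) \<cdot> (Idn C V \<boxtimes> Idn C (Und A) \<boxtimes> incl v v')"
        by (rule slide[symmetric]) (use lt in simp_all)
      also have "h v' \<cdot> \<dots> = \<psi> v' \<cdot> (Idn C V \<boxtimes> Idn C (Und A) \<boxtimes> incl v v')"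
        unfolding h(3)[OF v'S, symmetric] using h(1,2)[OF v'S] lt by simp
      also have "\<dots> = \<psi> v"
      proof -
        have "\<phi> (True # v') \<cdot> (Idn C V \<boxtimes> Idn C (Und A) \<boxtimes> incl v v') = \<phi> (True # v)"
          using compat[OF v'S le] by simp
        moreover have "incl v' ?t \<cdot> incl v v' = incl v ?t"
          by (rule incl_incl[OF v(2) le_t[OF v'S]])
        ultimately show ?thesis
          unfolding \<psi>_def using t\<phi>[OF v'S] e lt by (simp add: interchange)
      qed
      also have "\<dots> = h v \<cdot> (Idn C V \<boxtimes> q \<boxtimes> Idn C (W v))" using h(3)[OF vS] by simp
      finally show "(h v' \<cdot> (Idn C V \<boxtimes> Idn C ?Q \<boxtimes> incl v v')) \<cdot> (Idn C V \<boxtimes> q \<boxtimes> Idn C (W v)) =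
          h v \<cdot> (Idn C V \<boxtimes> q \<boxtimes> Idn C (W v))" .
    qed (use h[OF vS] h[OF v'S] lt in simp_all)
    then show "h v' \<cdot> (Idn C (V \<odot> ?Q) \<boxtimes> incl v v') = h v"
      by (simp flip: Idn_tensor)
  qed (use len h in auto)
  then obtain H where H: "Dom C H = V \<odot> ?Q \<odot> W ?t" "Cod C H = J"
    and Hh: "\<And>v. True # v \<in> S \<Longrightarrow> H \<cdot> (Idn C V \<boxtimes> Idn C ?Q \<boxtimes> incl v ?t) = h v"
    by (auto simp flip: Idn_tensor)
  \<comment> \<open>The correction factors through \<open>q\<close>, which kills K, so it does not
    disturb the words beginning with K.\<close>
  define \<Phi> where "\<Phi> = e \<boxplus> H \<cdot> (Idn C V \<boxtimes> q \<boxtimes> Idn C (W ?t))"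
  have \<Phi>t: "Dom C \<Phi> = V \<odot> Und A \<odot> W ?t" "Cod C \<Phi> = J" using e H by (simp_all add: \<Phi>_def)
  have "\<Phi> \<cdot> (Idn C V \<boxtimes> inc u True \<boxtimes> incl v ?t) = \<phi> (u # v)" if uv: "u # v \<in> S" for u v
  proof (cases u)
    case True
    then have v: "True # v \<in> S" using uv by simp
    note lt = incl_Hom[OF le_t[OF v]]
    have "(H \<cdot> (Idn C V \<boxtimes> q \<boxtimes> Idn C (W ?t))) \<cdot> (Idn C V \<boxtimes> Idn C (Und A) \<boxtimes> incl v ?t) =
        H \<cdot> ((Idn C V \<boxtimes> q \<boxtimes> Idn C (W ?t)) \<cdot> (Idn C V \<boxtimes> Idn C (Und A) \<boxtimes> incl v ?t))"
      using H lt by simp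
    also have "(Idn C V \<boxtimes> q \<boxtimes> Idn C (W ?t)) \<cdot> (Idn C V \<boxtimes> Idn C (Und A) \<boxtimes> incl v ?t) =
        (Idn C V \<boxtimes> Idn C ?Q \<boxtimes> incl v ?t) \<cdot> (Idn C V \<boxtimes> q \<boxtimes> Idn C (W v))"
      by (rule slide) (use lt in simp_all)
    also have "H \<cdot> \<dots> = h v \<cdot> (Idn C V \<boxtimes> q \<boxtimes> Idn C (W v))"
      unfolding Hh[OF v, symmetric] using H lt by simp
    also have "\<dots> = \<psi> v" by (rule h(3)[OF v])
    finally have "\<Phi> \<cdot> (Idn C V \<boxtimes> Idn C (Und A) \<boxtimes> incl v ?t) =
        e \<cdot> (Idn C V \<boxtimes> Idn C (Und A) \<boxtimes> incl v ?t) \<boxplus> \<psi> v"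
      unfolding \<Phi>_def using e H lt by (simp del: comp_assoc)
    also have "\<dots> = \<phi> (True # v)"
      unfolding \<psi>_def using t\<phi>[OF v] e lt by (simp add: Plus_left_commute)
    finally show ?thesis using True by simp
  next
    case False
    then have v: "False # v \<in> S" using uv by simp
    note lt = incl_Hom[OF le_t[OF v]]
    have "\<Phi> \<cdot> (Idn C V \<boxtimes> i \<boxtimes> incl v ?t) = (e \<cdot> (Idn C V \<boxtimes> i \<boxtimes> Idn C (W ?t))) \<cdot> (Idn C V \<boxtimes> Idn C (Und K) \<boxtimes> incl v ?t)"
      unfolding \<Phi>_def using e H lt by (simp add: interchange)
    also have "\<dots> = \<phi> (False # v)"
      unfolding eg by (rule g\<phi>[OF v])
    finally show ?thesis using False by (simp add: inc_def)
  qed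
  then have "\<Phi> \<cdot> (Idn C V \<boxtimes> incl w (T (Suc N))) = \<phi> w" if "w \<in> S" for w
    using that S(1)[OF that] by (cases w) simp_all
  then show ?case
    using \<Phi>t by (intro exI[of _ \<Phi>]) simp
qed

subsection \<open>Contracting the bar complex between two quotients\<close>

text \<open>Acyclicity of Hom(V \<otimes> C^bar K, J) for all V at once, in terms of arrows. In
  degree 0 there is nothing to bound with, so a cocycle has to be zero.\<close>

definition bar_acyclic :: "'o \<Rightarrow> bool" where
  "bar_acyclic J \<longleftrightarrow> (\<forall>V m f. Dom C f = V \<odot> CX (cyc_of C K) m \<longrightarrow> Cod C f = J \<longrightarrow>
     f \<cdot> (Idn C V \<boxtimes> Cb' (cyc_of C K) (Suc m)) = Zero C (V \<odot> CX (cyc_of C K) (Suc m)) J \<longrightarrow>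
     (if m = 0 then f = Zero C (V \<odot> CX (cyc_of C K) m) J
      else \<exists>g. Dom C g = V \<odot> CX (cyc_of C K) (m - 1) \<and> Cod C g = J \<and> f = g \<cdot> (Idn C V \<boxtimes> Cb' (cyc_of C K) m)))"

abbreviation "X \<equiv> CX (cyc_of C K)"
abbreviation "kb \<equiv> Cb' (cyc_of C K)"

lemma kb_Hom [simp]: "Dom C (kb (Suc n)) = X (Suc n)" "Cod C (kb (Suc n)) = X n"
  using cK.Cb_Hom(3,4)[of "Suc n"] by simp_all

text \<open>\<open>kill\<close> makes \<open>f\<close> factor through A/K in each of the first
  \<open>a\<close> factors, and \<open>tail\<close> through the cokernel \<open>p\<close> of
  \<open>s\<close>; what remains is a cocycle on the bar complex with coefficients. The induction on
  \<open>a\<close> absorbs one copy of A/K into \<open>V\<close> at a time. The primitive is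
  required to satisfy the same vanishing conditions, since it is later extended by zero to the lower
  words. The arrow \<open>s\<close> is a parameter because an empty and a nonempty tail need
  different ones.\<close>

lemma bar_contract:
  assumes J: "bar_acyclic J" and sp: "is_cokernel C s p" and Dp: "Cod C s = U"
    and f: "Dom C f = V \<odot> W (T a) \<odot> X m \<odot> U" "Cod C f = J"
    and kill: "\<And>j. j < a \<Longrightarrow> f \<cdot> (Idn C V \<boxtimes> incl ((T a)[j := False]) (T a) \<boxtimes> Idn C (X m \<odot> U)) =
      Zero C (V \<odot> W ((T a)[j := False]) \<odot> X m \<odot> U) J"
    and tail: "f \<cdot> (Idn C V \<boxtimes> Idn C (W (T a)) \<boxtimes> Idn C (X m) \<boxtimes> s) = Zero C (V \<odot> W (T a) \<odot> X m \<odot> Dom C s) J"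
    and cyc: "f \<cdot> (Idn C V \<boxtimes> Idn C (W (T a)) \<boxtimes> kb (Suc m) \<boxtimes> Idn C U) = Zero C (V \<odot> W (T a) \<odot> X (Suc m) \<odot> U) J"
  shows "if m = 0 then f = Zero C (V \<odot> W (T a) \<odot> X m \<odot> U) J
    else \<exists>g. Dom C g = V \<odot> W (T a) \<odot> X (m - 1) \<odot> U \<and> Cod C g = J \<and>
      f = g \<cdot> (Idn C V \<boxtimes> Idn C (W (T a)) \<boxtimes> kb m \<boxtimes> Idn C U) \<and>
      (\<forall>j<a. g \<cdot> (Idn C V \<boxtimes> incl ((T a)[j := False]) (T a) \<boxtimes> Idn C (X (m - 1) \<odot> U)) =
        Zero C (V \<odot> W ((T a)[j := False]) \<odot> X (m - 1) \<odot> U) J) \<and>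
      g \<cdot> (Idn C V \<boxtimes> Idn C (W (T a)) \<boxtimes> Idn C (X (m - 1)) \<boxtimes> s) = Zero C (V \<odot> W (T a) \<odot> X (m - 1) \<odot> Dom C s) J"
  using f kill tail cyc
proof (induction a arbitrary: V f)
  case 0
  note [simp] = is_cokernelD[OF sp] Dp
  let ?P = "Cod C p"
  have f [simp]: "Dom C f = V \<odot> X m \<odot> U" "Cod C f = J" using "0.prems" by simp_all
  have sp': "is_cokernel C (Idn C (V \<odot> X n) \<boxtimes> s) (Idn C (V \<odot> X n) \<boxtimes> p)" for n
    by (rule is_cokernel_tensor[OF sp])
  \<comment> \<open>The tail condition is that \<open>f\<close> kills \<open>s\<close>, so
    \<open>f\<close> factors through the cokernel.\<close>
  obtain f' where f' [simp]: "Dom C f' = V \<odot> X m \<odot> ?P" "Cod C f' = J" and ff': "f' \<cdot> (Idn C V \<boxtimes> Idn C (X m) \<boxtimes> p) = f"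
    by (rule cokernel_factor[OF sp'[of m], of f]) (use "0.prems"(4) in \<open>simp_all flip: Idn_tensor\<close>)
  have "f' \<cdot> (Idn C V \<boxtimes> kb (Suc m) \<boxtimes> Idn C ?P) = Zero C (V \<odot> X (Suc m) \<odot> ?P) J"
  proof (rule cokernel_epi[OF sp'[of "Suc m"]])
    have "(f' \<cdot> (Idn C V \<boxtimes> kb (Suc m) \<boxtimes> Idn C ?P)) \<cdot> (Idn C (V \<odot> X (Suc m)) \<boxtimes> p) =
        (f' \<cdot> (Idn C V \<boxtimes> Idn C (X m) \<boxtimes> p)) \<cdot> (Idn C V \<boxtimes> kb (Suc m) \<boxtimes> Idn C U)"
      by (simp add: interchange flip: Idn_tensor)
    also have "\<dots> = Zero C (V \<odot> X (Suc m) \<odot> U) J"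
      unfolding ff' using "0.prems"(5) by simp
    finally show "(f' \<cdot> (Idn C V \<boxtimes> kb (Suc m) \<boxtimes> Idn C ?P)) \<cdot> (Idn C (V \<odot> X (Suc m)) \<boxtimes> p) =
        Zero C (V \<odot> X (Suc m) \<odot> ?P) J \<cdot> (Idn C (V \<odot> X (Suc m)) \<boxtimes> p)" by simp
  qed simp_all
  note f'c = this
  \<comment> \<open>The coefficients in \<open>bar_acyclic\<close> stand on the left, so the
    quotient of the tail is moved there by the symmetry.\<close>
  have sl: "(Idn C V \<boxtimes> kb (Suc n) \<boxtimes> Idn C ?P) \<cdot> (Idn C V \<boxtimes> Symm C ?P (X (Suc n))) =
      (Idn C V \<boxtimes> Symm C ?P (X n)) \<cdot> (Idn C (V \<odot> ?P) \<boxtimes> kb (Suc n))" for n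
    by (simp add: interchange Symm_natural flip: Idn_tensor)
  let ?f = "f' \<cdot> (Idn C V \<boxtimes> Symm C ?P (X m))"
  have "?f \<cdot> (Idn C (V \<odot> ?P) \<boxtimes> kb (Suc m)) = Zero C ((V \<odot> ?P) \<odot> X (Suc m)) J"
  proof -
    have "?f \<cdot> (Idn C (V \<odot> ?P) \<boxtimes> kb (Suc m)) = (f' \<cdot> (Idn C V \<boxtimes> kb (Suc m) \<boxtimes> Idn C ?P)) \<cdot> (Idn C V \<boxtimes> Symm C ?P (X (Suc m)))"
      using sl[of m] by simp
    then show ?thesis unfolding f'c by simp
  qed
  moreover have "Dom C ?f = (V \<odot> ?P) \<odot> X m" "Cod C ?f = J" by simp_all
  ultimately have b: "if m = 0 then ?f = Zero C ((V \<odot> ?P) \<odot> X m) J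
      else \<exists>g. Dom C g = (V \<odot> ?P) \<odot> X (m - 1) \<and> Cod C g = J \<and> ?f = g \<cdot> (Idn C (V \<odot> ?P) \<boxtimes> kb m)"
    using J[unfolded bar_acyclic_def, rule_format, of ?f "V \<odot> ?P" m] by blast
  have unsymm: "?f \<cdot> (Idn C V \<boxtimes> Symm C (X m) ?P) = f'"
    by (simp add: interchange) (simp add: Idn_tensor)
  show ?case
  proof (cases m)
    case 0
    then have "f' = Zero C (V \<odot> X m \<odot> ?P) J"
      using b unsymm by (simp del: comp_assoc)
    then show ?thesis using ff' 0 by simp
  next
    case (Suc k)
    then obtain g where g [simp]: "Dom C g = V \<odot> ?P \<odot> X k" "Cod C g = J" and fg: "?f = g \<cdot> (Idn C (V \<odot> ?P) \<boxtimes> kb m)"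
      using b by auto
    define g' where "g' = g \<cdot> (Idn C V \<boxtimes> Symm C (X k) ?P)"
    have g't [simp]: "Dom C g' = V \<odot> X k \<odot> ?P" "Cod C g' = J" by (simp_all add: g'_def)
    have "f' = (g \<cdot> (Idn C (V \<odot> ?P) \<boxtimes> kb m)) \<cdot> (Idn C V \<boxtimes> Symm C (X m) ?P)"
      using unsymm fg by simp
    also have "\<dots> = g' \<cdot> (Idn C V \<boxtimes> kb m \<boxtimes> Idn C ?P)"
      unfolding g'_def Suc by (simp add: interchange Symm_natural flip: Idn_tensor)
    finally have f'g': "f' = g' \<cdot> (Idn C V \<boxtimes> kb m \<boxtimes> Idn C ?P)" .
    let ?g = "g' \<cdot> (Idn C V \<boxtimes> Idn C (X k) \<boxtimes> p)"
    have "f = ?g \<cdot> (Idn C V \<boxtimes> kb m \<boxtimes> Idn C U)"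
      unfolding ff'[symmetric] f'g' Suc by (simp add: interchange)
    moreover have "?g \<cdot> (Idn C V \<boxtimes> Idn C (X k) \<boxtimes> s) = Zero C (V \<odot> X k \<odot> Dom C s) J"
      by (simp add: interchange)
    ultimately show ?thesis
      using Suc by (simp, intro exI[of _ ?g] conjI) simp_all
  qed
next
  case (Suc a)
  note [simp] = is_cokernelD[OF sp] Dp
  let ?t = "T a" and ?Q = "Cod C q"
  have tup: "list_all2 (\<le>) ((T a)[j := False]) (T a)" for j
    by (auto simp: list_all2_conv_all_nth nth_list_update)
  note tt [simp] = incl_Hom[OF tup]
  define ki where "ki n j = incl ((T a)[j := False]) (T a) \<boxtimes> Idn C (X n \<odot> U)" for n j
  define ta where "ta n = Idn C (W (T a)) \<boxtimes> Idn C (X n) \<boxtimes> s" for n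
  define bb where "bb n = Idn C (W (T a)) \<boxtimes> kb n \<boxtimes> Idn C U" for n
  define R where "R n = W (T a) \<odot> X n \<odot> U" for n
  have ops [simp]: "Dom C (ki n j) = W ((T a)[j := False]) \<odot> X n \<odot> U" "Cod C (ki n j) = R n"
    "Dom C (ta n) = W (T a) \<odot> X n \<odot> Dom C s" "Cod C (ta n) = R n"
    "Dom C (bb (Suc n)) = R (Suc n)" "Cod C (bb (Suc n)) = R n" for n j
    by (simp_all add: ki_def ta_def bb_def R_def)
  have f [simp]: "Dom C f = V \<odot> Und A \<odot> R m" "Cod C f = J"
    using Suc.prems(1,2) by (simp_all add: R_def)
  have f0: "f \<cdot> (Idn C V \<boxtimes> i \<boxtimes> Idn C (R m)) = Zero C (V \<odot> Und K \<odot> R m) J"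
    using Suc.prems(3)[of 0] by (simp add: R_def inc_def flip: Idn_tensor)
  have fk: "f \<cdot> (Idn C V \<boxtimes> Idn C (Und A) \<boxtimes> ki m j) = Zero C (V \<odot> Und A \<odot> Dom C (ki m j)) J" if "j < a" for j
    using Suc.prems(3)[of "Suc j"] that by (simp add: ki_def)
  have ft: "f \<cdot> (Idn C V \<boxtimes> Idn C (Und A) \<boxtimes> ta m) = Zero C (V \<odot> Und A \<odot> Dom C (ta m)) J"
    using Suc.prems(4) by (simp add: ta_def flip: Idn_tensor)
  have fb: "f \<cdot> (Idn C V \<boxtimes> Idn C (Und A) \<boxtimes> bb (Suc m)) = Zero C (V \<odot> Und A \<odot> Dom C (bb (Suc m))) J"
    using Suc.prems(5) by (simp add: bb_def R_def flip: Idn_tensor)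
  obtain h where h [simp]: "Dom C h = V \<odot> ?Q \<odot> R m" "Cod C h = J" and hf: "h \<cdot> (Idn C V \<boxtimes> q \<boxtimes> Idn C (R m)) = f"
    by (rule q_factor[of f V "R m"]) (use f0 in simp_all)
  \<comment> \<open>A condition on \<open>f\<close> that concerns the factors to the right of the
    first A descends to \<open>h\<close>, because \<open>q\<close> tensored with identities is still
    an epimorphism.\<close>
  have pass: "h \<cdot> (Idn C V \<boxtimes> Idn C ?Q \<boxtimes> o') = Zero C (V \<odot> ?Q \<odot> Dom C o') J"
    if "Cod C o' = R m" "f \<cdot> (Idn C V \<boxtimes> Idn C (Und A) \<boxtimes> o') = Zero C (V \<odot> Und A \<odot> Dom C o') J" for o'
  proof (rule q_epi[of _ V "Dom C o'"])
    have "(h \<cdot> (Idn C V \<boxtimes> Idn C ?Q \<boxtimes> o')) \<cdot> (Idn C V \<boxtimes> q \<boxtimes> Idn C (Dom C o')) =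
        (h \<cdot> (Idn C V \<boxtimes> q \<boxtimes> Idn C (R m))) \<cdot> (Idn C V \<boxtimes> Idn C (Und A) \<boxtimes> o')"
      using that(1) by (simp add: interchange)
    then show "(h \<cdot> (Idn C V \<boxtimes> Idn C ?Q \<boxtimes> o')) \<cdot> (Idn C V \<boxtimes> q \<boxtimes> Idn C (Dom C o')) =
        Zero C (V \<odot> ?Q \<odot> Dom C o') J \<cdot> (Idn C V \<boxtimes> q \<boxtimes> Idn C (Dom C o'))"
      unfolding hf that(2) by simp
  qed (use that(1) in simp_all)
  have IH: "if m = 0 then h = Zero C ((V \<odot> ?Q) \<odot> W ?t \<odot> X m \<odot> U) J
    else \<exists>g. Dom C g = (V \<odot> ?Q) \<odot> W ?t \<odot> X (m - 1) \<odot> U \<and> Cod C g = J \<and>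
      h = g \<cdot> (Idn C (V \<odot> ?Q) \<boxtimes> Idn C (W ?t) \<boxtimes> kb m \<boxtimes> Idn C U) \<and>
      (\<forall>j<a. g \<cdot> (Idn C (V \<odot> ?Q) \<boxtimes> incl (?t[j := False]) ?t \<boxtimes> Idn C (X (m - 1) \<odot> U)) =
        Zero C ((V \<odot> ?Q) \<odot> W (?t[j := False]) \<odot> X (m - 1) \<odot> U) J) \<and>
      g \<cdot> (Idn C (V \<odot> ?Q) \<boxtimes> Idn C (W ?t) \<boxtimes> Idn C (X (m - 1)) \<boxtimes> s) = Zero C ((V \<odot> ?Q) \<odot> W ?t \<odot> X (m - 1) \<odot> Dom C s) J"
  proof (rule Suc.IH)
    show "h \<cdot> (Idn C (V \<odot> ?Q) \<boxtimes> incl (?t[j := False]) ?t \<boxtimes> Idn C (X m \<odot> U)) =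
        Zero C ((V \<odot> ?Q) \<odot> W (?t[j := False]) \<odot> X m \<odot> U) J" if "j < a" for j
      using pass[OF _ fk[OF that]] by (simp add: ki_def R_def flip: Idn_tensor)
    show "h \<cdot> (Idn C (V \<odot> ?Q) \<boxtimes> Idn C (W ?t) \<boxtimes> Idn C (X m) \<boxtimes> s) = Zero C ((V \<odot> ?Q) \<odot> W ?t \<odot> X m \<odot> Dom C s) J"
      using pass[OF _ ft] by (simp add: ta_def R_def flip: Idn_tensor)
    show "h \<cdot> (Idn C (V \<odot> ?Q) \<boxtimes> Idn C (W ?t) \<boxtimes> kb (Suc m) \<boxtimes> Idn C U) = Zero C ((V \<odot> ?Q) \<odot> W ?t \<odot> X (Suc m) \<odot> U) J"
      using pass[OF _ fb] by (simp add: bb_def R_def flip: Idn_tensor)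
  qed (simp_all add: R_def)
  show ?case
  proof (cases m)
    case 0
    then show ?thesis using IH hf by (simp add: R_def)
  next
    case (Suc k)
    then obtain g where g0: "Dom C g = V \<odot> ?Q \<odot> R k" "Cod C g = J"
      and hg: "h = g \<cdot> (Idn C V \<boxtimes> Idn C ?Q \<boxtimes> bb m)"
      and gk: "\<And>j. j < a \<Longrightarrow> g \<cdot> (Idn C V \<boxtimes> Idn C ?Q \<boxtimes> ki k j) = Zero C (V \<odot> ?Q \<odot> Dom C (ki k j)) J"
      and gt: "g \<cdot> (Idn C V \<boxtimes> Idn C ?Q \<boxtimes> ta k) = Zero C (V \<odot> ?Q \<odot> Dom C (ta k)) J"
      using IH by (auto simp: R_def bb_def ki_def ta_def simp flip: Idn_tensor)
    note g0 [simp]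
    let ?g = "g \<cdot> (Idn C V \<boxtimes> q \<boxtimes> Idn C (R k))"
    \<comment> \<open>Back again: the conditions on \<open>g\<close> are pulled back along
      \<open>q\<close>. The one for the first factor, new at this stage, holds because
      \<open>q\<close> kills K.\<close>
    have move: "?g \<cdot> (Idn C V \<boxtimes> Idn C (Und A) \<boxtimes> o') = (g \<cdot> (Idn C V \<boxtimes> Idn C ?Q \<boxtimes> o')) \<cdot> (Idn C V \<boxtimes> q \<boxtimes> Idn C (Dom C o'))"
      if "Cod C o' = R k" for o'
      using that by (simp add: interchange)
    have "f = ?g \<cdot> (Idn C V \<boxtimes> Idn C (Und A) \<boxtimes> bb m)"
      unfolding hf[symmetric] hg using Suc by (simp add: interchange)
    moreover have "?g \<cdot> (Idn C V \<boxtimes> i \<boxtimes> Idn C (R k)) = Zero C (V \<odot> Und K \<odot> R k) J"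
      by (simp add: interchange)
    moreover have "?g \<cdot> (Idn C V \<boxtimes> Idn C (Und A) \<boxtimes> ki k j) = Zero C (V \<odot> Und A \<odot> Dom C (ki k j)) J" if "j < a" for j
      by (subst move, simp, subst gk[OF that], simp)
    moreover have "?g \<cdot> (Idn C V \<boxtimes> Idn C (Und A) \<boxtimes> ta k) = Zero C (V \<odot> Und A \<odot> Dom C (ta k)) J"
      by (subst move, simp, subst gt, simp)
    moreover have gt': "Dom C ?g = V \<odot> Und A \<odot> R k" "Cod C ?g = J" by simp_all
    ultimately obtain G where G: "Dom C G = V \<odot> Und A \<odot> R k" "Cod C G = J"
      "f = G \<cdot> (Idn C V \<boxtimes> Idn C (Und A) \<boxtimes> bb m)"
      "G \<cdot> (Idn C V \<boxtimes> i \<boxtimes> Idn C (R k)) = Zero C (V \<odot> Und K \<odot> R k) J"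
      "\<And>j. j < a \<Longrightarrow> G \<cdot> (Idn C V \<boxtimes> Idn C (Und A) \<boxtimes> ki k j) = Zero C (V \<odot> Und A \<odot> Dom C (ki k j)) J"
      "G \<cdot> (Idn C V \<boxtimes> Idn C (Und A) \<boxtimes> ta k) = Zero C (V \<odot> Und A \<odot> Dom C (ta k)) J"
      by blast
    have "G \<cdot> (Idn C V \<boxtimes> incl ((T (Suc a))[j := False]) (T (Suc a)) \<boxtimes> Idn C (X k \<odot> U)) =
        Zero C (V \<odot> W ((T (Suc a))[j := False]) \<odot> X k \<odot> U) J" if "j < Suc a" for j
    proof (cases j)
      case 0
      then show ?thesis using G(4) by (simp add: R_def inc_def flip: Idn_tensor)
    next
      case (Suc j')
      then show ?thesis using G(5)[of j'] that by (simp add: ki_def)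
    qed
    moreover have "f = G \<cdot> (Idn C V \<boxtimes> Idn C (W (T (Suc a))) \<boxtimes> kb m \<boxtimes> Idn C U)"
      using G(3) by (simp add: bb_def flip: Idn_tensor)
    moreover have "G \<cdot> (Idn C V \<boxtimes> Idn C (W (T (Suc a))) \<boxtimes> Idn C (X k) \<boxtimes> s) = Zero C (V \<odot> W (T (Suc a)) \<odot> X k \<odot> Dom C s) J"
      using G(6) by (simp add: ta_def flip: Idn_tensor)
    ultimately show ?thesis
      using G(1,2) Suc by (simp add: R_def) blast
  qed
qed

end

subsection \<open>A filtration of the words\<close>

text \<open>As \<open>(a, c)\<close> increases lexicographically, each step adds to the words satisfying \<open>lev a c\<close> those below a
  single one, \<open>A\<^sup>a K\<^sup>m A\<^sup>c\<close>.\<close>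

definition lev :: "nat \<Rightarrow> nat \<Rightarrow> bool list \<Rightarrow> bool" where
  "lev a c w \<longleftrightarrow> (\<exists>j<a. j < length w \<and> \<not> w ! j) \<or>
     (0 < c \<and> a < length w \<and> \<not> w ! a \<and> (\<forall>j<length w. a \<le> j \<and> j + c \<le> length w \<longrightarrow> \<not> w ! j))"

definition TFT :: "nat \<Rightarrow> nat \<Rightarrow> nat \<Rightarrow> bool list" where
  "TFT a m c = replicate a True @ replicate m False @ replicate c True"

lemma length_TFT [simp]: "length (TFT a m c) = a + m + c"
  by (simp add: TFT_def)

lemma nth_TFT: "j < a + m + c \<Longrightarrow> TFT a m c ! j \<longleftrightarrow> j < a \<or> a + m \<le> j"
  by (auto simp: TFT_def nth_append)

lemma le_nthD: "list_all2 (\<le>) w w' \<Longrightarrow> j < length w \<Longrightarrow> w ! j \<Longrightarrow> w' ! j"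
  for w w' :: "bool list"
  by (auto simp: list_all2_conv_all_nth)

lemma le_iff_nth: "list_all2 (\<le>) w w' \<longleftrightarrow> length w = length w' \<and> (\<forall>j<length w. w ! j \<longrightarrow> w' ! j)"
  for w w' :: "bool list"
  by (auto simp: list_all2_conv_all_nth)

lemma lev_mono: "list_all2 (\<le>) w w' \<Longrightarrow> lev a c w' \<Longrightarrow> lev a c w"
  unfolding le_iff_nth lev_def by (metis order.strict_trans1 order_less_imp_le)

lemma nth_merge:
  assumes "Suc j < length w" "k < length w - 1"
  shows "merge j w ! k \<longleftrightarrow> (if k < j then w ! k else if k = j then w ! j \<and> w ! Suc j else w ! Suc k)"
  using assms by (auto simp: merge_def nth_append nth_Cons' min_def)

text \<open>A product with a factor in K lies in K, so a letter K among the first \<open>a\<close>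
  survives and moves left by at most one place. In the second alternative the word gets shorter by
  one, and a constrained place of the new word stems from constrained places of the old one.\<close>

lemma lev_merge:
  assumes "Suc j < length w" "lev a c w" shows "lev a c (merge j w)"
proof (cases "\<exists>k<a. k < length w \<and> \<not> w ! k")
  case True
  then obtain k where k: "k < a" "k < length w" "\<not> w ! k" by blast
  define k' where "k' = (if k \<le> j then k else k - 1)"
  have "k' < a" "k' < length w - 1" "\<not> merge j w ! k'"
    using k assms(1) by (auto simp: k'_def nth_merge split: if_splits)
      (metis One_nat_def Suc_lessI Suc_pred less_nat_zero_code linorder_neqE_nat not_less_eq zero_less_Suc)+
  then show ?thesis using assms(1) by (auto simp: lev_def length_merge)
next
  case False
  then have w: "0 < c" "a < length w" "\<not> w ! a" "\<And>k. k < length w \<Longrightarrow> a \<le> k \<Longrightarrow> k + c \<le> length w \<Longrightarrow> \<not> w ! k"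
    using assms(2) by (auto simp: lev_def)
  show ?thesis
  proof (cases "j < a")
    \<comment> \<open>A face to the left of place \<open>a\<close> moves the letter K at
      \<open>a\<close> to \<open>a - 1\<close>, which gives the first alternative.\<close>
    case True
    then have "a - 1 < length w - 1" "\<not> merge j w ! (a - 1)" "a - 1 < a"
      using w assms(1) by (auto simp: nth_merge)
    then show ?thesis using assms(1) by (auto simp: lev_def length_merge)
  next
    case F: False
    then have a: "a < length w - 1" "\<not> merge j w ! a"
      using w assms(1) by (auto simp: nth_merge)
    have "\<not> merge j w ! k" if "k < length w - 1" "a \<le> k" "k + c \<le> length w - 1" for k
    proof -
      have "k + c \<le> length w" "Suc k + c \<le> length w" "k < length w" "Suc k < length w" "a \<le> Suc k"
        using that by linarith+
      then show ?thesis
        using that w(4)[of k] w(4)[of "Suc k"] assms(1) by (auto simp: nth_merge)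
    qed
    then show ?thesis using a w(1) assms(1) by (auto simp: lev_def length_merge)
  qed
qed

lemma nth_rot: "w \<noteq> [] \<Longrightarrow> k < length w \<Longrightarrow> rot w ! k \<longleftrightarrow> (if k = 0 then w ! (length w - 1) else w ! (k - 1))"
  by (auto simp: rot_def nth_Cons' nth_butlast last_conv_nth)

text \<open>The word of the last face: the last letter is multiplied into the first one.\<close>

lemma nth_wrap:
  assumes "2 \<le> length w" "k < length w - 1"
  shows "merge 0 (rot w) ! k \<longleftrightarrow> (if k = 0 then w ! 0 \<and> w ! (length w - 1) else w ! k)"
proof -
  have "w \<noteq> []" using assms by auto
  then have "length (rot w) = length w" by (simp add: rot_def)
  then show ?thesis
    using assms \<open>w \<noteq> []\<close> by (auto simp: nth_merge nth_rot)
qed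

lemma length_wrap: "2 \<le> length w \<Longrightarrow> length (merge 0 (rot w)) = length w - 1"
  by (cases w) (auto simp: length_merge rot_def)

text \<open>The first letter can only turn into K, and the others keep their places. The one letter
  that is lost is the last; if it is the K that counts, it reappears at place 0.\<close>

lemma lev_wrap:
  assumes "2 \<le> length w" "lev a c w" shows "lev a c (merge 0 (rot w))"
proof (cases "\<exists>k<a. k < length w \<and> \<not> w ! k")
  case True
  then obtain k where k: "k < a" "k < length w" "\<not> w ! k" by blast
  define k' where "k' = (if k = length w - 1 then 0 else k)"
  have "k' < a" "k' < length w - 1" "\<not> merge 0 (rot w) ! k'"
    using k assms(1) by (auto simp: k'_def nth_wrap)
  then show ?thesis using assms(1) by (auto simp: lev_def length_wrap)
next
  case False
  then have w: "0 < c" "a < length w" "\<not> w ! a" "\<And>k. k < length w \<Longrightarrow> a \<le> k \<Longrightarrow> k + c \<le> length w \<Longrightarrow> \<not> w ! k"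
    using assms(2) by (auto simp: lev_def)
  show ?thesis
  proof (cases "a = length w - 1")
    \<comment> \<open>The letter K at \<open>a\<close> is the last one. As the word has length at
      least 2, \<open>a\<close> is positive and place 0 is among the first \<open>a\<close>.\<close>
    case True
    then have "0 < a" "\<not> merge 0 (rot w) ! 0" using assms(1) w by (auto simp: nth_wrap)
    then show ?thesis using assms(1) by (auto simp: lev_def length_wrap)
  next
    case F: False
    have "\<not> merge 0 (rot w) ! k" if "k < length w - 1" "a \<le> k" "k + c \<le> length w - 1" for k
    proof -
      have "k + c \<le> length w" "k < length w" using that by linarith+
      then show ?thesis
        using that w(4)[of k] assms(1) by (auto simp: nth_wrap)
    qed
    moreover have "a < length w - 1" using F w(2) by linarith
    moreover have "\<not> merge 0 (rot w) ! a" using w(2,3) F assms(1) by (auto simp: nth_wrap)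
    ultimately show ?thesis using w(1) assms(1) by (auto simp: lev_def length_wrap)
  qed
qed

text \<open>The bottom of the filtration, where the cochains in question vanish by
  assumption.\<close>

lemma lev_0_1: "lev 0 (Suc 0) w \<Longrightarrow> w = replicate (length w) False"
  by (rule nth_equalityI) (auto simp: lev_def)

text \<open>The pure words of K lie in every step from the bottom upwards, so a cochain that
  vanishes on such a step restricts to zero on K.\<close>

lemma lev_Ks: "0 < a \<or> 0 < c \<Longrightarrow> lev a c (replicate (Suc n) False)"
  by (cases a) (auto simp: lev_def simp del: replicate_Suc)

text \<open>Passage to the next \<open>a\<close>: once \<open>c\<close> exceeds the length of the
  word, the second alternative only asks for a K at place \<open>a\<close>.\<close>

lemma lev_Suc_0: "lev (Suc a) 0 w \<Longrightarrow> length w = Suc n \<Longrightarrow> lev a (Suc (Suc n)) w"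
  by (auto simp: lev_def less_Suc_eq)

lemma lev_all: "False \<in> set w \<Longrightarrow> lev (length w) 0 w"
  by (auto simp: lev_def in_set_conv_nth)

text \<open>The places from \<open>a\<close> on, except for the last \<open>c\<close>, carry the
  letter K, so replacing all letters outside this block by A gives the largest such word.\<close>

lemma lev_new:
  assumes "lev a (Suc c) w" "\<not> lev a c w" "length w = N"
  obtains m where "N = a + Suc m + c" "list_all2 (\<le>) w (TFT a (Suc m) c)"
proof -
  have w: "a < N" "\<not> w ! a" "\<And>j. j < N \<Longrightarrow> a \<le> j \<Longrightarrow> j + Suc c \<le> N \<Longrightarrow> \<not> w ! j"
    using assms by (auto simp: lev_def)
  \<comment> \<open>Otherwise the condition for \<open>c\<close> constrains at most place
    \<open>a\<close>, which carries K already, and the word would not be new.\<close>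
  have "a + c < N"
  proof (rule ccontr)
    assume "\<not> a + c < N"
    moreover have "\<not> w ! j" if "j < N" "a \<le> j" "j + c \<le> N" for j
    proof -
      have "j = a" using that \<open>\<not> a + c < N\<close> by linarith
      then show ?thesis using w by simp
    qed
    moreover have "0 < c" using \<open>\<not> a + c < N\<close> w(1) by simp
    ultimately have "lev a c w" using w assms(3) by (auto simp: lev_def)
    then show False using assms(2) by simp
  qed
  define m where "m = N - a - c - 1"
  have m: "N = a + Suc m + c" using \<open>a + c < N\<close> by (simp add: m_def)
  have "list_all2 (\<le>) w (TFT a (Suc m) c)"
    unfolding le_iff_nth
  proof (intro conjI allI impI)
    fix j assume j: "j < length w" "w ! j"
    have "j < a \<or> a + Suc m \<le> j"
    proof (rule ccontr)
      assume "\<not> (j < a \<or> a + Suc m \<le> j)"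
      then have "j < N" "a \<le> j" "j + Suc c \<le> N" using j(1) m assms(3) by linarith+
      then show False using w(3) j(2) by blast
    qed
    then show "TFT a (Suc m) c ! j"
      using j(1) m assms(3) by (simp add: nth_TFT)
  qed (use m assms(3) in simp)
  then show thesis using that m by blast
qed

text \<open>A face that involves a letter A shortens a block of A's and keeps that of the K's: on
  the left a K moves to place \<open>a - 1\<close>, on the right the tail has only
  \<open>c - 1\<close> letters left.\<close>

lemma lev_merge_TFT:
  assumes "j + 1 < a + Suc m + c" "j < a \<or> a + m \<le> j"
  shows "lev a c (merge j (TFT a (Suc m) c))"
proof (cases "j < a")
  case True
  then have "a - 1 < a + m + c" "\<not> merge j (TFT a (Suc m) c) ! (a - 1)" "a - 1 < a"
    using assms(1) by (auto simp: nth_merge nth_TFT)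
  then show ?thesis using assms(1) by (auto simp: lev_def length_merge)
next
  case False
  then have j: "a + m \<le> j" "0 < c" using assms by auto
  have "\<not> merge j (TFT a (Suc m) c) ! k" if "k < a + m + c" "a \<le> k" "k \<le> a + m" for k
    using that j assms(1) by (auto simp: nth_merge nth_TFT)
  then show ?thesis using assms(1) j by (auto simp: lev_def length_merge)
qed

text \<open>If \<open>c = 0\<close> the last K is multiplied into the A at place 0; otherwise the
  last A disappears and the tail gets shorter. For \<open>a = c = 0\<close> the last face would
  again be a pure word of K, which is where the Hochschild and the bar boundary really
  differ.\<close>

lemma lev_wrap_TFT:
  assumes "0 < a \<or> 0 < c" "2 \<le> a + Suc m + c" "0 < m"
  shows "lev a c (merge 0 (rot (TFT a (Suc m) c)))"
proof (cases "c = 0")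
  case True
  then have "0 < a" "\<not> merge 0 (rot (TFT a (Suc m) c)) ! 0"
    using assms by (auto simp: nth_wrap nth_TFT)
  then show ?thesis using assms by (auto simp: lev_def length_wrap)
next
  case False
  have "\<not> merge 0 (rot (TFT a (Suc m) c)) ! k" if "k < a + m + c" "a \<le> k" "k \<le> a + m" for k
    using that False assms by (auto simp: nth_wrap nth_TFT)
  then show ?thesis using assms False by (auto simp: lev_def length_wrap)
qed

lemma merge_TFT:
  assumes "l < m" shows "merge (a + l) (TFT a (Suc m) c) = TFT a m c"
proof (rule nth_equalityI)
  fix k assume "k < length (merge (a + l) (TFT a (Suc m) c))"
  then show "merge (a + l) (TFT a (Suc m) c) ! k = TFT a m c ! k"
    using assms by (auto simp: length_merge nth_merge nth_TFT)
qed (use assms in \<open>simp add: length_merge\<close>)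

context cof_pair begin

lemma W_TFT: "W (TFT a (Suc m) c) = W (T a) \<odot> X m \<odot> W (T c)"
  unfolding TFT_def CX_K by simp

lemma wface_TFT:
  assumes "l < Suc m"
  shows "wface (TFT a (Suc (Suc m)) c) (a + l) = Idn C (W (T a)) \<boxtimes> alg_face C K (Suc m) l \<boxtimes> Idn C (W (T c))"
proof -
  have "Suc l < length (Ks (Suc m))" using assms by simp
  then obtain x u v y where w: "Ks (Suc m) = x @ u # v # y" "length x = l" by (rule split_word)
  have "TFT a (Suc (Suc m)) c = (T a @ x) @ u # v # (y @ T c)"
    unfolding TFT_def w(1) by simp
  then have "wface (TFT a (Suc (Suc m)) c) (a + l) = Idn C (W (T a @ x)) \<boxtimes> mu u v \<boxtimes> Idn C (W (y @ T c))"
    using wface_split[of "T a @ x" u v "y @ T c"] w(2) by simp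
  moreover have "alg_face C K (Suc m) l = Idn C (W x) \<boxtimes> mu u v \<boxtimes> Idn C (W y)"
    using alg_face_wface[of K False l "Suc m"] wface_split[of x u v y] assms w by (simp del: replicate_Suc)
  ultimately show ?thesis by (simp flip: Idn_tensor)
qed

text \<open>\<open>True\<close> selects the Hochschild boundary, \<open>False\<close> the bar
  boundary, so that both are treated by one argument.\<close>

definition bd :: "bool \<Rightarrow> nat \<Rightarrow> 'm" where
  "bd \<beta> n = (if \<beta> then Cb rel n else Cb' rel n)"

lemma bd_Hom [simp]: "0 < n \<Longrightarrow> Dom C (bd \<beta> n) = rob n" "0 < n \<Longrightarrow> Cod C (bd \<beta> n) = rob (n - 1)"
  using R.Cb_Hom by (simp_all add: bd_def)

lemma bd_bd: "0 < n \<Longrightarrow> bd \<beta> n \<cdot> bd \<beta> (Suc n) = Zero C (rob (Suc n)) (rob (n - 1))"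
  using R.Cb_Cb[of "Suc n"] R.Cb'_Cb'[of "Suc n"] by (simp add: bd_def)

lemma bd_in:
  assumes w: "w \<in> words n" and n: "0 < n" and x: "Dom C x = rob (n - 1)"
  shows "(x \<cdot> bd \<beta> n) \<cdot> rin n w =
    arr_sum C (W w) (Cod C x) (\<lambda>j. scale C ((- 1) ^ j) ((x \<cdot> rin (n - 1) (merge j w)) \<cdot> wface w j)) {..<n} \<boxplus>
    (if \<beta> then scale C ((- 1) ^ n) ((x \<cdot> rin (n - 1) (merge 0 (rot w))) \<cdot> wface (rot w) 0 \<cdot> wrot w)
     else Zero C (W w) (Cod C x))"
proof -
  note r = rot_words[OF w]
  note nz = words_nonempty[OF w]
  have t: "Dom C (Cb' rel n) = rob n" "Cod C (Cb' rel n) = rob (n - 1)"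
    using R.Cb_Hom[OF n] by simp_all
  have "(x \<cdot> Cb' rel n) \<cdot> rin n w = x \<cdot> word_b' C K A i n w"
    using rsum_in[OF w n] R.Cb'_eq[OF n] x w t by simp
  also have "\<dots> = arr_sum C (W w) (Cod C x) (\<lambda>j. x \<cdot> scale C ((- 1) ^ j) (rin (n - 1) (merge j w) \<cdot> wface w j)) {..<n}"
    unfolding word_b'_def using x words_length[OF w] merge_words[OF w] by (intro comp_sum) simp_all
  also have "\<dots> = arr_sum C (W w) (Cod C x) (\<lambda>j. scale C ((- 1) ^ j) ((x \<cdot> rin (n - 1) (merge j w)) \<cdot> wface w j)) {..<n}"
    using x words_length[OF w] merge_words[OF w] by (intro sum_cong) simp_all
  finally have b': "(x \<cdot> Cb' rel n) \<cdot> rin n w = \<dots>" .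
  have "(x \<cdot> rface n 0 \<cdot> rrot n) \<cdot> rin n w = x \<cdot> ((rface n 0 \<cdot> rin n (rot w)) \<cdot> wrot w)"
    using x n w r nz rrot_in[OF w] by simp
  also have "\<dots> = (x \<cdot> rin (n - 1) (merge 0 (rot w))) \<cdot> wface (rot w) 0 \<cdot> wrot w"
    unfolding rface_in[OF n r] using x nz words_length[OF r n] merge_words[OF r n] by simp
  finally have l: "(x \<cdot> rface n 0 \<cdot> rrot n) \<cdot> rin n w = \<dots>" .
  show ?thesis
  proof (cases \<beta>)
    case True
    have "(x \<cdot> bd \<beta> n) \<cdot> rin n w = (x \<cdot> Cb' rel n) \<cdot> rin n w \<boxplus>
        scale C ((- 1) ^ n) ((x \<cdot> rface n 0 \<cdot> rrot n) \<cdot> rin n w)"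
      using True R.Cb_eq[OF n] x n w t by (simp add: bd_def)
    then show ?thesis unfolding b' l using True by simp
  next
    case False
    then have "(x \<cdot> bd \<beta> n) \<cdot> rin n w = (x \<cdot> Cb' rel n) \<cdot> rin n w" by (simp add: bd_def)
    moreover have "Dom C ((x \<cdot> Cb' rel n) \<cdot> rin n w) = W w" "Cod C ((x \<cdot> Cb' rel n) \<cdot> rin n w) = Cod C x"
      using x w t by simp_all
    ultimately show ?thesis unfolding b'[symmetric] using False by simp
  qed
qed

text \<open>No face leaves a step of the filtration, the last one included, by
  \<open>lev_merge\<close> and \<open>lev_wrap\<close>.\<close>

lemma bd_lev:
  assumes n: "0 < n" and x: "Dom C x = rob (n - 1)" "Cod C x = J"
    and van: "\<And>w. w \<in> words (n - 1) \<Longrightarrow> lev a c w \<Longrightarrow> x \<cdot> rin (n - 1) w = Zero C (W w) J"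
    and w: "w \<in> words n" "lev a c w"
  shows "(x \<cdot> bd \<beta> n) \<cdot> rin n w = Zero C (W w) J"
proof -
  note r = rot_words[OF w(1)]
  have l2: "2 \<le> length w" using w(1) n by (simp add: in_words_iff)
  have z1: "scale C ((- 1) ^ j) ((x \<cdot> rin (n - 1) (merge j w)) \<cdot> wface w j) = Zero C (W w) J" if "j < n" for j
    using van[OF merge_words[OF w(1) that] lev_merge[OF words_length[OF w(1) that] w(2)]] words_length[OF w(1) that]
    by simp
  have z2: "(x \<cdot> rin (n - 1) (merge 0 (rot w))) \<cdot> wface (rot w) 0 \<cdot> wrot w = Zero C (W w) J"
    using van[OF merge_words[OF r n] lev_wrap[OF l2 w(2)]] words_length[OF r n] words_nonempty[OF w(1)]
    by simp
  have "arr_sum C (W w) J (\<lambda>j. scale C ((- 1) ^ j) ((x \<cdot> rin (n - 1) (merge j w)) \<cdot> wface w j)) {..<n} = Zero C (W w) J"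
    by (rule sum_zero) (use z1 in simp)
  then show ?thesis
    unfolding bd_in[OF w(1) n x(1)] x(2) z2 by simp
qed

lemma TFT_words: "0 < m \<Longrightarrow> Suc n = a + m + c \<Longrightarrow> TFT a m c \<in> words n"
  by (auto simp: in_words_iff TFT_def)

text \<open>Modulo smaller levels, the boundary of \<open>A\<^sup>a K\<^bsup>m+2\<^esup> A\<^sup>c\<close> is the bar boundary of its middle part.\<close>

lemma bd_TFT:
  assumes n: "n = a + Suc m + c" and ac: "0 < a \<or> 0 < c" and x: "Dom C x = rob (n - 1)" "Cod C x = J"
    and van: "\<And>w. w \<in> words (n - 1) \<Longrightarrow> lev a c w \<Longrightarrow> x \<cdot> rin (n - 1) w = Zero C (W w) J"
  shows "(x \<cdot> bd \<beta> n) \<cdot> rin n (TFT a (Suc (Suc m)) c) =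
    scale C ((- 1) ^ a) ((x \<cdot> rin (n - 1) (TFT a (Suc m) c)) \<cdot> (Idn C (W (T a)) \<boxtimes> kb (Suc m) \<boxtimes> Idn C (W (T c))))"
proof -
  let ?w = "TFT a (Suc (Suc m)) c" and ?v = "TFT a (Suc m) c"
  have n0: "0 < n" using n by simp
  have w: "?w \<in> words n" and v: "?v \<in> words (n - 1)" using n by (auto intro!: TFT_words)
  note r = rot_words[OF w]
  let ?y = "x \<cdot> rin (n - 1) ?v"
  have yt: "Dom C ?y = W (T a) \<odot> X m \<odot> W (T c)" "Cod C ?y = J"
    using x v by (simp_all add: W_TFT)
  let ?f = "\<lambda>j. scale C ((- 1) ^ j) ((x \<cdot> rin (n - 1) (merge j ?w)) \<cdot> wface ?w j)"
  have ft: "Dom C (?f j) = W ?w" "Cod C (?f j) = J" if "j < n" for j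
    using x words_length[OF w that] merge_words[OF w that] by simp_all
  \<comment> \<open>The faces that touch a letter A lead to words on which \<open>x\<close>
    vanishes.\<close>
  have z1: "?f j = Zero C (W ?w) J" if "j < n" "j < a \<or> a + Suc m \<le> j" for j
  proof -
    have "lev a c (merge j ?w)" using that n by (intro lev_merge_TFT) simp_all
    from van[OF merge_words[OF w that(1)] this] show ?thesis
      using words_length[OF w that(1)] by simp
  qed
  have "lev a c (merge 0 (rot ?w))" using ac n by (intro lev_wrap_TFT) simp_all
  from van[OF merge_words[OF r n0] this]
  have z2: "(x \<cdot> rin (n - 1) (merge 0 (rot ?w))) \<cdot> wface (rot ?w) 0 \<cdot> wrot ?w = Zero C (W ?w) J"
    using words_length[OF r n0] words_nonempty[OF w] by simp
  have dt: "Dom C (alg_face C K (Suc m) l) = X (Suc m)" "Cod C (alg_face C K (Suc m) l) = X m" if "l < Suc m" for l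
    using cK.d_Hom[OF that] by simp_all
  \<comment> \<open>What is left are the faces inside the block of K's. Their numbering starts at
    \<open>a\<close>, hence the sign (-1)^a in front of the bar boundary.\<close>
  have "arr_sum C (W ?w) J ?f {..<n} = arr_sum C (W ?w) J ?f ((+) a ` {..<Suc m})"
  proof (rule sum_mono_neutral)
    fix j assume j: "j \<in> {..<n} - (+) a ` {..<Suc m}"
    have "j < a \<or> a + Suc m \<le> j"
    proof (rule ccontr)
      assume "\<not> (j < a \<or> a + Suc m \<le> j)"
      then have "j = a + (j - a)" "j - a < Suc m" by auto
      then show False using j by blast
    qed
    then show "?f j = Zero C (W ?w) J" using z1 j by simp
  qed (use n ft in auto)
  also have "\<dots> = arr_sum C (W ?w) J (\<lambda>l. ?f (a + l)) {..<Suc m}"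
  proof (rule sum_reindex)
    fix l assume "l \<in> {..<Suc m}"
    then have "a + l < n" using n by simp
    then show "Dom C (?f (a + l)) = W ?w \<and> Cod C (?f (a + l)) = J" using ft by blast
  qed simp
  also have "\<dots> = arr_sum C (W ?w) J (\<lambda>l. scale C ((- 1) ^ a) (?y \<cdot> (Idn C (W (T a)) \<boxtimes>
      scale C ((- 1) ^ l) (alg_face C K (Suc m) l) \<boxtimes> Idn C (W (T c))))) {..<Suc m}"
  proof (rule sum_cong[OF refl])
    fix l assume "l \<in> {..<Suc m}"
    then have l: "l < Suc m" by simp
    show "?f (a + l) = scale C ((- 1) ^ a) (?y \<cdot> (Idn C (W (T a)) \<boxtimes>
      scale C ((- 1) ^ l) (alg_face C K (Suc m) l) \<boxtimes> Idn C (W (T c))))"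
      unfolding merge_TFT[OF l] wface_TFT[OF l] using yt dt[OF l] by (simp add: power_add del: comp_assoc)
  qed (use yt dt in \<open>simp_all add: W_TFT\<close>)
  also have "\<dots> = scale C ((- 1) ^ a) (?y \<cdot> (Idn C (W (T a)) \<boxtimes> kb (Suc m) \<boxtimes> Idn C (W (T c))))"
  proof -
    let ?g = "\<lambda>l. scale C ((- 1) ^ l) (alg_face C K (Suc m) l)"
    have kb: "kb (Suc m) = arr_sum C (X (Suc m)) (X m) ?g {..<Suc m}"
      using cK.Cb'_eq[of "Suc m"] by simp
    have "Idn C (W (T a)) \<boxtimes> kb (Suc m) \<boxtimes> Idn C (W (T c)) =
        arr_sum C (W ?w) (W ?v) (\<lambda>l. Idn C (W (T a)) \<boxtimes> ?g l \<boxtimes> Idn C (W (T c))) {..<Suc m}"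
      unfolding kb W_TFT using dt
      by (subst tensor_sum(2), simp, subst tensor_sum(1), simp_all)
    then show ?thesis
      using yt dt by (subst scale_sum[symmetric], simp add: W_TFT, subst comp_sum[where b = "W ?v" and c = J and a = "W ?w", symmetric],
        simp_all add: W_TFT del: comp_assoc)
  qed
  finally have s: "arr_sum C (W ?w) J ?f {..<n} = \<dots>" .
  have "Dom C (arr_sum C (W ?w) J ?f {..<n}) = W ?w" "Cod C (arr_sum C (W ?w) J ?f {..<n}) = J"
    using ft by (auto intro!: Dom_sum Cod_sum)
  then show ?thesis
    unfolding bd_in[OF w n0 x(1)] x(2) z2 s[symmetric] by simp
qed


text \<open>The words of a lower step below A^a K^m A^c lie below one of the words obtained by
  turning a single A into K: one of the first \<open>a\<close>, or the one next to the block of K's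
  on the right. Vanishing on the lower step thus becomes the conditions \<open>kill\<close> and
  \<open>tail\<close> of \<open>bar_contract\<close>.\<close>

lemma TFT_above:
  assumes v: "list_all2 (\<le>) v (TFT a m c)" and lev: "lev a c v"
  shows "(\<exists>j<a. list_all2 (\<le>) v ((TFT a m c)[j := False])) \<or>
    (\<exists>c'. c = Suc c' \<and> list_all2 (\<le>) v (TFT a (Suc m) c'))"
proof (cases "\<exists>j<a. j < length v \<and> \<not> v ! j")
  case True
  then obtain j where "j < a" "\<not> v ! j" by blast
  then have "list_all2 (\<le>) v ((TFT a m c)[j := False])"
    using v unfolding le_iff_nth by (auto simp: nth_list_update)
  then show ?thesis using \<open>j < a\<close> by blast
next
  case False
  then have l: "0 < c" "\<And>j. j < length v \<Longrightarrow> a \<le> j \<Longrightarrow> j + c \<le> length v \<Longrightarrow> \<not> v ! j"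
    using lev by (auto simp: lev_def)
  have len: "length v = a + m + c" using v by (auto simp: le_iff_nth)
  obtain c' where c': "c = Suc c'" using l(1) by (cases c) auto
  have "list_all2 (\<le>) v (TFT a (Suc m) c')"
    unfolding le_iff_nth
  proof (intro conjI allI impI)
    fix j assume j: "j < length v" "v ! j"
    have "j < a \<or> a + Suc m \<le> j"
    proof (rule ccontr)
      assume "\<not> (j < a \<or> a + Suc m \<le> j)"
      then have "a \<le> j" "j + c \<le> length v" using len by linarith+
      then show False using l(2) j by blast
    qed
    then show "TFT a (Suc m) c' ! j" using j(1) len c' by (simp add: nth_TFT)
  qed (use len c' in simp)
  then show ?thesis using c' by blast
qed

lemma lev_below:
  assumes "0 < m" "Suc n = a + m + c"
  shows "j < a \<Longrightarrow> (TFT a m c)[j := False] \<in> words n \<and> lev a c ((TFT a m c)[j := False]) \<and>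
      list_all2 (\<le>) ((TFT a m c)[j := False]) (TFT a m c)"
    and "c = Suc c' \<Longrightarrow> TFT a (Suc m) c' \<in> words n \<and> lev a c (TFT a (Suc m) c') \<and>
      list_all2 (\<le>) (TFT a (Suc m) c') (TFT a m c)"
proof -
  show "(TFT a m c)[j := False] \<in> words n \<and> lev a c ((TFT a m c)[j := False]) \<and>
      list_all2 (\<le>) ((TFT a m c)[j := False]) (TFT a m c)" if "j < a"
  proof (intro conjI)
    have "\<not> (TFT a m c)[j := False] ! j" "j < length ((TFT a m c)[j := False])" using that by simp_all
    then show "lev a c ((TFT a m c)[j := False])"
      using that assms by (auto simp: lev_def)
    have "False \<in> set ((TFT a m c)[j := False])" using that assms by (intro set_update_memI) simp
    then show "(TFT a m c)[j := False] \<in> words n" using assms by (simp add: in_words_iff)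
    show "list_all2 (\<le>) ((TFT a m c)[j := False]) (TFT a m c)"
      using that by (auto simp: le_iff_nth nth_list_update split: if_splits)
  qed
  show "TFT a (Suc m) c' \<in> words n \<and> lev a c (TFT a (Suc m) c') \<and>
      list_all2 (\<le>) (TFT a (Suc m) c') (TFT a m c)" if "c = Suc c'"
    using assms that by (auto simp: le_iff_nth nth_TFT lev_def intro!: TFT_words)
qed

lemma incl_TFT_update:
  assumes "j < a"
  shows "incl ((TFT a (Suc m) c)[j := False]) (TFT a (Suc m) c) = incl ((T a)[j := False]) (T a) \<boxtimes> Idn C (X m \<odot> W (T c))"
    and "W ((TFT a (Suc m) c)[j := False]) = W ((T a)[j := False]) \<odot> X m \<odot> W (T c)"
proof -
  have "(TFT a (Suc m) c)[j := False] = (T a)[j := False] @ Ks m @ T c"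
    using assms by (simp add: TFT_def list_update_append del: replicate_Suc)
  then show "incl ((TFT a (Suc m) c)[j := False]) (TFT a (Suc m) c) = incl ((T a)[j := False]) (T a) \<boxtimes> Idn C (X m \<odot> W (T c))"
    "W ((TFT a (Suc m) c)[j := False]) = W ((T a)[j := False]) \<odot> X m \<odot> W (T c)"
    by (simp_all add: TFT_def incl_append CX_K Idn_tensor del: replicate_Suc)
qed

lemma incl_TFT_tail:
  shows "incl (TFT a (Suc (Suc m)) c) (TFT a (Suc m) (Suc c)) = Idn C (W (T a)) \<boxtimes> Idn C (X m) \<boxtimes> (i \<boxtimes> Idn C (W (T c)))"
    and "W (TFT a (Suc (Suc m)) c) = W (T a) \<odot> X m \<odot> Und K \<odot> W (T c)"
proof -
  have "TFT a (Suc (Suc m)) c = T a @ Ks m @ False # T c" "TFT a (Suc m) (Suc c) = T a @ Ks m @ True # T c"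
    by (simp_all add: TFT_def replicate_app_Cons_same)
  then show "incl (TFT a (Suc (Suc m)) c) (TFT a (Suc m) (Suc c)) = Idn C (W (T a)) \<boxtimes> Idn C (X m) \<boxtimes> (i \<boxtimes> Idn C (W (T c)))"
    "W (TFT a (Suc (Suc m)) c) = W (T a) \<odot> X m \<odot> Und K \<odot> W (T c)"
    by (simp_all add: incl_append CX_K inc_def del: replicate_Suc)
qed

text \<open>This plays the part of the tail for \<open>c = 0\<close>, where the condition is empty
  and the cokernel is the identity.\<close>

lemma cokernel_zero_ob: "is_cokernel C (Zero C (zero_ob C) a) (Idn C a)"
  unfolding is_cokernel_def by (auto intro!: exI[of _ "_"])

subsection \<open>Excision for the Hochschild and bar complexes\<close>

text \<open>One step of the filtration. The value \<open>f\<close> of \<open>x\<close> on the single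
  new maximal word A^a K^(m+1) A^c is contracted by \<open>bar_contract\<close>. The primitive lives
  on A^a K^m A^c; it is extended by zero to the lower step, then to a whole tensor power of A by
  \<open>extend_family\<close>, and pulled back along \<open>\<theta>\<close>. Since
  \<open>y\<close> vanishes on the step (a, c), its coboundary does so as well, and nothing is
  spoilt there.\<close>

lemma kill_level:
  assumes J: "rel_injective C J" "bar_acyclic J" and n: "0 < n" and ac: "0 < a \<or> 0 < c"
    and x: "Dom C x = rob n" "Cod C x = J" "x \<cdot> bd \<beta> (Suc n) = Zero C (rob (Suc n)) J"
    and van: "\<And>w. w \<in> words n \<Longrightarrow> lev a c w \<Longrightarrow> x \<cdot> rin n w = Zero C (W w) J"
  shows "\<exists>y. Dom C y = rob (n - 1) \<and> Cod C y = J \<and> y \<cdot> rin (n - 1) (Ks (n - 1)) = Zero C (W (Ks (n - 1))) J \<and>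
    (\<forall>w\<in>words n. lev a (Suc c) w \<longrightarrow> (y \<cdot> bd \<beta> n) \<cdot> rin n w = x \<cdot> rin n w)"
proof -
  \<comment> \<open>If \<open>x\<close> vanishes on the next step already, there is nothing to
    correct.\<close>
  have triv: ?thesis if "\<And>w. w \<in> words n \<Longrightarrow> lev a (Suc c) w \<Longrightarrow> x \<cdot> rin n w = Zero C (W w) J"
  proof (intro exI[of _ "Zero C (rob (n - 1)) J"] conjI ballI impI)
    show "Zero C (rob (n - 1)) J \<cdot> rin (n - 1) (Ks (n - 1)) = Zero C (W (Ks (n - 1))) J"
      by (subst Zero_comp) (simp_all only: rin_Hom[OF Ks_words])
    show "(Zero C (rob (n - 1)) J \<cdot> bd \<beta> n) \<cdot> rin n w = x \<cdot> rin n w"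
      if "w \<in> words n" "lev a (Suc c) w" for w
      using that \<open>\<And>w. w \<in> words n \<Longrightarrow> lev a (Suc c) w \<Longrightarrow> x \<cdot> rin n w = Zero C (W w) J\<close> n by simp
  qed simp_all
  show ?thesis
proof (cases "\<exists>m. n = a + m + c")
  case False
  have "x \<cdot> rin n w = Zero C (W w) J" if w: "w \<in> words n" "lev a (Suc c) w" for w
  proof (cases "lev a c w")
    case F: False
    then show ?thesis
      using lev_new[OF w(2) F, of "Suc n"] w(1) False by (metis add_Suc add_Suc_right in_words_iff nat.inject)
  qed (rule van[OF w(1)])
  then show ?thesis by (rule triv)
next
  case True
  then obtain m where m: "n = a + m + c" by blast
  let ?w = "TFT a (Suc m) c"
  have w: "?w \<in> words n" by (rule TFT_words) (use m in simp_all)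
  define f where "f = x \<cdot> rin n ?w"
  have f: "Dom C f = W (T a) \<odot> X m \<odot> W (T c)" "Cod C f = J"
    using x w by (simp_all add: f_def W_TFT)
  have below: "f \<cdot> incl v ?w = Zero C (W v) J" if "v \<in> words n" "lev a c v" "list_all2 (\<le>) v ?w" for v
    using rin_incl[OF that(1) w that(3)] van[OF that(1,2)] x w incl_Hom[OF that(3)] by (simp add: f_def)
  have kill: "f \<cdot> (incl ((T a)[j := False]) (T a) \<boxtimes> Idn C (X m \<odot> W (T c))) =
      Zero C (W ((T a)[j := False]) \<odot> X m \<odot> W (T c)) J" if "j < a" for j
    using below lev_below(1)[of "Suc m" n a c j] m that unfolding incl_TFT_update[OF that, symmetric] by simp
  \<comment> \<open>The tail condition concerns the letter A next to the block of K's: it is killed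
    by K in this place. An empty tail gets the zero arrow from the zero object.\<close>
  define s where "s = (if c = 0 then Zero C (zero_ob C) (Unit C) else i \<boxtimes> Idn C (W (T (c - 1))))"
  define p where "p = (if c = 0 then Idn C (Unit C) else q \<boxtimes> Idn C (W (T (c - 1))))"
  have sp: "is_cokernel C s p" and sU: "Cod C s = W (T c)"
    using cokernel_zero_ob is_cokernel_tensor(2)[OF q] by (cases c; simp add: s_def p_def)+
  have tail: "f \<cdot> (Idn C (W (T a)) \<boxtimes> Idn C (X m) \<boxtimes> s) = Zero C (W (T a) \<odot> X m \<odot> Dom C s) J"
  proof (cases c)
    case 0
    then show ?thesis using f by (simp add: s_def)
  next
    case (Suc c')
    show ?thesis
      using below[of "TFT a (Suc (Suc m)) c'"] lev_below(2)[of "Suc m" n a c c'] m incl_TFT_tail[of a m c']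
      unfolding Suc s_def by (simp del: le_bool_def)
  qed
  have cyc: "f \<cdot> (Idn C (W (T a)) \<boxtimes> kb (Suc m) \<boxtimes> Idn C (W (T c))) = Zero C (W (T a) \<odot> X (Suc m) \<odot> W (T c)) J"
  proof -
    have w2: "TFT a (Suc (Suc m)) c \<in> words (Suc n)" by (rule TFT_words) (use m in simp_all)
    have "scale C ((- 1) ^ a) (f \<cdot> (Idn C (W (T a)) \<boxtimes> kb (Suc m) \<boxtimes> Idn C (W (T c)))) =
        (x \<cdot> bd \<beta> (Suc n)) \<cdot> rin (Suc n) (TFT a (Suc (Suc m)) c)"
      unfolding f_def using bd_TFT[of "Suc n" a m c x J \<beta>] m ac x van by simp
    also have "\<dots> = Zero C (W (T a) \<odot> X (Suc m) \<odot> W (T c)) J"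
      unfolding x(3) using w2 by (simp add: W_TFT)
    finally show ?thesis
      using f cK.Cb_Hom(3,4)[of "Suc m"] by (subst (asm) scale_eq_Zero_iff) simp_all
  qed
  note contract = bar_contract[where V = "Unit C", OF J(2) sp sU, of f a m, unfolded tensor_Unit, OF f kill tail cyc]
  have new: "w' \<in> words n \<Longrightarrow> lev a (Suc c) w' \<Longrightarrow> \<not> lev a c w' \<Longrightarrow> list_all2 (\<le>) w' ?w" for w'
  proof -
    assume w': "w' \<in> words n" "lev a (Suc c) w'" "\<not> lev a c w'"
    have "length w' = Suc n" using w'(1) by (simp add: in_words_iff)
    from lev_new[OF w'(2,3) this] obtain k where "Suc n = a + Suc k + c" "list_all2 (\<le>) w' (TFT a (Suc k) c)" .
    then show ?thesis using m by simp
  qed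
  show ?thesis
  proof (cases m)
    \<comment> \<open>A single letter K is the bottom degree of the bar complex, so acyclicity
      forces \<open>f\<close> to vanish, and with it \<open>x\<close> on all words below.\<close>
    case 0
    then have f0: "f = Zero C (W (T a) \<odot> X m \<odot> W (T c)) J" using contract by simp
    have "x \<cdot> rin n w' = Zero C (W w') J" if w': "w' \<in> words n" "lev a (Suc c) w'" for w'
    proof (cases "lev a c w'")
      case False
      note le = new[OF w' False]
      have "x \<cdot> rin n w' = f \<cdot> incl w' ?w"
        unfolding f_def rin_incl[OF w'(1) w le, symmetric] using x w incl_Hom[OF le] by simp
      then show ?thesis unfolding f0 using incl_Hom[OF le] by (simp add: W_TFT)
    qed (rule van[OF w'(1)])
    then show ?thesis by (rule triv)
  next
    case (Suc k)
    let ?v = "TFT a (Suc k) c"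
    have nv: "n = a + Suc k + c" "Suc (n - 1) = a + Suc k + c" using m Suc by simp_all
    obtain g where g: "Dom C g = W (T a) \<odot> X k \<odot> W (T c)" "Cod C g = J"
      and fg: "f = g \<cdot> (Idn C (W (T a)) \<boxtimes> kb (Suc k) \<boxtimes> Idn C (W (T c)))"
      and gk: "\<And>j. j < a \<Longrightarrow> g \<cdot> (incl ((T a)[j := False]) (T a) \<boxtimes> Idn C (X k \<odot> W (T c))) =
        Zero C (W ((T a)[j := False]) \<odot> X k \<odot> W (T c)) J"
      and gt: "g \<cdot> (Idn C (W (T a)) \<boxtimes> Idn C (X k) \<boxtimes> s) = Zero C (W (T a) \<odot> X k \<odot> Dom C s) J"
      using contract Suc by auto
    have gt1: "Dom C g = W ?v" using g by (simp add: W_TFT)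
    \<comment> \<open>By \<open>TFT_above\<close> the vanishing conditions on the primitive cover
      all words of the lower step, so extending it by zero is compatible with the
      inclusions.\<close>
    have gkill: "g \<cdot> incl u ?v = Zero C (W u) J" if u: "list_all2 (\<le>) u ?v" "lev a c u" for u
      using TFT_above[OF u]
    proof (elim disjE exE conjE)
      fix j assume j: "j < a" "list_all2 (\<le>) u (?v[j := False])"
      have le: "list_all2 (\<le>) (?v[j := False]) ?v" using lev_below(1)[OF _ nv(2) j(1)] by simp
      have "g \<cdot> incl u ?v = (g \<cdot> incl (?v[j := False]) ?v) \<cdot> incl u (?v[j := False])"
        using incl_incl[OF j(2) le] gt1 incl_Hom[OF j(2)] incl_Hom[OF le] by simp
      also have "g \<cdot> incl (?v[j := False]) ?v = Zero C (W (?v[j := False])) J"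
        unfolding incl_TFT_update[OF j(1)] by (rule gk[OF j(1)])
      finally show ?thesis using incl_Hom[OF j(2)] by simp
    next
      fix c' assume c': "c = Suc c'" "list_all2 (\<le>) u (TFT a (Suc (Suc k)) c')"
      let ?v' = "TFT a (Suc (Suc k)) c'"
      have le: "list_all2 (\<le>) ?v' ?v" using lev_below(2)[OF _ nv(2) c'(1)] by simp
      have "g \<cdot> incl u ?v = (g \<cdot> incl ?v' ?v) \<cdot> incl u ?v'"
        using incl_incl[OF c'(2) le] gt1 incl_Hom[OF c'(2)] incl_Hom[OF le] by simp
      also have "g \<cdot> incl ?v' ?v = Zero C (W ?v') J"
        using gt unfolding c'(1) incl_TFT_tail s_def by simp
      finally show ?thesis using incl_Hom[OF c'(2)] by simp
    qed
    \<comment> \<open>A down-closed set: the lower step together with the words below the new one.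
      The factor (-1)^a in \<open>\<phi>\<close> cancels the sign from
      \<open>bd_TFT\<close>.\<close>
    define S where "S = {u. length u = n \<and> (lev a c u \<or> list_all2 (\<le>) u ?v)}"
    define \<phi> where "\<phi> u = (if list_all2 (\<le>) u ?v then scale C ((- 1) ^ a) (g \<cdot> incl u ?v) else Zero C (W u) J)" for u
    have \<phi>0: "\<phi> u = Zero C (W u) J" if "lev a c u" for u
      using gkill[of u] that by (simp add: \<phi>_def)
    have "\<exists>\<Phi>. Dom C \<Phi> = Unit C \<odot> W (T n) \<and> Cod C \<Phi> = J \<and> (\<forall>u\<in>S. \<Phi> \<cdot> (Idn C (Unit C) \<boxtimes> incl u (T n)) = \<phi> u)"
    proof (rule extend_family[OF J(1)])
      show "length u = n" if "u \<in> S" for u using that by (simp add: S_def)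
      show "u \<in> S" if "u' \<in> S" "list_all2 (\<le>) u u'" for u u'
        using that lev_mono[OF that(2)] all2_le_trans[OF that(2)] list_all2_lengthD[OF that(2)]
        unfolding S_def mem_Collect_eq by metis
      show "Dom C (\<phi> u) = Unit C \<odot> W u \<and> Cod C (\<phi> u) = J" for u
        using incl_Hom[of u ?v] gt1 g(2) by (simp add: \<phi>_def del: le_bool_def)
      show "\<phi> u' \<cdot> (Idn C (Unit C) \<boxtimes> incl u u') = \<phi> u" if u': "u' \<in> S" and le: "list_all2 (\<le>) u u'" for u u'
      proof (cases "list_all2 (\<le>) u' ?v")
        case True
        have uv: "list_all2 (\<le>) u ?v" by (rule all2_le_trans[OF le True])
        have "\<phi> u' = scale C ((- 1) ^ a) (g \<cdot> incl u' ?v)" "\<phi> u = scale C ((- 1) ^ a) (g \<cdot> incl u ?v)"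
          unfolding \<phi>_def using True uv by (simp_all only: if_True)
        then show ?thesis
          using incl_incl[OF le True] incl_Hom[OF le] incl_Hom[OF True] gt1 by simp
      next
        case False
        then have "lev a c u'" using u' by (simp add: S_def)
        from \<phi>0[OF this] \<phi>0[OF lev_mono[OF le this]] show ?thesis
          using incl_Hom[OF le] by simp
      qed
    qed
    then obtain \<Phi> where \<Phi>: "Dom C \<Phi> = W (As (n - 1))" "Cod C \<Phi> = J"
      and \<Phi>u: "\<And>u. u \<in> S \<Longrightarrow> \<Phi> \<cdot> incl u (As (n - 1)) = \<phi> u"
      using n by (auto simp del: replicate_Suc W_simps)
    define y where "y = \<Phi> \<cdot> \<theta> (n - 1)"
    have yt: "Dom C y = rob (n - 1)" "Cod C y = J" using \<Phi> by (simp_all add: y_def del: replicate_Suc W_simps \<theta>.g_Hom)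
    have y_in: "y \<cdot> rin (n - 1) u = \<phi> u" if "u \<in> words (n - 1)" "u \<in> S" for u
      using \<Phi>u[OF that(2)] \<theta>_in[OF that(1)] that(1) \<Phi> by (simp add: y_def del: replicate_Suc W_simps \<theta>.g_Hom)
    have wS: "u \<in> S" if "u \<in> words (n - 1)" "lev a c u \<or> list_all2 (\<le>) u ?v" for u
      using that n unfolding S_def in_words_iff mem_Collect_eq by auto
    have y_van: "y \<cdot> rin (n - 1) u = Zero C (W u) J" if "u \<in> words (n - 1)" "lev a c u" for u
      using y_in[OF that(1) wS] that \<phi>0[OF that(2)] by simp
    have vw: "?v \<in> words (n - 1)" by (rule TFT_words) (use nv in simp_all)
    have yv: "y \<cdot> rin (n - 1) ?v = scale C ((- 1) ^ a) g"
      using y_in[OF vw wS[OF vw]] gt1 by (simp add: \<phi>_def)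
    have yw: "(y \<cdot> bd \<beta> n) \<cdot> rin n ?w = f"
    proof -
      have "(y \<cdot> bd \<beta> n) \<cdot> rin n (TFT a (Suc (Suc k)) c) =
          scale C ((- 1) ^ a) ((y \<cdot> rin (n - 1) ?v) \<cdot> (Idn C (W (T a)) \<boxtimes> kb (Suc k) \<boxtimes> Idn C (W (T c))))"
        using y_van by (intro bd_TFT[OF nv(1) ac yt])
      also have "\<dots> = f"
        unfolding yv fg using g cK.Cb_Hom(3,4)[of "Suc k"] by (simp flip: power_mult_distrib)
      finally show ?thesis using Suc by simp
    qed
    \<comment> \<open>On the lower step both sides are zero; all new words lie below the maximal
      one, on which the two agree.\<close>
    have y_lev: "(y \<cdot> bd \<beta> n) \<cdot> rin n w' = x \<cdot> rin n w'" if w': "w' \<in> words n" "lev a (Suc c) w'" for w'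
    proof (cases "lev a c w'")
      case True
      then show ?thesis
        using bd_lev[OF n yt y_van w'(1) True] van[OF w'(1) True] by simp
    next
      case False
      note le = new[OF w' False]
      have "(y \<cdot> bd \<beta> n) \<cdot> rin n w' = ((y \<cdot> bd \<beta> n) \<cdot> rin n ?w) \<cdot> incl w' ?w"
        unfolding rin_incl[OF w'(1) w le, symmetric] using yt n w incl_Hom[OF le] by simp
      also have "\<dots> = x \<cdot> rin n w'"
        unfolding yw f_def rin_incl[OF w'(1) w le, symmetric] using x w incl_Hom[OF le] by simp
      finally show ?thesis .
    qed
    show ?thesis
      using yt y_lev y_van[OF Ks_words lev_Ks[OF ac]] by blast
  qed
qed
qed

text \<open>Acyclicity of the kernel of restriction to K. The filtration is climbed from (0, 1) by
  raising \<open>c\<close>, with a passage to (a + 1, 0) each time \<open>c\<close> has reached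
  \<open>n + 2\<close>; the level (n + 1, 0) contains all words.\<close>

lemma rel_cocycle_bounds:
  assumes J: "rel_injective C J" "bar_acyclic J"
    and x: "Dom C x = rob n" "Cod C x = J" "x \<cdot> bd \<beta> (Suc n) = Zero C (rob (Suc n)) J"
      "x \<cdot> rin n (Ks n) = Zero C (W (Ks n)) J"
  shows "if n = 0 then x = Zero C (rob n) J
    else \<exists>y. Dom C y = rob (n - 1) \<and> Cod C y = J \<and> y \<cdot> rin (n - 1) (Ks (n - 1)) = Zero C (W (Ks (n - 1))) J \<and>
      x = y \<cdot> bd \<beta> n"
proof (cases "n = 0")
  case True
  have "x = Zero C (rob n) J"
  proof (rule rel_ext[where n = n])
    fix w assume w: "w \<in> words n"
    then have "length w = Suc 0" "False \<in> set w" using True by (simp_all add: in_words_iff)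
    \<comment> \<open>In degree 0 the relative complex has K as its only word.\<close>
    then have "w = Ks n" using True by (auto simp: length_Suc_conv)
    then show "x \<cdot> rin n w = Zero C (rob n) J \<cdot> rin n w"
      using x(4) w by (simp del: replicate_Suc W_simps)
  qed (use x in simp_all)
  then show ?thesis using True by simp
next
  case False
  then have n: "0 < n" by simp
  define good where "good a c \<longleftrightarrow> (\<exists>y. Dom C y = rob (n - 1) \<and> Cod C y = J \<and>
      y \<cdot> rin (n - 1) (Ks (n - 1)) = Zero C (W (Ks (n - 1))) J \<and>
      (\<forall>w\<in>words n. lev a c w \<longrightarrow> (y \<cdot> bd \<beta> n) \<cdot> rin n w = x \<cdot> rin n w))" for a c
  have start: "good 0 (Suc 0)"
    unfolding good_def
  proof (intro exI[of _ "Zero C (rob (n - 1)) J"] conjI ballI impI)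
    show "Zero C (rob (n - 1)) J \<cdot> rin (n - 1) (Ks (n - 1)) = Zero C (W (Ks (n - 1))) J"
      by (subst Zero_comp) (simp_all only: rin_Hom[OF Ks_words])
    fix w assume w: "w \<in> words n" "lev 0 (Suc 0) w"
    then have "w = Ks n" using lev_0_1[OF w(2)] unfolding in_words_iff by metis
    then show "(Zero C (rob (n - 1)) J \<cdot> bd \<beta> n) \<cdot> rin n w = x \<cdot> rin n w"
      using x(4) w n by (simp del: replicate_Suc W_simps)
  qed simp_all
  have step: "good a (Suc c)" if ac: "0 < a \<or> 0 < c" and good: "good a c" for a c
  proof -
    obtain y where y: "Dom C y = rob (n - 1)" "Cod C y = J"
      "y \<cdot> rin (n - 1) (Ks (n - 1)) = Zero C (W (Ks (n - 1))) J"
      and yx: "\<And>w. w \<in> words n \<Longrightarrow> lev a c w \<Longrightarrow> (y \<cdot> bd \<beta> n) \<cdot> rin n w = x \<cdot> rin n w"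
      using good unfolding good_def by blast
    note b = bd_Hom[OF n, of \<beta>] bd_Hom[of "Suc n" \<beta>, simplified]
    \<comment> \<open>The part of the cocycle not yet accounted for; it vanishes on the current
      step.\<close>
    define x' where "x' = x \<boxplus> scale C (- 1) (y \<cdot> bd \<beta> n)"
    have x't: "Dom C x' = rob n" "Cod C x' = J" using x y b by (simp_all add: x'_def)
    have x'b: "x' \<cdot> bd \<beta> (Suc n) = Zero C (rob (Suc n)) J"
      using x y b bd_bd[OF n, of \<beta>] by (simp add: x'_def)
    have x'w: "x' \<cdot> rin n w = x \<cdot> rin n w \<boxplus> scale C (- 1) ((y \<cdot> bd \<beta> n) \<cdot> rin n w)" if "w \<in> words n" for w
      using x y b that by (simp add: x'_def)
    have x'v: "x' \<cdot> rin n w = Zero C (W w) J" if "w \<in> words n" "lev a c w" for w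
      unfolding x'w[OF that(1)] yx[OF that] using x that by simp
    obtain y' where y': "Dom C y' = rob (n - 1)" "Cod C y' = J"
      "y' \<cdot> rin (n - 1) (Ks (n - 1)) = Zero C (W (Ks (n - 1))) J"
      and y'x: "\<And>w. w \<in> words n \<Longrightarrow> lev a (Suc c) w \<Longrightarrow> (y' \<cdot> bd \<beta> n) \<cdot> rin n w = x' \<cdot> rin n w"
      using kill_level[OF J n ac x't x'b x'v] by blast
    show ?thesis
      unfolding good_def
    proof (intro exI[of _ "y \<boxplus> y'"] conjI ballI impI)
      show "(y \<boxplus> y') \<cdot> rin (n - 1) (Ks (n - 1)) = Zero C (W (Ks (n - 1))) J"
        using y y' rin_Hom[OF Ks_words, of "n - 1"] by (simp del: replicate_Suc W_simps)
      fix w assume w: "w \<in> words n" "lev a (Suc c) w"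
      have "((y \<boxplus> y') \<cdot> bd \<beta> n) \<cdot> rin n w = (y \<cdot> bd \<beta> n) \<cdot> rin n w \<boxplus> (y' \<cdot> bd \<beta> n) \<cdot> rin n w"
        using y y' b w by simp
      also have "\<dots> = x \<cdot> rin n w"
        unfolding y'x[OF w] x'w[OF w(1)] using x y b w by (simp add: Plus_left_commute del: comp_assoc)
      finally show "((y \<boxplus> y') \<cdot> bd \<beta> n) \<cdot> rin n w = x \<cdot> rin n w" .
    qed (use y y' in simp_all)
  qed
  have steps: "good a (c + k)" if "0 < a \<or> 0 < c" "good a c" for a c k
    using that by (induction k) (auto intro: step)
  \<comment> \<open>Words of degree \<open>n\<close> have \<open>n + 1\<close> letters, so with
    \<open>c = n + 2\<close> the second alternative of \<open>lev\<close> asks only for a K at place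
    \<open>a\<close>.\<close>
  have top: "good (Suc a) 0" if "good a (Suc (Suc n))" for a
  proof -
    have "lev a (Suc (Suc n)) w" if "w \<in> words n" "lev (Suc a) 0 w" for w
      using lev_Suc_0[OF that(2), of n] that(1) by (simp add: in_words_iff)
    moreover obtain y where "Dom C y = rob (n - 1)" "Cod C y = J"
      "y \<cdot> rin (n - 1) (Ks (n - 1)) = Zero C (W (Ks (n - 1))) J"
      "\<And>w. w \<in> words n \<Longrightarrow> lev a (Suc (Suc n)) w \<Longrightarrow> (y \<cdot> bd \<beta> n) \<cdot> rin n w = x \<cdot> rin n w"
      using \<open>good a (Suc (Suc n))\<close> unfolding good_def by blast
    ultimately show ?thesis unfolding good_def by (intro exI[of _ y]) blast
  qed
  have all: "good (Suc a) 0" for a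
  proof (induction a)
    case 0
    show ?case using top[of 0] steps[OF _ start, of "Suc n"] by simp
  next
    case (Suc a)
    show ?case using top[of "Suc a"] steps[OF _ Suc, of "Suc (Suc n)"] by simp
  qed
  obtain y where y: "Dom C y = rob (n - 1)" "Cod C y = J"
    "y \<cdot> rin (n - 1) (Ks (n - 1)) = Zero C (W (Ks (n - 1))) J"
    and yx: "\<And>w. w \<in> words n \<Longrightarrow> lev (Suc n) 0 w \<Longrightarrow> (y \<cdot> bd \<beta> n) \<cdot> rin n w = x \<cdot> rin n w"
    using all[of n] unfolding good_def by blast
  have "x = y \<cdot> bd \<beta> n"
  proof (rule rel_ext[where n = n])
    fix w assume w: "w \<in> words n"
    then have "lev (Suc n) 0 w" using lev_all[of w] by (simp add: in_words_iff)
    from yx[OF w this] show "x \<cdot> rin n w = (y \<cdot> bd \<beta> n) \<cdot> rin n w" ..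
  qed (use x y n in simp_all)
  then show ?thesis using y False by auto
qed

text \<open>The pure word of K is minimal, so it forms a down-closed set by itself, and
  \<open>extend_family\<close> applies with a single arrow.\<close>

lemma rel_nat_extend:
  assumes J: "rel_injective C J" and x: "Dom C x = W (Ks n)" "Cod C x = J"
  obtains y where "Dom C y = rob n" "Cod C y = J" "y \<cdot> rin n (Ks n) = x"
proof -
  have "\<exists>\<Phi>. Dom C \<Phi> = Unit C \<odot> W (T (Suc n)) \<and> Cod C \<Phi> = J \<and>
      (\<forall>w\<in>{Ks n}. \<Phi> \<cdot> (Idn C (Unit C) \<boxtimes> incl w (T (Suc n))) = x)"
  proof (rule extend_family[OF J, where \<phi> = "\<lambda>_. x"])
    fix w w' assume w: "w' \<in> {Ks n}" "list_all2 (\<le>) w w'"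
    have "w = Ks n"
    proof (rule nth_equalityI)
      show "length w = length (Ks n)" using w by (simp add: list_all2_lengthD)
      show "w ! j = Ks n ! j" if "j < length w" for j
        using le_nthD[OF w(2) that] list_all2_lengthD[OF w(2)] w(1) that by (auto simp del: replicate_Suc)
    qed
    then show "w \<in> {Ks n}" by simp
    show "x \<cdot> (Idn C (Unit C) \<boxtimes> incl w w') = x"
      using w(1) x \<open>w = Ks n\<close> by (simp del: replicate_Suc W_simps)
  qed (use x in \<open>simp_all del: replicate_Suc W_simps\<close>)
  then obtain \<Phi> where \<Phi>: "Dom C \<Phi> = W (As n)" "Cod C \<Phi> = J" "\<Phi> \<cdot> incl (Ks n) (As n) = x"
    by (auto simp del: replicate_Suc W_simps)
  show thesis
  proof
    show "(\<Phi> \<cdot> \<theta> n) \<cdot> rin n (Ks n) = x"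
      using \<Phi> \<theta>_in[OF Ks_words, of n] by (simp del: replicate_Suc W_simps \<theta>.g_Hom)
  qed (use \<Phi> in \<open>simp_all del: replicate_Suc W_simps \<theta>.g_Hom\<close>)
qed

end

section \<open>From the contractibility condition to the four weak equivalences\<close>

context base_cat begin

lemma chain_complex_in_degree_0: "chain_complex C (in_degree_0 C J)"
  unfolding chain_complex_def by (simp add: in_degree_0_def Let_def)

lemma chain_complex_tensor: "chain_complex C Q \<Longrightarrow> chain_complex C (tensor_chain C V Q)"
  unfolding chain_complex_def by (simp add: tensor_chain_def interchange)

text \<open>The source is zero in every degree, so surjectivity on cohomology is automatic, and
  injectivity says that every cocycle is a coboundary.\<close>

lemma weakly_contractible_iff:
  assumes Q: "chain_complex C Q"
  shows "weakly_contractible C Q \<longleftrightarrow>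
    (\<forall>J. rel_injective C J \<longrightarrow> (\<forall>k y. cocycle Q J k y \<longrightarrow> coboundary Q J k y))"
proof -
  let ?Z = "in_degree_0 C (zero_ob C)" and ?f = "\<lambda>n. Zero C (zero_ob C) (Ob Q n)"
  note Z = chain_complex_in_degree_0[of "zero_ob C"]
  note [simp] = chain_complexD(1,2)[OF Q] chain_complexD(1,2)[OF Z]
  have Ob [simp]: "Ob ?Z n = zero_ob C" for n by (simp add: Ob_in_degree_0)
  have "chain_map C ?Z Q ?f"
    unfolding chain_map_def by (simp add: Q Z)
  moreover have "equiv_on ?Z Q ?f J \<longleftrightarrow> (\<forall>k y. cocycle Q J k y \<longrightarrow> coboundary Q J k y)" for J
  proof -
    have triv: "coboundary ?Z J k (Zero C (zero_ob C) J)" for k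
      unfolding coboundary_def by (intro exI[of _ "Zero C (zero_ob C) J"]) simp
    have "\<exists>y u. cocycle Q J k y \<and> coboundary ?Z J k u \<and> x = u \<boxplus> y \<cdot> ?f k" if "cocycle ?Z J k x" for k x
    proof (intro exI conjI)
      show "cocycle Q J k (Zero C (Ob Q k) J)" by (simp add: cocycle_def)
      show "coboundary ?Z J k (Zero C (zero_ob C) J)" by (rule triv)
      show "x = Zero C (zero_ob C) J \<boxplus> Zero C (Ob Q k) J \<cdot> ?f k"
        using that zero_ob_Zero[OF is_zero_ob_zero_ob, of x "zero_ob C" J] by (simp add: cocycle_def)
    qed
    moreover have "y \<cdot> ?f k = Zero C (zero_ob C) J" if "cocycle Q J k y" for k y
      using that by (simp add: cocycle_def)
    ultimately show ?thesis
      unfolding equiv_on_def using triv by (smt (verit))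
  qed
  ultimately show ?thesis
    unfolding weakly_contractible_def weak_equiv_iff by simp
qed

end

context cof_pair begin

lemma Bar_complex: "chain_complex C (Bar C (cyc_of C K))"
  using nat.Bar_chain_map by (simp add: chain_map_def)

lemma bar_acyclic_iff:
  "bar_acyclic J \<longleftrightarrow> (\<forall>V k y. cocycle (tensor_chain C V (Bar C (cyc_of C K))) J k y \<longrightarrow>
     coboundary (tensor_chain C V (Bar C (cyc_of C K))) J k y)"
proof -
  let ?Q = "\<lambda>V. tensor_chain C V (Bar C (cyc_of C K))"
  have Ob: "Ob (?Q V) (int m) = V \<odot> X m" "Bd (?Q V) (int (Suc m)) = Idn C V \<boxtimes> kb (Suc m)" for V m
    by (simp_all add: tensor_chain_def Bar_def Ob_nonneg Bd_nonneg del: of_nat_Suc)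
  have Ob_neg: "is_zero_ob C (Ob (?Q V) k)" if "k < 0" for V k
    using that by (simp add: tensor_chain_def Bar_def Ob_nonneg is_zero_ob_tensor is_zero_ob_zero_ob)
  have Bd: "Dom C (Bd (?Q V) k) = Ob (?Q V) k" "Cod C (Bd (?Q V) k) = Ob (?Q V) (k - 1)" for V k
    using chain_complexD(1,2)[OF chain_complex_tensor[OF Bar_complex]] by simp_all
  have zero: "coboundary (?Q V) J k (Zero C (Ob (?Q V) k) J)" for V k
    unfolding coboundary_def by (intro exI[of _ "Zero C (Ob (?Q V) (k - 1)) J"]) (simp add: Bd)
  have cyc: "cocycle (?Q V) J (int m) y \<longleftrightarrow> Dom C y = V \<odot> X m \<and> Cod C y = J \<and>
      y \<cdot> (Idn C V \<boxtimes> kb (Suc m)) = Zero C (V \<odot> X (Suc m)) J" for V m y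
    unfolding cocycle_def using Ob[of V "Suc m"] Ob(1)[of V m] Ob(2)[of V m] by (simp add: add.commute)
  have cob: "coboundary (?Q V) J (int m) y \<longleftrightarrow> (if m = 0 then y = Zero C (V \<odot> X m) J
      else \<exists>g. Dom C g = V \<odot> X (m - 1) \<and> Cod C g = J \<and> y = g \<cdot> (Idn C V \<boxtimes> kb m))" for V m y
  proof (cases m)
    case 0
    have "y = Zero C (Ob (?Q V) 0) J" if c: "coboundary (?Q V) J 0 y"
    proof -
      obtain g where g: "Dom C g = Ob (?Q V) (- 1)" "Cod C g = J" "y = g \<cdot> Bd (?Q V) 0"
        using c[unfolded coboundary_def, simplified] by blast
      then have "g = Zero C (Ob (?Q V) (- 1)) J"
        using zero_ob_Zero[OF Ob_neg[of "- 1" V], of g _ J] by simp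
      then show ?thesis using g(3) Bd[of V 0] by simp
    qed
    then show ?thesis using zero[of V 0] Ob(1)[of V 0] 0 by auto
  next
    case (Suc m')
    then show ?thesis
      unfolding coboundary_def using Ob(1)[of V m'] Ob(2)[of V m'] by simp
  qed
  have "(\<forall>k y. cocycle (?Q V) J k y \<longrightarrow> coboundary (?Q V) J k y) \<longleftrightarrow>
      (\<forall>m y. cocycle (?Q V) J (int m) y \<longrightarrow> coboundary (?Q V) J (int m) y)" for V
  proof (intro iffI allI impI)
    fix k y assume nonneg: "\<forall>m y. cocycle (?Q V) J (int m) y \<longrightarrow> coboundary (?Q V) J (int m) y"
      and y: "cocycle (?Q V) J k y"
    show "coboundary (?Q V) J k y"
    proof (cases "k < 0")
      case True
      then have "y = Zero C (Ob (?Q V) k) J"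
        using zero_ob_Zero[OF Ob_neg[OF True, of V], of y _ J] y unfolding cocycle_def by blast
      then show ?thesis using zero by simp
    next
      case False
      then have "k = int (nat k)" by simp
      then show ?thesis using nonneg y by metis
    qed
  qed blast
  then show ?thesis
    unfolding bar_acyclic_def by (simp only: cyc cob) blast
qed

lemma contractible_iff_bar_acyclic:
  "(\<forall>V. weakly_contractible C (tensor_chain C V (Bar C (cyc_of C K)))) \<longleftrightarrow>
    (\<forall>J. rel_injective C J \<longrightarrow> bar_acyclic J)"
  unfolding weakly_contractible_iff[OF chain_complex_tensor[OF Bar_complex]] bar_acyclic_iff by blast

text \<open>A common form for both complexes: it is instantiated with \<open>b\<close> of
  \<open>K\<close> and \<open>\<beta>\<close> true, and with \<open>b'\<close> of \<open>K\<close>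
  and \<open>\<beta>\<close> false.\<close>

lemma rel_acyclic_nonneg:
  assumes J: "rel_injective C J" "bar_acyclic J"
  shows "rel_acyclic (nonneg_chain C X \<delta>) (nonneg_chain C rob (bd \<beta>)) (nonneg_map C (rel_nat C K A i)) J"
    (is "rel_acyclic ?X ?Y ?f J")
  unfolding rel_acyclic_def
proof (intro allI conjI impI)
  have nat: "?f (int n) = rin n (Ks n)" for n
    by (simp add: nonneg_map_def rel_nat_def)
  have Ob: "Ob ?X (int n) = W (Ks n)" "Ob ?Y (int n) = rob n" for n
    by (simp_all add: Ob_nonneg CX_K del: replicate_Suc W_simps)
  have neg: "Ob ?X k = zero_ob C" "Ob ?Y k = zero_ob C" "?f k = Zero C (zero_ob C) (zero_ob C)" if "k < 0" for k
    using that by (simp_all add: Ob_nonneg nonneg_map_def)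
  fix k
  show "\<exists>y. Dom C y = Ob ?Y k \<and> Cod C y = J \<and> y \<cdot> ?f k = x" if x: "Dom C x = Ob ?X k" "Cod C x = J" for x
  proof (cases "k < 0")
    case True
    then show ?thesis
      using x zero_ob_Zero[OF is_zero_ob_zero_ob, of x "zero_ob C" J]
      by (intro exI[of _ "Zero C (zero_ob C) J"]) (simp add: neg)
  next
    case False
    then obtain n where k: "k = int n" by (metis nonneg_int_cases not_less)
    from x obtain y where "Dom C y = rob n" "Cod C y = J" "y \<cdot> rin n (Ks n) = x"
      unfolding k Ob by (rule rel_nat_extend[OF J(1)])
    then show ?thesis unfolding k nat Ob by blast
  qed
  fix y assume y: "cocycle ?Y J k y" "y \<cdot> ?f k = Zero C (Ob ?X k) J"
  show "\<exists>z. Dom C z = Ob ?Y (k - 1) \<and> Cod C z = J \<and> z \<cdot> ?f (k - 1) = Zero C (Ob ?X (k - 1)) J \<and> y = z \<cdot> Bd ?Y k"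
  proof (cases "k \<le> 0")
    case True
    have "y = Zero C (Ob ?Y k) J"
    proof (cases "k = 0")
      case False
      then have "Ob ?Y k = zero_ob C" using True by (simp add: neg)
      then show ?thesis
        using y(1) zero_ob_Zero[OF is_zero_ob_zero_ob, of y "zero_ob C" J] by (simp add: cocycle_def)
    next
      case k: True
      have "y \<cdot> bd \<beta> (Suc 0) = Zero C (rob (Suc 0)) J" "Dom C y = rob 0" "Cod C y = J"
        using y(1) k by (simp_all add: cocycle_def Ob_nonneg Bd_nonneg)
      moreover have "y \<cdot> rin 0 (Ks 0) = Zero C (W (Ks 0)) J"
        using y(2) nat[of 0] Ob(1)[of 0] k by simp
      ultimately show ?thesis
        using rel_cocycle_bounds[OF J, of y 0 \<beta>] Ob(2)[of 0] k by simp
    qed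
    then show ?thesis
      using True by (intro exI[of _ "Zero C (zero_ob C) J"]) (simp add: neg Bd_nonneg)
  next
    case False
    then obtain n where k: "k = int (Suc n)" by (metis not_le zero_less_imp_eq_int gr0_implies_Suc)
    have k1: "k + 1 = int (Suc (Suc n))" "k - 1 = int n" using k by simp_all
    have b: "Bd ?Y (int (Suc m)) = bd \<beta> (Suc m)" for m
      by (simp add: Bd_nonneg del: of_nat_Suc)
    have y': "Dom C y = rob (Suc n)" "Cod C y = J" "y \<cdot> bd \<beta> (Suc (Suc n)) = Zero C (rob (Suc (Suc n))) J"
      using y(1) unfolding cocycle_def k1 unfolding k Ob b by blast+
    have "y \<cdot> rin (Suc n) (Ks (Suc n)) = Zero C (W (Ks (Suc n))) J"
      using y(2) unfolding k Ob nat .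
    from rel_cocycle_bounds[OF J y' this] show ?thesis
      unfolding k1 unfolding k Ob nat b by simp
  qed
qed

lemma rel_acyclic_rel:
  assumes "rel_injective C J" "bar_acyclic J"
  shows "rel_acyclic (Hoch C (cyc_of C K)) (Hoch C rel) (nonneg_map C (rel_nat C K A i)) J"
    and "rel_acyclic (Bar C (cyc_of C K)) (Bar C rel) (nonneg_map C (rel_nat C K A i)) J"
  using rel_acyclic_nonneg[OF assms, of "Cb (cyc_of C K)" True]
    rel_acyclic_nonneg[OF assms, of "Cb' (cyc_of C K)" False]
  by (simp_all add: Hoch_def Bar_def bd_def[abs_def])

sublocale BB: mixed_map C "Om C (cyc_of C K)" "Om C rel" "Om_map C (cyc_of C K) rel (rel_nat C K A i)"
  by unfold_locales
    (simp_all add: cK.mixed_complex_Om R.mixed_complex_Om zero_in_Om nat.Om_chain_map nat.Om_map_Bop)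

lemma weak_equivs:
  assumes "\<And>J. rel_injective C J \<Longrightarrow> bar_acyclic J"
  shows "weak_equiv C (Hoch C (cyc_of C K)) (Hoch C rel) (nonneg_map C (rel_nat C K A i))"
    and "weak_equiv C (Bar C (cyc_of C K)) (Bar C rel) (nonneg_map C (rel_nat C K A i))"
    and "mixed_weak_equiv C (Om C (cyc_of C K)) (Om C rel) (Om_map C (cyc_of C K) rel (rel_nat C K A i))"
    and "S_weak_equiv C (BB C (Om C (cyc_of C K))) (BB C (Om C rel))
      (BB_map C (Om C (cyc_of C K)) (Om C rel) (Om_map C (cyc_of C K) rel (rel_nat C K A i)))"
proof -
  note Om = nat.rel_acyclic_Om[OF rel_acyclic_rel]
  show "weak_equiv C (Hoch C (cyc_of C K)) (Hoch C rel) (nonneg_map C (rel_nat C K A i))"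
    "weak_equiv C (Bar C (cyc_of C K)) (Bar C rel) (nonneg_map C (rel_nat C K A i))"
    unfolding weak_equiv_iff
    using rel_acyclic_equiv_on[OF nat.Hoch_chain_map rel_acyclic_rel(1)]
      rel_acyclic_equiv_on[OF nat.Bar_chain_map rel_acyclic_rel(2)] nat.Hoch_chain_map nat.Bar_chain_map assms
    by blast+
  show "mixed_weak_equiv C (Om C (cyc_of C K)) (Om C rel) (Om_map C (cyc_of C K) rel (rel_nat C K A i))"
    unfolding mixed_weak_equiv_def weak_equiv_iff
    using rel_acyclic_equiv_on[OF nat.Om_chain_map Om] nat.Om_chain_map nat.Om_map_Bop
      cK.mixed_complex_Om R.mixed_complex_Om assms by blast
  show "S_weak_equiv C (BB C (Om C (cyc_of C K))) (BB C (Om C rel))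
      (BB_map C (Om C (cyc_of C K)) (Om C rel) (Om_map C (cyc_of C K) rel (rel_nat C K A i)))"
    unfolding S_weak_equiv_def weak_equiv_iff
    using rel_acyclic_equiv_on[OF BB.BB_chain_map BB.rel_acyclic_BB[OF Om]] BB.BB_chain_map BB.BB_map_Sop
      BB.M.BB_S_complex BB.N.BB_S_complex assms by blast
qed

end

context base_cat begin

text \<open>The form in which excision is used in the converse.\<close>

lemma equiv_onD:
  assumes "chain_complex C X'" "equiv_on X' Y' f J" "cocycle Y' J k y" "y \<cdot> f k = Zero C (Ob X' k) J"
  shows "coboundary Y' J k y"
proof -
  have "coboundary X' J k (Zero C (Ob X' k) J)"
    unfolding coboundary_def using chain_complexD(1,2)[OF assms(1), of k]
    by (intro exI[of _ "Zero C (Ob X' (k - 1)) J"]) simp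
  then show ?thesis
    using assms(2-4) unfolding equiv_on_def by metis
qed

end

section \<open>Hochschild cochains extended by zero to the mixed complex and to the
  S-complex\<close>

context precyclic_map begin

definition Om_ext0 :: "nat \<Rightarrow> 'm \<Rightarrow> 'm" where
  "Om_ext0 n x = x \<cdot> dsum_prj C (Om_idx (int n)) (Om_smd D' (int n)) 0"

context
  fixes x :: 'm and m :: nat and J :: 'o
  assumes x: "Dom C x = CX D' (Suc m)" "Cod C x = J"
begin

lemma Om_smd_int: "Om_smd D' (int (Suc m)) 0 = CX D' (Suc m)" "Om_smd D' (int (Suc m)) (Suc 0) = CX D' m"
  by (simp_all add: Om_smd_def nat_add_distrib)

lemma Om_ext0_Hom: "Dom C (Om_ext0 (Suc m) x) = Ob (Om C D') (int (Suc m))" "Cod C (Om_ext0 (Suc m) x) = J"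
  using x by (simp_all add: Om_ext0_def Ob_Om Om_idx_iff Om_smd_int del: of_nat_Suc)

lemma Om_ext0_in:
  "Om_ext0 (Suc m) x \<cdot> Om_in D' (Suc m) 0 = x"
  "Om_ext0 (Suc m) x \<cdot> Om_in D' (Suc m) (Suc 0) = Zero C (CX D' m) J"
  using x by (simp_all add: Om_ext0_def Om_in_def Om_idx_iff Om_smd_int prj_inj del: of_nat_Suc)

text \<open>Summand 0 of \<open>Om\<close> is reached by \<open>b\<close> from summand 0 and by 1 -
  t from summand 1, so the extension by zero has to kill both.\<close>

lemma Om_ext0_cocycle:
  assumes "x \<cdot> Cb D' (Suc (Suc m)) = Zero C (CX D' (Suc (Suc m))) J" "x \<cdot> D'.\<omega> (Suc m) = Zero C (CX D' (Suc m)) J"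
  shows "cocycle (Om C D') J (int (Suc m)) (Om_ext0 (Suc m) x)"
proof -
  let ?y = "Om_ext0 (Suc m) x" and ?b = "Bd (Om C D') (int (Suc (Suc m)))"
  note [simp] = Om_ext0_Hom D'.Om_Bd_Hom[of "int (Suc (Suc m))"]
  have n: "int (Suc (Suc m)) - 1 = int (Suc m)" by simp
  have "?y \<cdot> ?b = Zero C (Ob (Om C D') (int (Suc (Suc m)))) J"
  proof (rule Om_ext[where n = "Suc (Suc m)"])
    have "(?y \<cdot> ?b) \<cdot> Om_in D' (Suc (Suc m)) 0 = ?y \<cdot> (?b \<cdot> Om_in D' (Suc (Suc m)) 0)"
      by (rule comp_assoc) (simp_all only: n Om_ext0_Hom D'.Om_Bd_Hom Om_in_Hom)
    also have "\<dots> = (?y \<cdot> Om_in D' (Suc m) 0) \<cdot> Cb D' (Suc (Suc m))"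
      unfolding D'.Om_Bd_0 using D'.Cb_Hom[of "Suc (Suc m)"]
      by (intro comp_assoc[symmetric]) (simp_all del: of_nat_Suc)
    finally show "(?y \<cdot> ?b) \<cdot> Om_in D' (Suc (Suc m)) 0 = Zero C (Ob (Om C D') (int (Suc (Suc m)))) J \<cdot> Om_in D' (Suc (Suc m)) 0"
      unfolding Om_ext0_in assms by (simp del: of_nat_Suc)
    fix k assume "Suc (Suc m) = Suc k"
    have b': "Dom C (Cb' D' (Suc m)) = CX D' (Suc m)" "Cod C (Cb' D' (Suc m)) = CX D' m"
      using D'.Cb_Hom[of "Suc m"] by simp_all
    have "(?y \<cdot> ?b) \<cdot> Om_in D' (Suc (Suc m)) (Suc 0) = ?y \<cdot> (?b \<cdot> Om_in D' (Suc (Suc m)) (Suc 0))"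
      by (rule comp_assoc) (simp_all only: n Om_ext0_Hom D'.Om_Bd_Hom Om_in_Hom)
    also have "\<dots> = (?y \<cdot> Om_in D' (Suc m) 0) \<cdot> D'.\<omega> (Suc m) \<boxplus>
        (?y \<cdot> Om_in D' (Suc m) (Suc 0)) \<cdot> scale C (- 1) (Cb' D' (Suc m))"
      unfolding D'.Om_Bd_1 using b' by (simp del: of_nat_Suc)
    finally show "(?y \<cdot> ?b) \<cdot> Om_in D' (Suc (Suc m)) (Suc 0) =
        Zero C (Ob (Om C D') (int (Suc (Suc m)))) J \<cdot> Om_in D' (Suc (Suc m)) (Suc 0)"
      unfolding Om_ext0_in assms using b' by (simp del: of_nat_Suc)
  qed (simp_all only: n Dom_comp Cod_comp Om_ext0_Hom D'.Om_Bd_Hom Dom_Zero Cod_Zero)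
  then show ?thesis
    using Om_ext0_Hom unfolding cocycle_def by (simp add: add.commute)
qed

text \<open>B lands in summand 1, where the extension is zero.\<close>

lemma Om_ext0_Bop: "Om_ext0 (Suc m) x \<cdot> Bop (Om C D') (int m) = Zero C (Ob (Om C D') (int m)) J"
proof (rule Om_ext[where n = m])
  let ?y = "Om_ext0 (Suc m) x" and ?B = "Bop (Om C D') (int m)"
  have n: "int m + 1 = int (Suc m)" by simp
  have B: "Dom C ?B = Ob (Om C D') (int m)" "Cod C ?B = Ob (Om C D') (int (Suc m))"
    using D'.Om_Bop_Hom[of "int m"] by (simp_all add: add.commute)
  show "Dom C (?y \<cdot> ?B) = Ob (Om C D') (int m)" "Cod C (?y \<cdot> ?B) = Cod C (Zero C (Ob (Om C D') (int m)) J)"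
    using B Om_ext0_Hom by simp_all
  have "(?y \<cdot> ?B) \<cdot> Om_in D' m 0 = (?y \<cdot> Om_in D' (Suc m) (Suc 0)) \<cdot> cyc_norm C D' m"
    using B Om_ext0_Hom D'.Om_Bop_0[of m] by (simp del: of_nat_Suc)
  then show "(?y \<cdot> ?B) \<cdot> Om_in D' m 0 = Zero C (Ob (Om C D') (int m)) J \<cdot> Om_in D' m 0"
    unfolding Om_ext0_in by simp
  fix k assume k: "m = Suc k"
  have "(?y \<cdot> ?B) \<cdot> Om_in D' m (Suc 0) = ?y \<cdot> (?B \<cdot> Om_in D' m (Suc 0))"
    using B Om_ext0_Hom k by (simp del: of_nat_Suc)
  then show "(?y \<cdot> ?B) \<cdot> Om_in D' m (Suc 0) = Zero C (Ob (Om C D') (int m)) J \<cdot> Om_in D' m (Suc 0)"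
    using D'.Om_Bop_1[of k] Om_ext0_Hom k by (simp del: of_nat_Suc)
qed simp

lemma Om_ext0_map:
  assumes "x \<cdot> g (Suc m) = Zero C (CX D (Suc m)) J"
  shows "Om_ext0 (Suc m) x \<cdot> G (int (Suc m)) = Zero C (Ob (Om C D) (int (Suc m))) J"
proof (rule Om_ext[where n = "Suc m"])
  let ?y = "Om_ext0 (Suc m) x" and ?G = "G (int (Suc m))"
  note y = Om_ext0_Hom and G = Om_map_Hom[of "int (Suc m)"]
  have "(?y \<cdot> ?G) \<cdot> Om_in D (Suc m) 0 = (?y \<cdot> Om_in D' (Suc m) 0) \<cdot> g (Suc m)"
    using y Om_map_0[of "Suc m"] by (simp del: of_nat_Suc)
  then show "(?y \<cdot> ?G) \<cdot> Om_in D (Suc m) 0 = Zero C (Ob (Om C D) (int (Suc m))) J \<cdot> Om_in D (Suc m) 0"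
    unfolding Om_ext0_in assms by (simp del: of_nat_Suc)
  have "(?y \<cdot> ?G) \<cdot> Om_in D (Suc m) (Suc 0) = (?y \<cdot> Om_in D' (Suc m) (Suc 0)) \<cdot> g m"
    using y Om_map_1[of m] by (simp del: of_nat_Suc)
  then show "(?y \<cdot> ?G) \<cdot> Om_in D (Suc m) (Suc 0) = Zero C (Ob (Om C D) (int (Suc m))) J \<cdot> Om_in D (Suc m) (Suc 0)"
    unfolding Om_ext0_in by (simp del: of_nat_Suc)
qed (use Om_ext0_Hom in \<open>simp_all del: of_nat_Suc\<close>)

text \<open>Summand 0 is a subcomplex, so the restriction of a primitive to it is a primitive for
  \<open>b\<close>.\<close>

lemma Om_ext0_coboundary:
  assumes "coboundary (Om C D') J (int (Suc m)) (Om_ext0 (Suc m) x)"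
  shows "\<exists>z. Dom C z = CX D' m \<and> Cod C z = J \<and> x = z \<cdot> Cb D' (Suc m)"
proof -
  obtain z where z: "Dom C z = Ob (Om C D') (int m)" "Cod C z = J"
    and xz: "Om_ext0 (Suc m) x = z \<cdot> Bd (Om C D') (int (Suc m))"
    using assms unfolding coboundary_def by auto
  have B: "Cod C (Bd (Om C D') (int (Suc m))) = Ob (Om C D') (int m)"
    using D'.Om_Bd_Hom(2)[of "int (Suc m)"] by simp
  have "x = (z \<cdot> Bd (Om C D') (int (Suc m))) \<cdot> Om_in D' (Suc m) 0"
    unfolding xz[symmetric] Om_ext0_in ..
  also have "\<dots> = (z \<cdot> Om_in D' m 0) \<cdot> Cb D' (Suc m)"
    using z B D'.Om_Bd_0[of m] D'.Cb_Hom[of "Suc m"] by (simp del: of_nat_Suc)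
  finally show ?thesis using z by (intro exI[of _ "z \<cdot> Om_in D' m 0"]) simp
qed

end

end

context mixed_map begin

text \<open>The cochain is extended by zero from summand 0. This summand is reached by
  \<open>b\<close> from itself and by B from summand 1, which explains the hypotheses on
  \<open>y\<close>; it is a subcomplex, so a primitive can be restricted to it.\<close>

lemma BB_injective:
  assumes F: "equiv_on (BB C M) (BB C N) F J" and n: "0 \<le> n"
    and y: "cocycle N J n y" "y \<cdot> Bop N (n - 1) = Zero C (Ob N (n - 1)) J" "y \<cdot> f n = Zero C (Ob M n) J"
  shows "coboundary N J n y"
proof -
  have y0: "Dom C y = Ob N n" "Cod C y = J" "y \<cdot> Bd N (n + 1) = Zero C (Ob N (n + 1)) J"
    using y(1) by (simp_all add: cocycle_def)
  have 0: "0 \<in> BB_idx n" using n by (simp add: BB_idx_iff)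
  define y' where "y' = y \<cdot> dsum_prj C (BB_idx n) (BB_smd N n) 0"
  have y'_Hom: "Dom C y' = Ob (BB C N) n" "Cod C y' = J"
    using y0 0 by (simp_all add: y'_def Ob_BB BB_smd_def)
  have y'_in: "y' \<cdot> BB_in N n p = (if p = 0 then y else Zero C (Ob N (n - 2 * int p)) J)" if "p \<in> BB_idx n" for p
    using y0 0 that by (simp add: y'_def BB_in_def BB_smd_def prj_inj)
  have "y' \<cdot> Bd (BB C N) (n + 1) = Zero C (Ob (BB C N) (n + 1)) J"
  proof (rule BB_ext[where n = "n + 1"])
    fix p assume p: "p \<in> BB_idx (n + 1)"
    define k where "k = n + 1 - 2 * int p"
    have bd: "Bd (BB C N) (n + 1) \<cdot> BB_in N (n + 1) p =
        (if p \<in> BB_idx n then BB_in N n p \<cdot> Bd N k else Zero C (Ob N k) (Ob (BB C N) n)) \<boxplus>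
        (if 0 < p then BB_in N n (p - 1) \<cdot> Bop N k else Zero C (Ob N k) (Ob (BB C N) n))"
      by (rule N.Bd_BB_in[OF p]) (simp_all add: k_def)
    have 1: "y' \<cdot> (if p \<in> BB_idx n then BB_in N n p \<cdot> Bd N k else Zero C (Ob N k) (Ob (BB C N) n)) = Zero C (Ob N k) J"
    proof (cases "p \<in> BB_idx n")
      case True
      have "y' \<cdot> BB_in N n p \<cdot> Bd N k = (y' \<cdot> BB_in N n p) \<cdot> Bd N k"
        using y'_Hom True by (simp add: k_def)
      also have "\<dots> = Zero C (Ob N k) J"
        unfolding y'_in[OF True] using y0 by (cases "p = 0") (simp_all add: k_def algebra_simps)
      finally show ?thesis using True by simp
    qed (use y'_Hom in simp)
    have 2: "y' \<cdot> (if 0 < p then BB_in N n (p - 1) \<cdot> Bop N k else Zero C (Ob N k) (Ob (BB C N) n)) = Zero C (Ob N k) J"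
    proof (cases "0 < p")
      case True
      then have q: "p - 1 \<in> BB_idx n" using p by (simp add: BB_idx_iff)
      have k1: "n - 2 * int (p - 1) = k + 1" using True by (simp add: k_def of_nat_diff)
      have "y' \<cdot> BB_in N n (p - 1) \<cdot> Bop N k = (y' \<cdot> BB_in N n (p - 1)) \<cdot> Bop N k"
        by (rule comp_assoc[symmetric]) (simp_all only: y'_Hom BB_in_Hom[OF q] k1 N.M_Bop)
      also have "\<dots> = Zero C (Ob N k) J"
      proof (cases "p = 1")
        case True
        then have "k = n - 1" by (simp add: k_def)
        then show ?thesis unfolding y'_in[OF q] using True y(2) by simp
      next
        case False
        then have "p - 1 \<noteq> 0" using \<open>0 < p\<close> by simp
        then have "y' \<cdot> BB_in N n (p - 1) = Zero C (Ob N (k + 1)) J"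
          using y'_in[OF q] unfolding k1 by (simp only: if_False)
        then show ?thesis by (simp only: Zero_comp N.M_Bop)
      qed
      finally show ?thesis using True by simp
    qed (use y'_Hom in simp)
    have "(y' \<cdot> Bd (BB C N) (n + 1)) \<cdot> BB_in N (n + 1) p = y' \<cdot> (Bd (BB C N) (n + 1) \<cdot> BB_in N (n + 1) p)"
      using y'_Hom p by simp
    also have "\<dots> = Zero C (Ob N k) J"
    proof -
      have "Dom C (if p \<in> BB_idx n then BB_in N n p \<cdot> Bd N k else Zero C (Ob N k) (Ob (BB C N) n)) = Ob N k"
        "Cod C (if p \<in> BB_idx n then BB_in N n p \<cdot> Bd N k else Zero C (Ob N k) (Ob (BB C N) n)) = Ob (BB C N) n"
        by (simp_all add: k_def)
      moreover have "Dom C (if 0 < p then BB_in N n (p - 1) \<cdot> Bop N k else Zero C (Ob N k) (Ob (BB C N) n)) = Ob N k \<and>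
        Cod C (if 0 < p then BB_in N n (p - 1) \<cdot> Bop N k else Zero C (Ob N k) (Ob (BB C N) n)) = Ob (BB C N) n"
      proof (cases "0 < p")
        case True
        then have q: "p - 1 \<in> BB_idx n" and k1: "n - 2 * int (p - 1) = k + 1"
          using p by (simp_all add: k_def BB_idx_iff of_nat_diff)
        then have "Dom C (BB_in N n (p - 1)) = Ob N (k + 1)" "Cod C (BB_in N n (p - 1)) = Ob (BB C N) n"
          using BB_in_Hom[OF q, of N] by simp_all
        then show ?thesis using True by simp
      qed simp
      ultimately show ?thesis unfolding bd using y'_Hom 1 2 by (subst comp_Plus) (simp_all del: if_split)
    qed
    finally show "(y' \<cdot> Bd (BB C N) (n + 1)) \<cdot> BB_in N (n + 1) p = Zero C (Ob (BB C N) (n + 1)) J \<cdot> BB_in N (n + 1) p"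
      using p by (simp add: k_def)
  qed (use y'_Hom in simp_all)
  then have cyc: "cocycle (BB C N) J n y'"
    using y'_Hom by (simp add: cocycle_def)
  have "y' \<cdot> F n = Zero C (Ob (BB C M) n) J"
  proof (rule BB_ext[where n = n])
    fix p assume p: "p \<in> BB_idx n"
    have "(y' \<cdot> F n) \<cdot> BB_in M n p = (y' \<cdot> BB_in N n p) \<cdot> f (n - 2 * int p)"
      using y'_Hom p BB_map_in[OF p refl] by simp
    then show "(y' \<cdot> F n) \<cdot> BB_in M n p = Zero C (Ob (BB C M) n) J \<cdot> BB_in M n p"
      unfolding y'_in[OF p] using y(3) p by (cases "p = 0") simp_all
  qed (use y'_Hom in simp_all)
  then have "coboundary (BB C N) J n y'"
    by (rule equiv_onD[OF M.BB_chain_complex F cyc])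
  then obtain z where z: "Dom C z = Ob (BB C N) (n - 1)" "Cod C z = J" and yz: "y' = z \<cdot> Bd (BB C N) n"
    unfolding coboundary_def by blast
  show ?thesis
  proof (cases "n = 0")
    case True
    have "z = Zero C (Ob (BB C N) (n - 1)) J"
      using zero_ob_Zero[OF zero_in_BB[of "n - 1" N], of z _ J] z True by simp
    then have "y' = Zero C (Ob (BB C N) n) J" using yz by simp
    then have "y = Zero C (Ob N n) J" using y'_in[OF 0] 0 by simp
    then show ?thesis
      unfolding coboundary_def by (intro exI[of _ "Zero C (Ob N (n - 1)) J"]) simp
  next
    case False
    then have 01: "0 \<in> BB_idx (n - 1)" using n by (simp add: BB_idx_iff)
    have "y = (z \<cdot> Bd (BB C N) n) \<cdot> BB_in N n 0"
      unfolding yz[symmetric] using y'_in[OF 0] by simp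
    also have "\<dots> = z \<cdot> (Bd (BB C N) n \<cdot> BB_in N n 0)"
      using z 0 by simp
    also have "\<dots> = (z \<cdot> BB_in N (n - 1) 0) \<cdot> Bd N n"
      using N.Bd_BB_in[OF 0 refl refl] z 0 01 by simp
    finally show ?thesis
      unfolding coboundary_def using z 01 by (intro exI[of _ "z \<cdot> BB_in N (n - 1) 0"]) simp
  qed
qed

end

subsection \<open>Square-zero extensions\<close>

text \<open>\<open>U\<close> stands for the direct sum of K and \<open>V\<close>, with injections
  \<open>\<iota>\<close>, \<open>\<nu>\<close> and projections \<open>\<pi>\<close>,
  \<open>v\<close>.\<close>

locale split_pair = base_cat C for C :: "('o, 'm) tensor_cat" (structure) +
  fixes K :: "('o, 'm) alg" and V U :: 'o and \<iota> \<pi> \<nu> v :: 'm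
  assumes K: "algebra C K"
    and split_Hom [simp]: "Dom C \<iota> = Und K" "Cod C \<iota> = U" "Dom C \<pi> = U" "Cod C \<pi> = Und K"
      "Dom C \<nu> = V" "Cod C \<nu> = U" "Dom C v = U" "Cod C v = V"
    and split [simp]: "\<pi> \<cdot> \<iota> = Idn C (Und K)" "v \<cdot> \<nu> = Idn C V" "\<pi> \<cdot> \<nu> = Zero C V (Und K)"
      "v \<cdot> \<iota> = Zero C (Und K) V"
begin

lemma split_left: "Cod C f = Und K \<Longrightarrow> \<pi> \<cdot> \<iota> \<cdot> f = f" "Cod C f = Und K \<Longrightarrow> v \<cdot> \<iota> \<cdot> f = Zero C (Dom C f) V"
  by (simp_all flip: comp_assoc)

text \<open>The product of K after projection to K, so any product with a factor in \<open>V\<close>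
  vanishes.\<close>

definition A :: "('o, 'm) alg" where
  "A = \<lparr>Und = U, Mul = \<iota> \<cdot> Mul K \<cdot> (\<pi> \<boxtimes> \<pi>)\<rparr>"

lemma A_simps [simp]: "Und A = U"
  and Mul_A: "Mul A = \<iota> \<cdot> Mul K \<cdot> (\<pi> \<boxtimes> \<pi>)"
  by (simp_all add: A_def)

lemma MulK_Hom: "Dom C (Mul K) = Und K \<odot> Und K" "Cod C (Mul K) = Und K"
  using K by (simp_all add: algebra_def)

lemma algebra_A: "algebra C A"
proof -
  note [simp] = MulK_Hom
  have "Mul A \<cdot> (Mul A \<boxtimes> Idn C U) = \<iota> \<cdot> ((Mul K \<cdot> (Mul K \<boxtimes> Idn C (Und K))) \<cdot> (\<pi> \<boxtimes> \<pi> \<boxtimes> \<pi>))"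
    using interchange[of "\<pi> \<boxtimes> \<pi>" "Mul K" \<pi> "Idn C (Und K)"] by (simp add: Mul_A interchange split_left)
  also have "Mul K \<cdot> (Mul K \<boxtimes> Idn C (Und K)) = Mul K \<cdot> (Idn C (Und K) \<boxtimes> Mul K)"
    using K by (simp add: algebra_def)
  also have "\<iota> \<cdot> (\<dots> \<cdot> (\<pi> \<boxtimes> \<pi> \<boxtimes> \<pi>)) = Mul A \<cdot> (Idn C U \<boxtimes> Mul A)"
    by (simp add: Mul_A interchange split_left)
  finally show ?thesis by (simp add: algebra_def Mul_A)
qed

text \<open>The inclusion is split by \<open>\<pi>\<close>, hence monic and a cofibration.\<close>

lemma cof_ideal_A: "cof_ideal C K A \<iota>"
proof -
  note [simp] = MulK_Hom
  have m: "monic C \<iota>"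
    unfolding monic_def
  proof (intro allI impI)
    fix g h assume gh: "Cod C g = Dom C \<iota> \<and> Cod C h = Dom C \<iota> \<and> Dom C g = Dom C h \<and> \<iota> \<cdot> g = \<iota> \<cdot> h"
    then show "g = h" by (metis split_left(1) split_Hom(1))
  qed
  have "algebra_map C K A \<iota>"
    using K algebra_A by (simp add: algebra_map_def Mul_A interchange Idn_tensor)
  moreover have "is_left_mult C K A \<iota> (Mul K \<cdot> (\<pi> \<boxtimes> Idn C (Und K)))"
    "is_right_mult C K A \<iota> (Mul K \<cdot> (Idn C (Und K) \<boxtimes> \<pi>))"
    by (simp_all add: is_left_mult_def is_right_mult_def Mul_A interchange)
  moreover have "cofibration C \<iota>"
    unfolding cofibration_def hom_surj_def
  proof (intro ballI equalityI subsetI)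
    fix J f assume f: "f \<in> Hom C (Dom C \<iota>) J"
    then have "f = (f \<cdot> \<pi>) \<cdot> \<iota>" "f \<cdot> \<pi> \<in> Hom C (Cod C \<iota>) J" by simp_all
    then show "f \<in> (\<lambda>g. g \<cdot> \<iota>) ` Hom C (Cod C \<iota>) J" by blast
  qed auto
  ultimately show ?thesis
    using m unfolding cof_ideal_def two_sided_ideal_def by blast
qed

sublocale cof_pair C K A \<iota>
  by unfold_locales (rule cof_ideal_A)

lemma mu_mixed_eq: "mu True False = Mul K \<cdot> (\<pi> \<boxtimes> Idn C (Und K))" "mu False True = Mul K \<cdot> (Idn C (Und K) \<boxtimes> \<pi>)"
  by (rule monicD[OF i_monic]; simp add: mu_mixed Mul_A interchange)+

fun pw :: "nat \<Rightarrow> 'm" where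
  "pw 0 = Idn C (Unit C)"
| "pw (Suc n) = \<pi> \<boxtimes> pw n"

abbreviation "Fs n \<equiv> replicate n False"

lemma pw_Hom [simp]: "Dom C (pw n) = W (T n)" "Cod C (pw n) = W (Fs n)"
  by (induction n) simp_all

lemma pw_add: "pw (a + b) = pw a \<boxtimes> pw b"
  by (induction a) simp_all

lemma Fs_le_T: "list_all2 (\<le>) (Fs n) (T n)"
  by (simp add: list_all2_conv_all_nth)

lemma incl_Fs_Hom [simp]: "Dom C (incl (Fs n) (T n)) = W (Fs n)" "Cod C (incl (Fs n) (T n)) = W (T n)"
  using incl_Hom[OF Fs_le_T] by simp_all

lemma pw_incl: "pw n \<cdot> incl (Fs n) (T n) = Idn C (W (Fs n))"
  by (induction n) (simp_all add: interchange inc_def Idn_tensor)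

lemma W_T_add: "W (T a) \<odot> W (T b) = W (T (a + b))" "W (Fs a) \<odot> W (Fs b) = W (Fs (a + b))"
  by (simp_all add: replicate_add)

abbreviation "Y \<equiv> CX (cyc_of C A)"

text \<open>The projection of a tensor power of A to its component V \<otimes> K^(m+1).\<close>

definition Rm :: "nat \<Rightarrow> 'm" where "Rm m = v \<boxtimes> pw (Suc m)"

lemma Rm_Hom [simp]: "Dom C (Rm m) = Y (Suc m)" "Cod C (Rm m) = V \<odot> X m"
  unfolding CX_A CX_K by (simp_all add: Rm_def)

lemma face_A:
  "alg_face C A (Suc (Suc m)) 0 = Mul A \<boxtimes> Idn C (W (T (Suc m)))"
  "l < Suc m \<Longrightarrow> alg_face C A (Suc (Suc m)) (Suc l) = Idn C U \<boxtimes> Idn C (W (T l)) \<boxtimes> Mul A \<boxtimes> Idn C (W (T (m - l)))"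
proof -
  show "alg_face C A (Suc (Suc m)) 0 = Mul A \<boxtimes> Idn C (W (T (Suc m)))"
    using alg_face_wface[of A True 0 "Suc (Suc m)"] wface_split[of "[]" True True "T (Suc m)"]
    by (simp add: mu_same)
  assume l: "l < Suc m"
  have "As (Suc (Suc m)) = (True # T l) @ True # True # T (m - l)"
    using l by (intro nth_equalityI) (auto simp: nth_append nth_Cons' simp del: replicate_Suc)
  then show "alg_face C A (Suc (Suc m)) (Suc l) = Idn C U \<boxtimes> Idn C (W (T l)) \<boxtimes> Mul A \<boxtimes> Idn C (W (T (m - l)))"
    using alg_face_wface[of A True "Suc l" "Suc (Suc m)"] wface_split[of "True # T l" True True "T (m - l)"] l
    by (simp add: mu_same del: replicate_Suc flip: Idn_tensor)
qed

lemma face_K: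
  "l < Suc m \<Longrightarrow> alg_face C K (Suc m) l = Idn C (W (Fs l)) \<boxtimes> Mul K \<boxtimes> Idn C (W (Fs (m - l)))"
proof -
  assume l: "l < Suc m"
  have "Ks (Suc m) = Fs l @ False # False # Fs (m - l)"
    using l by (intro nth_equalityI) (auto simp: nth_append nth_Cons' simp del: replicate_Suc)
  then show "alg_face C K (Suc m) l = Idn C (W (Fs l)) \<boxtimes> Mul K \<boxtimes> Idn C (W (Fs (m - l)))"
    using alg_face_wface[of K False l "Suc m"] wface_split[of "Fs l" False False "Fs (m - l)"] l
    by (simp add: mu_same del: replicate_Suc)
qed

text \<open>The face 0 yields a product in first place, and products have no component in
  \<open>V\<close>. The other faces leave the first factor alone and are compatible with the
  projection to K.\<close>

lemma Rm_face:
  "Rm m \<cdot> alg_face C A (Suc (Suc m)) 0 = Zero C (Y (Suc (Suc m))) (V \<odot> X m)"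
  "l < Suc m \<Longrightarrow> Rm m \<cdot> alg_face C A (Suc (Suc m)) (Suc l) = (Idn C V \<boxtimes> alg_face C K (Suc m) l) \<cdot> Rm (Suc m)"
proof -
  note [simp] = MulK_Hom
  show "Rm m \<cdot> alg_face C A (Suc (Suc m)) 0 = Zero C (Y (Suc (Suc m))) (V \<odot> X m)"
    unfolding face_A Rm_def CX_A CX_K by (simp add: interchange Mul_A split_left del: pw.simps)
  assume l: "l < Suc m"
  have p1: "pw (Suc m) = pw l \<boxtimes> \<pi> \<boxtimes> pw (m - l)"
    using pw_add[of l "Suc (m - l)"] l by simp
  have p2: "pw (Suc (Suc m)) = pw l \<boxtimes> (\<pi> \<boxtimes> \<pi>) \<boxtimes> pw (m - l)"
    using pw_add[of l "Suc (Suc (m - l))"] l by (simp add: Suc_diff_le)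
  show "Rm m \<cdot> alg_face C A (Suc (Suc m)) (Suc l) = (Idn C V \<boxtimes> alg_face C K (Suc m) l) \<cdot> Rm (Suc m)"
    unfolding face_A(2)[OF l] face_K[OF l] Rm_def p1 p2
    using interchange[of "\<pi> \<boxtimes> \<pi>" "Mul K" "pw (m - l)" "Idn C (W (Fs (m - l)))"]
      interchange[of "pw l" "Idn C (W (Fs l))" "(\<pi> \<boxtimes> \<pi>) \<boxtimes> pw (m - l)" "Mul K \<boxtimes> Idn C (W (Fs (m - l)))"]
      interchange[of v "Idn C V" "pw l \<boxtimes> (\<pi> \<boxtimes> \<pi>) \<boxtimes> pw (m - l)" "Idn C (W (Fs l)) \<boxtimes> Mul K \<boxtimes> Idn C (W (Fs (m - l)))"]
    by (simp add: interchange Mul_A split_left del: pw.simps)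
qed

text \<open>The factor in \<open>V\<close> shifts the numbering of the faces by one, hence the
  sign.\<close>

lemma Rm_Cb': "Rm m \<cdot> Cb' (cyc_of C A) (Suc (Suc m)) = scale C (- 1) ((Idn C V \<boxtimes> kb (Suc m)) \<cdot> Rm (Suc m))"
proof -
  let ?a = "Y (Suc (Suc m))" and ?b = "V \<odot> X m"
  let ?g = "\<lambda>l. scale C ((- 1) ^ l) (alg_face C K (Suc m) l)"
  have fK: "Dom C (alg_face C K (Suc m) l) = X (Suc m)" "Cod C (alg_face C K (Suc m) l) = X m" if "l < Suc m" for l
    using cK.d_Hom[OF that] by simp_all
  have fA: "Dom C (alg_face C A (Suc (Suc m)) j) = ?a" "Cod C (alg_face C A (Suc (Suc m)) j) = Y (Suc m)"
    if "j < Suc (Suc m)" for j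
    using cA.d_Hom[OF that] by simp_all
  have "Rm m \<cdot> Cb' (cyc_of C A) (Suc (Suc m)) =
      arr_sum C ?a ?b (\<lambda>j. Rm m \<cdot> scale C ((- 1) ^ j) (alg_face C A (Suc (Suc m)) j)) {..<Suc (Suc m)}"
    unfolding cA.Cb'_eq[OF zero_less_Suc] diff_Suc_1 by (rule comp_sum) (use fA in simp_all)
  also have "\<dots> = arr_sum C ?a ?b (\<lambda>j. Rm m \<cdot> scale C ((- 1) ^ j) (alg_face C A (Suc (Suc m)) j)) (Suc ` {..<Suc m})"
  proof (rule sum_mono_neutral)
    fix j assume "j \<in> {..<Suc (Suc m)} - Suc ` {..<Suc m}"
    then have "j = 0" by (cases j) auto
    then show "Rm m \<cdot> scale C ((- 1) ^ j) (alg_face C A (Suc (Suc m)) j) = Zero C ?a ?b"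
      using fA[of 0] Rm_face(1)[of m] by simp
  qed (use fA in auto)
  also have "\<dots> = arr_sum C ?a ?b (\<lambda>l. Rm m \<cdot> scale C ((- 1) ^ Suc l) (alg_face C A (Suc (Suc m)) (Suc l))) {..<Suc m}"
    by (rule sum_reindex) (use fA in auto)
  also have "\<dots> = arr_sum C ?a ?b (\<lambda>l. scale C (- 1) ((Idn C V \<boxtimes> ?g l) \<cdot> Rm (Suc m))) {..<Suc m}"
  proof (rule sum_cong[OF refl])
    fix l assume "l \<in> {..<Suc m}"
    then have l: "l < Suc m" by simp
    show "Rm m \<cdot> scale C ((- 1) ^ Suc l) (alg_face C A (Suc (Suc m)) (Suc l)) =
        scale C (- 1) ((Idn C V \<boxtimes> ?g l) \<cdot> Rm (Suc m))"
      using fA[of "Suc l"] fK[OF l] Rm_face(2)[OF l] l by simp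
  qed (use fK in simp_all)
  also have "\<dots> = scale C (- 1) ((Idn C V \<boxtimes> kb (Suc m)) \<cdot> Rm (Suc m))"
  proof -
    have "Idn C V \<boxtimes> kb (Suc m) = arr_sum C (V \<odot> X (Suc m)) ?b (\<lambda>l. Idn C V \<boxtimes> ?g l) {..<Suc m}"
      unfolding cK.Cb'_eq[OF zero_less_Suc] diff_Suc_1 by (rule tensor_sum(1)) (use fK in simp)
    then have "(Idn C V \<boxtimes> kb (Suc m)) \<cdot> Rm (Suc m) = arr_sum C ?a ?b (\<lambda>l. (Idn C V \<boxtimes> ?g l) \<cdot> Rm (Suc m)) {..<Suc m}"
      by (simp only:) (rule sum_comp, use fK in simp_all)
    then show ?thesis
      by (simp only:) (rule scale_sum[symmetric], use fK in simp)
  qed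
  finally show ?thesis .
qed

text \<open>The inclusion of V \<otimes> K^(m+1) into the relative complex, through the word A
  K^(m+1); \<open>Rm\<close> retracts it.\<close>

definition Jm :: "nat \<Rightarrow> 'm" where "Jm m = rin (Suc m) (True # Ks m) \<cdot> (\<nu> \<boxtimes> Idn C (X m))"

lemma TK_words [simp]: "True # Ks m \<in> words (Suc m)"
  by (simp add: in_words_iff)

lemma W_TK: "W (True # Ks m) = U \<odot> X m"
  unfolding CX_K by simp

lemma rin_TK [simp]: "Dom C (rin (Suc m) (True # Ks m)) = U \<odot> X m" "Cod C (rin (Suc m) (True # Ks m)) = rob (Suc m)"
  using rin_Hom[OF TK_words] unfolding W_TK by blast+

lemma Jm_Hom [simp]: "Dom C (Jm m) = V \<odot> X m" "Cod C (Jm m) = rob (Suc m)"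
  by (simp_all add: Jm_def del: replicate_Suc)

lemma \<theta>_Jm: "\<theta> (Suc m) \<cdot> Jm m = \<nu> \<boxtimes> incl (Ks m) (As m)"
proof -
  have le: "Dom C (incl (Ks m) (As m)) = X m" "Cod C (incl (Ks m) (As m)) = W (As m)"
    unfolding CX_K by (rule incl_Fs_Hom)+
  have "\<theta> (Suc m) \<cdot> Jm m = (\<theta> (Suc m) \<cdot> rin (Suc m) (True # Ks m)) \<cdot> (\<nu> \<boxtimes> Idn C (X m))"
    unfolding Jm_def by (simp del: replicate_Suc)
  also have "\<theta> (Suc m) \<cdot> rin (Suc m) (True # Ks m) = Idn C U \<boxtimes> incl (Ks m) (As m)"
    unfolding \<theta>_in[OF TK_words] by (subst replicate_Suc[of "Suc m"]) (simp del: replicate_Suc)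
  finally show ?thesis using le by (simp add: interchange del: replicate_Suc)
qed

lemma Rm_\<theta>_Jm: "Rm m \<cdot> \<theta> (Suc m) \<cdot> Jm m = Idn C (V \<odot> X m)"
proof -
  have "(v \<boxtimes> pw (Suc m)) \<cdot> (\<nu> \<boxtimes> incl (Ks m) (As m)) = Idn C V \<boxtimes> Idn C (W (Ks m))"
    by (subst interchange, simp, simp del: replicate_Suc W_simps pw.simps incl_Cons)
      (simp only: split pw_incl)
  then show ?thesis unfolding \<theta>_Jm Rm_def CX_K Idn_tensor .
qed

lemma tp_A: "cA.tp n k = rots k (As n)"
proof -
  have r: "(rot ^^ k) (As n) = As n" for k
    by (induction k) (simp_all add: rot_replicate del: replicate_Suc)
  have "Ct (cyc_of C A) n = wrot (As n)"
    by (simp add: cyc_of_def alg_rot_wrot[of A True] del: replicate_Suc)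
  then show ?thesis
    by (induction k) (simp_all add: cA.tp_simps r CX_A del: replicate_Suc W_simps)
qed

text \<open>A proper rotation brings a factor K to the first place, where the projection to
  \<open>V\<close> kills it.\<close>

lemma Rm_tp:
  assumes k: "0 < k" "k \<le> Suc m"
  shows "Rm m \<cdot> cA.tp (Suc m) k \<cdot> \<theta> (Suc m) \<cdot> Jm m = Zero C (V \<odot> X m) (V \<odot> X m)"
proof -
  obtain k' where k': "k = Suc k'" using k by (cases k) auto
  \<comment> \<open>The number of factors K that stay behind \<open>V\<close>: the rotation
    exchanges the block of \<open>V\<close> and these with the last \<open>k\<close>
    factors.\<close>
  define l where "l = Suc m - k"
  have m: "Suc m = l + Suc k'" using k k' by (simp add: l_def)
  have "As (Suc m) = T (Suc l) @ T k" unfolding m k' replicate_add[symmetric] by simp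
  then have t: "cA.tp (Suc m) k = Symm C (W (T (Suc l))) (W (T k))"
    unfolding tp_A using rots_append[of "T k" k "T (Suc l)"] by simp
  have J: "\<theta> (Suc m) \<cdot> Jm m = (\<nu> \<boxtimes> incl (Fs l) (T l)) \<boxtimes> incl (Fs k) (T k)"
    unfolding \<theta>_Jm by (simp only: m k'[symmetric] replicate_add incl_append length_replicate tensor_assoc)
  have "cA.tp (Suc m) k \<cdot> \<theta> (Suc m) \<cdot> Jm m =
      (incl (Fs k) (T k) \<boxtimes> \<nu> \<boxtimes> incl (Fs l) (T l)) \<cdot> Symm C (V \<odot> W (Fs l)) (W (Fs k))"
    unfolding t J by (subst Symm_natural) simp_all
  also have "incl (Fs k) (T k) = \<iota> \<boxtimes> incl (Fs k') (T k')" unfolding k' by (simp add: inc_def)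
  finally have e: "cA.tp (Suc m) k \<cdot> \<theta> (Suc m) \<cdot> Jm m =
      (\<iota> \<boxtimes> incl (Fs k') (T k') \<boxtimes> \<nu> \<boxtimes> incl (Fs l) (T l)) \<cdot> Symm C (V \<odot> W (Fs l)) (W (Fs k))" by simp
  have c: "W (T k') \<odot> U \<odot> W (T l) = W (T (Suc m))"
    using W_T_add(1)[of k' "Suc l"] m by (simp add: add.commute)
  have z: "(v \<boxtimes> pw (Suc m)) \<cdot> (\<iota> \<boxtimes> incl (Fs k') (T k') \<boxtimes> \<nu> \<boxtimes> incl (Fs l) (T l)) =
      Zero C (Und K \<odot> W (Fs k') \<odot> V \<odot> W (Fs l)) (V \<odot> W (Ks m))"
    by (subst interchange) (simp_all add: c del: pw.simps replicate_Suc)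
  have "Rm m \<cdot> cA.tp (Suc m) k \<cdot> \<theta> (Suc m) \<cdot> Jm m =
      ((v \<boxtimes> pw (Suc m)) \<cdot> (\<iota> \<boxtimes> incl (Fs k') (T k') \<boxtimes> \<nu> \<boxtimes> incl (Fs l) (T l))) \<cdot> Symm C (V \<odot> W (Fs l)) (W (Fs k))"
    unfolding e Rm_def by (rule comp_assoc[symmetric]) (simp_all add: c k' del: pw.simps)
  also have "\<dots> = Zero C (V \<odot> X m) (V \<odot> X m)"
  proof -
    have "V \<odot> W (Fs l) \<odot> W (Fs k) = V \<odot> W (Ks m)" unfolding W_T_add m k' ..
    then show ?thesis unfolding z CX_K by (simp add: k')
  qed
  finally show ?thesis .
qed

text \<open>By \<open>Rm_tp\<close> only the trivial rotation, which has sign +1,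
  contributes.\<close>

lemma Rm_norm: "Rm m \<cdot> cyc_norm C (cyc_of C A) (Suc m) \<cdot> \<theta> (Suc m) \<cdot> Jm m = Idn C (V \<odot> X m)"
proof -
  let ?f = "\<lambda>k. scale C ((- 1) ^ (Suc m * k)) (cA.tp (Suc m) k)"
  have "Rm m \<cdot> cyc_norm C (cyc_of C A) (Suc m) \<cdot> \<theta> (Suc m) \<cdot> Jm m =
      Rm m \<cdot> arr_sum C (V \<odot> X m) (Y (Suc m)) (\<lambda>k. ?f k \<cdot> \<theta> (Suc m) \<cdot> Jm m) {..Suc m}"
    unfolding cA.norm_eq by (subst sum_comp) simp_all
  also have "\<dots> = arr_sum C (V \<odot> X m) (V \<odot> X m) (\<lambda>k. Rm m \<cdot> ?f k \<cdot> \<theta> (Suc m) \<cdot> Jm m) {..Suc m}"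
    by (rule comp_sum) simp_all
  also have "\<dots> = Rm m \<cdot> ?f 0 \<cdot> \<theta> (Suc m) \<cdot> Jm m"
  proof (rule sum_single)
    fix k assume "k \<in> {..Suc m}" "k \<noteq> 0"
    then show "Rm m \<cdot> ?f k \<cdot> \<theta> (Suc m) \<cdot> Jm m = Zero C (V \<odot> X m) (V \<odot> X m)"
      using Rm_tp[of k m] by simp
  qed simp_all
  also have "\<dots> = Idn C (V \<odot> X m)"
    using Rm_\<theta>_Jm[of m] by (simp add: cA.tp_simps)
  finally show ?thesis .
qed

end

section \<open>What each kind of excision provides for the converse\<close>

context cof_pair begin

text \<open>A common consequence of excision: injectivity on cohomology in positive degrees, for
  cocycles that restrict to zero on K. For the Hochschild boundary the cocycle is moreover asked to
  kill 1 - t, so that its extension by zero to the mixed complex and the S-complex is a cocycle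
  too.\<close>

definition lifts :: "bool \<Rightarrow> 'o \<Rightarrow> bool" where
  "lifts \<beta> J \<longleftrightarrow> (\<forall>m x. Dom C x = rob (Suc m) \<longrightarrow> Cod C x = J \<longrightarrow>
     x \<cdot> bd \<beta> (Suc (Suc m)) = Zero C (rob (Suc (Suc m))) J \<longrightarrow>
     (\<beta> \<longrightarrow> x \<cdot> R.\<omega> (Suc m) = Zero C (rob (Suc m)) J) \<longrightarrow>
     x \<cdot> rel_nat C K A i (Suc m) = Zero C (X (Suc m)) J \<longrightarrow>
     (\<exists>z. Dom C z = rob m \<and> Cod C z = J \<and> x = z \<cdot> bd \<beta> (Suc m)))"

lemma lifts_nonneg:
  assumes "chain_complex C (nonneg_chain C X \<delta>)"
    and "equiv_on (nonneg_chain C X \<delta>) (nonneg_chain C rob (bd \<beta>)) (nonneg_map C (rel_nat C K A i)) J"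
  shows "lifts \<beta> J"
  unfolding lifts_def
proof (intro allI impI)
  let ?Y = "nonneg_chain C rob (bd \<beta>)"
  have Ob: "Ob ?Y (int n) = rob n" "Bd ?Y (int (Suc n)) = bd \<beta> (Suc n)" "Ob (nonneg_chain C X \<delta>) (int n) = X n"
    "nonneg_map C (rel_nat C K A i) (int n) = rel_nat C K A i n" for n
    by (simp_all add: Ob_nonneg Bd_nonneg nonneg_map_def del: of_nat_Suc)
  have n: "int (Suc m) + 1 = int (Suc (Suc m))" "int (Suc m) - 1 = int m" for m by simp_all
  fix m x assume x: "Dom C x = rob (Suc m)" "Cod C x = J"
    "x \<cdot> bd \<beta> (Suc (Suc m)) = Zero C (rob (Suc (Suc m))) J"
    "x \<cdot> rel_nat C K A i (Suc m) = Zero C (X (Suc m)) J"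
  have "cocycle ?Y J (int (Suc m)) x"
    unfolding cocycle_def n Ob using x by blast
  from equiv_onD[OF assms this, unfolded Ob, OF x(4)]
  show "\<exists>z. Dom C z = rob m \<and> Cod C z = J \<and> x = z \<cdot> bd \<beta> (Suc m)"
    unfolding coboundary_def n Ob .
qed

lemma lifts_Hoch:
  assumes "equiv_on (Hoch C (cyc_of C K)) (Hoch C rel) (nonneg_map C (rel_nat C K A i)) J"
  shows "lifts True J"
proof -
  have "chain_complex C (Hoch C (cyc_of C K))"
    using nat.Hoch_chain_map by (simp add: chain_map_def)
  then show ?thesis
    using lifts_nonneg[of "Cb (cyc_of C K)" True J] assms by (simp add: Hoch_def bd_def[abs_def])
qed

lemma lifts_Bar:
  assumes "equiv_on (Bar C (cyc_of C K)) (Bar C rel) (nonneg_map C (rel_nat C K A i)) J"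
  shows "lifts False J"
  using lifts_nonneg[of "Cb' (cyc_of C K)" False J] Bar_complex assms by (simp add: Bar_def bd_def[abs_def])

lemma lifts_Om:
  assumes "equiv_on (Om C (cyc_of C K)) (Om C rel) (Om_map C (cyc_of C K) rel (rel_nat C K A i)) J"
  shows "lifts True J"
  unfolding lifts_def
proof (intro allI impI)
  fix m x assume x: "Dom C x = rob (Suc m)" "Cod C x = J"
    "x \<cdot> bd True (Suc (Suc m)) = Zero C (rob (Suc (Suc m))) J"
    "True \<longrightarrow> x \<cdot> R.\<omega> (Suc m) = Zero C (rob (Suc m)) J"
    "x \<cdot> rel_nat C K A i (Suc m) = Zero C (X (Suc m)) J"
  have x': "Dom C x = CX rel (Suc m)" using x(1) by simp
  have "coboundary (Om C rel) J (int (Suc m)) (nat.Om_ext0 (Suc m) x)"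
    by (rule equiv_onD[OF cK.Om_chain_complex assms nat.Om_ext0_cocycle[OF x' x(2)] nat.Om_ext0_map[OF x' x(2)]])
      (use x in \<open>simp_all add: bd_def\<close>)
  from nat.Om_ext0_coboundary[OF x' x(2) this]
  show "\<exists>z. Dom C z = rob m \<and> Cod C z = J \<and> x = z \<cdot> bd True (Suc m)"
    by (simp add: bd_def)
qed

lemma lifts_BB:
  assumes "equiv_on (BB C (Om C (cyc_of C K))) (BB C (Om C rel))
      (BB_map C (Om C (cyc_of C K)) (Om C rel) (Om_map C (cyc_of C K) rel (rel_nat C K A i))) J"
  shows "lifts True J"
  unfolding lifts_def
proof (intro allI impI)
  fix m x assume x: "Dom C x = rob (Suc m)" "Cod C x = J"
    "x \<cdot> bd True (Suc (Suc m)) = Zero C (rob (Suc (Suc m))) J"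
    "True \<longrightarrow> x \<cdot> R.\<omega> (Suc m) = Zero C (rob (Suc m)) J"
    "x \<cdot> rel_nat C K A i (Suc m) = Zero C (X (Suc m)) J"
  have x': "Dom C x = CX rel (Suc m)" using x(1) by simp
  have n: "int (Suc m) - 1 = int m" by simp
  have "coboundary (Om C rel) J (int (Suc m)) (nat.Om_ext0 (Suc m) x)"
  proof (rule BB.BB_injective[OF assms])
    show "nat.Om_ext0 (Suc m) x \<cdot> Bop (Om C rel) (int (Suc m) - 1) = Zero C (Ob (Om C rel) (int (Suc m) - 1)) J"
      unfolding n by (rule nat.Om_ext0_Bop[OF x' x(2)])
    show "cocycle (Om C rel) J (int (Suc m)) (nat.Om_ext0 (Suc m) x)"
      by (rule nat.Om_ext0_cocycle[OF x' x(2)]) (use x in \<open>simp_all add: bd_def\<close>)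
    show "nat.Om_ext0 (Suc m) x \<cdot> Om_map C (cyc_of C K) rel (rel_nat C K A i) (int (Suc m)) =
        Zero C (Ob (Om C (cyc_of C K)) (int (Suc m))) J"
      by (rule nat.Om_ext0_map[OF x' x(2) x(5)])
  qed simp
  from nat.Om_ext0_coboundary[OF x' x(2) this]
  show "\<exists>z. Dom C z = rob m \<and> Cod C z = J \<and> x = z \<cdot> bd True (Suc m)"
    by (simp add: bd_def)
qed

end

section \<open>Recovering a bar cocycle with coefficients in V\<close>

context split_pair begin

text \<open>On the word A K^(m+1), face 0 multiplies the first factor into K and so vanishes on
  \<open>V\<close>; the others are the faces of K.\<close>

lemma TK_face:
  "merge 0 (True # Ks m) = Ks m" "wface (True # Ks m) 0 \<cdot> (\<nu> \<boxtimes> Idn C (X m)) = Zero C (V \<odot> X m) (X m)"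
  "l < Suc m \<Longrightarrow> merge (Suc l) (True # Ks (Suc m)) = True # Ks m"
  "l < Suc m \<Longrightarrow> wface (True # Ks (Suc m)) (Suc l) = Idn C U \<boxtimes> alg_face C K (Suc m) l"
proof -
  note [simp] = MulK_Hom
  have w0: "True # Ks m = [] @ True # False # Fs m" by simp
  show "merge 0 (True # Ks m) = Ks m"
    using merge_split[of "[]" True False "Fs m"] by simp
  have "wface (True # Ks m) 0 = (Mul K \<cdot> (\<pi> \<boxtimes> Idn C (Und K))) \<boxtimes> Idn C (W (Fs m))"
    using wface_split[of "[]" True False "Fs m"] mu_mixed_eq by simp
  moreover have "\<nu> \<boxtimes> Idn C (X m) = (\<nu> \<boxtimes> Idn C (Und K)) \<boxtimes> Idn C (W (Fs m))"
    unfolding CX_K by (simp flip: Idn_tensor)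
  moreover have "((Mul K \<cdot> (\<pi> \<boxtimes> Idn C (Und K))) \<boxtimes> Idn C (W (Fs m))) \<cdot> ((\<nu> \<boxtimes> Idn C (Und K)) \<boxtimes> Idn C (W (Fs m))) =
      Zero C (V \<odot> X m) (X m)"
    unfolding CX_K by (subst interchange) (simp_all add: interchange)
  ultimately show "wface (True # Ks m) 0 \<cdot> (\<nu> \<boxtimes> Idn C (X m)) = Zero C (V \<odot> X m) (X m)"
    by (simp only:)
  assume l: "l < Suc m"
  have w: "True # Ks (Suc m) = (True # Fs l) @ False # False # Fs (m - l)" and v: "True # Ks m = (True # Fs l) @ False # Fs (m - l)"
    using l by (intro nth_equalityI; auto simp: nth_append nth_Cons' simp del: replicate_Suc)+
  show "merge (Suc l) (True # Ks (Suc m)) = True # Ks m"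
    unfolding w v using merge_split[of "True # Fs l" False False "Fs (m - l)"] by simp
  show "wface (True # Ks (Suc m)) (Suc l) = Idn C U \<boxtimes> alg_face C K (Suc m) l"
    unfolding w face_K[OF l] using wface_split[of "True # Fs l" False False "Fs (m - l)"]
    by (simp add: mu_same flip: Idn_tensor)
qed

text \<open>The last face multiplies K with \<open>V\<close> and so vanishes, which is why
  \<open>b\<close> and \<open>b'\<close> have the same restriction to V \<otimes> K^(m+1).\<close>

lemma TK_wrap:
  "wface (rot (True # Ks m)) 0 \<cdot> wrot (True # Ks m) \<cdot> (\<nu> \<boxtimes> Idn C (X m)) =
    Zero C (V \<odot> X m) (W (merge 0 (rot (True # Ks m))))"
proof -
  note [simp] = MulK_Hom
  have w: "True # Ks m = (True # Fs m) @ [False]"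
    by (simp add: replicate_append_same)
  have r: "rot (True # Ks m) = [] @ False # True # Fs m"
    unfolding w wrot_snoc by simp
  have t: "wrot (True # Ks m) = Symm C (U \<odot> W (Fs m)) (Und K)"
    unfolding w wrot_snoc by simp
  have X: "X m = W (Fs m) \<odot> Und K"
    unfolding CX_K using W_simps(3)[of "Fs m" "[False]"] by (simp add: replicate_append_same)
  have n: "\<nu> \<boxtimes> Idn C (X m) = (\<nu> \<boxtimes> Idn C (W (Fs m))) \<boxtimes> Idn C (Und K)"
    unfolding X by (simp flip: Idn_tensor)
  have f: "wface (rot (True # Ks m)) 0 = (Mul K \<cdot> (Idn C (Und K) \<boxtimes> \<pi>)) \<boxtimes> Idn C (W (Fs m))"
    unfolding r using wface_split[of "[]" False True "Fs m"] mu_mixed_eq by simp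
  have mm: "W (merge 0 (rot (True # Ks m))) = Und K \<odot> W (Fs m)"
    unfolding r using merge_split[of "[]" False True "Fs m"] by simp
  have "wrot (True # Ks m) \<cdot> (\<nu> \<boxtimes> Idn C (X m)) =
      ((Idn C (Und K) \<boxtimes> \<nu>) \<boxtimes> Idn C (W (Fs m))) \<cdot> Symm C (V \<odot> W (Fs m)) (Und K)"
    unfolding t n by (subst Symm_natural) simp_all
  moreover have "((Mul K \<cdot> (Idn C (Und K) \<boxtimes> \<pi>)) \<boxtimes> Idn C (W (Fs m))) \<cdot> ((Idn C (Und K) \<boxtimes> \<nu>) \<boxtimes> Idn C (W (Fs m))) =
      Zero C (Und K \<odot> V \<odot> W (Fs m)) (Und K \<odot> W (Fs m))"
    by (subst interchange) (simp_all add: interchange)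
  then have "((Mul K \<cdot> (Idn C (Und K) \<boxtimes> \<pi>)) \<boxtimes> Idn C (W (Fs m))) \<cdot>
      (((Idn C (Und K) \<boxtimes> \<nu>) \<boxtimes> Idn C (W (Fs m))) \<cdot> Symm C (V \<odot> W (Fs m)) (Und K)) =
      Zero C (V \<odot> X m) (Und K \<odot> W (Fs m))"
    by (subst comp_assoc[symmetric]) (simp_all add: X)
  ultimately show ?thesis unfolding f mm by (simp only:)
qed

text \<open>Face 0 and the last face vanish on \<open>V\<close>; the remaining ones are the faces of
  K, renumbered by one, which accounts for the sign.\<close>

lemma bd_Jm:
  assumes z: "Dom C z = rob m" "Cod C z = J"
  shows "(z \<cdot> bd \<beta> (Suc m)) \<cdot> Jm m = (if m = 0 then Zero C (V \<odot> X m) J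
    else scale C (- 1) ((z \<cdot> Jm (m - 1)) \<cdot> (Idn C V \<boxtimes> kb m)))"
proof -
  let ?w = "True # Ks m" and ?e = "\<nu> \<boxtimes> Idn C (X m)"
  let ?f = "\<lambda>j. scale C ((- 1) ^ j) ((z \<cdot> rin m (merge j ?w)) \<cdot> wface ?w j)"
  let ?l = "(z \<cdot> rin m (merge 0 (rot ?w))) \<cdot> wface (rot ?w) 0 \<cdot> wrot ?w"
  have ww: "?w \<in> words (Suc m)" and r: "rot ?w \<in> words (Suc m)" using TK_words rot_words[OF TK_words] .
  have e: "Dom C ?e = V \<odot> X m" "Cod C ?e = W ?w" unfolding W_TK by simp_all
  have ft: "Dom C (?f j) = W ?w" "Cod C (?f j) = J" if "j < Suc m" for j
    using z words_length[OF ww that] merge_words[OF ww that] by (simp_all del: replicate_Suc W_simps)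
  have mr: "merge 0 (rot ?w) \<in> words m" using merge_words[OF r zero_less_Suc] by simp
  have fr: "Dom C (wface (rot ?w) 0) = W (rot ?w)" "Cod C (wface (rot ?w) 0) = W (merge 0 (rot ?w))"
    "Dom C (wrot ?w) = W ?w" "Cod C (wrot ?w) = W (rot ?w)"
    using words_length[OF r zero_less_Suc] by (simp_all del: replicate_Suc W_simps)
  have lt: "Dom C ?l = W ?w" "Cod C ?l = J"
    using z mr fr by (simp_all del: replicate_Suc W_simps)
  have le: "?l \<cdot> ?e = Zero C (V \<odot> X m) J"
  proof -
    have "?l \<cdot> ?e = (z \<cdot> rin m (merge 0 (rot ?w))) \<cdot> (wface (rot ?w) 0 \<cdot> wrot ?w \<cdot> ?e)"
      using z mr fr e by (simp del: replicate_Suc W_simps)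
    then show ?thesis unfolding TK_wrap using z mr by (simp del: replicate_Suc W_simps)
  qed
  have f0: "?f 0 \<cdot> ?e = Zero C (V \<odot> X m) J"
  proof -
    have "wface ?w 0 \<cdot> ?e = Zero C (V \<odot> X m) (W (Ks m))" using TK_face(2)[of m] unfolding CX_K .
    moreover have "Dom C (wface ?w 0) = W ?w" "Cod C (wface ?w 0) = W (Ks m)"
      using words_length[OF ww zero_less_Suc] TK_face(1)[of m] by (simp_all del: replicate_Suc W_simps)
    ultimately show ?thesis using z e unfolding TK_face(1) by (simp del: replicate_Suc W_simps)
  qed
  let ?s = "arr_sum C (W ?w) J ?f {..<Suc m}"
  have st: "Dom C ?s = W ?w" "Cod C ?s = J" using ft by (auto intro!: Dom_sum Cod_sum)
  have "(z \<cdot> bd \<beta> (Suc m)) \<cdot> Jm m = ((z \<cdot> bd \<beta> (Suc m)) \<cdot> rin (Suc m) ?w) \<cdot> ?e"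
    unfolding Jm_def using z by (simp del: replicate_Suc)
  also have "(z \<cdot> bd \<beta> (Suc m)) \<cdot> rin (Suc m) ?w = ?s \<boxplus> (if \<beta> then scale C ((- 1) ^ Suc m) ?l else Zero C (W ?w) J)"
    using bd_in[OF ww zero_less_Suc, of z \<beta>] z by (simp only: diff_Suc_1)
  also have "\<dots> \<cdot> ?e = ?s \<cdot> ?e"
    using st lt le e by (cases \<beta>) (simp_all del: replicate_Suc W_simps comp_assoc power_Suc)
  also have "\<dots> = arr_sum C (V \<odot> X m) J (\<lambda>j. ?f j \<cdot> ?e) {..<Suc m}"
    by (rule sum_comp) (use ft e in auto)
  finally have main: "(z \<cdot> bd \<beta> (Suc m)) \<cdot> Jm m = \<dots>" .
  show ?thesis
  proof (cases m)
    case 0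
    have "arr_sum C (V \<odot> X m) J (\<lambda>j. ?f j \<cdot> ?e) {..<Suc m} = Zero C (V \<odot> X m) J"
    proof (rule sum_zero)
      fix j assume "j \<in> {..<Suc m}"
      then have "j = 0" using 0 by simp
      then show "?f j \<cdot> ?e = Zero C (V \<odot> X m) J" using f0 by (simp only:)
    qed
    then show ?thesis unfolding main if_P[OF 0] by (simp only:)
  next
    case (Suc k)
    have face: "?f (Suc l) \<cdot> ?e = scale C (- 1) ((z \<cdot> Jm k) \<cdot> (Idn C V \<boxtimes> scale C ((- 1) ^ l) (alg_face C K m l)))"
      if l: "l < Suc k" for l
    proof -
      have a: "Dom C (alg_face C K m l) = X m" "Cod C (alg_face C K m l) = X k"
        using cK.d_Hom[of l m] l Suc by simp_all
      have "?f (Suc l) \<cdot> ?e = scale C ((- 1) ^ Suc l) ((z \<cdot> rin m (True # Ks k)) \<cdot> ((Idn C U \<boxtimes> alg_face C K m l) \<cdot> ?e))"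
        using TK_face(3,4)[OF l] a z Suc by (simp del: replicate_Suc)
      also have "(Idn C U \<boxtimes> alg_face C K m l) \<cdot> ?e = (\<nu> \<boxtimes> Idn C (X k)) \<cdot> (Idn C V \<boxtimes> alg_face C K m l)"
        using a by (simp add: interchange)
      finally show ?thesis
        unfolding Jm_def using a z Suc by (simp del: replicate_Suc)
    qed
    have a: "Dom C (alg_face C K m l) = X m" "Cod C (alg_face C K m l) = X k" if "l < Suc k" for l
      using cK.d_Hom[of l m] that Suc by simp_all
    let ?g = "\<lambda>l. (z \<cdot> Jm k) \<cdot> (Idn C V \<boxtimes> scale C ((- 1) ^ l) (alg_face C K m l))"
    have zJ: "Dom C (z \<cdot> Jm k) = V \<odot> X k" "Cod C (z \<cdot> Jm k) = J" using z Suc by simp_all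
    have g: "Dom C (?g l) = V \<odot> X m" "Cod C (?g l) = J" if "l < Suc k" for l
      using a[OF that] zJ by (simp_all del: comp_assoc)
    have fe: "Dom C (?f j \<cdot> ?e) = V \<odot> X m" "Cod C (?f j \<cdot> ?e) = J" if "j < Suc m" for j
      using ft[OF that] e by (simp_all del: comp_assoc)
    have "arr_sum C (V \<odot> X m) J (\<lambda>j. ?f j \<cdot> ?e) {..<Suc m} = arr_sum C (V \<odot> X m) J (\<lambda>j. ?f j \<cdot> ?e) (Suc ` {..<Suc k})"
    proof (rule sum_mono_neutral)
      fix j assume "j \<in> {..<Suc m} - Suc ` {..<Suc k}"
      then have "j = 0" using Suc by (cases j) auto
      then show "?f j \<cdot> ?e = Zero C (V \<odot> X m) J" using f0 by (simp only:)
    next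
      show "Suc ` {..<Suc k} \<subseteq> {..<Suc m}" using Suc by auto
      fix j assume "j \<in> Suc ` {..<Suc k}"
      then have "j < Suc m" using Suc by auto
      then show "Dom C (?f j \<cdot> ?e) = V \<odot> X m \<and> Cod C (?f j \<cdot> ?e) = J" using fe by blast
    qed simp
    also have "\<dots> = arr_sum C (V \<odot> X m) J (\<lambda>l. ?f (Suc l) \<cdot> ?e) {..<Suc k}"
    proof (rule sum_reindex)
      fix l assume "l \<in> {..<Suc k}"
      then have "Suc l < Suc m" using Suc by simp
      then show "Dom C (?f (Suc l) \<cdot> ?e) = V \<odot> X m \<and> Cod C (?f (Suc l) \<cdot> ?e) = J" using fe by blast
    qed simp
    also have "\<dots> = arr_sum C (V \<odot> X m) J (\<lambda>l. scale C (- 1) (?g l)) {..<Suc k}"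
    proof (rule sum_cong[OF refl])
      fix l assume "l \<in> {..<Suc k}"
      then have l: "l < Suc k" by simp
      show "?f (Suc l) \<cdot> ?e = scale C (- 1) (?g l)" by (rule face[OF l])
      show "Dom C (scale C (- 1) (?g l)) = V \<odot> X m" "Cod C (scale C (- 1) (?g l)) = J"
        using g[OF l] by (simp_all only: Dom_scale Cod_scale)
    qed
    also have "\<dots> = scale C (- 1) (arr_sum C (V \<odot> X m) J ?g {..<Suc k})"
      by (rule scale_sum[symmetric]) (use g in simp)
    also have "arr_sum C (V \<odot> X m) J ?g {..<Suc k} = (z \<cdot> Jm k) \<cdot> (Idn C V \<boxtimes> kb m)"
    proof -
      have "Idn C V \<boxtimes> kb m =
          arr_sum C (V \<odot> X m) (V \<odot> X k) (\<lambda>l. Idn C V \<boxtimes> scale C ((- 1) ^ l) (alg_face C K m l)) {..<Suc k}"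
        unfolding Suc cK.Cb'_eq[OF zero_less_Suc] diff_Suc_1
        by (rule tensor_sum(1)) (use a Suc in simp)
      then show ?thesis
        by (simp only:) (rule comp_sum[symmetric], use a zJ in simp_all)
    qed
    finally show ?thesis unfolding main using Suc by simp
  qed
qed

text \<open>Chosen so that \<open>S\<close> after \<open>\<theta>\<close> turns either boundary into
  the bar boundary of A, to which \<open>Rm_Cb'\<close> applies.\<close>

definition S :: "bool \<Rightarrow> nat \<Rightarrow> 'm" where
  "S \<beta> n = (if \<beta> then cyc_norm C (cyc_of C A) n else Idn C (Y n))"

lemma S_Hom [simp]: "Dom C (S \<beta> n) = Y n" "Cod C (S \<beta> n) = Y n"
  by (simp_all add: S_def)

lemma S_bd: "S \<beta> n \<cdot> \<theta> n \<cdot> bd \<beta> (Suc n) = Cb' (cyc_of C A) (Suc n) \<cdot> S \<beta> (Suc n) \<cdot> \<theta> (Suc n)"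
proof -
  note t = cA.Cb_Hom[of "Suc n", simplified]
  have "\<theta> n \<cdot> Cb rel (Suc n) = Cb (cyc_of C A) (Suc n) \<cdot> \<theta> (Suc n)"
    "\<theta> n \<cdot> Cb' rel (Suc n) = Cb' (cyc_of C A) (Suc n) \<cdot> \<theta> (Suc n)"
    using \<theta>.g_Cb[of "Suc n"] \<theta>.g_Cb'[of "Suc n"] by simp_all
  moreover have "(cyc_norm C (cyc_of C A) n \<cdot> Cb (cyc_of C A) (Suc n)) \<cdot> \<theta> (Suc n) =
      (Cb' (cyc_of C A) (Suc n) \<cdot> cyc_norm C (cyc_of C A) (Suc n)) \<cdot> \<theta> (Suc n)"
    using cA.Cb'_norm[of "Suc n"] by simp
  ultimately show ?thesis
    using t by (cases \<beta>) (simp_all add: S_def bd_def)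
qed

text \<open>A cocycle \<open>f\<close> on \<open>V \<otimes> K\<^bsup>m+1\<^esup>\<close> is pulled back to a cochain of the relative complex that vanishes on the
  words of \<open>K\<close>; for the cyclic complexes the norm turns it into a cocycle, and restriction along \<open>Jm\<close>
  recovers \<open>f\<close>, since among the rotations only the trivial one puts \<open>V\<close> first.\<close>

lemma bar_acyclic_lifts:
  assumes lifts: "lifts \<beta> J" and f: "Dom C f = V \<odot> X m" "Cod C f = J"
    and cyc: "f \<cdot> (Idn C V \<boxtimes> kb (Suc m)) = Zero C (V \<odot> X (Suc m)) J"
  shows "if m = 0 then f = Zero C (V \<odot> X m) J
    else \<exists>g. Dom C g = V \<odot> X (m - 1) \<and> Cod C g = J \<and> f = g \<cdot> (Idn C V \<boxtimes> kb m)"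
proof -
  define x where "x = f \<cdot> Rm m \<cdot> S \<beta> (Suc m) \<cdot> \<theta> (Suc m)"
  have xt: "Dom C x = rob (Suc m)" "Cod C x = J" using f by (simp_all add: x_def)
  have t: "Dom C (Cb' (cyc_of C A) (Suc n)) = Y (Suc n)" "Cod C (Cb' (cyc_of C A) (Suc n)) = Y n" for n
    using cA.Cb_Hom(3,4)[of "Suc n"] by simp_all
  have "x \<cdot> bd \<beta> (Suc (Suc m)) = f \<cdot> Rm m \<cdot> (S \<beta> (Suc m) \<cdot> \<theta> (Suc m) \<cdot> bd \<beta> (Suc (Suc m)))"
    using f by (simp add: x_def)
  \<comment> \<open>With the boundary turned into \<open>b'\<close> of A, the projection carries it
    to the bar boundary with coefficients in \<open>V\<close>, which \<open>f\<close> kills.\<close>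
  also have "\<dots> = f \<cdot> (Rm m \<cdot> Cb' (cyc_of C A) (Suc (Suc m))) \<cdot> S \<beta> (Suc (Suc m)) \<cdot> \<theta> (Suc (Suc m))"
    unfolding S_bd using t by simp
  also have "\<dots> = scale C (- 1) ((f \<cdot> (Idn C V \<boxtimes> kb (Suc m))) \<cdot> Rm (Suc m) \<cdot> S \<beta> (Suc (Suc m)) \<cdot> \<theta> (Suc (Suc m)))"
    unfolding Rm_Cb' using f by simp
  also have "\<dots> = Zero C (rob (Suc (Suc m))) J"
    unfolding cyc by simp
  finally have x_bd: "x \<cdot> bd \<beta> (Suc (Suc m)) = Zero C (rob (Suc (Suc m))) J" .
  have x_\<omega>: "x \<cdot> R.\<omega> (Suc m) = Zero C (rob (Suc m)) J" if \<beta>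
  proof -
    have "x \<cdot> R.\<omega> (Suc m) = f \<cdot> Rm m \<cdot> cyc_norm C (cyc_of C A) (Suc m) \<cdot> (\<theta> (Suc m) \<cdot> R.\<omega> (Suc m))"
      using f that by (simp add: x_def S_def)
    also have "\<dots> = f \<cdot> Rm m \<cdot> (cyc_norm C (cyc_of C A) (Suc m) \<cdot> cA.\<omega> (Suc m)) \<cdot> \<theta> (Suc m)"
      unfolding \<theta>.g_\<omega>[symmetric] by simp
    finally show ?thesis unfolding cA.norm_\<omega> using f by simp
  qed
  \<comment> \<open>The words of K have no component in \<open>V\<close>.\<close>
  have "Rm m \<cdot> \<theta> (Suc m) \<cdot> rel_nat C K A \<iota> (Suc m) = Zero C (X (Suc m)) (V \<odot> X m)"
  proof -
    have "\<theta> (Suc m) \<cdot> rel_nat C K A \<iota> (Suc m) = \<iota> \<boxtimes> incl (Ks m) (As m)"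
      using \<theta>_in[OF Ks_words, of "Suc m"] by (simp add: rel_nat_def inc_def)
    moreover have "(v \<boxtimes> pw (Suc m)) \<cdot> (\<iota> \<boxtimes> incl (Ks m) (As m)) = Zero C (Und K \<odot> W (Ks m)) (V \<odot> W (Ks m))"
      by (subst interchange) (simp_all only: incl_Fs_Hom pw_Hom split_Hom split tensor_Zero' Dom_comp Cod_comp)
    ultimately show ?thesis
      unfolding Rm_def CX_K by simp
  qed
  note RN = this
  have x_nat: "x \<cdot> rel_nat C K A \<iota> (Suc m) = Zero C (X (Suc m)) J"
  proof (cases \<beta>)
    case True
    \<comment> \<open>The norm is natural and can be moved to the far right, after which the
      preceding fact applies.\<close>
    have "x \<cdot> rel_nat C K A \<iota> (Suc m) = f \<cdot> Rm m \<cdot> (cyc_norm C (cyc_of C A) (Suc m) \<cdot> \<theta> (Suc m)) \<cdot> rel_nat C K A \<iota> (Suc m)"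
      using f True by (simp add: x_def S_def)
    also have "\<dots> = f \<cdot> Rm m \<cdot> \<theta> (Suc m) \<cdot> (cyc_norm C rel (Suc m) \<cdot> rel_nat C K A \<iota> (Suc m))"
      unfolding \<theta>.g_norm by simp
    also have "\<dots> = f \<cdot> (Rm m \<cdot> \<theta> (Suc m) \<cdot> rel_nat C K A \<iota> (Suc m)) \<cdot> cyc_norm C (cyc_of C K) (Suc m)"
      unfolding nat.g_norm by simp
    finally show ?thesis unfolding RN using f by simp
  next
    case False
    then have "x \<cdot> rel_nat C K A \<iota> (Suc m) = f \<cdot> (Rm m \<cdot> \<theta> (Suc m) \<cdot> rel_nat C K A \<iota> (Suc m))"
      using f by (simp add: x_def S_def)
    then show ?thesis unfolding RN using f by simp
  qed
  obtain z where z: "Dom C z = rob m" "Cod C z = J" and xz: "x = z \<cdot> bd \<beta> (Suc m)"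
    using lifts[unfolded lifts_def, rule_format, OF xt x_bd x_\<omega> x_nat] by blast
  \<comment> \<open>Restriction along \<open>Jm\<close> recovers \<open>f\<close> from
    \<open>x\<close> and turns the primitive \<open>z\<close> into one for the bar boundary.\<close>
  have "x \<cdot> Jm m = f \<cdot> (Rm m \<cdot> S \<beta> (Suc m) \<cdot> \<theta> (Suc m) \<cdot> Jm m)"
    using f by (simp add: x_def)
  also have "\<dots> = f"
    using Rm_norm[of m] Rm_\<theta>_Jm[of m] f by (cases \<beta>) (simp_all add: S_def)
  finally have fz: "f = (z \<cdot> bd \<beta> (Suc m)) \<cdot> Jm m" unfolding xz ..
  show ?thesis
  proof (cases m)
    case 0
    then show ?thesis using fz bd_Jm[OF z, of \<beta>] z by simp
  next
    case (Suc k)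
    have "f = scale C (- 1) ((z \<cdot> Jm k) \<cdot> (Idn C V \<boxtimes> kb m))"
      using fz bd_Jm[OF z, of \<beta>] Suc by simp
    also have "\<dots> = scale C (- 1) (z \<cdot> Jm k) \<cdot> (Idn C V \<boxtimes> kb m)"
      using z Suc by simp
    finally show ?thesis
      using z Suc by (auto intro!: exI[of _ "scale C (- 1) (z \<cdot> Jm k)"])
  qed
qed

end

section \<open>Assembling the equivalences\<close>

context base_cat begin

text \<open>\<open>bar_acyclic\<close> depends on \<open>K\<close> alone but is defined for a pair;
  \<open>K\<close> as an ideal of itself provides one.\<close>

lemma cof_ideal_Idn:
  assumes "algebra C K" shows "cof_ideal C K K (Idn C (Und K))"
proof -
  have "cofibration C (Idn C (Und K))"
    unfolding cofibration_def hom_surj_def by (auto simp: image_iff)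
  then show ?thesis
    using assms monic_Idn unfolding cof_ideal_def two_sided_ideal_def algebra_map_def is_left_mult_def is_right_mult_def
    by (auto simp: algebra_def Idn_tensor)
qed

lemma bar_acyclicI:
  assumes K: "algebra C K" and lifts: "\<And>A i. cof_ideal C K A i \<Longrightarrow> cof_pair.lifts C K A i \<beta> J"
  shows "cof_pair.bar_acyclic C K J"
proof -
  interpret I: cof_pair C K K "Idn C (Und K)" by unfold_locales (rule cof_ideal_Idn[OF K])
  show ?thesis
    unfolding I.bar_acyclic_def
  proof (intro allI impI)
    fix V m f
    \<comment> \<open>For each coefficient object \<open>V\<close> the algebra is built on the
      direct sum of K and \<open>V\<close>, so excision is used with a different algebra for each
      \<open>V\<close>.\<close>
    let ?I = "{0, 1} :: nat set" and ?X = "\<lambda>s :: nat. if s = 0 then Und K else V"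
    interpret split_pair C K V "dsum_ob C ?I ?X" "dsum_inj C ?I ?X 0" "dsum_prj C ?I ?X 0"
        "dsum_inj C ?I ?X 1" "dsum_prj C ?I ?X 1"
      by unfold_locales (use K in \<open>simp_all add: prj_inj\<close>)
    assume "Dom C f = V \<odot> CX (cyc_of C K) m" "Cod C f = J"
      "f \<cdot> (Idn C V \<boxtimes> Cb' (cyc_of C K) (Suc m)) = Zero C (V \<odot> CX (cyc_of C K) (Suc m)) J"
    then show "if m = 0 then f = Zero C (V \<odot> CX (cyc_of C K) m) J
      else \<exists>g. Dom C g = V \<odot> CX (cyc_of C K) (m - 1) \<and> Cod C g = J \<and> f = g \<cdot> (Idn C V \<boxtimes> Cb' (cyc_of C K) m)"
      by (rule bar_acyclic_lifts[OF lifts[OF cof_ideal_A]])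
  qed
qed

lemma contractible_iff_excisive:
  assumes K: "algebra C K"
  defines "P \<equiv> \<forall>V. weakly_contractible C (tensor_chain C V (Bar C (cyc_of C K)))"
  shows "P \<longleftrightarrow> C_excisive C K" "P \<longleftrightarrow> Cbar_excisive C K" "P \<longleftrightarrow> Omega_excisive C K" "P \<longleftrightarrow> BBOmega_excisive C K"
proof -
  interpret I: cof_pair C K K "Idn C (Und K)" by unfold_locales (rule cof_ideal_Idn[OF K])
  have P: "P \<longleftrightarrow> (\<forall>J. rel_injective C J \<longrightarrow> I.bar_acyclic J)"
    unfolding P_def by (rule I.contractible_iff_bar_acyclic)
  note pair = cof_pair.intro[OF base_cat_axioms cof_pair_axioms.intro]
  show "P \<longleftrightarrow> C_excisive C K"
  proof
    show "C_excisive C K" if P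
      unfolding C_excisive_def using cof_pair.weak_equivs(1)[OF pair] that unfolding P by blast
    assume e: "C_excisive C K"
    show P unfolding P
    proof (intro allI impI)
      fix J assume J: "rel_injective C J"
      show "I.bar_acyclic J"
      proof (rule bar_acyclicI[OF K])
        fix A i assume i: "cof_ideal C K A i"
        show "cof_pair.lifts C K A i True J"
          using e i J unfolding C_excisive_def weak_equiv_iff by (intro cof_pair.lifts_Hoch[OF pair]) blast+
      qed
    qed
  qed
  show "P \<longleftrightarrow> Cbar_excisive C K"
  proof
    show "Cbar_excisive C K" if P
      unfolding Cbar_excisive_def using cof_pair.weak_equivs(2)[OF pair] that unfolding P by blast
    assume e: "Cbar_excisive C K"
    show P unfolding P
    proof (intro allI impI)
      fix J assume J: "rel_injective C J"
      show "I.bar_acyclic J"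
      proof (rule bar_acyclicI[OF K])
        fix A i assume i: "cof_ideal C K A i"
        show "cof_pair.lifts C K A i False J"
          using e i J unfolding Cbar_excisive_def weak_equiv_iff by (intro cof_pair.lifts_Bar[OF pair]) blast+
      qed
    qed
  qed
  show "P \<longleftrightarrow> Omega_excisive C K"
  proof
    show "Omega_excisive C K" if P
      unfolding Omega_excisive_def using cof_pair.weak_equivs(3)[OF pair] that unfolding P by blast
    assume e: "Omega_excisive C K"
    show P unfolding P
    proof (intro allI impI)
      fix J assume J: "rel_injective C J"
      show "I.bar_acyclic J"
      proof (rule bar_acyclicI[OF K])
        fix A i assume i: "cof_ideal C K A i"
        show "cof_pair.lifts C K A i True J"
          using e i J unfolding Omega_excisive_def mixed_weak_equiv_def weak_equiv_iff
          by (intro cof_pair.lifts_Om[OF pair]) blast+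
      qed
    qed
  qed
  show "P \<longleftrightarrow> BBOmega_excisive C K"
  proof
    show "BBOmega_excisive C K" if P
      unfolding BBOmega_excisive_def using cof_pair.weak_equivs(4)[OF pair] that unfolding P by blast
    assume e: "BBOmega_excisive C K"
    show P unfolding P
    proof (intro allI impI)
      fix J assume J: "rel_injective C J"
      show "I.bar_acyclic J"
      proof (rule bar_acyclicI[OF K])
        fix A i assume i: "cof_ideal C K A i"
        show "cof_pair.lifts C K A i True J"
          using e i J unfolding BBOmega_excisive_def S_weak_equiv_def weak_equiv_iff
          by (intro cof_pair.lifts_BB[OF pair]) blast+
      qed
    qed
  qed
qed

end

theorem theorem5p2:
  fixes \<A> :: "('o, 'm) tensor_cat" and K :: "('o, 'm) alg"
  assumes "base_category \<A>"
    and "algebra \<A> K"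
  shows "((\<forall>V. weakly_contractible \<A> (tensor_chain \<A> V (Bar \<A> (cyc_of \<A> K))))
           \<longleftrightarrow> C_excisive \<A> K)
       \<and> (C_excisive \<A> K \<longleftrightarrow> Cbar_excisive \<A> K)
       \<and> (Cbar_excisive \<A> K \<longleftrightarrow> Omega_excisive \<A> K)
       \<and> (Omega_excisive \<A> K \<longleftrightarrow> BBOmega_excisive \<A> K)"
proof -
  interpret base_cat \<A> by unfold_locales (rule assms(1))
  show ?thesis
    using contractible_iff_excisive[OF assms(2)] by blast
qed

end
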